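(* Let $\{X_{ij}:i,j\ge1\}$ be i.i.d. symmetric real random variables such that $\mathbb{P}(|X_{11}|>x)=L(x)$, $x>0$, with $L$ slowly varying at infinity (regular variation with index $\alpha=0$), and let $\mathbf{Y}_n$ be the associated $n\times n$ self-normalized matrix. Let $(N_{-,q})_{q\ge1}$ and $(N_{+,q})_{q\ge1}$ be two independent sequences of independent random variables, where $N_{-,q}$ and $N_{+,q}$ both have the Poisson distribution with parameter $\frac{1}{2q}$. Define $$Z_k^{(0)}=\sum_{q\mid k}q\,\big(N_{+,q}+(-1)^{k/q}N_{-,q}\big),\qquad k\ge1,$$ the sum being over all positive divisors $q$ of $k$. Then: (i) for all integers $\ell\ge1$ and $k_1,\dots,k_\ell\ge1$, as $n\to\infty$, $\big(\mathrm{Tr}[\mathbf{Y}_n^{k_1}],\dots,\mathrm{Tr}[\mathbf{Y}_n^{k_\ell}]\big)\to\big(Z_{k_1}^{(0)},\dots,Z_{k_\ell}^{(0)}\big)$ in distribution; (ii) with $p_n(z)=\det(\mathbf{I}-z\mathbf{Y}_n)$, $z\in\mathbb{D}=\{z\in\mathbb{C}:|z|<1\}$, as $n\to\infty$, $p_n\to F_0$ in distribution as random elements of the space of holomorphic functions on $\mathbb{D}$ with the topology of uniform convergence on compact subsets, where $F_0$ is the random holomorphic function $$F_0(z)=\exp\Big(-\sum_{k\ge1}\frac{z^k}{k}Z_k^{(0)}\Big).$$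
   Context: $\{X_{ij}\}_{i,j\ge1}$ are i.i.d., non-degenerate, symmetric ($X_{11}\overset{d}{=}-X_{11}$). The self-normalized matrix is $\mathbf{Y}_n=(Y_{ij})_{1\le i,j\le n}$ with $Y_{ij}=X_{ij}/\sqrt{X_{i1}^2+\cdots+X_{in}^2}$ (a row of $\mathbf Y_n$ is set to $0$ if the corresponding row $(X_{i1},\dots,X_{in})$ vanishes). $L$ is slowly varying at infinity if $\lim_{x\to\infty}L(tx)/L(x)=1$ for all $t>0$. *)

theory Defs
  imports
    "HOL-Probability.Probability"
    "HOL-Complex_Analysis.Complex_Analysis"
    "Jordan_Normal_Form.Determinant"
begin

text \<open>
  For \<open>L x = P(\<bar>X\<bar> > x)\<close> the quotient below can only tend to 1 if \<open>L\<close> is eventually nonzero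
  (as \<open>a / 0 = 0\<close>), so the convention for division by zero plays no role.
\<close>

definition slowly_varying :: "(real \<Rightarrow> real) \<Rightarrow> bool" where
  "slowly_varying L \<longleftrightarrow> (\<forall>t>0. ((\<lambda>x. L (t * x) / L x) \<longlongrightarrow> 1) at_top)"


subsection \<open>Convergence in distribution in a topological space\<close>

definition borel_measure_of :: "'c topology \<Rightarrow> 'c measure" where
  "borel_measure_of T = sigma (topspace T) {U. openin T U}"

text \<open>
  Weak convergence of the laws, tested against bounded continuous real functions. That all the maps
  involved are random elements of the space is part of the definition; without it the
  Bochner integrals below could silently be 0. The limit may live on a different probability space.
\<close>

definition converges_in_distribution ::
  "'c topology \<Rightarrow> 'a measure \<Rightarrow> (nat \<Rightarrow> 'a \<Rightarrow> 'c) \<Rightarrow> 'b measure \<Rightarrow> ('b \<Rightarrow> 'c) \<Rightarrow> bool" where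
  "converges_in_distribution T M W M' W' \<longleftrightarrow>
     (\<forall>n. W n \<in> measurable M (borel_measure_of T)) \<and>
     W' \<in> measurable M' (borel_measure_of T) \<and>
     (\<forall>f. continuous_map T euclideanreal f \<and> bounded (f ` topspace T) \<longrightarrow>
        (\<lambda>n. \<integral>\<omega>. f (W n \<omega>) \<partial>M) \<longlonglongrightarrow> (\<integral>\<omega>. f (W' \<omega>) \<partial>M'))"

lemma sets_borel_measure_of_euclidean:
  "sets (borel_measure_of (euclidean :: 'c::topological_space topology)) = sets borel"
  by (simp add: borel_measure_of_def borel_def)


subsection \<open>Holomorphic functions with locally uniform convergence\<close>

text \<open>
  HOL functions are total, so a holomorphic function on \<open>D\<close> is represented by the one that is
  \<open>undefined\<close> outside \<open>D\<close>.
\<close>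

definition holomorphic_space :: "complex set \<Rightarrow> (complex \<Rightarrow> complex) set" where
  "holomorphic_space D = {f \<in> extensional D. f holomorphic_on D}"

text \<open>The topology of uniform convergence on compact subsets of \<open>D\<close>.\<close>

definition holomorphic_topology :: "complex set \<Rightarrow> (complex \<Rightarrow> complex) topology" where
  "holomorphic_topology D = topology (\<lambda>U. U \<subseteq> holomorphic_space D \<and>
     (\<forall>f\<in>U. \<exists>K e. compact K \<and> K \<subseteq> D \<and> e > 0 \<and>
        {g \<in> holomorphic_space D. \<forall>z\<in>K. dist (g z) (f z) < e} \<subseteq> U))"

lemma openin_holomorphic_topology:
  "openin (holomorphic_topology D) U \<longleftrightarrow> U \<subseteq> holomorphic_space D \<and>
     (\<forall>f\<in>U. \<exists>K e. compact K \<and> K \<subseteq> D \<and> e > 0 \<and>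
        {g \<in> holomorphic_space D. \<forall>z\<in>K. dist (g z) (f z) < e} \<subseteq> U)"
proof -
  let ?P = "\<lambda>U f K e. compact K \<and> K \<subseteq> D \<and> (e::real) > 0 \<and>
        {g \<in> holomorphic_space D. \<forall>z\<in>K. dist (g z) (f z) < e} \<subseteq> U"
  have "istopology (\<lambda>U. U \<subseteq> holomorphic_space D \<and> (\<forall>f\<in>U. \<exists>K e. ?P U f K e))"
    unfolding istopology_def
  proof (intro conjI allI impI ballI)
    fix S T f
    assume S: "S \<subseteq> holomorphic_space D \<and> (\<forall>f\<in>S. \<exists>K e. ?P S f K e)"
      and T: "T \<subseteq> holomorphic_space D \<and> (\<forall>f\<in>T. \<exists>K e. ?P T f K e)"
    show "S \<inter> T \<subseteq> holomorphic_space D"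
      using S by blast
    assume "f \<in> S \<inter> T"
    then have "\<exists>K e. ?P S f K e" "\<exists>K e. ?P T f K e"
      using S T by simp_all
    then obtain K e K' e' where "?P S f K e" "?P T f K' e'"
      by (elim exE)
    then have "?P (S \<inter> T) f (K \<union> K') (min e e')"
      by auto
    then show "\<exists>K e. ?P (S \<inter> T) f K e"
      by (intro exI)
  next
    fix \<K> :: "(complex \<Rightarrow> complex) set set"
    assume *: "\<forall>U\<in>\<K>. U \<subseteq> holomorphic_space D \<and> (\<forall>f\<in>U. \<exists>K e. ?P U f K e)"
    show "\<Union>\<K> \<subseteq> holomorphic_space D"
      using * by blast
    fix f assume "f \<in> \<Union>\<K>"
    then obtain U where U: "U \<in> \<K>" "f \<in> U"
      by blast
    then have "\<exists>K e. ?P U f K e"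
      using * by simp
    then obtain K e where "?P U f K e"
      by (elim exE)
    with U(1) have "?P (\<Union>\<K>) f K e"
      by (meson Union_upper subset_trans)
    then show "\<exists>K e. ?P (\<Union>\<K>) f K e"
      by (intro exI)
  qed
  then show ?thesis
    by (simp add: holomorphic_topology_def topology_inverse')
qed

lemma topspace_holomorphic_topology [simp]:
  "topspace (holomorphic_topology D) = holomorphic_space D"
proof
  show "topspace (holomorphic_topology D) \<subseteq> holomorphic_space D"
    using openin_topspace[of "holomorphic_topology D"] openin_holomorphic_topology by blast
  have "\<exists>K e. compact K \<and> K \<subseteq> D \<and> (e::real) > 0 \<and>
     {g \<in> holomorphic_space D. \<forall>z\<in>K. dist (g z) (f z) < e} \<subseteq> holomorphic_space D" for f
    by (rule exI[of _ "{}"], rule exI[of _ 1]) auto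
  then have "openin (holomorphic_topology D) (holomorphic_space D)"
    by (simp add: openin_holomorphic_topology)
  then show "holomorphic_space D \<subseteq> topspace (holomorphic_topology D)"
    by (rule openin_subset)
qed

lemma limitin_holomorphic_topology:
  assumes f: "\<And>n. f n \<in> holomorphic_space D" and l: "l \<in> holomorphic_space D"
  shows "limitin (holomorphic_topology D) f l F \<longleftrightarrow>
     (\<forall>K. compact K \<and> K \<subseteq> D \<longrightarrow> uniform_limit K f l F)"
proof
  assume lim: "\<forall>K. compact K \<and> K \<subseteq> D \<longrightarrow> uniform_limit K f l F"
  show "limitin (holomorphic_topology D) f l F"
    unfolding limitin_def
  proof (intro conjI allI impI)
    fix U assume U: "openin (holomorphic_topology D) U \<and> l \<in> U"
    then obtain K e where K: "compact K" "K \<subseteq> D" "e > 0"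
      and sub: "{g \<in> holomorphic_space D. \<forall>z\<in>K. dist (g z) (l z) < e} \<subseteq> U"
      unfolding openin_holomorphic_topology by blast
    from lim K have "\<forall>\<^sub>F n in F. \<forall>z\<in>K. dist (f n z) (l z) < e"
      by (simp add: uniform_limit_iff)
    then show "\<forall>\<^sub>F n in F. f n \<in> U"
    proof eventually_elim
      case (elim n)
      then show "f n \<in> U"
        using sub f by blast
    qed
  qed (use l in simp)
next
  assume lim: "limitin (holomorphic_topology D) f l F"
  show "\<forall>K. compact K \<and> K \<subseteq> D \<longrightarrow> uniform_limit K f l F"
  proof (intro allI impI uniform_limitI)
    fix K and e :: real
    assume K: "compact K \<and> K \<subseteq> D" and e: "e > 0"
    define U where "U = {g \<in> holomorphic_space D. \<forall>z\<in>K. dist (g z) (l z) < e}"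
    have "\<exists>K e. compact K \<and> K \<subseteq> D \<and> e > 0 \<and>
        {h \<in> holomorphic_space D. \<forall>z\<in>K. dist (h z) (g z) < e} \<subseteq> U" if g: "g \<in> U" for g
    proof -
      have "\<exists>s<e. \<forall>z\<in>K. dist (g z) (l z) \<le> s"
      proof (cases "K = {}")
        case True
        then show ?thesis using e by auto
      next
        case False
        have "continuous_on K (\<lambda>z. dist (g z) (l z))"
        proof (rule continuous_on_dist)
          have "g holomorphic_on D" "l holomorphic_on D"
            using g l by (auto simp: U_def holomorphic_space_def)
          then show "continuous_on K g" "continuous_on K l"
            using K by (meson continuous_on_subset holomorphic_on_imp_continuous_on)+
        qed
        then obtain z where "z \<in> K" "\<forall>w\<in>K. dist (g w) (l w) \<le> dist (g z) (l z)"
          using continuous_attains_sup[of K "\<lambda>z. dist (g z) (l z)"] K False by blast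
        then show ?thesis using g unfolding U_def by blast
      qed
      then obtain s where s: "s < e" "\<And>z. z \<in> K \<Longrightarrow> dist (g z) (l z) \<le> s"
        by blast
      have "dist (h z) (l z) < e" if "dist (h z) (g z) < e - s" "z \<in> K" for h z
        using that s(2)[of z] dist_triangle[of "h z" "l z" "g z"] by linarith
      then have "{h \<in> holomorphic_space D. \<forall>z\<in>K. dist (h z) (g z) < e - s} \<subseteq> U"
        unfolding U_def by blast
      then show ?thesis using K s(1) by (intro exI[of _ K] exI[of _ "e - s"]) auto
    qed
    then have "openin (holomorphic_topology D) U"
      unfolding openin_holomorphic_topology by (auto simp: U_def)
    moreover have "l \<in> U"
      using l e by (simp add: U_def)
    ultimately have "\<forall>\<^sub>F n in F. f n \<in> U"
      using lim by (simp add: limitin_def)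
    then show "\<forall>\<^sub>F n in F. \<forall>z\<in>K. dist (f n z) (l z) < e"
      by eventually_elim (simp add: U_def)
  qed
qed


subsection \<open>Self-normalized matrices\<close>

text \<open>
  Entries of \<open>mat\<close> are indexed from 0 and those of \<open>X\<close> from 1, hence the shift.
  A vanishing row of \<open>X\<close> gives a zero row, since \<open>0 / 0 = 0\<close>.
\<close>

definition self_normalized_matrix ::
  "(nat \<Rightarrow> nat \<Rightarrow> 'a \<Rightarrow> real) \<Rightarrow> nat \<Rightarrow> 'a \<Rightarrow> real Matrix.mat" where
  "self_normalized_matrix X n \<omega> =
     Matrix.mat n n (\<lambda>(i, j). X (Suc i) (Suc j) \<omega> / sqrt (\<Sum>l=1..n. (X (Suc i) l \<omega>)\<^sup>2))"

definition mat_trace :: "'c::comm_monoid_add Matrix.mat \<Rightarrow> 'c" where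
  "mat_trace A = (\<Sum>i<dim_row A. A $$ (i, i))"

definition reciprocal_char_poly ::
  "(nat \<Rightarrow> nat \<Rightarrow> 'a \<Rightarrow> real) \<Rightarrow> nat \<Rightarrow> 'a \<Rightarrow> complex \<Rightarrow> complex" where
  "reciprocal_char_poly X n \<omega> = (\<lambda>z\<in>ball 0 1.
     Determinant.det (1\<^sub>m n - z \<cdot>\<^sub>m map_mat complex_of_real (self_normalized_matrix X n \<omega>)))"


subsection \<open>The limiting objects\<close>

definition limit_trace ::
  "(nat \<Rightarrow> 'b \<Rightarrow> nat) \<Rightarrow> (nat \<Rightarrow> 'b \<Rightarrow> nat) \<Rightarrow> nat \<Rightarrow> 'b \<Rightarrow> real" where
  "limit_trace Nm Np k \<omega> =
     (\<Sum>q | q dvd k. real q * (real (Np q \<omega>) + (-1) ^ (k div q) * real (Nm q \<omega>)))"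

definition limit_series_converges ::
  "(nat \<Rightarrow> 'b \<Rightarrow> nat) \<Rightarrow> (nat \<Rightarrow> 'b \<Rightarrow> nat) \<Rightarrow> 'b \<Rightarrow> bool" where
  "limit_series_converges Nm Np \<omega> \<longleftrightarrow> (\<forall>z\<in>ball 0 1.
     summable (\<lambda>k. z ^ Suc k / of_nat (Suc k) * complex_of_real (limit_trace Nm Np (Suc k) \<omega>)))"

text \<open>
  The series converges on the whole disc only almost surely; on the exceptional set the function is
  given the arbitrary value 1, so that every realization is holomorphic.
\<close>

definition limit_function ::
  "(nat \<Rightarrow> 'b \<Rightarrow> nat) \<Rightarrow> (nat \<Rightarrow> 'b \<Rightarrow> nat) \<Rightarrow> 'b \<Rightarrow> complex \<Rightarrow> complex" where
  "limit_function Nm Np \<omega> = (\<lambda>z\<in>ball 0 1.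
     if limit_series_converges Nm Np \<omega>
     then exp (- (\<Sum>k. z ^ Suc k / of_nat (Suc k) * complex_of_real (limit_trace Nm Np (Suc k) \<omega>)))
     else 1)"

end

theory Submission
  imports
    Defs
    "HOL-Real_Asymp.Real_Asymp"
    "Jordan_Normal_Form.Schur_Decomposition"
    "Jordan_Normal_Form.Char_Poly"
begin

text \<open>
  Because the tail of the entries varies slowly, a single entry dominates its row of \<open>X\<close> with probability
  tending to 1, so a row of \<open>Y\<close> is close to a random sign times a unit vector in a uniformly chosen
  direction. Rounding every entry whose square exceeds \<open>1/2\<close> to its sign, and all others to 0, turns
  \<open>Y\<close> into the matrix of a partial map of \<open>{0, \<dots>, n - 1}\<close> whose arrows carry random signs.

  By symmetry of the entries, the monomials in the Leibniz expansion of the coefficients of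
  \<open>det (I - z Y)\<close> are orthogonal. Hence each coefficient has second moment at most 1, and rounding changes
  it by a quantity that tends to 0 in \<open>L\<^sup>2\<close>.

  The trace of the \<open>k\<close>-th power of a signed partial map is a sum over its cycles whose length divides \<open>k\<close>.
  The joint factorial moments of the numbers of cycles of given length and sign are explicit, so the
  probability generating functions of these numbers converge to Poisson ones. The theorem of Stone and
  Weierstrass turns this into joint weak convergence, and Newton's identities translate between traces
  and coefficients. Finally, the second moment bound confines the sequence of coefficients, up to small
  probability, to a compact box on which the power series depends continuously on its coefficients.
\<close>

subsection \<open>Laplace transforms of laws with slowly varying tails\<close>

text \<open>One entry dominates a row as soon as n(n-1) E(Y_1^2 Y_2^2) tends to 0, because the
  squares of a nonzero row of \<open>Y\<close> sum to 1. The obstacle is the common denominator S^2,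
  where S is the sum of squares of the row of \<open>X\<close>. Writing 1/S^2 as the integral of s
  exp(-sS) over s > 0 separates the entries and leaves only E exp(-s X^2) and its derivative; slow
  variation makes s times this derivative negligible against 1 - E exp(-s X^2) near 0. Coefficients
  rather than traces carry the rounding argument because a Leibniz monomial meets every row at most
  once, whereas a closed walk counted by a trace may revisit rows. The parameter 1/(2q) comes from
  about n^q/q possible cycles of length q, each present with probability about n^(-q) and carrying
  either sign with probability 1/2. Counts are unbounded, so Stone-Weierstrass is applied to their
  images 2^(-count) in a compact cube, where monomials become generating functions.\<close>

locale slowly_varying_law = prob_space \<mu> for \<mu> :: "real measure" +
  assumes sets_mu [measurable_cong, simp]: "sets \<mu> = sets borel"
    and slow: "slowly_varying (\<lambda>x. measure \<mu> {y. x < \<bar>y\<bar>})"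
begin

lemma space_mu [simp]: "space \<mu> = UNIV"
  using sets_eq_imp_space_eq[OF sets_mu] by simp

lemma prob_UNIV [simp]: "prob UNIV = 1" and emeasure_UNIV [simp]: "emeasure \<mu> UNIV = 1"
  using prob_space emeasure_space_1 by simp_all

definition tail :: "real \<Rightarrow> real" where "tail x = measure \<mu> {y. x < \<bar>y\<bar>}"
text \<open>The Laplace transform of the squared entry; squares, because rows are normalized by sums
  of squares. \<open>laplace'\<close> is minus its derivative.\<close>

definition laplace :: "real \<Rightarrow> real" where "laplace s = (\<integral>x. exp (- s * x\<^sup>2) \<partial>\<mu>)"
definition laplace' :: "real \<Rightarrow> real" where "laplace' s = (\<integral>x. x\<^sup>2 * exp (- s * x\<^sup>2) \<partial>\<mu>)"

lemma tail_nonneg: "0 \<le> tail x" and tail_le_1: "tail x \<le> 1"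
  by (auto simp: tail_def)

lemma tail_antimono: "x \<le> y \<Longrightarrow> tail y \<le> tail x"
  unfolding tail_def by (intro finite_measure_mono) auto

lemma eventually_tail_ratio:
  assumes "t > 0" "e > 0"
  shows "eventually (\<lambda>x. tail x > 0 \<and> tail x \<le> (1 + e) * tail (t * x)) at_top"
proof -
  have "((\<lambda>x. tail (t * x) / tail x) \<longlongrightarrow> 1) at_top"
    using slow assms by (auto simp: slowly_varying_def tail_def)
  moreover have "1 / (1 + e) < 1" using assms by simp
  ultimately have "eventually (\<lambda>x. 1 / (1 + e) < tail (t * x) / tail x) at_top"
    by (rule order_tendstoD)
  then show ?thesis
  proof eventually_elim
    case (elim x)
    \<comment> \<open>A vanishing \<open>tail x\<close> would make the quotient 0, which is below
      \<open>1 / (1 + e)\<close>.\<close>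
    have "tail x \<noteq> 0"
      using elim assms by (auto simp: field_simps)
    then have "tail x > 0" using tail_nonneg[of x] by simp
    then show ?case using elim assms by (simp add: field_simps)
  qed
qed

text \<open>If doubling the argument at most halves the tail beyond \<open>Y\<close>, then
  \<open>tail y\<close> is at least a constant over \<open>y\<close>, so
  \<open>y\<^sup>2 * tail y\<close> grows at least linearly. Slow variation allows ratios
  arbitrarily close to 1; the ratio 1/2 is enough here.\<close>

lemma tail_decay:
  obtains y0 where "y0 > 0" "\<And>y. y \<ge> y0 \<Longrightarrow> B \<le> y\<^sup>2 * tail y"
proof -
  from eventually_tail_ratio[of 2 1]
  obtain Y0 where Y0: "\<And>y. y \<ge> Y0 \<Longrightarrow> tail y > 0 \<and> tail y \<le> 2 * tail (2 * y)"
    by (auto simp: eventually_at_top_linorder)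
  define Y where "Y = max Y0 1"
  have Y: "Y \<ge> 1" "\<And>y. y \<ge> Y \<Longrightarrow> tail y > 0" "\<And>y. y \<ge> Y \<Longrightarrow> tail y \<le> 2 * tail (2 * y)"
    using Y0 by (auto simp: Y_def)
  have pow: "tail Y \<le> 2 ^ k * tail (2 ^ k * Y)" for k
  proof (induction k)
    case (Suc k)
    have "2 ^ k * Y \<ge> 1 * Y" using Y(1) by (intro mult_right_mono) auto
    then have "tail (2 ^ k * Y) \<le> 2 * tail (2 * (2 ^ k * Y))" by (intro Y) simp
    then have "2 ^ k * tail (2 ^ k * Y) \<le> 2 ^ k * (2 * tail (2 * (2 ^ k * Y)))"
      by (rule mult_left_mono) simp
    moreover have "2 ^ Suc k * tail (2 ^ Suc k * Y) = 2 ^ k * (2 * tail (2 * (2 ^ k * Y)))"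
      by (simp add: mult.assoc)
    ultimately show ?case using Suc by linarith
  qed simp
  have lower: "tail Y * Y / 2 * y \<le> y\<^sup>2 * tail y" if "y \<ge> Y" for y
  proof -
    have "\<exists>k. y < 2 ^ k * Y"
    proof -
      obtain k where "y / Y < real k" using reals_Archimedean2 by blast
      also have "real k < 2 ^ k" by (rule of_nat_less_two_power)
      finally show ?thesis using Y(1) by (auto simp: field_simps)
    qed
    \<comment> \<open>The least \<open>k\<close> traps \<open>y\<close> between
      \<open>2 ^ (k - 1) * Y\<close> and \<open>2 ^ k * Y\<close>, so monotonicity of the tail loses
      only a factor 2.\<close>
    define k where "k = (LEAST k. y < 2 ^ k * Y)"
    have k: "y < 2 ^ k * Y" unfolding k_def by (rule LeastI_ex) fact
    have "k \<noteq> 0" using k that by (intro notI) auto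
    then obtain j where j: "k = Suc j" by (cases k) auto
    have "\<not> y < 2 ^ j * Y" using not_less_Least[of j "\<lambda>k. y < 2 ^ k * Y"] j k_def by auto
    then have yj: "2 ^ j * Y \<le> y" by simp
    have "tail Y \<le> 2 ^ k * tail (2 ^ k * Y)" by (rule pow)
    also have "\<dots> \<le> 2 ^ k * tail y" using k by (intro mult_left_mono tail_antimono) auto
    finally have "tail Y * Y \<le> (2 ^ k * tail y) * Y" using Y(1) by (intro mult_right_mono) auto
    also have "\<dots> = 2 * tail y * (2 ^ j * Y)" by (simp add: j)
    also have "\<dots> \<le> 2 * tail y * y" using yj tail_nonneg[of y] by (intro mult_left_mono) auto
    finally have "tail Y * Y / 2 * y \<le> tail y * y * y"
      using that Y(1) by (intro mult_right_mono) auto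
    then show ?thesis by (simp add: power2_eq_square mult_ac)
  qed
  define c where "c = tail Y * Y / 2"
  have c: "c > 0" using Y by (auto simp: c_def)
  show ?thesis
  proof (rule that[of "max Y (B / c)"])
    fix y assume "y \<ge> max Y (B / c)"
    then have "B \<le> c * y" "y \<ge> Y" using c by (auto simp: field_simps)
    with lower[of y] show "B \<le> y\<^sup>2 * tail y" by (simp add: c_def)
  qed (use Y in auto)
qed

lemma integrable_exp_sq: "s \<ge> 0 \<Longrightarrow> integrable \<mu> (\<lambda>x. exp (- s * x\<^sup>2))"
  by (rule integrable_const_bound[of _ 1]) auto

lemma exp_moment_bound:
  fixes y s :: real
  assumes "y \<ge> 0" "s > 0"
  shows "y * exp (- s * y) \<le> 1 / s" "y\<^sup>2 * exp (- s * y) \<le> 4 / s\<^sup>2"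
proof -
  have *: "t * exp (- t) \<le> 1" if "t \<ge> 0" for t :: real
  proof -
    have "t \<le> exp t" using exp_ge_add_one_self[of t] by linarith
    then show ?thesis by (simp add: exp_minus field_simps)
  qed
  show "y * exp (- s * y) \<le> 1 / s" using *[of "s * y"] assms by (simp add: field_simps)
  \<comment> \<open>The second bound is the square of the first at half the rate, which produces the
    4.\<close>
  have "(s * y / 2 * exp (- (s * y / 2)))\<^sup>2 \<le> 1\<^sup>2"
    by (rule power_mono) (use *[of "s * y / 2"] assms in auto)
  also have "(s * y / 2 * exp (- (s * y / 2)))\<^sup>2 = s\<^sup>2 * (y\<^sup>2 * exp (- s * y)) / 4"
    by (simp add: power_mult_distrib power_divide exp_double[symmetric])
  finally show "y\<^sup>2 * exp (- s * y) \<le> 4 / s\<^sup>2" using assms by (simp add: field_simps)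
qed

lemma integrable_sq_exp_sq: "s > 0 \<Longrightarrow> integrable \<mu> (\<lambda>x. x\<^sup>2 * exp (- s * x\<^sup>2))"
  by (rule integrable_const_bound[of _ "1/s"]) (use exp_moment_bound(1)[of "_\<^sup>2"] in auto)

lemma laplace_pos: "s \<ge> 0 \<Longrightarrow> 0 < laplace s"
  unfolding laplace_def
  using integral_less_AE_space[of "\<lambda>_. 0" "\<lambda>x. exp (- s * x\<^sup>2)"] integrable_exp_sq[of s] by simp

lemma laplace_antimono: "0 \<le> s \<Longrightarrow> s \<le> t \<Longrightarrow> laplace t \<le> laplace s"
  unfolding laplace_def
  by (intro integral_mono integrable_exp_sq) (auto intro!: mult_right_mono)

lemma laplace_0: "laplace 0 = 1"
  by (simp add: laplace_def prob_space)

lemma laplace_le_1: "s \<ge> 0 \<Longrightarrow> laplace s \<le> 1"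
  using laplace_antimono[of 0 s] by (simp add: laplace_0)

lemma laplace'_nonneg: "0 \<le> laplace' s"
  unfolding laplace'_def by (intro integral_nonneg_AE) auto

lemma laplace'_bound: "s > 0 \<Longrightarrow> s * laplace' s \<le> 1"
proof -
  assume s: "s > 0"
  have "laplace' s \<le> (\<integral>x. 1 / s \<partial>\<mu>)"
    unfolding laplace'_def using s exp_moment_bound(1)[of "_\<^sup>2" s]
    by (intro integral_mono integrable_sq_exp_sq) auto
  then show ?thesis using s by (simp add: prob_space field_simps)
qed

text \<open>Convexity of the exponential replaces the derivative by a difference over one halving of
  \<open>s\<close>. Such differences are what a slowly varying tail controls.\<close>

lemma laplace'_le_diff:
  assumes "s > 0"
  shows "s * laplace' s \<le> 2 * (laplace (s/2) - laplace s)"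
proof -
  have *: "t * exp (- t) \<le> 2 * (exp (- t/2) - exp (- t))" for t :: real
  proof -
    have "exp (-t) * (1 + t / 2) \<le> exp (-t) * exp (t / 2)"
      by (intro mult_left_mono exp_ge_add_one_self) simp
    also have "\<dots> = exp (- t / 2)" by (simp add: exp_add[symmetric] field_simps)
    finally show ?thesis by (simp add: field_simps)
  qed
  have "s * laplace' s = (\<integral>x. s * x\<^sup>2 * exp (- s * x\<^sup>2) \<partial>\<mu>)"
    by (simp add: laplace'_def mult.assoc)
  also have "\<dots> \<le> (\<integral>x. 2 * (exp (- (s/2) * x\<^sup>2) - exp (- s * x\<^sup>2)) \<partial>\<mu>)"
    using assms integrable_sq_exp_sq[of s] *[of "s * _\<^sup>2"]
    by (intro integral_mono integrable_mult_right Bochner_Integration.integrable_diff integrable_exp_sq)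
      (auto simp: mult.assoc)
  also have "\<dots> = 2 * (laplace (s/2) - laplace s)"
    unfolding laplace_def using assms
    by (subst integral_mult_right_zero, subst Bochner_Integration.integral_diff) (auto intro!: integrable_exp_sq[unfolded minus_mult_left[symmetric]] integrable_exp_sq[of "s/2", simplified])
  finally show ?thesis .
qed

text \<open>A Taylor estimate uniform in \<open>x\<close>: for
  \<open>\<bar>h\<bar> \<le> s / 2\<close> a decay rate \<open>s / 2\<close> is left over to absorb
  the remainder of the exponential.\<close>

lemma laplace_derivative:
  assumes s: "s > 0"
  shows "(laplace has_real_derivative - laplace' s) (at s)"
    and "isCont laplace' s"
proof -
  \<comment> \<open>This is the second bound of \<open>exp_moment_bound\<close> at rate
    \<open>s / 2\<close>.\<close>
  define C where "C = 16 / s\<^sup>2"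
  have C: "y\<^sup>2 * exp (- (s/2) * y) \<le> C" if "y \<ge> 0" for y
    using exp_moment_bound(2)[OF that, of "s/2"] s by (simp add: C_def field_simps power2_eq_square)
  have e1: "\<bar>exp u - 1 - u\<bar> \<le> u\<^sup>2 * exp \<bar>u\<bar>" and e2: "\<bar>exp u - 1\<bar> \<le> \<bar>u\<bar> * exp \<bar>u\<bar>" for u :: real
  proof -
    have a: "exp u - 1 \<le> u * exp u" for u :: real
    proof -
      have "exp u * (1 - u) \<le> exp u * exp (- u)" using exp_ge_add_one_self[of "-u"]
        by (intro mult_left_mono) auto
      then show ?thesis by (simp add: exp_add[symmetric] algebra_simps)
    qed
    have l: "u \<le> exp u - 1" using exp_ge_add_one_self[of u] by linarith
    have "\<bar>exp u - 1 - u\<bar> \<le> u * (exp u - 1)" using a[of u] l by (simp add: algebra_simps)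
    also have "\<dots> \<le> \<bar>u\<bar> * \<bar>exp u - 1\<bar>" by (metis abs_ge_self abs_mult)
    finally have 1: "\<bar>exp u - 1 - u\<bar> \<le> \<bar>u\<bar> * \<bar>exp u - 1\<bar>" .
    show 2: "\<bar>exp u - 1\<bar> \<le> \<bar>u\<bar> * exp \<bar>u\<bar>"
    proof (cases "u \<ge> 0")
      case True then show ?thesis using a[of u] l by simp
    next
      case False
      then have "\<bar>exp u - 1\<bar> \<le> \<bar>u\<bar> * 1" using l by simp
      also have "\<dots> \<le> \<bar>u\<bar> * exp \<bar>u\<bar>" by (intro mult_left_mono) auto
      finally show ?thesis .
    qed
    have "\<bar>u\<bar> * \<bar>exp u - 1\<bar> \<le> \<bar>u\<bar> * (\<bar>u\<bar> * exp \<bar>u\<bar>)" by (intro mult_left_mono 2) auto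
    with 1 show "\<bar>exp u - 1 - u\<bar> \<le> u\<^sup>2 * exp \<bar>u\<bar>" by (simp only: power2_eq_square mult.assoc[symmetric] abs_mult_self_eq)
  qed
  have ee: "exp (- s * y) * exp \<bar>h * y\<bar> \<le> exp (- (s/2) * y)" if "y \<ge> 0" "\<bar>h\<bar> \<le> s / 2" for h y
  proof -
    have "\<bar>h * y\<bar> \<le> s/2 * y" using mult_right_mono[OF that(2) that(1)] that by (simp add: abs_mult)
    then have "exp (- s * y + \<bar>h * y\<bar>) \<le> exp (- (s/2) * y)" by (subst exp_le_cancel_iff) linarith
    then show ?thesis by (simp only: exp_add)
  qed
  have p1: "\<bar>exp (- (s + h) * x\<^sup>2) - exp (- s * x\<^sup>2) + h * (x\<^sup>2 * exp (- s * x\<^sup>2))\<bar> \<le> C * h\<^sup>2"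
    and p2: "\<bar>x\<^sup>2 * exp (- (s + h) * x\<^sup>2) - x\<^sup>2 * exp (- s * x\<^sup>2)\<bar> \<le> C * \<bar>h\<bar>"
    if h: "\<bar>h\<bar> \<le> s / 2" for h x
  proof -
    define y where "y = x\<^sup>2"
    have y: "y \<ge> 0" by (simp add: y_def)
    have eq: "exp (- (s + h) * y) = exp (- s * y) * exp (- h * y)"
      by (simp add: exp_add[symmetric] algebra_simps)
    have "exp (- (s + h) * y) - exp (- s * y) + h * (y * exp (- s * y)) = exp (- s * y) * (exp (- h * y) - 1 - (- h * y))"
      unfolding eq by (simp add: algebra_simps)
    then have "\<bar>exp (- (s + h) * y) - exp (- s * y) + h * (y * exp (- s * y))\<bar> =
        exp (- s * y) * \<bar>exp (- h * y) - 1 - (- h * y)\<bar>"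
      by (simp only: abs_mult abs_exp_cancel)
    also have "\<dots> \<le> exp (- s * y) * ((- h * y)\<^sup>2 * exp \<bar>- h * y\<bar>)" by (intro mult_left_mono e1) simp
    also have "\<dots> = h\<^sup>2 * (y\<^sup>2 * (exp (- s * y) * exp \<bar>h * y\<bar>))" by (simp add: power_mult_distrib)
    also have "\<dots> \<le> h\<^sup>2 * (y\<^sup>2 * exp (- (s/2) * y))" by (intro mult_left_mono ee h y) auto
    also have "\<dots> \<le> h\<^sup>2 * C" by (intro mult_left_mono C y) auto
    finally show "\<bar>exp (- (s + h) * x\<^sup>2) - exp (- s * x\<^sup>2) + h * (x\<^sup>2 * exp (- s * x\<^sup>2))\<bar> \<le> C * h\<^sup>2"
      by (simp add: y_def mult.commute)
    have "y * exp (- (s + h) * y) - y * exp (- s * y) = y * exp (- s * y) * (exp (- h * y) - 1)"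
      unfolding eq by (simp only: algebra_simps)
    then have "\<bar>y * exp (- (s + h) * y) - y * exp (- s * y)\<bar> = y * exp (- s * y) * \<bar>exp (- h * y) - 1\<bar>"
      using y by (simp only: abs_mult abs_exp_cancel abs_of_nonneg)
    also have "\<dots> \<le> y * exp (- s * y) * (\<bar>- h * y\<bar> * exp \<bar>- h * y\<bar>)"
      by (intro mult_left_mono e2) (use y in auto)
    also have "\<dots> = \<bar>h\<bar> * (y\<^sup>2 * (exp (- s * y) * exp \<bar>h * y\<bar>))"
      using y by (simp add: abs_mult power2_eq_square)
    also have "\<dots> \<le> \<bar>h\<bar> * (y\<^sup>2 * exp (- (s/2) * y))" by (intro mult_left_mono ee h y) auto
    also have "\<dots> \<le> \<bar>h\<bar> * C" by (intro mult_left_mono C y) auto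
    finally show "\<bar>x\<^sup>2 * exp (- (s + h) * x\<^sup>2) - x\<^sup>2 * exp (- s * x\<^sup>2)\<bar> \<le> C * \<bar>h\<bar>"
      by (simp add: y_def mult.commute)
  qed
  have b: "\<bar>integral\<^sup>L \<mu> f\<bar> \<le> c" if "\<And>x. \<bar>f x\<bar> \<le> c" "f \<in> borel_measurable \<mu>" for f and c :: real
  proof -
    have "\<bar>integral\<^sup>L \<mu> f\<bar> \<le> (\<integral>x. \<bar>f x\<bar> \<partial>\<mu>)" by (rule integral_abs_bound)
    also have "\<dots> \<le> (\<integral>x. c \<partial>\<mu>)" using that order_trans[OF abs_ge_zero that(1)]
      by (intro integral_mono integrable_const_bound[where B=c]) auto
    finally show ?thesis by simp
  qed
  have i1: "\<bar>laplace (s + h) - laplace s + h * laplace' s\<bar> \<le> C * h\<^sup>2"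
    and i2: "\<bar>laplace' (s + h) - laplace' s\<bar> \<le> C * \<bar>h\<bar>" if h: "\<bar>h\<bar> \<le> s / 2" for h
  proof -
    have sh: "s + h > 0" using h s by linarith
    have "laplace (s + h) - laplace s + h * laplace' s =
      (\<integral>x. exp (- (s + h) * x\<^sup>2) - exp (- s * x\<^sup>2) + h * (x\<^sup>2 * exp (- s * x\<^sup>2)) \<partial>\<mu>)"
      unfolding laplace_def laplace'_def
      using integrable_exp_sq[of s] integrable_exp_sq[of "s + h"] integrable_sq_exp_sq[of s] s sh by simp
    also have "\<bar>\<dots>\<bar> \<le> C * h\<^sup>2" by (rule b[OF p1[OF h]]) simp
    finally show "\<bar>laplace (s + h) - laplace s + h * laplace' s\<bar> \<le> C * h\<^sup>2" .
    have "laplace' (s + h) - laplace' s =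
      (\<integral>x. x\<^sup>2 * exp (- (s + h) * x\<^sup>2) - x\<^sup>2 * exp (- s * x\<^sup>2) \<partial>\<mu>)"
      unfolding laplace'_def
      using integrable_sq_exp_sq[of s] integrable_sq_exp_sq[of "s + h"] s sh by simp
    also have "\<bar>\<dots>\<bar> \<le> C * \<bar>h\<bar>" by (rule b[OF p2[OF h]]) simp
    finally show "\<bar>laplace' (s + h) - laplace' s\<bar> \<le> C * \<bar>h\<bar>" .
  qed
  have ev: "eventually (\<lambda>h. \<bar>h\<bar> \<le> s / 2) (at 0)"
    using s by (intro eventually_at_in_open'[of "{-s/2<..<s/2}", THEN eventually_mono]) auto
  have tz: "((\<lambda>h. C * \<bar>h\<bar>) \<longlongrightarrow> 0) (at 0)"
    by (rule tendsto_eq_intros refl | simp)+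
  show "(laplace has_real_derivative - laplace' s) (at s)"
    unfolding DERIV_def
  proof (rule Lim_transform2[where a = "- laplace' s" and f = "\<lambda>h. - laplace' s"])
    show "((\<lambda>h. - laplace' s - (laplace (s + h) - laplace s) / h) \<longlongrightarrow> 0) (at 0)"
    proof (rule Lim_null_comparison[OF _ tz])
      show "\<forall>\<^sub>F h in at 0. norm (- laplace' s - (laplace (s + h) - laplace s) / h) \<le> C * \<bar>h\<bar>"
        using ev eventually_neq_at_within[of 0]
      proof eventually_elim
        case (elim h)
        have "- laplace' s - (laplace (s + h) - laplace s) / h
            = - (laplace (s + h) - laplace s + h * laplace' s) / h"
          using elim by (simp add: field_simps)
        then have "norm (- laplace' s - (laplace (s + h) - laplace s) / h)
           = \<bar>laplace (s + h) - laplace s + h * laplace' s\<bar> / \<bar>h\<bar>" by (simp only: abs_divide abs_minus_cancel real_norm_def)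
        also have "\<dots> \<le> C * h\<^sup>2 / \<bar>h\<bar>" using i1[OF elim(1)] by (intro divide_right_mono) auto
        also have "\<dots> = C * \<bar>h\<bar>" using elim by (simp add: power2_eq_square field_simps abs_if)
        finally show ?case .
      qed
    qed
  qed simp
  have "((\<lambda>h. laplace' (s + h) - laplace' s) \<longlongrightarrow> 0) (at 0)"
    by (rule Lim_null_comparison[OF _ tz]) (use ev in eventually_elim, use i2 in simp)
  then show "isCont laplace' s"
    unfolding isCont_iff using LIM_zero_iff by blast
qed

text \<open>A layer-cake formula in the variable \<open>w = sqrt s * \<bar>x\<bar>\<close>. Only the
  argument of \<open>tail\<close> contains \<open>s\<close>, so halving \<open>s\<close> stretches
  that argument by \<open>sqrt 2\<close>, which is the operation that slow variation speaks
  about.\<close>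

lemma one_minus_laplace_eq:
  assumes s: "s > 0"
  shows "ennreal (1 - laplace s) =
    (\<integral>\<^sup>+w. ennreal (2 * w * exp (- w\<^sup>2) * tail (w / sqrt s)) * indicator {0..} w \<partial>lborel)"
proof -
  interpret pair_sigma_finite lborel \<mu> ..
  have pt: "ennreal (1 - exp (- s * x\<^sup>2)) =
    (\<integral>\<^sup>+w. ennreal (2 * w * exp (- w\<^sup>2)) * indicator {0..} w * indicator {x. w / sqrt s < \<bar>x\<bar>} x \<partial>lborel)" for x
  proof -
    have "(\<integral>\<^sup>+w. ennreal (2 * w * exp (- w\<^sup>2)) * indicator {0..} w * indicator {x. w / sqrt s < \<bar>x\<bar>} x \<partial>lborel)
      = (\<integral>\<^sup>+w. ennreal (2 * w * exp (- w\<^sup>2)) * indicator {0..sqrt s * \<bar>x\<bar>} w \<partial>lborel)"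
      \<comment> \<open>The two integrands differ at most at the endpoint
        \<open>w = sqrt s * \<bar>x\<bar>\<close>, which the strict inequality excludes.\<close>
      using AE_lborel_singleton[of "sqrt s * \<bar>x\<bar>"] s
      by (intro nn_integral_cong_AE) (auto elim!: eventually_mono simp: indicator_def field_simps)
    also have "\<dots> = ennreal (- exp (- (sqrt s * \<bar>x\<bar>)\<^sup>2) - (- exp (- 0\<^sup>2)))"
      using s by (intro nn_integral_FTC_Icc) (auto intro!: derivative_eq_intros)
    also have "\<dots> = ennreal (1 - exp (- s * x\<^sup>2))"
      using s by (simp add: power_mult_distrib)
    finally show ?thesis ..
  qed
  have "ennreal (1 - laplace s) = ennreal (\<integral>x. 1 - exp (- s * x\<^sup>2) \<partial>\<mu>)"
    using integrable_exp_sq[of s] s by (simp add: laplace_def)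
  also have "\<dots> = (\<integral>\<^sup>+x. ennreal (1 - exp (- s * x\<^sup>2)) \<partial>\<mu>)"
    using integrable_exp_sq[of s] s by (intro nn_integral_eq_integral[symmetric]) auto
  also have "\<dots> = (\<integral>\<^sup>+x. \<integral>\<^sup>+w. ennreal (2 * w * exp (- w\<^sup>2)) * indicator {0..} w *
      indicator {x. w / sqrt s < \<bar>x\<bar>} x \<partial>lborel \<partial>\<mu>)"
    by (simp only: pt)
  also have "\<dots> = (\<integral>\<^sup>+w. \<integral>\<^sup>+x. ennreal (2 * w * exp (- w\<^sup>2)) * indicator {0..} w *
      indicator {x. w / sqrt s < \<bar>x\<bar>} x \<partial>\<mu> \<partial>lborel)"
  proof (rule Fubini')
    have *: "indicator {x. w / sqrt s < \<bar>x\<bar>} x = (if w / sqrt s < \<bar>x\<bar> then 1 else 0 :: ennreal)" for w x :: real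
      by (simp add: indicator_def)
    show "(\<lambda>(w, x). ennreal (2 * w * exp (- w\<^sup>2)) * indicator {0..} w * indicator {x. w / sqrt s < \<bar>x\<bar>} x)
      \<in> borel_measurable (lborel \<Otimes>\<^sub>M \<mu>)"
      unfolding * by measurable
  qed
  also have "\<dots> = (\<integral>\<^sup>+w. ennreal (2 * w * exp (- w\<^sup>2) * tail (w / sqrt s)) * indicator {0..} w \<partial>lborel)"
  proof (rule nn_integral_cong)
    fix w :: real
    have "(\<integral>\<^sup>+x. ennreal (2 * w * exp (- w\<^sup>2)) * indicator {0..} w * indicator {x. w / sqrt s < \<bar>x\<bar>} x \<partial>\<mu>)
       = ennreal (2 * w * exp (- w\<^sup>2)) * indicator {0..} w * emeasure \<mu> {x. w / sqrt s < \<bar>x\<bar>}"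
      by (subst nn_integral_cmult_indicator) auto
    also have "\<dots> = ennreal (2 * w * exp (- w\<^sup>2) * tail (w / sqrt s)) * indicator {0..} w"
      by (auto simp: indicator_def tail_def emeasure_eq_measure ennreal_mult')
    finally show "(\<integral>\<^sup>+x. ennreal (2 * w * exp (- w\<^sup>2)) * indicator {0..} w * indicator {x. w / sqrt s < \<bar>x\<bar>} x \<partial>\<mu>)
       = ennreal (2 * w * exp (- w\<^sup>2) * tail (w / sqrt s)) * indicator {0..} w" .
  qed
  finally show ?thesis .
qed

text \<open>Slow variation compares the integrands of \<open>one_minus_laplace_eq\<close> at
  \<open>s\<close> and \<open>s / 2\<close> wherever the tail argument is at least \<open>Y\<close>.
  The remaining range \<open>w \<le> Y * sqrt s\<close> contributes at most the integral of
  \<open>2 * w\<close>, that is \<open>Y\<^sup>2 * s\<close>.\<close>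

lemma one_minus_laplace_half:
  assumes e: "e > 0"
  obtains C where "C > 0" "\<And>s. s > 0 \<Longrightarrow> 1 - laplace s \<le> (1 + e) * (1 - laplace (s/2)) + C * s"
proof -
  from eventually_tail_ratio[of "sqrt 2" e] e
  obtain Y0 where Y0: "\<And>y. y \<ge> Y0 \<Longrightarrow> tail y \<le> (1 + e) * tail (sqrt 2 * y)"
    by (auto simp: eventually_at_top_linorder)
  define Y where "Y = max Y0 1"
  have Y: "Y > 0" "\<And>y. y \<ge> Y \<Longrightarrow> tail y \<le> (1 + e) * tail (sqrt 2 * y)"
    using Y0 by (auto simp: Y_def)
  have pt: "2 * w * exp (- w\<^sup>2) * tail (w / sqrt s) \<le>
      (1 + e) * (2 * w * exp (- w\<^sup>2) * tail (w / sqrt (s/2))) + 2 * w * indicator {0..Y * sqrt s} w"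
    if "w \<ge> 0" "s > 0" for w s
  proof (cases "w / sqrt s \<ge> Y")
    case True
    have "sqrt 2 * (w / sqrt s) = w / sqrt (s/2)" by (simp add: real_sqrt_divide)
    then have "tail (w / sqrt s) \<le> (1 + e) * tail (w / sqrt (s/2))" using Y(2)[OF True] by simp
    then have "2 * w * exp (- w\<^sup>2) * tail (w / sqrt s) \<le> 2 * w * exp (- w\<^sup>2) * ((1 + e) * tail (w / sqrt (s/2)))"
      using that by (intro mult_left_mono) auto
    also have "\<dots> \<le> 2 * w * exp (- w\<^sup>2) * ((1 + e) * tail (w / sqrt (s/2))) + 2 * w * indicator {0..Y * sqrt s} w"
      using that by simp
    finally show ?thesis by (simp add: mult_ac)
  next
    case False
    then have w: "indicator {0..Y * sqrt s} w = (1::real)" using that by (auto simp: field_simps)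
    have "2 * w * exp (- w\<^sup>2) * tail (w / sqrt s) \<le> 2 * w * 1 * 1"
      using that tail_nonneg tail_le_1 by (intro mult_mono) auto
    moreover have "0 \<le> (1 + e) * (2 * w * exp (- w\<^sup>2) * tail (w / sqrt (s/2)))"
      using that e tail_nonneg by auto
    ultimately show ?thesis unfolding w by linarith
  qed
  show ?thesis
  proof (rule that[of "Y\<^sup>2"])
    show "Y\<^sup>2 > 0" using Y by simp
    fix s :: real assume s: "s > 0"
    have [measurable]: "tail \<in> borel_measurable borel"
    proof -
      have "(\<lambda>x. - tail x) \<in> borel_measurable borel"
        by (intro borel_measurable_mono monoI) (auto intro: tail_antimono)
      then show ?thesis by simp
    qed
    have "ennreal (1 - laplace s) =
      (\<integral>\<^sup>+w. ennreal (2 * w * exp (- w\<^sup>2) * tail (w / sqrt s)) * indicator {0..} w \<partial>lborel)"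
      by (rule one_minus_laplace_eq[OF s])
    also have "\<dots> \<le> (\<integral>\<^sup>+w. ennreal (1 + e) * (ennreal (2 * w * exp (- w\<^sup>2) * tail (w / sqrt (s/2))) * indicator {0..} w)
        + ennreal (2 * w) * indicator {0..Y * sqrt s} w \<partial>lborel)"
    proof (rule nn_integral_mono)
      fix w :: real
      show "ennreal (2 * w * exp (- w\<^sup>2) * tail (w / sqrt s)) * indicator {0..} w \<le>
        ennreal (1 + e) * (ennreal (2 * w * exp (- w\<^sup>2) * tail (w / sqrt (s/2))) * indicator {0..} w)
        + ennreal (2 * w) * indicator {0..Y * sqrt s} w"
      proof (cases "w \<ge> 0")
        case True
        have "ennreal (1 + e) * ennreal (2 * w * exp (- w\<^sup>2) * tail (w / sqrt (s/2))) + ennreal (2 * w) * indicator {0..Y * sqrt s} w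
          = ennreal ((1 + e) * (2 * w * exp (- w\<^sup>2) * tail (w / sqrt (s/2))) + 2 * w * indicator {0..Y * sqrt s} w)"
          using True e tail_nonneg by (subst ennreal_plus) (auto simp: ennreal_mult indicator_def)
        with pt[OF True s] True show ?thesis by (simp add: ennreal_leI)
      qed simp
    qed
    also have "\<dots> = ennreal (1 + e) * ennreal (1 - laplace (s/2)) +
       (\<integral>\<^sup>+w. ennreal (2 * w) * indicator {0..Y * sqrt s} w \<partial>lborel)"
      using s by (subst nn_integral_add) (auto simp: nn_integral_cmult one_minus_laplace_eq[of "s/2"])
    also have "(\<integral>\<^sup>+w. ennreal (2 * w) * indicator {0..Y * sqrt s} w \<partial>lborel) = ennreal ((Y * sqrt s)\<^sup>2 - 0\<^sup>2)"
      using s Y by (intro nn_integral_FTC_Icc) (auto intro!: derivative_eq_intros)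
    also have "ennreal (1 + e) * ennreal (1 - laplace (s/2)) + \<dots> =
       ennreal ((1 + e) * (1 - laplace (s/2)) + Y\<^sup>2 * s)"
      using s e laplace_le_1[of "s/2"] by (subst ennreal_plus) (auto simp: ennreal_mult power_mult_distrib)
    finally show "1 - laplace s \<le> (1 + e) * (1 - laplace (s/2)) + Y\<^sup>2 * s"
      using s e laplace_le_1[of "s/2"] by (subst (asm) ennreal_le_iff) auto
  qed
qed

text \<open>With \<open>y = 1 / sqrt s\<close>, the event \<open>\<bar>x\<bar> > y\<close> alone
  contributes at least half its probability, and \<open>y\<^sup>2 * tail y\<close> exceeds any
  constant by \<open>tail_decay\<close>. Error terms linear in \<open>s\<close> thereby become
  negligible.\<close>

lemma one_minus_laplace_superlinear:
  obtains s0 where "s0 > 0" "\<And>s. 0 < s \<Longrightarrow> s \<le> s0 \<Longrightarrow> B * s \<le> 1 - laplace s"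
proof -
  from tail_decay[of "2 * B"] obtain y0 where y0: "y0 > 0" "\<And>y. y \<ge> y0 \<Longrightarrow> 2 * B \<le> y\<^sup>2 * tail y" by blast
  show ?thesis
  proof (rule that[of "1 / y0\<^sup>2"])
    show "1 / y0\<^sup>2 > 0" using y0 by simp
    fix s assume s: "0 < s" "s \<le> 1 / y0\<^sup>2"
    define y where "y = 1 / sqrt s"
    have ys: "y\<^sup>2 * s = 1" "y > 0" using s by (auto simp: y_def power_divide)
    have "y0\<^sup>2 \<le> y\<^sup>2" using s y0 by (simp add: y_def power_divide field_simps)
    then have "y0 \<le> y" using ys by (rule_tac power2_le_imp_le) auto
    have "tail y / 2 = (\<integral>x. indicator {x. y < \<bar>x\<bar>} x / 2 \<partial>\<mu>)" by (simp add: tail_def)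
    also have "\<dots> \<le> (\<integral>x. 1 - exp (- s * x\<^sup>2) \<partial>\<mu>)"
    proof (intro integral_mono)
      fix x :: real
      show "indicator {x. y < \<bar>x\<bar>} x / 2 \<le> 1 - exp (- s * x\<^sup>2)"
      proof (cases "y < \<bar>x\<bar>")
        case True
        then have "y\<^sup>2 \<le> x\<^sup>2" using ys by (intro abs_le_square_iff[THEN iffD1]) auto
        then have "y\<^sup>2 * s \<le> x\<^sup>2 * s" using s by (intro mult_right_mono) auto
        then have "1 \<le> s * x\<^sup>2" using ys by (simp add: mult.commute)
        then have "2 \<le> exp (s * x\<^sup>2)" using exp_ge_add_one_self[of "s * x\<^sup>2"] by linarith
        then have "exp (- s * x\<^sup>2) \<le> 1/2" by (simp add: exp_minus field_simps)
        then show ?thesis using True by simp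
      qed (use s in simp)
    qed (use integrable_exp_sq[of s] s in \<open>auto intro!: integrable_const_bound[where B = 1] simp: indicator_def\<close>)
    also have "\<dots> = 1 - laplace s" using integrable_exp_sq[of s] s by (simp add: laplace_def)
    finally have "tail y \<le> 2 * (1 - laplace s)" by simp
    then have "2 * B \<le> y\<^sup>2 * (2 * (1 - laplace s))"
      using y0(2)[OF \<open>y0 \<le> y\<close>] mult_left_mono[of "tail y" _ "y\<^sup>2"] by (meson order_trans zero_le_power2)
    then have "2 * B * s \<le> y\<^sup>2 * (2 * (1 - laplace s)) * s" using s by (intro mult_right_mono) auto
    also have "\<dots> = (y\<^sup>2 * s) * (2 * (1 - laplace s))" by (simp add: mult_ac)
    finally show "B * s \<le> 1 - laplace s" using ys by simp
  qed
qed

text \<open>\<open>laplace'_le_diff\<close> bounds the left side by the gain of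
  \<open>1 - laplace\<close> over one halving of the argument. Slow variation makes this gain a
  small fraction of \<open>1 - laplace s\<close>, up to a linear error that superlinearity
  absorbs.\<close>

lemma laplace'_negligible:
  assumes e: "e > 0"
  obtains s0 where "s0 > 0" "\<And>s. 0 < s \<Longrightarrow> s \<le> s0 \<Longrightarrow> s * laplace' s \<le> e * (1 - laplace s)"
proof -
  \<comment> \<open>Two error terms, doubled by the factor of \<open>laplace'_le_diff\<close>, must
    add up to \<open>e\<close>.\<close>
  have e4: "e/4 > 0" using e by simp
  from one_minus_laplace_half[OF e4] obtain C where
    C: "C > 0" "\<And>s. s > 0 \<Longrightarrow> 1 - laplace s \<le> (1 + e/4) * (1 - laplace (s/2)) + C * s" by blast
  from one_minus_laplace_superlinear[of "4 * C / e"] obtain s0 where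
    s0: "s0 > 0" "\<And>s. 0 < s \<Longrightarrow> s \<le> s0 \<Longrightarrow> 4 * C / e * s \<le> 1 - laplace s" by blast
  show ?thesis
  proof (rule that[OF s0(1)])
    fix s assume s: "0 < s" "s \<le> s0"
    have "s * laplace' s \<le> 2 * (laplace (s/2) - laplace s)" by (rule laplace'_le_diff[OF s(1)])
    also have "\<dots> \<le> 2 * (e/4 * (1 - laplace (s/2)) + C * s)" using C(2)[OF s(1)] by (simp add: algebra_simps)
    also have "\<dots> \<le> 2 * (e/4 * (1 - laplace s) + e/4 * (1 - laplace s))"
    proof -
      have "e/4 * (1 - laplace (s/2)) \<le> e/4 * (1 - laplace s)"
        using laplace_antimono[of "s/2" s] s e by (intro mult_left_mono) auto
      moreover have "C * s \<le> e/4 * (1 - laplace s)" using s0(2)[OF s] e by (simp add: field_simps)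
      ultimately show ?thesis by (simp only: mult_le_cancel_left_pos[OF zero_less_numeral] add_mono)
    qed
    finally show "s * laplace' s \<le> e * (1 - laplace s)" by simp
  qed
qed

end

text \<open>The expression is the integral of \<open>t ^ m * (1 - t)\<close> over \<open>t\<close>
  from 0 to \<open>u\<close>, and the upper bound is its value at \<open>u = 1\<close>, a Beta
  integral.\<close>

lemma beta_primitive_bounds:
  fixes u :: real
  assumes "0 \<le> u" "u \<le> 1"
  shows "0 \<le> u ^ (m+1) / (real m + 1) - u ^ (m+2) / (real m + 2)"
    and "u ^ (m+1) / (real m + 1) - u ^ (m+2) / (real m + 2) \<le> 1 / ((real m + 1) * (real m + 2))"
proof -
  have "u ^ (m+1) * u / (real m + 2) \<le> u ^ (m+1) * 1 / (real m + 1)"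
    using assms by (intro frac_le mult_left_mono) auto
  then show "0 \<le> u ^ (m+1) / (real m + 1) - u ^ (m+2) / (real m + 2)"
    by (simp add: mult_ac)
  \<comment> \<open>A relative of Bernoulli's inequality: the left side does not increase with
    \<open>k\<close>.\<close>
  have *: "u ^ k * (1 + real k * (1 - u)) \<le> 1" for k
  proof (induction k)
    case (Suc k)
    have "0 \<le> (1 - u)\<^sup>2 * (real k + 1)" by simp
    then have "u * (1 + real (Suc k) * (1 - u)) \<le> 1 + real k * (1 - u)"
      by (simp add: power2_eq_square algebra_simps)
    then have "u ^ k * (u * (1 + real (Suc k) * (1 - u))) \<le> u ^ k * (1 + real k * (1 - u))"
      using assms by (intro mult_left_mono) auto
    also note Suc
    finally show ?case by (simp only: power_Suc mult_ac)
  qed simp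
  have "u ^ (m+1) * (real m + 2 - u * (real m + 1)) \<le> 1"
    using *[of "m+1"] by (simp add: algebra_simps)
  then have "u ^ (m+1) * (real m + 2 - u * (real m + 1)) / ((real m + 1) * (real m + 2)) \<le> 1 / ((real m + 1) * (real m + 2))"
    by (intro divide_right_mono) auto
  also have "u ^ (m+1) * (real m + 2 - u * (real m + 1)) / ((real m + 1) * (real m + 2)) =
    u ^ (m+1) / (real m + 1) - u ^ (m+2) / (real m + 2)"
    by (simp add: divide_simps) (simp add: algebra_simps)
  finally show "u ^ (m+1) / (real m + 1) - u ^ (m+2) / (real m + 2) \<le> 1 / ((real m + 1) * (real m + 2))" .
qed

text \<open>Represents the inverse square of a sum as a mixture of exponentials, which factorize
  over independent summands.\<close>

lemma nn_integral_Gamma_2: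
  fixes S :: real
  assumes S: "S > 0"
  shows "(\<integral>\<^sup>+s. ennreal (s * exp (- s * S)) * indicator {0<..} s \<partial>lborel) = ennreal (1 / S\<^sup>2)"
proof -
  define F where "F = (\<lambda>s. - (s / S + 1 / S\<^sup>2) * exp (- s * S))"
  have "(\<integral>\<^sup>+s. ennreal (s * exp (- s * S)) * indicator {0<..} s \<partial>lborel) =
    (\<integral>\<^sup>+s. ennreal (s * exp (- s * S)) * indicator {0..} s \<partial>lborel)"
    by (intro nn_integral_cong) (auto simp: indicator_def)
  also have "\<dots> = ennreal (0 - F 0)"
  proof (rule nn_integral_FTC_atLeast)
    show "(F has_real_derivative s * exp (- s * S)) (at s)" for s
      unfolding F_def using S
      by (auto intro!: derivative_eq_intros simp: field_simps power2_eq_square)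
    show "(F \<longlongrightarrow> 0) at_top"
      unfolding F_def using S by real_asymp
  qed auto
  finally show ?thesis by (simp add: F_def)
qed

section \<open>The mean product of two squared entries of a normalized row\<close>

context slowly_varying_law
begin

lemma measurable_laplace [measurable]: "laplace \<in> borel_measurable borel"
  unfolding laplace_def[abs_def] by measurable

lemma measurable_laplace' [measurable]: "laplace' \<in> borel_measurable borel"
  unfolding laplace'_def[abs_def] by measurable

lemma laplace_less_1: "s > 0 \<Longrightarrow> laplace s < 1"
proof -
  assume s: "s > 0"
  from one_minus_laplace_superlinear[of 1] obtain s0 where
    s0: "s0 > 0" "\<And>s. 0 < s \<Longrightarrow> s \<le> s0 \<Longrightarrow> 1 * s \<le> 1 - laplace s" by blast
  have "laplace s \<le> laplace (min s s0)" using s s0 by (intro laplace_antimono) auto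
  also have "\<dots> < 1" using s0(2)[of "min s s0"] s s0(1) by auto
  finally show ?thesis .
qed

text \<open>By \<open>nn_integral_row_pair\<close> this is the mean of the product of two squared
  normalized entries in a row of length \<open>m + 2\<close>: each of the two gives a factor
  \<open>laplace'\<close>, every other entry a factor \<open>laplace\<close>.\<close>

definition pair_mass :: "nat \<Rightarrow> ennreal" where
  "pair_mass m = (\<integral>\<^sup>+s. ennreal (s * (laplace' s)\<^sup>2 * laplace s ^ m) * indicator {0<..} s \<partial>lborel)"

text \<open>Near 0 one factor \<open>s * laplace' s\<close> is replaced by
  \<open>e * (1 - laplace s)\<close>, and the substitution \<open>u = laplace s\<close> leaves a
  Beta integral. Beyond \<open>s0\<close> the crude bound \<open>s * laplace' s \<le> 1\<close> is
  enough, since \<open>laplace s ^ m\<close> is at most \<open>laplace s0 ^ m\<close>.\<close>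

lemma pair_mass_bound:
  assumes e: "e > 0" and s0: "s0 > 0"
    and small: "\<And>s. 0 < s \<Longrightarrow> s \<le> s0 \<Longrightarrow> s * laplace' s \<le> e * (1 - laplace s)"
  shows "pair_mass m \<le> ennreal (e / ((real m + 1) * (real m + 2)) + laplace s0 ^ m)"
proof -
  define f where "f = (\<lambda>s. e * (1 - laplace s) * laplace s ^ m * laplace' s + laplace s0 ^ m * laplace' s)"
  define g where "g = (\<lambda>u::real. u ^ (m+1) / (real m + 1) - u ^ (m+2) / (real m + 2))"
  \<comment> \<open>A primitive of \<open>f\<close>, found by substituting
    \<open>u = laplace s\<close>; \<open>g\<close> is the primitive of
    \<open>u ^ m * (1 - u)\<close>.\<close>
  define F where "F = (\<lambda>s. - (e * g (laplace s)) - laplace s0 ^ m * laplace s)"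
  have le: "s * (laplace' s)\<^sup>2 * laplace s ^ m \<le> f s" if s: "s > 0" for s
  proof (cases "s \<le> s0")
    case True
    have "(s * laplace' s) * (laplace' s * laplace s ^ m) \<le> (e * (1 - laplace s)) * (laplace' s * laplace s ^ m)"
      using small[OF s True] laplace'_nonneg[of s] laplace_pos[of s] s by (intro mult_right_mono) auto
    moreover have "0 \<le> laplace s0 ^ m * laplace' s" using laplace'_nonneg[of s] laplace_pos[of s0] s0 by simp
    ultimately show ?thesis by (simp add: f_def power2_eq_square mult_ac)
  next
    case False
    have "(s * laplace' s) * (laplace' s * laplace s ^ m) \<le> 1 * (laplace' s * laplace s ^ m)"
      using laplace'_bound[of s] laplace'_nonneg[of s] laplace_pos[of s] s by (intro mult_right_mono) auto
    also have "\<dots> \<le> laplace' s * laplace s0 ^ m"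
      using laplace_antimono[of s0 s] laplace'_nonneg[of s] laplace_pos[of s] s s0 False
      by (auto intro!: mult_left_mono power_mono)
    finally have "s * (laplace' s)\<^sup>2 * laplace s ^ m \<le> laplace s0 ^ m * laplace' s"
      by (simp add: power2_eq_square mult_ac)
    moreover have "0 \<le> e * (1 - laplace s) * laplace s ^ m * laplace' s"
      using e laplace_le_1[of s] laplace_pos[of s] laplace'_nonneg[of s] s by simp
    ultimately show ?thesis by (simp add: f_def)
  qed
  have f0: "f s \<ge> 0" if "s > 0" for s
    using e laplace_le_1[of s] laplace_pos[of s] laplace_pos[of s0] laplace'_nonneg[of s] s0 that by (simp add: f_def)
  have DF: "(F has_real_derivative f s) (at s)" if "s > 0" for s
  proof -
    have "(g has_real_derivative u ^ m * (1 - u)) (at u)" for u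
    proof -
      have "(g has_real_derivative (real (m+1) * u ^ m / (real m + 1) - real (m+2) * u ^ (m+1) / (real m + 2))) (at u)"
        unfolding g_def by (rule derivative_eq_intros refl | simp)+
      moreover have "real (m+1) * u ^ m / (real m + 1) = u ^ m" "real (m+2) * u ^ (m+1) / (real m + 2) = u ^ (m+1)"
        by (simp_all add: divide_eq_eq algebra_simps)
      ultimately show ?thesis by (simp add: algebra_simps)
    qed
    from DERIV_chain2[OF this laplace_derivative(1)[OF that]]
    have "((\<lambda>s. g (laplace s)) has_real_derivative laplace s ^ m * (1 - laplace s) * (- laplace' s)) (at s)" .
    from this laplace_derivative(1)[OF that] show ?thesis
      unfolding F_def f_def by (auto intro!: derivative_eq_intros simp: algebra_simps)
  qed
  have FF: "F b - F a \<le> e / ((real m + 1) * (real m + 2)) + laplace s0 ^ m" if "0 < a" "a \<le> b" for a b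
  proof -
    have "e * (g (laplace a) - g (laplace b)) \<le> e * (1 / ((real m + 1) * (real m + 2)) - 0)"
      using that e unfolding g_def
      by (intro mult_left_mono diff_mono beta_primitive_bounds less_imp_le[OF laplace_pos] laplace_le_1) auto
    moreover have "laplace s0 ^ m * (laplace a - laplace b) \<le> laplace s0 ^ m * (1 - 0)"
      using that laplace_pos[of s0] laplace_le_1[of a] laplace_pos[of b] s0
      by (intro mult_left_mono diff_mono) auto
    ultimately show ?thesis by (simp add: F_def algebra_simps)
  qed
  have [measurable]: "f \<in> borel_measurable borel" unfolding f_def by measurable
  have "pair_mass m \<le> (\<integral>\<^sup>+s. ennreal (f s) * indicator {0<..} s \<partial>lborel)"
    unfolding pair_mass_def using le by (intro nn_integral_mono) (auto simp: indicator_def intro!: ennreal_leI)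
  \<comment> \<open>The half-line is exhausted by compact intervals, because \<open>F\<close> is a
    primitive only at \<open>s > 0\<close>.\<close>
  also have "\<dots> = (\<integral>\<^sup>+s. (SUP k. ennreal (f s) * indicator {1 / real (Suc k)..real (Suc k)} s) \<partial>lborel)"
  proof (rule nn_integral_cong)
    fix s :: real
    show "ennreal (f s) * indicator {0<..} s = (SUP k. ennreal (f s) * indicator {1 / real (Suc k)..real (Suc k)} s)"
    proof (cases "s > 0")
      case True
      obtain k where k: "max s (1/s) < real k" using reals_Archimedean2 by blast
      then have "s \<in> {1 / real (Suc k)..real (Suc k)}" using True by (auto simp: field_simps)
      then show ?thesis using True
        by (intro antisym SUP_least) (auto intro!: SUP_upper2[of k] simp: indicator_def)
    next
      case False
      then have "s \<notin> {1 / real (Suc k)..real (Suc k)}" for k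
        by (auto simp: not_le) (smt (verit) divide_pos_pos of_nat_0_le_iff)
      then show ?thesis using False by simp
    qed
  qed
  also have "\<dots> = (SUP k. \<integral>\<^sup>+s. ennreal (f s) * indicator {1 / real (Suc k)..real (Suc k)} s \<partial>lborel)"
  proof (rule nn_integral_monotone_convergence_SUP)
    show "incseq (\<lambda>k s. ennreal (f s) * indicator {1 / real (Suc k)..real (Suc k)} s)"
    proof (intro incseq_SucI le_funI mult_left_mono indicator_leI)
      fix k s assume "s \<in> {1 / real (Suc k)..real (Suc k)}"
      moreover have "1 / real (Suc (Suc k)) \<le> 1 / real (Suc k)" by (intro divide_left_mono) auto
      ultimately show "s \<in> {1 / real (Suc (Suc k))..real (Suc (Suc k))}" by auto
    qed simp
  qed measurable
  also have "\<dots> \<le> ennreal (e / ((real m + 1) * (real m + 2)) + laplace s0 ^ m)"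
  proof (rule SUP_least)
    fix k
    have pos: "s > 0" if "1 / real (Suc k) \<le> s" for s
      using that by (rule less_le_trans[rotated]) simp
    have "1 / real (Suc k) \<le> 1" by simp
    also have "1 \<le> real (Suc k)" by simp
    finally have ab: "1 / real (Suc k) \<le> real (Suc k)" .
    have "(\<integral>\<^sup>+s. ennreal (f s) * indicator {1 / real (Suc k)..real (Suc k)} s \<partial>lborel) =
      ennreal (F (real (Suc k)) - F (1 / real (Suc k)))"
    proof (rule nn_integral_FTC_Icc)
      fix x assume "x \<in> {1 / real (Suc k)..real (Suc k)}"
      then have "1 / real (Suc k) \<le> x" by simp
      then have "x > 0" by (rule_tac pos)
      then show "(F has_real_derivative f x) (at x)" "0 \<le> f x"
        using DF[of x] f0[of x] by auto
    qed (use ab in auto)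
    also have "\<dots> \<le> ennreal (e / ((real m + 1) * (real m + 2)) + laplace s0 ^ m)"
      by (intro ennreal_leI FF ab) auto
    finally show "(\<integral>\<^sup>+s. ennreal (f s) * indicator {1 / real (Suc k)..real (Suc k)} s \<partial>lborel) \<le> \<dots>" .
  qed
  finally show ?thesis .
qed

text \<open>For \<open>m = n - 2\<close> the factor is \<open>n * (n - 1)\<close>, the number of
  ordered pairs of distinct entries, so the total interaction inside a row vanishes in the
  limit.\<close>

lemma pair_mass_tendsto_0:
  "(\<lambda>m. ennreal ((real m + 1) * (real m + 2)) * pair_mass m) \<longlonglongrightarrow> 0"
proof (rule order_tendstoI)
  fix a :: ennreal assume "0 < a"
  obtain e where e: "0 < e" "ennreal (2 * e) < a"
  proof -
    obtain r where "0 < r" "ennreal r < a"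
    proof (cases a)
      case (real r)
      with \<open>0 < a\<close> show ?thesis by (intro that[of "r/2"]) (auto simp: ennreal_less_iff)
    next
      case top then show ?thesis by (intro that[of 1]) auto
    qed
    then show ?thesis by (intro that[of "r/2"]) auto
  qed
  from laplace'_negligible[OF e(1)] obtain s0 where
    s0: "s0 > 0" "\<And>s. 0 < s \<Longrightarrow> s \<le> s0 \<Longrightarrow> s * laplace' s \<le> e * (1 - laplace s)" by blast
  define c where "c = laplace s0"
  have c: "0 < c" "c < 1" using laplace_pos[of s0] laplace_less_1[of s0] s0 by (auto simp: c_def)
  have "(\<lambda>m. (real m + 1) * (real m + 2) * c ^ m) \<longlonglongrightarrow> 0"
    using c by real_asymp
  then have "eventually (\<lambda>m. (real m + 1) * (real m + 2) * c ^ m < e) sequentially"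
    using e(1) by (rule order_tendstoD)
  then show "eventually (\<lambda>m. ennreal ((real m + 1) * (real m + 2)) * pair_mass m < a) sequentially"
  proof eventually_elim
    case (elim m)
    have "ennreal ((real m + 1) * (real m + 2)) * pair_mass m \<le>
      ennreal ((real m + 1) * (real m + 2)) * ennreal (e / ((real m + 1) * (real m + 2)) + c ^ m)"
      unfolding c_def by (intro mult_left_mono pair_mass_bound e(1) s0) auto
    also have "\<dots> = ennreal (e + (real m + 1) * (real m + 2) * c ^ m)"
    proof -
      have "D * (e / D + c ^ m) = e + D * c ^ m" if "D > 0" for D using that by (simp add: distrib_left)
      from this[of "(real m + 1) * (real m + 2)"] show ?thesis
        using c e(1) by (subst ennreal_mult[symmetric]) (auto intro!: add_nonneg_nonneg divide_nonneg_nonneg)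
    qed
    also have "\<dots> \<le> ennreal (2 * e)" using elim by (intro ennreal_leI) auto
    finally show ?case using e(2) by (rule le_less_trans)
  qed
qed auto

end

section \<open>One row: its law, its normalized entries and their rounding\<close>

context slowly_varying_law
begin

definition row_law :: "nat \<Rightarrow> (nat \<Rightarrow> real) measure" where
  "row_law n = (\<Pi>\<^sub>M j\<in>{..<n}. \<mu>)"

end

definition norm_entry :: "nat \<Rightarrow> nat \<Rightarrow> (nat \<Rightarrow> real) \<Rightarrow> real" where
  "norm_entry n j x = x j / sqrt (\<Sum>l<n. (x l)\<^sup>2)"

text \<open>The threshold 1/2 is what makes a nonzero rounded entry unique in its row: the squares
  sum to at most 1, so two of them cannot both exceed 1/2.\<close>

definition peak_entry :: "nat \<Rightarrow> nat \<Rightarrow> (nat \<Rightarrow> real) \<Rightarrow> real" where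
  "peak_entry n j x = (if (norm_entry n j x)\<^sup>2 > 1/2 then sgn (norm_entry n j x) else 0)"

lemma norm_entry_sq: "(norm_entry n j x)\<^sup>2 = (x j)\<^sup>2 / (\<Sum>l<n. (x l)\<^sup>2)"
  by (simp add: norm_entry_def power_divide sum_nonneg)

lemma sum_norm_entry_sq: "(\<Sum>j<n. (norm_entry n j x)\<^sup>2) = (if \<forall>j<n. x j = 0 then 0 else 1)"
proof -
  have "(\<Sum>j<n. (norm_entry n j x)\<^sup>2) = (\<Sum>j<n. (x j)\<^sup>2) / (\<Sum>j<n. (x j)\<^sup>2)"
    unfolding norm_entry_sq by (rule sum_divide_distrib[symmetric])
  moreover have "(\<Sum>j<n. (x j)\<^sup>2) = 0 \<longleftrightarrow> (\<forall>j<n. x j = 0)"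
    by (subst sum_nonneg_eq_0_iff) auto
  ultimately show ?thesis by simp
qed

lemma norm_entry_sq_le_1: "j < n \<Longrightarrow> (norm_entry n j x)\<^sup>2 \<le> 1"
  using member_le_sum[of j "{..<n}" "\<lambda>j. (norm_entry n j x)\<^sup>2"] sum_norm_entry_sq[of n x]
  by (auto split: if_splits)

lemma abs_norm_entry_le_1: "j < n \<Longrightarrow> \<bar>norm_entry n j x\<bar> \<le> 1"
  using norm_entry_sq_le_1 by (simp add: abs_square_le_1)

lemma abs_peak_entry_le_1: "\<bar>peak_entry n j x\<bar> \<le> 1"
  by (auto simp: peak_entry_def sgn_if)

lemma peak_entry_cases: "peak_entry n j x \<in> {-1, 0, 1}"
  by (auto simp: peak_entry_def sgn_if)

lemma peak_entry_unique:
  assumes "i < n" "j < n" "peak_entry n i x \<noteq> 0" "peak_entry n j x \<noteq> 0"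
  shows "i = j"
proof (rule ccontr)
  assume "i \<noteq> j"
  have "(norm_entry n i x)\<^sup>2 + (norm_entry n j x)\<^sup>2 = (\<Sum>k\<in>{i,j}. (norm_entry n k x)\<^sup>2)"
    using \<open>i \<noteq> j\<close> by simp
  also have "\<dots> \<le> (\<Sum>k<n. (norm_entry n k x)\<^sup>2)"
    using assms by (intro sum_mono2) auto
  also have "\<dots> \<le> 1" by (simp add: sum_norm_entry_sq)
  finally show False using assms by (auto simp: peak_entry_def split: if_splits)
qed

lemma measurable_norm_entry [measurable]:
  "j < n \<Longrightarrow> norm_entry n j \<in> borel_measurable (\<Pi>\<^sub>M j\<in>{..<n}. borel)"
  unfolding norm_entry_def[abs_def] by measurable

lemma measurable_peak_entry [measurable]:
  "j < n \<Longrightarrow> peak_entry n j \<in> borel_measurable (\<Pi>\<^sub>M j\<in>{..<n}. borel)"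
  unfolding peak_entry_def[abs_def] by measurable

context slowly_varying_law
begin

lemma prob_space_row_law: "prob_space (row_law n)"
  unfolding row_law_def by (intro prob_space_PiM prob_space_axioms)

lemma sets_row_law [measurable_cong]: "sets (row_law n) = sets (\<Pi>\<^sub>M j\<in>{..<n}. borel)"
  unfolding row_law_def by (intro sets_PiM_cong) auto

lemma row_law_permute:
  assumes "\<pi> permutes {..<n}"
  shows "distr (row_law n) (row_law n) (\<lambda>x. \<lambda>j\<in>{..<n}. x (\<pi> j)) = row_law n"
  unfolding row_law_def using assms prob_space_axioms
  by (intro distr_PiM_reindex) (auto intro: permutes_inj_on simp: permutes_in_image[of _ "{..<n}", simplified])

lemma norm_entry_permute:
  assumes "\<pi> permutes {..<n}" "j < n"
  shows "norm_entry n j (\<lambda>j\<in>{..<n}. x (\<pi> j)) = norm_entry n (\<pi> j) x"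
proof -
  have "(\<Sum>l<n. (x (\<pi> l))\<^sup>2) = (\<Sum>l<n. (x l)\<^sup>2)"
    using sum.permute[OF assms(1), of "\<lambda>l. (x l)\<^sup>2"] by (simp add: comp_def)
  then show ?thesis using assms(2) by (simp add: norm_entry_def)
qed

lemma row_integral_permute:
  fixes f :: "_ \<Rightarrow> real"
  assumes \<pi>: "\<pi> permutes {..<n}" and f[measurable]: "f \<in> borel_measurable (row_law n)"
  shows "(\<integral>x. f (\<lambda>j\<in>{..<n}. x (\<pi> j)) \<partial>row_law n) = (\<integral>x. f x \<partial>row_law n)"
proof -
  have [measurable]: "(\<lambda>x. \<lambda>j\<in>{..<n}. x (\<pi> j)) \<in> measurable (row_law n) (row_law n)"
    unfolding row_law_def using permutes_in_image[OF \<pi>] by (intro measurable_restrict) auto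
  show ?thesis
    by (subst (2) row_law_permute[OF \<pi>, symmetric]) (simp add: integral_distr)
qed

text \<open>After \<open>nn_integral_Gamma_2\<close> has removed the denominator, Tonelli's theorem
  moves the integral over \<open>s\<close> outside, and the integrand becomes a product over the
  coordinates of the row.\<close>

lemma nn_integral_row_pair:
  assumes ij: "i < n" "j < n" "i \<noteq> j"
  shows "(\<integral>\<^sup>+x. ennreal ((norm_entry n i x)\<^sup>2 * (norm_entry n j x)\<^sup>2) \<partial>row_law n) = pair_mass (n - 2)"
proof -
  interpret product_prob_space "\<lambda>_::nat. \<mu>" ..
  interpret pair_sigma_finite "row_law n" lborel
    using prob_space_imp_sigma_finite[OF prob_space_row_law] by (simp add: pair_sigma_finite_def lborel.sigma_finite_measure_axioms)
  have pt: "ennreal ((norm_entry n i x)\<^sup>2 * (norm_entry n j x)\<^sup>2) =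
    (\<integral>\<^sup>+s. ennreal (s * ((x i)\<^sup>2 * (x j)\<^sup>2) * exp (- s * (\<Sum>l<n. (x l)\<^sup>2))) * indicator {0<..} s \<partial>lborel)" for x
  proof (cases "(\<Sum>l<n. (x l)\<^sup>2) > 0")
    case True
    let ?S = "\<Sum>l<n. (x l)\<^sup>2"
    have "(\<integral>\<^sup>+s. ennreal (s * ((x i)\<^sup>2 * (x j)\<^sup>2) * exp (- s * ?S)) * indicator {0<..} s \<partial>lborel) =
      (\<integral>\<^sup>+s. ennreal ((x i)\<^sup>2 * (x j)\<^sup>2) * (ennreal (s * exp (- s * ?S)) * indicator {0<..} s) \<partial>lborel)"
      by (intro nn_integral_cong) (auto simp: indicator_def ennreal_mult[symmetric] mult_ac)
    also have "\<dots> = ennreal ((x i)\<^sup>2 * (x j)\<^sup>2) * ennreal (1 / ?S\<^sup>2)"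
      by (subst nn_integral_cmult, measurable) (simp only: nn_integral_Gamma_2[OF True])
    also have "\<dots> = ennreal ((norm_entry n i x)\<^sup>2 * (norm_entry n j x)\<^sup>2)"
      by (simp add: ennreal_mult[symmetric] norm_entry_sq power2_eq_square[of ?S])
    finally show ?thesis ..
  next
    case False
    \<comment> \<open>For the zero row both sides vanish: the left one by \<open>0 / 0 = 0\<close>,
      the right one by its factor \<open>(x i)\<^sup>2\<close>.\<close>
    then have "(\<Sum>l<n. (x l)\<^sup>2) = 0" using sum_nonneg[of "{..<n}" "\<lambda>l. (x l)\<^sup>2"] by auto
    then have "x i = 0" using ij by (subst (asm) sum_nonneg_eq_0_iff) auto
    then show ?thesis by (simp add: norm_entry_def)
  qed
  have "(\<integral>\<^sup>+x. ennreal ((norm_entry n i x)\<^sup>2 * (norm_entry n j x)\<^sup>2) \<partial>row_law n) =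
    (\<integral>\<^sup>+x. \<integral>\<^sup>+s. ennreal (s * ((x i)\<^sup>2 * (x j)\<^sup>2) * exp (- s * (\<Sum>l<n. (x l)\<^sup>2))) * indicator {0<..} s \<partial>lborel \<partial>row_law n)"
    by (simp only: pt)
  also have "\<dots> = (\<integral>\<^sup>+s. \<integral>\<^sup>+x. ennreal (s * ((x i)\<^sup>2 * (x j)\<^sup>2) * exp (- s * (\<Sum>l<n. (x l)\<^sup>2))) * indicator {0<..} s \<partial>row_law n \<partial>lborel)"
    using ij by (intro Fubini'[symmetric]) measurable
  also have "\<dots> = pair_mass (n - 2)"
    unfolding pair_mass_def
  proof (rule nn_integral_cong)
    fix s :: real
    show "(\<integral>\<^sup>+x. ennreal (s * ((x i)\<^sup>2 * (x j)\<^sup>2) * exp (- s * (\<Sum>l<n. (x l)\<^sup>2))) * indicator {0<..} s \<partial>row_law n) =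
      ennreal (s * (laplace' s)\<^sup>2 * laplace s ^ (n - 2)) * indicator {0<..} s"
    proof (cases "s > 0")
      case s: True
      define h where "h = (\<lambda>l x. ennreal ((if l \<in> {i,j} then x\<^sup>2 else 1) * exp (- s * x\<^sup>2)) :: ennreal)"
      have h: "(\<integral>\<^sup>+x. h l x \<partial>\<mu>) = ennreal (if l \<in> {i,j} then laplace' s else laplace s)" for l
        unfolding h_def laplace_def laplace'_def
        using integrable_exp_sq[of s] integrable_sq_exp_sq[of s] s
        by (auto intro!: nn_integral_eq_integral)
      have I: "{..<n} = insert i (insert j ({..<n} - {i,j}))" using ij by auto
      have "ennreal (s * ((x i)\<^sup>2 * (x j)\<^sup>2) * exp (- s * (\<Sum>l<n. (x l)\<^sup>2))) = ennreal s * (\<Prod>l<n. h l (x l))" for x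
      proof -
        have "(\<Prod>l<n. h l (x l)) = ennreal (\<Prod>l<n. (if l \<in> {i,j} then (x l)\<^sup>2 else 1) * exp (- s * (x l)\<^sup>2))"
          unfolding h_def by (intro prod_ennreal) auto
        also have "(\<Prod>l<n. (if l \<in> {i,j} then (x l)\<^sup>2 else 1) * exp (- s * (x l)\<^sup>2)) =
          (\<Prod>l<n. if l \<in> {i,j} then (x l)\<^sup>2 else 1) * (\<Prod>l<n. exp (- s * (x l)\<^sup>2))"
          by (rule prod.distrib)
        also have "(\<Prod>l<n. exp (- s * (x l)\<^sup>2)) = exp (- s * (\<Sum>l<n. (x l)\<^sup>2))"
          by (simp add: exp_sum[symmetric] sum_negf sum_distrib_left)
        also have "(\<Prod>l<n. if l \<in> {i,j} then (x l)\<^sup>2 else 1) = (x i)\<^sup>2 * (x j)\<^sup>2"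
          by (subst I) (use ij in \<open>simp add: prod.neutral\<close>)
        finally show ?thesis using s by (simp add: ennreal_mult[symmetric] mult_ac)
      qed
      then have "(\<integral>\<^sup>+x. ennreal (s * ((x i)\<^sup>2 * (x j)\<^sup>2) * exp (- s * (\<Sum>l<n. (x l)\<^sup>2))) * indicator {0<..} s \<partial>row_law n)
        = (\<integral>\<^sup>+x. ennreal s * (\<Prod>l<n. h l (x l)) \<partial>row_law n)" using s by simp
      also have "\<dots> = ennreal s * (\<Prod>l<n. \<integral>\<^sup>+x. h l x \<partial>\<mu>)"
      proof -
        have [measurable]: "h l \<in> borel_measurable \<mu>" for l unfolding h_def by measurable
        show ?thesis unfolding row_law_def by (subst nn_integral_cmult) (auto simp: product_nn_integral_prod)
      qed
      also have "(\<Prod>l<n. \<integral>\<^sup>+x. h l x \<partial>\<mu>) = ennreal (\<Prod>l<n. if l \<in> {i,j} then laplace' s else laplace s)"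
        unfolding h using s laplace'_nonneg laplace_pos[of s] by (intro prod_ennreal) auto
      also have "(\<Prod>l<n. if l \<in> {i,j} then laplace' s else laplace s) = (laplace' s)\<^sup>2 * laplace s ^ (n - 2)"
      proof -
        have "card ({..<n} - {i,j}) = n - 2" using ij by (subst card_Diff_subset) auto
        then have "(\<Prod>l\<in>{..<n} - {i,j}. if l \<in> {i,j} then laplace' s else laplace s) = laplace s ^ (n - 2)"
          by (subst prod.cong[OF refl, of _ _ "\<lambda>_. laplace s"]) auto
        then show ?thesis by (subst I) (use ij in \<open>simp add: power2_eq_square\<close>)
      qed
      finally show ?thesis using s laplace_pos[of s] by (simp add: ennreal_mult[symmetric] mult_ac)
    qed simp
  qed
  finally show ?thesis .
qed

lemma row_entry_exchange:
  fixes f :: "real \<Rightarrow> real \<Rightarrow> real"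
  assumes j: "i < n" "j < n" and f[measurable]: "case_prod f \<in> borel_measurable (borel \<Otimes>\<^sub>M borel)"
  shows "(\<integral>x. f (norm_entry n i x) (peak_entry n i x) \<partial>row_law n) =
    (\<integral>x. f (norm_entry n j x) (peak_entry n j x) \<partial>row_law n)"
proof -
  define \<pi> where "\<pi> = Transposition.transpose i j"
  have \<pi>: "\<pi> permutes {..<n}" unfolding \<pi>_def using j by (intro permutes_swap_id) auto
  have "\<pi> i = j" by (simp add: \<pi>_def)
  have "norm_entry n i (\<lambda>j\<in>{..<n}. x (\<pi> j)) = norm_entry n j x" for x
    using norm_entry_permute[OF \<pi> j(1), of x] \<open>\<pi> i = j\<close> by simp
  moreover from this have "peak_entry n i (\<lambda>j\<in>{..<n}. x (\<pi> j)) = peak_entry n j x" for x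
    by (simp add: peak_entry_def)
  ultimately show ?thesis
    using row_integral_permute[OF \<pi>, of "\<lambda>x. f (norm_entry n i x) (peak_entry n i x)"] j by simp
qed

text \<open>At most one rounded entry is nonzero and its square is then 1, so this is the
  probability that a row has a dominant entry.\<close>

definition peak_prob :: "nat \<Rightarrow> real" where
  "peak_prob n = (\<integral>x. (\<Sum>j<n. (peak_entry n j x)\<^sup>2) \<partial>row_law n)"

text \<open>The mean absolute value of the dominant normalized entry, counted as 0 if there is none.
  Its distance from 1 controls the \<open>L\<^sup>2\<close> error of rounding.\<close>

definition peak_corr :: "nat \<Rightarrow> real" where
  "peak_corr n = (\<integral>x. (\<Sum>j<n. norm_entry n j x * peak_entry n j x) \<partial>row_law n)"

lemma integrable_row:
  assumes "f \<in> borel_measurable (\<Pi>\<^sub>M j\<in>{..<n}. borel)" "\<And>x. \<bar>f x\<bar> \<le> (B::real)"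
  shows "integrable (row_law n) f"
proof -
  interpret R: prob_space "row_law n" by (rule prob_space_row_law)
  show ?thesis using assms by (intro R.integrable_const_bound[of _ B]) (auto simp: sets_row_law)
qed

lemma sum_peak_entry_sq_le_1: "(\<Sum>j<n. (peak_entry n j x)\<^sup>2) \<le> 1"
proof (cases "\<exists>i<n. peak_entry n i x \<noteq> 0")
  case True
  then obtain i where i: "i < n" "peak_entry n i x \<noteq> 0" by blast
  have "(\<Sum>j<n. (peak_entry n j x)\<^sup>2) = (\<Sum>j\<in>{i}. (peak_entry n j x)\<^sup>2)"
  proof (rule sum.mono_neutral_right)
    show "\<forall>j\<in>{..<n} - {i}. (peak_entry n j x)\<^sup>2 = 0"
      using peak_entry_unique[OF i(1) _ i(2)] by fastforce
  qed (use i in auto)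
  then show ?thesis using abs_peak_entry_le_1[of n i x] by (simp add: abs_square_le_1)
qed auto

lemma row_sum_entries:
  fixes f :: "real \<Rightarrow> real \<Rightarrow> real"
  assumes n: "i < n" and f[measurable]: "case_prod f \<in> borel_measurable (borel \<Otimes>\<^sub>M borel)"
    and b: "\<And>x j. j < n \<Longrightarrow> \<bar>f (norm_entry n j x) (peak_entry n j x)\<bar> \<le> 1"
  shows "(\<integral>x. (\<Sum>j<n. f (norm_entry n j x) (peak_entry n j x)) \<partial>row_law n) =
    real n * (\<integral>x. f (norm_entry n i x) (peak_entry n i x) \<partial>row_law n)"
proof -
  have "(\<integral>x. (\<Sum>j<n. f (norm_entry n j x) (peak_entry n j x)) \<partial>row_law n) =
    (\<Sum>j<n. \<integral>x. f (norm_entry n j x) (peak_entry n j x) \<partial>row_law n)"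
    by (intro Bochner_Integration.integral_sum integrable_row[where B=1]) (use b in auto)
  also have "\<dots> = (\<Sum>j<n. \<integral>x. f (norm_entry n i x) (peak_entry n i x) \<partial>row_law n)"
    using n by (intro sum.cong row_entry_exchange) auto
  finally show ?thesis by simp
qed

lemma row_norm_entry_sq: "j < n \<Longrightarrow> (\<integral>x. (norm_entry n j x)\<^sup>2 \<partial>row_law n) \<le> 1 / real n"
proof -
  assume j: "j < n"
  interpret R: prob_space "row_law n" by (rule prob_space_row_law)
  have "real n * (\<integral>x. (norm_entry n j x)\<^sup>2 \<partial>row_law n) = (\<integral>x. (\<Sum>j<n. (norm_entry n j x)\<^sup>2) \<partial>row_law n)"
    using j by (intro row_sum_entries[symmetric, of j n "\<lambda>y a. y\<^sup>2"]) (auto simp: norm_entry_sq_le_1)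
  also have "\<dots> \<le> (\<integral>x. 1 \<partial>row_law n)"
    by (intro integral_mono integrable_row[where B=1]) (auto simp: sum_norm_entry_sq sum_nonneg)
  finally show ?thesis using j by (simp add: field_simps R.prob_space)
qed

lemma row_peak_entry_sq: "j < n \<Longrightarrow> (\<integral>x. (peak_entry n j x)\<^sup>2 \<partial>row_law n) = peak_prob n / real n"
  using row_sum_entries[of j n "\<lambda>y a. a\<^sup>2"] abs_peak_entry_le_1
  by (simp add: peak_prob_def abs_square_le_1)

lemma row_norm_peak: "j < n \<Longrightarrow> (\<integral>x. norm_entry n j x * peak_entry n j x \<partial>row_law n) = peak_corr n / real n"
  using row_sum_entries[of j n "\<lambda>y a. y * a"] abs_peak_entry_le_1 abs_norm_entry_le_1
  by (simp add: peak_corr_def abs_mult mult_le_one)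

lemma peak_prob_le_1: "peak_prob n \<le> 1"
proof -
  interpret R: prob_space "row_law n" by (rule prob_space_row_law)
  have "peak_prob n \<le> (\<integral>x. 1 \<partial>row_law n)" unfolding peak_prob_def
    by (intro integral_mono integrable_row[where B=1]) (auto simp: sum_peak_entry_sq_le_1 sum_nonneg)
  then show ?thesis by (simp add: R.prob_space)
qed

lemma norm_peak_le: "j < n \<Longrightarrow> norm_entry n j x * peak_entry n j x \<le> (peak_entry n j x)\<^sup>2"
  using abs_norm_entry_le_1[of j n x] by (auto simp: peak_entry_def sgn_if)

lemma norm_peak_nonneg: "0 \<le> norm_entry n j x * peak_entry n j x"
  by (auto simp: peak_entry_def sgn_if)

lemma peak_corr_le_prob: "peak_corr n \<le> peak_prob n"
  unfolding peak_prob_def peak_corr_def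
  by (intro integral_mono integrable_row[where B=1])
    (auto simp: sum_peak_entry_sq_le_1 sum_nonneg norm_peak_nonneg intro!: sum_mono norm_peak_le
      order_trans[OF sum_mono[OF norm_peak_le] sum_peak_entry_sq_le_1])

text \<open>Some value of \<open>tail\<close> is positive by \<open>tail_decay\<close>, so mass is
  left outside 0.\<close>

lemma prob_zero_less_1: "measure \<mu> {0} < 1"
proof -
  from tail_decay[of 1] obtain y0 where y0: "y0 > 0" "1 \<le> y0\<^sup>2 * tail y0" by blast
  then have "tail y0 > 0" using tail_nonneg[of y0] by (metis less_eq_real_def mult_zero_right not_one_le_zero)
  moreover have "measure \<mu> {0} \<le> measure \<mu> (UNIV - {y. y0 < \<bar>y\<bar>})"
    using y0 by (intro finite_measure_mono) auto
  moreover have "measure \<mu> (UNIV - {y. y0 < \<bar>y\<bar>}) = 1 - tail y0"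
    using prob_compl[of "{y. y0 < \<bar>y\<bar>}"] by (simp add: tail_def)
  ultimately show ?thesis by simp
qed

text \<open>The sum of squares is 1 unless the whole row vanishes, an event whose probability is a
  power by independence.\<close>

lemma row_nonzero:
  "(\<integral>x. (\<Sum>j<n. (norm_entry n j x)\<^sup>2) \<partial>row_law n) = 1 - measure \<mu> {0} ^ n"
proof -
  interpret R: prob_space "row_law n" by (rule prob_space_row_law)
  have em: "emeasure \<mu> {0} = ennreal (measure \<mu> {0})" by (rule emeasure_eq_measure)
  interpret product_prob_space "\<lambda>_::nat. \<mu>" ..
  let ?Z = "\<Pi>\<^sub>E j\<in>{..<n}. {0::real}"
  have Z: "?Z \<in> sets (row_law n)" unfolding row_law_def by (intro sets_PiM_I_finite) auto
  have "(\<integral>x. (\<Sum>j<n. (norm_entry n j x)\<^sup>2) \<partial>row_law n) = (\<integral>x. 1 - indicator ?Z x \<partial>row_law n)"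
    by (intro Bochner_Integration.integral_cong refl)
      (auto simp: sum_norm_entry_sq indicator_def row_law_def space_PiM PiE_iff extensional_def)
  also have "\<dots> = 1 - measure (row_law n) ?Z"
    using Z by (subst Bochner_Integration.integral_diff) (auto simp: R.prob_space R.emeasure_eq_measure)
  also have "measure (row_law n) ?Z = measure \<mu> {0} ^ n"
  proof -
    have "emeasure (row_law n) ?Z = (\<Prod>j<n. emeasure \<mu> {0})"
      unfolding row_law_def by (intro emeasure_PiM) auto
    also have "\<dots> = ennreal (measure \<mu> {0} ^ n)"
      by (simp only: em prod_constant card_lessThan ennreal_power measure_nonneg)
    finally show ?thesis
      by (simp only: R.emeasure_eq_measure ennreal_inj measure_nonneg zero_le_power)
  qed
  finally show ?thesis .
qed

text \<open>Pointwise, the sum of \<open>2 * y ^ 4 - y\<^sup>2\<close> over the normalized entries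
  \<open>y\<close> is at most the sum of \<open>y\<close> times its rounding: an entry above the
  threshold satisfies \<open>y ^ 4 \<le> y\<^sup>2 \<le> \<bar>y\<bar>\<close>, any other makes its
  term on the left nonpositive. The sum of fourth powers is the sum of squares minus the products of
  distinct squares, which \<open>pair_mass\<close> measures.\<close>

lemma peak_corr_lower:
  assumes n: "n \<ge> 2"
  shows "1 - 2 * measure \<mu> {0} ^ n - 2 * (real n * (real n - 1) * enn2real (pair_mass (n - 2))) \<le> peak_corr n"
proof -
  interpret R: prob_space "row_law n" by (rule prob_space_row_law)
  let ?Y = "\<lambda>x j. norm_entry n j x"
  have pair: "(\<integral>x. (?Y x i)\<^sup>2 * (?Y x j)\<^sup>2 \<partial>row_law n) = enn2real (pair_mass (n - 2))"
    if "i < n" "j < n" "i \<noteq> j" for i j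
    unfolding nn_integral_row_pair[OF that, symmetric] using that
    by (intro integral_eq_nn_integral) (auto simp: sets_row_law)
  have pt: "2 * ((\<Sum>j<n. (?Y x j)\<^sup>2) - (\<Sum>i<n. \<Sum>j\<in>{..<n}-{i}. (?Y x i)\<^sup>2 * (?Y x j)\<^sup>2)) - 1
      \<le> (\<Sum>j<n. ?Y x j * peak_entry n j x)" for x
  proof -
    define S where "S = (\<Sum>j<n. (?Y x j)\<^sup>2)"
    \<comment> \<open>\<open>S\<close> is 0 or 1, according to whether the row vanishes.\<close>
    have S: "S * S = S" "S \<le> 1" unfolding S_def sum_norm_entry_sq by auto
    have "(\<Sum>j<n. (?Y x j)\<^sup>2) - (\<Sum>i<n. \<Sum>j\<in>{..<n}-{i}. (?Y x i)\<^sup>2 * (?Y x j)\<^sup>2) =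
      S * S - (\<Sum>i<n. (?Y x i)\<^sup>2 * (S - (?Y x i)\<^sup>2))"
      unfolding S(1) unfolding S_def by (intro arg_cong2[of _ _ _ _ "(-)"] refl sum.cong)
        (simp_all add: sum_distrib_left[symmetric] sum_diff1)
    also have "\<dots> = (\<Sum>i<n. (?Y x i)\<^sup>2 * (?Y x i)\<^sup>2)"
      by (simp add: S_def sum_distrib_right[symmetric] right_diff_distrib sum_subtractf)
    finally have "2 * ((\<Sum>j<n. (?Y x j)\<^sup>2) - (\<Sum>i<n. \<Sum>j\<in>{..<n}-{i}. (?Y x i)\<^sup>2 * (?Y x j)\<^sup>2)) - 1 \<le>
      2 * (\<Sum>i<n. (?Y x i)\<^sup>2 * (?Y x i)\<^sup>2) - S" using S by simp
    also have "\<dots> = (\<Sum>i<n. 2 * ((?Y x i)\<^sup>2 * (?Y x i)\<^sup>2) - (?Y x i)\<^sup>2)"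
      by (simp add: S_def sum_subtractf sum_distrib_left)
    also have "\<dots> \<le> (\<Sum>j<n. ?Y x j * peak_entry n j x)"
    proof (rule sum_mono)
      fix j assume "j \<in> {..<n}"
      then have y: "(?Y x j)\<^sup>2 \<le> 1" "\<bar>?Y x j\<bar> \<le> 1" using norm_entry_sq_le_1 abs_norm_entry_le_1 by auto
      show "2 * ((?Y x j)\<^sup>2 * (?Y x j)\<^sup>2) - (?Y x j)\<^sup>2 \<le> ?Y x j * peak_entry n j x"
      proof (cases "(?Y x j)\<^sup>2 > 1/2")
        case True
        have "2 * ((?Y x j)\<^sup>2 * (?Y x j)\<^sup>2) \<le> 2 * ((?Y x j)\<^sup>2 * 1)" using y by (intro mult_left_mono) auto
        moreover have "(?Y x j)\<^sup>2 \<le> \<bar>?Y x j\<bar>"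
          using mult_left_mono[OF y(2), of "\<bar>?Y x j\<bar>"] by (simp add: power2_eq_square abs_mult_self_eq)
        moreover have "?Y x j * peak_entry n j x = \<bar>?Y x j\<bar>" using True by (auto simp: peak_entry_def abs_sgn mult.commute)
        ultimately show ?thesis by linarith
      next
        case False
        then have "(?Y x j)\<^sup>2 * (?Y x j)\<^sup>2 \<le> (?Y x j)\<^sup>2 * (1/2)" by (intro mult_left_mono) auto
        then show ?thesis using False by (simp add: peak_entry_def)
      qed
    qed
    finally show ?thesis .
  qed
  have i1: "integrable (row_law n) (\<lambda>x. \<Sum>j<n. (?Y x j)\<^sup>2)"
    by (intro Bochner_Integration.integrable_sum integrable_row[where B=1]) (auto simp: norm_entry_sq_le_1)
  have i2: "integrable (row_law n) (\<lambda>x. (?Y x i)\<^sup>2 * (?Y x j)\<^sup>2)" if "i < n" "j < n" for i j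
    using that by (intro integrable_row[where B=1]) (auto simp: norm_entry_sq_le_1 abs_mult intro!: mult_le_one)
  have i3: "integrable (row_law n) (\<lambda>x. \<Sum>i<n. \<Sum>j\<in>{..<n}-{i}. (?Y x i)\<^sup>2 * (?Y x j)\<^sup>2)"
    using i2 by (intro Bochner_Integration.integrable_sum) auto
  have "(\<integral>x. (\<Sum>i<n. \<Sum>j\<in>{..<n}-{i}. (?Y x i)\<^sup>2 * (?Y x j)\<^sup>2) \<partial>row_law n) =
    (\<Sum>i<n. \<Sum>j\<in>{..<n}-{i}. \<integral>x. (?Y x i)\<^sup>2 * (?Y x j)\<^sup>2 \<partial>row_law n)"
    using i2 by (subst Bochner_Integration.integral_sum, force intro!: Bochner_Integration.integrable_sum)
      (intro sum.cong refl Bochner_Integration.integral_sum, auto)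
  also have "\<dots> = (\<Sum>i<n. \<Sum>j\<in>{..<n}-{i}. enn2real (pair_mass (n - 2)))"
    using pair by (intro sum.cong refl) auto
  finally have i4: "(\<integral>x. (\<Sum>i<n. \<Sum>j\<in>{..<n}-{i}. (?Y x i)\<^sup>2 * (?Y x j)\<^sup>2) \<partial>row_law n) = \<dots>" .
  have "(\<integral>x. 2 * ((\<Sum>j<n. (?Y x j)\<^sup>2) - (\<Sum>i<n. \<Sum>j\<in>{..<n}-{i}. (?Y x i)\<^sup>2 * (?Y x j)\<^sup>2)) - 1 \<partial>row_law n) =
    2 * ((\<integral>x. (\<Sum>j<n. (?Y x j)\<^sup>2) \<partial>row_law n) - (\<integral>x. (\<Sum>i<n. \<Sum>j\<in>{..<n}-{i}. (?Y x i)\<^sup>2 * (?Y x j)\<^sup>2) \<partial>row_law n)) - 1"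
    by (subst Bochner_Integration.integral_diff integral_mult_right_zero Bochner_Integration.integral_diff[OF i1 i3],
        simp_all add: R.prob_space i1 i3 Bochner_Integration.integral_diff[OF i1 i3])
  also have "\<dots> = 2 * ((1 - measure \<mu> {0} ^ n) - (\<Sum>i<n. \<Sum>j\<in>{..<n}-{i}. enn2real (pair_mass (n - 2)))) - 1"
    by (simp only: i4 row_nonzero)
  also have "(\<Sum>i<n. \<Sum>j\<in>{..<n}-{i}. enn2real (pair_mass (n - 2))) = real n * (real n - 1) * enn2real (pair_mass (n - 2))"
    using n by (simp add: of_nat_diff)
  finally have "1 - 2 * measure \<mu> {0} ^ n - 2 * (real n * (real n - 1) * enn2real (pair_mass (n - 2))) =
    (\<integral>x. 2 * ((\<Sum>j<n. (?Y x j)\<^sup>2) - (\<Sum>i<n. \<Sum>j\<in>{..<n}-{i}. (?Y x i)\<^sup>2 * (?Y x j)\<^sup>2)) - 1 \<partial>row_law n)"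
    by simp
  also have "\<dots> \<le> peak_corr n"
    unfolding peak_corr_def
  proof (rule integral_mono)
    show "integrable (row_law n) (\<lambda>x. \<Sum>j<n. norm_entry n j x * peak_entry n j x)"
      by (intro Bochner_Integration.integrable_sum integrable_row[where B=1])
        (auto simp: abs_mult intro!: mult_le_one abs_norm_entry_le_1 abs_peak_entry_le_1)
  qed (use i1 i3 pt in \<open>auto intro!: Bochner_Integration.integrable_diff\<close>)
  finally show ?thesis .
qed

lemma peak_corr_tendsto: "peak_corr \<longlonglongrightarrow> 1"
proof -
  have h: "(\<lambda>m. enn2real (ennreal ((real m + 1) * (real m + 2)) * pair_mass m)) \<longlonglongrightarrow> 0"
    by (rule tendsto_enn2real) (use pair_mass_tendsto_0 in \<open>simp_all only: ennreal_0 order_refl\<close>)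
  \<comment> \<open>Shifts the index by 2, from the argument of \<open>pair_mass\<close> to the
    length of the row.\<close>
  have h2: "(\<lambda>n. enn2real (ennreal ((real (n - 2) + 1) * (real (n - 2) + 2)) * pair_mass (n - 2))) \<longlonglongrightarrow> 0"
    by (rule LIMSEQ_offset[where k = 2]) (use h in \<open>simp only: diff_add_inverse2\<close>)
  have "(\<lambda>n. 1 - 2 * measure \<mu> {0} ^ n - 2 * enn2real (ennreal ((real (n - 2) + 1) * (real (n - 2) + 2)) * pair_mass (n - 2)))
     \<longlonglongrightarrow> 1 - 2 * 0 - 2 * 0"
    by (intro tendsto_diff tendsto_mult tendsto_const LIMSEQ_power_zero h2) (use prob_zero_less_1 in auto)
  then have "(\<lambda>n. 1 - 2 * measure \<mu> {0} ^ n - 2 * enn2real (ennreal ((real (n - 2) + 1) * (real (n - 2) + 2)) * pair_mass (n - 2)))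
     \<longlonglongrightarrow> 1" by simp
  then show ?thesis
  proof (rule tendsto_sandwich[rotated 2])
    show "\<forall>\<^sub>F n in sequentially. 1 - 2 * measure \<mu> {0} ^ n - 2 * enn2real (ennreal ((real (n - 2) + 1) * (real (n - 2) + 2)) * pair_mass (n - 2)) \<le> peak_corr n"
      using eventually_ge_at_top[of 2]
    proof eventually_elim
      case (elim n)
      have "(real (n - 2) + 1) * (real (n - 2) + 2) = real n * (real n - 1)"
        using elim by (simp add: of_nat_diff)
      then show ?case using peak_corr_lower[OF elim] elim by (simp add: enn2real_mult mult_ac)
    qed
    show "\<forall>\<^sub>F n in sequentially. peak_corr n \<le> 1"
      using order_trans[OF peak_corr_le_prob peak_prob_le_1] by simp
  qed auto
qed

lemma peak_prob_tendsto: "peak_prob \<longlonglongrightarrow> 1"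
  by (rule tendsto_sandwich[OF _ _ peak_corr_tendsto tendsto_const])
    (auto simp: peak_corr_le_prob peak_prob_le_1)

end

section \<open>Sign flips of a symmetric row\<close>

locale symmetric_slowly_varying_law = slowly_varying_law +
  assumes symmetric: "distr \<mu> borel uminus = \<mu>"
begin

lemma measurable_row_flip: "j < n \<Longrightarrow> (\<lambda>x. x(j := - x j)) \<in> measurable (row_law n) (row_law n)"
  unfolding row_law_def by (rule measurable_fun_upd[where J = "{..<n}"]) auto

lemma row_law_flip:
  assumes j: "j < n"
  shows "distr (row_law n) (row_law n) (\<lambda>x. x(j := - x j)) = row_law n"
proof -
  interpret product_prob_space "\<lambda>_::nat. \<mu>" ..
  note [measurable] = measurable_row_flip[OF j]
  have "distr (row_law n) (row_law n) (\<lambda>x. x(j := - x j)) = PiM {..<n} (\<lambda>_. \<mu>)"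
  proof (rule PiM_eqI)
    fix A assume A: "\<And>i. i \<in> {..<n} \<Longrightarrow> A i \<in> sets \<mu>"
    define B where "B = A(j := uminus -` A j)"
    have Aj: "A j \<in> sets borel" using A[of j] j by simp
    have mj: "uminus -` A j \<in> sets borel" using measurable_sets[OF borel_measurable_uminus[OF measurable_ident] Aj] by (simp add: id_def)
    have "emeasure (distr (row_law n) (row_law n) (\<lambda>x. x(j := - x j))) (Pi\<^sub>E {..<n} A) =
      emeasure (row_law n) ((\<lambda>x. x(j := - x j)) -` Pi\<^sub>E {..<n} A \<inter> space (row_law n))"
      by (rule emeasure_distr[OF measurable_row_flip[OF j]])
        (use A in \<open>unfold row_law_def, intro sets_PiM_I_finite, auto\<close>)
    also have "(\<lambda>x. x(j := - x j)) -` Pi\<^sub>E {..<n} A \<inter> space (row_law n) = Pi\<^sub>E {..<n} B"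
    proof (rule Set.set_eqI)
      fix x
      have "x \<in> space (row_law n) \<longleftrightarrow> x \<in> extensional {..<n}"
        by (simp add: row_law_def space_PiM PiE_iff)
      moreover have "x(j := - x j) \<in> extensional {..<n} \<longleftrightarrow> x \<in> extensional {..<n}"
        unfolding extensional_def using j by (simp add: fun_upd_apply)
      moreover have "(x(j := - x j)) i \<in> A i \<longleftrightarrow> x i \<in> B i" for i
        by (simp add: B_def)
      ultimately show "x \<in> (\<lambda>x. x(j := - x j)) -` Pi\<^sub>E {..<n} A \<inter> space (row_law n) \<longleftrightarrow> x \<in> Pi\<^sub>E {..<n} B"
        unfolding PiE_iff vimage_eq Int_iff by blast
    qed
    also have "emeasure (row_law n) (Pi\<^sub>E {..<n} B) = (\<Prod>i<n. emeasure \<mu> (B i))"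
      unfolding row_law_def using A mj by (intro emeasure_PiM) (auto simp: B_def)
    also have "\<dots> = (\<Prod>i<n. emeasure \<mu> (A i))"
    proof (rule prod.cong)
      have "emeasure \<mu> (A j) = emeasure (distr \<mu> borel uminus) (A j)" by (simp only: symmetric)
      also have "\<dots> = emeasure \<mu> (uminus -` A j)" using Aj by (subst emeasure_distr) auto
      finally show "emeasure \<mu> (B i) = emeasure \<mu> (A i)" for i by (simp add: B_def)
    qed simp
    finally show "emeasure (distr (row_law n) (row_law n) (\<lambda>x. x(j := - x j))) (Pi\<^sub>E {..<n} A) = \<dots>" .
  qed (auto simp: row_law_def)
  then show ?thesis by (simp add: row_law_def)
qed

text \<open>The flip preserves the law and negates the integrand, so the integral equals its own
  negative.\<close>

lemma row_integral_odd:
  fixes f :: "_ \<Rightarrow> real"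
  assumes j: "j < n" and f[measurable]: "f \<in> borel_measurable (\<Pi>\<^sub>M j\<in>{..<n}. borel)"
    and odd: "\<And>x. f (x(j := - x j)) = - f x"
  shows "(\<integral>x. f x \<partial>row_law n) = 0"
proof -
  note m = measurable_row_flip[OF j]
  have "(\<integral>x. f x \<partial>row_law n) = (\<integral>x. f x \<partial>distr (row_law n) (row_law n) (\<lambda>x. x(j := - x j)))"
    by (simp only: row_law_flip[OF j])
  also have "\<dots> = (\<integral>x. - f x \<partial>row_law n)" using m by (subst integral_distr) (auto simp: odd)
  finally show ?thesis by simp
qed

end

lemma norm_entry_flip: "j < n \<Longrightarrow> norm_entry n i (x(j := - x j)) = (if i = j then - norm_entry n i x else norm_entry n i x)"
proof -
  have "(\<Sum>l<n. ((x(j := - x j)) l)\<^sup>2) = (\<Sum>l<n. (x l)\<^sup>2)" by (intro sum.cong) auto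
  then show ?thesis by (simp add: norm_entry_def)
qed

lemma peak_entry_flip: "j < n \<Longrightarrow> peak_entry n i (x(j := - x j)) = (if i = j then - peak_entry n i x else peak_entry n i x)"
  by (simp add: peak_entry_def norm_entry_flip sgn_minus)

subsection \<open>Minors and Newton's identities\<close>

definition minor_index :: "nat \<Rightarrow> nat \<Rightarrow> (nat set \<times> (nat \<Rightarrow> nat)) set" where
  "minor_index n k = (SIGMA S:{S. S \<subseteq> {..<n} \<and> card S = k}. {\<pi>. \<pi> permutes S})"

text \<open>The coefficient of \<open>z ^ k\<close> in \<open>det (I - z W)\<close>: up to sign, the
  sum of all principal minors of order \<open>k\<close>, written out in Leibniz monomials.\<close>

definition minor_coeff :: "nat \<Rightarrow> (nat \<Rightarrow> nat \<Rightarrow> 'a::comm_ring_1) \<Rightarrow> nat \<Rightarrow> 'a" where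
  "minor_coeff n W k = (-1) ^ k * (\<Sum>(S, \<pi>)\<in>minor_index n k. of_int (sign \<pi>) * (\<Prod>i\<in>S. W i (\<pi> i)))"

lemma finite_minor_index: "finite (minor_index n k)"
proof -
  have "finite {S. S \<subseteq> {..<n} \<and> card S = k}"
    by (rule finite_subset[of _ "Pow {..<n}"]) auto
  then show ?thesis
    unfolding minor_index_def
    by (intro finite_SigmaI) (auto intro!: finite_permutations dest: finite_subset)
qed

text \<open>The bound \<open>n ^ k\<close> is made to balance the second moment of a single
  monomial, which is at most \<open>(1 / n) ^ k\<close>.\<close>

lemma card_minor_index: "card (minor_index n k) \<le> n ^ k"
proof -
  have fin: "finite {S. S \<subseteq> {..<n} \<and> card S = k}"
    by (rule finite_subset[of _ "Pow {..<n}"]) auto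
  have "card (minor_index n k) = (\<Sum>S | S \<subseteq> {..<n} \<and> card S = k. card {\<pi>. \<pi> permutes S})"
    unfolding minor_index_def using fin
    by (intro card_SigmaI) (auto intro!: finite_permutations dest: finite_subset)
  also have "\<dots> = (\<Sum>S | S \<subseteq> {..<n} \<and> card S = k. fact k)"
    by (intro sum.cong refl) (auto intro!: card_permutations dest: finite_subset)
  also have "\<dots> = (n choose k) * fact k"
    by (simp add: n_subsets)
  also have "\<dots> \<le> n ^ k"
    by (rule binomial_fact_pow)
  finally show ?thesis .
qed

lemma minor_coeff_eq_0: "k > n \<Longrightarrow> minor_coeff n W k = 0"
proof -
  assume "k > n"
  have False if "S \<subseteq> {..<n}" "card S = k" for S
    using card_mono[OF _ that(1)] that(2) \<open>k > n\<close> by simp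
  then have "minor_index n k = {}" by (auto simp: minor_index_def)
  then show ?thesis by (simp add: minor_coeff_def)
qed

lemma minor_coeff_of_real: "minor_coeff n (\<lambda>i j. complex_of_real (W i j)) k = complex_of_real (minor_coeff n W k)"
  unfolding minor_coeff_def by (simp add: split_def)

text \<open>Each factor of a Leibniz term is \<open>- z * W i (p i)\<close> plus a Kronecker delta.
  Expanding over the set \<open>S\<close> of rows where the first summand is taken forces
  \<open>p\<close> to fix all points outside \<open>S\<close>, hence to permute
  \<open>S\<close>.\<close>

lemma det_one_minus_smult:
  fixes W :: "nat \<Rightarrow> nat \<Rightarrow> 'a::comm_ring_1"
  shows "Determinant.det (1\<^sub>m n - z \<cdot>\<^sub>m Matrix.mat n n (\<lambda>(i, j). W i j)) = (\<Sum>k\<le>n. minor_coeff n W k * z ^ k)"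
proof -
  let ?A = "1\<^sub>m n - z \<cdot>\<^sub>m Matrix.mat n n (\<lambda>(i, j). W i j)"
  have fin: "finite S" if "S \<subseteq> {..<n}" for S using that by (auto dest: finite_subset)
  have "Determinant.det ?A = (\<Sum>p | p permutes {0..<n}. signof p * (\<Prod>i = 0..<n. ?A $$ (i, p i)))"
    by (rule det_def') auto
  also have "\<dots> = (\<Sum>p | p permutes {..<n}. of_int (sign p) * (\<Prod>i<n. (- z) * W i (p i) + (if i = p i then 1 else 0)))"
    unfolding atLeast0LessThan
  proof (intro sum.cong refl arg_cong2[where f="(*)"] prod.cong)
    fix p i assume "p \<in> {p. p permutes {..<n}}" "i \<in> {..<n}"
    then have "i < n" "p i < n" using permutes_in_image[of p "{..<n}" i] by auto
    then show "?A $$ (i, p i) = (- z) * W i (p i) + (if i = p i then 1 else 0)"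
      by simp
  qed
  also have "\<dots> = (\<Sum>p | p permutes {..<n}. \<Sum>S\<in>Pow {..<n}. of_int (sign p) * ((\<Prod>i\<in>S. (- z) * W i (p i)) * (\<Prod>i\<in>{..<n}-S. if i = p i then 1 else 0)))"
    by (subst prod_add) (auto simp: sum_distrib_left)
  also have "\<dots> = (\<Sum>S\<in>Pow {..<n}. \<Sum>p | p permutes {..<n}. of_int (sign p) * ((\<Prod>i\<in>S. (- z) * W i (p i)) * (\<Prod>i\<in>{..<n}-S. if i = p i then 1 else 0)))"
    by (rule sum.swap)
  also have "\<dots> = (\<Sum>S\<in>Pow {..<n}. \<Sum>p | p permutes S. of_int (sign p) * (\<Prod>i\<in>S. (- z) * W i (p i)))"
  proof (rule sum.cong[OF refl])
    fix S assume S: "S \<in> Pow {..<n}"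
    show "(\<Sum>p | p permutes {..<n}. of_int (sign p) * ((\<Prod>i\<in>S. (- z) * W i (p i)) * (\<Prod>i\<in>{..<n}-S. if i = p i then 1 else 0))) =
      (\<Sum>p | p permutes S. of_int (sign p) * (\<Prod>i\<in>S. (- z) * W i (p i)))"
    proof (rule sum.mono_neutral_cong_right)
      show "{p. p permutes S} \<subseteq> {p. p permutes {..<n}}"
        using S by (auto intro: permutes_subset)
      show "\<forall>p\<in>{p. p permutes {..<n}} - {p. p permutes S}.
         of_int (sign p) * ((\<Prod>i\<in>S. (- z) * W i (p i)) * (\<Prod>i\<in>{..<n}-S. if i = p i then 1 else 0)) = 0"
      proof
        fix p assume p: "p \<in> {p. p permutes {..<n}} - {p. p permutes S}"
        have "\<exists>i\<in>{..<n} - S. i \<noteq> p i"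
        proof (rule ccontr)
          assume "\<not> (\<exists>i\<in>{..<n} - S. i \<noteq> p i)"
          then have "\<forall>i\<in>{..<n} - S. p i = i" by metis
          with p have "p permutes S" using permutes_superset[of p "{..<n}" S] by blast
          with p show False by simp
        qed
        then obtain i where "i \<in> {..<n} - S" "i \<noteq> p i" by blast
        then have "(\<Prod>i\<in>{..<n}-S. if i = p i then 1 else 0 :: 'a) = 0"
          by (intro prod_zero bexI[of _ i]) auto
        then show "of_int (sign p) * ((\<Prod>i\<in>S. (- z) * W i (p i)) * (\<Prod>i\<in>{..<n}-S. if i = p i then 1 else 0)) = 0"
          by simp
      qed
      fix p assume "p \<in> {p. p permutes S}"
      then have "(\<Prod>i\<in>{..<n}-S. if i = p i then 1 else 0 :: 'a) = 1"
        by (intro prod.neutral) (auto simp: permutes_not_in)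
      then show "of_int (sign p) * ((\<Prod>i\<in>S. (- z) * W i (p i)) * (\<Prod>i\<in>{..<n}-S. if i = p i then 1 else 0)) =
        of_int (sign p) * (\<Prod>i\<in>S. (- z) * W i (p i))" by simp
    qed (auto intro: finite_permutations)
  qed
  also have "\<dots> = (\<Sum>S\<in>Pow {..<n}. \<Sum>p | p permutes S. (- z) ^ card S * (of_int (sign p) * (\<Prod>i\<in>S. W i (p i))))"
    by (simp only: prod.distrib prod_constant mult_ac)
  also have "\<dots> = (\<Sum>k\<le>n. \<Sum>S\<in>{S \<in> Pow {..<n}. card S = k}. \<Sum>p | p permutes S. (- z) ^ card S * (of_int (sign p) * (\<Prod>i\<in>S. W i (p i))))"
    by (rule sum.group[symmetric]) (auto intro: subset_eq_atLeast0_lessThan_card[unfolded atLeast0LessThan])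
  also have "\<dots> = (\<Sum>k\<le>n. minor_coeff n W k * z ^ k)"
  proof (rule sum.cong[OF refl])
    fix k
    have "(\<Sum>S\<in>{S \<in> Pow {..<n}. card S = k}. \<Sum>p | p permutes S. (- z) ^ card S * (of_int (sign p) * (\<Prod>i\<in>S. W i (p i)))) =
      (\<Sum>(S, p)\<in>minor_index n k. (- z) ^ card S * (of_int (sign p) * (\<Prod>i\<in>S. W i (p i))))"
      unfolding minor_index_def
      by (subst sum.Sigma) (auto intro!: sum.cong finite_permutations dest: finite_subset)
    also have "\<dots> = (\<Sum>(S, p)\<in>minor_index n k. (- z) ^ k * (of_int (sign p) * (\<Prod>i\<in>S. W i (p i))))"
      by (intro sum.cong refl) (auto simp: minor_index_def)
    also have "\<dots> = minor_coeff n W k * z ^ k"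
      by (simp add: minor_coeff_def sum_distrib_left split_def power_minus[of z] mult_ac)
    finally show "(\<Sum>S\<in>{S \<in> Pow {..<n}. card S = k}. \<Sum>p | p permutes S. (- z) ^ card S * (of_int (sign p) * (\<Prod>i\<in>S. W i (p i)))) =
      minor_coeff n W k * z ^ k" .
  qed
  finally show ?thesis .
qed

section \<open>Newton's recursion between power sums and coefficients\<close>

fun newton :: "(nat \<Rightarrow> 'a::field_char_0) \<Rightarrow> nat \<Rightarrow> 'a" where
  "newton p 0 = 1"
| "newton p (Suc k) = - (\<Sum>j\<le>k. newton p (k - j) * p (Suc j)) / of_nat (Suc k)"

text \<open>Newton's recursion solved for the newest power sum instead of the newest
  coefficient.\<close>

fun newton_inv :: "(nat \<Rightarrow> 'a::field_char_0) \<Rightarrow> nat \<Rightarrow> 'a" where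
  "newton_inv a 0 = 0"
| "newton_inv a (Suc k) = - of_nat (Suc k) * a (Suc k) - (\<Sum>j<k. a (k - j) * newton_inv a (Suc j))"

declare newton.simps(2) [simp del] newton_inv.simps(2) [simp del]

text \<open>Only positive indices are read, so sequences of traces may differ at index 0.\<close>

lemma newton_cong: "(\<And>j. 1 \<le> j \<Longrightarrow> j \<le> k \<Longrightarrow> p j = q j) \<Longrightarrow> newton p k = newton q k"
proof (induction k rule: less_induct)
  case (less k)
  show ?case
  proof (cases k)
    case (Suc m)
    have "newton p (m - j) * p (Suc j) = newton q (m - j) * q (Suc j)" if "j \<le> m" for j
      using less.IH[of "m - j"] less.prems Suc that by simp
    then show ?thesis by (simp add: Suc newton.simps(2))
  qed simp
qed

lemma newton_inv_newton: "k \<ge> 1 \<Longrightarrow> newton_inv (newton p) k = p k"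
proof (induction k rule: less_induct)
  case (less k)
  then obtain m where k: "k = Suc m" by (cases k) auto
  let ?S = "\<Sum>j<m. newton p (m - j) * p (Suc j)"
  have 1: "(\<Sum>j<m. newton p (m - j) * newton_inv (newton p) (Suc j)) = ?S"
    using less.IH k by (intro sum.cong) auto
  have 2: "(\<Sum>j\<le>m. newton p (m - j) * p (Suc j)) = ?S + p (Suc m)"
    by (simp add: lessThan_Suc_atMost[symmetric])
  have 3: "of_nat (Suc m) * newton p (Suc m) = - (\<Sum>j\<le>m. newton p (m - j) * p (Suc j))"
    by (simp add: newton.simps(2) del: of_nat_Suc)
  have "newton_inv (newton p) (Suc m) = - (of_nat (Suc m) * newton p (Suc m)) - ?S"
    by (subst newton_inv.simps(2)) (simp only: mult_minus_left 1)
  also have "\<dots> = p (Suc m)"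
    by (simp only: 2 3 minus_minus add_diff_cancel_left')
  finally show ?case by (simp only: k)
qed

lemma newton_of_real: "newton (\<lambda>k. complex_of_real (p k)) k = complex_of_real (newton p k)"
proof (induction k rule: less_induct)
  case (less k)
  show ?case
  proof (cases k)
    case (Suc m)
    then show ?thesis using less.IH by (simp add: newton.simps(2) of_real_divide del: of_nat_Suc)
  qed simp
qed

text \<open>The differential equation says that \<open>P\<close> is the exponential of minus the
  series with coefficients \<open>p k / k\<close>. Comparing coefficients in it is Newton's
  recursion.\<close>

lemma fps_nth_newton:
  fixes P :: "'a::field_char_0 fps"
  assumes "fps_nth P 0 = 1" and "fps_deriv P = - P * Abs_fps (\<lambda>k. p (Suc k))"
  shows "fps_nth P k = newton p k"
proof (induction k rule: less_induct)
  case (less k)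
  show ?case
  proof (cases k)
    case (Suc m)
    have "of_nat (Suc m) * fps_nth P (Suc m) = fps_nth (fps_deriv P) m" by simp
    also have "\<dots> = - (\<Sum>i=0..m. fps_nth P i * p (Suc (m - i)))"
      unfolding assms(2) by (simp add: fps_mult_nth)
    also have "(\<Sum>i=0..m. fps_nth P i * p (Suc (m - i))) = (\<Sum>j\<le>m. fps_nth P (m - j) * p (Suc j))"
      by (rule sum.reindex_bij_witness[of _ "\<lambda>i. m - i" "\<lambda>i. m - i"]) auto
    also have "\<dots> = (\<Sum>j\<le>m. newton p (m - j) * p (Suc j))"
      using less.IH Suc by (intro sum.cong) auto
    finally show ?thesis using Suc by (simp add: newton.simps(2) field_simps del: of_nat_Suc)
  qed (use assms in simp)
qed

lemma continuous_on_newton: "continuous_on UNIV (\<lambda>p::nat \<Rightarrow> real. newton p k)"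
proof (induction k rule: less_induct)
  case (less k)
  show ?case
  proof (cases k)
    case (Suc m)
    show ?thesis unfolding Suc newton.simps(2)
      by (intro continuous_intros continuous_on_product_coordinates less.IH) (simp_all add: Suc del: of_nat_Suc)
  qed simp
qed

lemma continuous_on_newton_inv: "continuous_on UNIV (\<lambda>a::nat \<Rightarrow> real. newton_inv a k)"
proof (induction k rule: less_induct)
  case (less k)
  show ?case
  proof (cases k)
    case (Suc m)
    show ?thesis unfolding Suc newton_inv.simps(2)[of _ m]
      by (intro continuous_intros continuous_on_product_coordinates less.IH) (simp add: Suc)
  qed simp
qed

text \<open>Multiplying by \<open>1 - e X\<close> adds \<open>e / (1 - e X)\<close>, the generating
  function of the positive powers of \<open>e\<close>, to minus the logarithmic derivative. Hence
  the product solves the differential equation of \<open>fps_nth_newton\<close>.\<close>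

lemma newton_prod_list:
  fixes es :: "'a::field_char_0 list"
  shows "coeff (\<Prod>e\<leftarrow>es. [:1, - e:]) k = newton (\<lambda>k. \<Sum>e\<leftarrow>es. e ^ k) k"
proof -
  define P where "P = (\<lambda>es::'a list. fps_of_poly (\<Prod>e\<leftarrow>es. [:1, - e:]))"
  define Q where "Q = (\<lambda>es::'a list. Abs_fps (\<lambda>k. \<Sum>e\<leftarrow>es. e ^ Suc k))"
  have P_Cons: "P (e # es) = (1 - fps_const e * fps_X) * P es" for e es
  proof -
    have "fps_of_poly [:1, - e:] = 1 - fps_const e * fps_X"
      by (rule fps_ext) (auto simp: coeff_pCons split: nat.split)
    then show ?thesis by (simp add: P_def fps_of_poly_mult)
  qed
  \<comment> \<open>The relation is kept multiplied by \<open>1 - e X\<close>, which avoids dividing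
    power series.\<close>
  have Q_Cons: "(1 - fps_const e * fps_X) * Q (e # es) = fps_const e + (1 - fps_const e * fps_X) * Q es" for e es
  proof -
    have "Q (e # es) = Abs_fps (\<lambda>k. e ^ Suc k) + Q es"
      by (rule fps_ext) (simp add: Q_def)
    moreover have "(1 - fps_const e * fps_X) * Abs_fps (\<lambda>k. e ^ Suc k) = fps_const e"
    proof (rule fps_ext)
      fix m
      show "fps_nth ((1 - fps_const e * fps_X) * Abs_fps (\<lambda>k. e ^ Suc k)) m = fps_nth (fps_const e) m"
        by (cases m) (simp_all add: left_diff_distrib mult.assoc)
    qed
    ultimately show ?thesis by (simp add: distrib_left)
  qed
  have "fps_nth (P es) 0 = 1 \<and> fps_deriv (P es) = - P es * Q es"
  proof (induction es)
    case Nil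
    have "Q [] = 0" by (rule fps_ext) (simp add: Q_def)
    then show ?case by (simp add: P_def)
  next
    case (Cons e es)
    let ?L = "1 - fps_const e * fps_X :: 'a fps"
    have "fps_deriv (P (e # es)) = - fps_const e * P es + ?L * fps_deriv (P es)"
      by (simp add: P_Cons left_diff_distrib fps_const_neg[symmetric] del: fps_const_neg)
    also have "\<dots> = - P es * (fps_const e + ?L * Q es)"
    proof -
      have "- a * b + L * (- b * q) = - b * (a + L * q)" for a b L q :: "'a fps"
        by (simp add: algebra_simps)
      then show ?thesis unfolding conjunct2[OF Cons] .
    qed
    also have "\<dots> = - P (e # es) * Q (e # es)"
      unfolding Q_Cons[symmetric] P_Cons by (simp only: mult_minus_left mult_minus_right mult_ac)
    finally show ?case using Cons by (simp add: P_Cons)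
  qed
  from fps_nth_newton[of "P es" "\<lambda>k. \<Sum>e\<leftarrow>es. e ^ k", OF conjunct1[OF this]] conjunct2[OF this]
  show ?thesis by (simp add: P_def Q_def)
qed

lemma mat_trace_mult_commute:
  fixes A B :: "'a::comm_semiring_1 Matrix.mat"
  assumes "A \<in> carrier_mat n n" "B \<in> carrier_mat n n"
  shows "mat_trace (A * B) = mat_trace (B * A)"
proof -
  have "mat_trace (A * B) = (\<Sum>i<n. \<Sum>j<n. A $$ (i, j) * B $$ (j, i))"
    using assms unfolding mat_trace_def
    by (auto simp: scalar_prod_def atLeast0LessThan intro!: sum.cong)
  also have "\<dots> = (\<Sum>j<n. \<Sum>i<n. B $$ (j, i) * A $$ (i, j))"
    by (subst sum.swap) (simp add: mult.commute)
  also have "\<dots> = mat_trace (B * A)"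
    using assms unfolding mat_trace_def
    by (auto simp: scalar_prod_def atLeast0LessThan intro!: sum.cong)
  finally show ?thesis .
qed

lemma upper_triangular_pow_diag:
  fixes B :: "'a::comm_ring_1 Matrix.mat"
  assumes B: "B \<in> carrier_mat n n" "upper_triangular B"
  shows "upper_triangular (B ^\<^sub>m k) \<and> (\<forall>i<n. (B ^\<^sub>m k) $$ (i, i) = (B $$ (i, i)) ^ k)"
proof (induction k)
  case 0
  then show ?case using B by auto
next
  case (Suc k)
  have C: "B ^\<^sub>m k \<in> carrier_mat n n" using B by simp
  have e: "(B ^\<^sub>m k * B) $$ (i, j) = (\<Sum>l<n. (B ^\<^sub>m k) $$ (i, l) * B $$ (l, j))" if "i < n" "j < n" for i j
    using that B C by (auto simp: scalar_prod_def atLeast0LessThan intro!: sum.cong)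
  have z: "(B ^\<^sub>m k) $$ (i, l) = 0" if "l < i" "i < n" for i l
    using Suc upper_triangularD[of "B ^\<^sub>m k" l i] that C by auto
  have z': "B $$ (l, j) = 0" if "j < l" "l < n" for l j
    using B upper_triangularD[of B j l] that by auto
  show ?case
  proof (intro conjI allI impI)
    show "upper_triangular (B ^\<^sub>m Suc k)"
    proof (rule upper_triangularI)
      fix i j assume ij: "j < i" "i < dim_row (B ^\<^sub>m Suc k)"
      then have "i < n" "j < n" using C B by auto
      then have "(B ^\<^sub>m Suc k) $$ (i, j) = (\<Sum>l<n. (B ^\<^sub>m k) $$ (i, l) * B $$ (l, j))" using e by simp
      also have "\<dots> = 0"
      proof (rule sum.neutral, rule)
        fix l assume "l \<in> {..<n}"
        then show "(B ^\<^sub>m k) $$ (i, l) * B $$ (l, j) = 0"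
          using z[of l i] z'[of j l] ij \<open>i < n\<close> by (cases "l < i") auto
      qed
      finally show "(B ^\<^sub>m Suc k) $$ (i, j) = 0" .
    qed
    fix i assume i: "i < n"
    have "(B ^\<^sub>m Suc k) $$ (i, i) = (\<Sum>l<n. (B ^\<^sub>m k) $$ (i, l) * B $$ (l, i))" using e i by simp
    also have "\<dots> = (\<Sum>l\<in>{i}. (B ^\<^sub>m k) $$ (i, l) * B $$ (l, i))"
    proof (rule sum.mono_neutral_right)
      show "\<forall>l\<in>{..<n} - {i}. (B ^\<^sub>m k) $$ (i, l) * B $$ (l, i) = 0"
      proof
        fix l assume "l \<in> {..<n} - {i}"
        then have "l < i \<or> i < l" "l < n" by auto
        then show "(B ^\<^sub>m k) $$ (i, l) * B $$ (l, i) = 0" using z[of l i] z'[of i l] i by auto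
      qed
    qed (use i in auto)
    finally show "(B ^\<^sub>m Suc k) $$ (i, i) = (B $$ (i, i)) ^ Suc k" using Suc i by (simp add: mult.commute)
  qed
qed

text \<open>After Schur triangularization both sides depend on the diagonal entries \<open>e\<close>
  only: traces of powers are their power sums, and \<open>det (I - z A)\<close> is the product of
  the factors \<open>1 - z e\<close>. Eigenvalues may be complex, so the real case is deduced from
  this one.\<close>

lemma minor_coeff_eq_newton_complex:
  fixes W :: "nat \<Rightarrow> nat \<Rightarrow> complex"
  shows "minor_coeff n W k = newton (\<lambda>k. mat_trace (Matrix.mat n n (\<lambda>(i, j). W i j) ^\<^sub>m k)) k"
proof -
  define A where "A = Matrix.mat n n (\<lambda>(i, j). W i j)"
  have A: "A \<in> carrier_mat n n" by (simp add: A_def)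
  obtain as where as: "char_poly A = (\<Prod>a\<leftarrow>as. [:- a, 1:])"
    using char_poly_factorized[OF A] by blast
  obtain B P Q where dec: "schur_decomposition A as = (B, P, Q)" by (cases "schur_decomposition A as") auto
  from schur_decomposition[OF A as dec] have sim: "similar_mat_wit A B P Q" and ut: "upper_triangular B"
    by auto
  from similar_mat_witD2[OF A sim] have B: "B \<in> carrier_mat n n" and P: "P \<in> carrier_mat n n"
    and Q: "Q \<in> carrier_mat n n" and PQ: "P * Q = 1\<^sub>m n" and QP: "Q * P = 1\<^sub>m n" and APBQ: "A = P * B * Q"
    by auto
  define es where "es = map (\<lambda>i. B $$ (i, i)) [0..<n]"
  have tr: "mat_trace (A ^\<^sub>m k) = (\<Sum>e\<leftarrow>es. e ^ k)" for k
  proof -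
    have Bk: "B ^\<^sub>m k \<in> carrier_mat n n" using B by simp
    have "mat_trace (A ^\<^sub>m k) = mat_trace (P * B ^\<^sub>m k * Q)"
      using similar_mat_wit_pow_id[OF sim] by simp
    also have "\<dots> = mat_trace (Q * (P * B ^\<^sub>m k))"
      using P Q Bk by (intro mat_trace_mult_commute[of _ n]) auto
    also have "Q * (P * B ^\<^sub>m k) = B ^\<^sub>m k"
      using P Q Bk QP by (simp add: assoc_mult_mat[symmetric, of Q n n P n "B ^\<^sub>m k" n] left_mult_one_mat[of _ n n])
    also have "mat_trace (B ^\<^sub>m k) = (\<Sum>i<n. (B $$ (i, i)) ^ k)"
      using upper_triangular_pow_diag[OF B ut, of k] Bk B by (simp add: mat_trace_def)
    also have "\<dots> = (\<Sum>e\<leftarrow>es. e ^ k)"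
      by (simp add: es_def interv_sum_list_conv_sum_set_nat comp_def atLeast0LessThan)
    finally show ?thesis .
  qed
  have "poly (\<Sum>k\<le>n. Polynomial.monom (minor_coeff n W k) k) z = poly (\<Prod>e\<leftarrow>es. [:1, - e:]) z" for z
  proof -
    have zA: "z \<cdot>\<^sub>m A = P * (z \<cdot>\<^sub>m B) * Q"
      using P Q B by (simp add: APBQ mult_smult_distrib[of _ n n _ n] mult_smult_assoc_mat[of _ n n _ n])
    have "1\<^sub>m n - z \<cdot>\<^sub>m A = P * (1\<^sub>m n - z \<cdot>\<^sub>m B) * Q"
    proof -
      have "P * (1\<^sub>m n - z \<cdot>\<^sub>m B) * Q = (P * 1\<^sub>m n - P * (z \<cdot>\<^sub>m B)) * Q"
        using P B by (subst mult_minus_distrib_mat[of _ n n _ n]) auto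
      also have "\<dots> = P * Q - P * (z \<cdot>\<^sub>m B) * Q"
        using P B Q by (subst minus_mult_distrib_mat[of _ n n _ _ n]) auto
      finally show ?thesis using PQ zA by simp
    qed
    then have "similar_mat (1\<^sub>m n - z \<cdot>\<^sub>m A) (1\<^sub>m n - z \<cdot>\<^sub>m B)"
      using A B P Q PQ QP by (intro similar_matI[of _ _ P Q n]) auto
    then have "Determinant.det (1\<^sub>m n - z \<cdot>\<^sub>m A) = Determinant.det (1\<^sub>m n - z \<cdot>\<^sub>m B)"
      by (rule det_similar)
    also have "\<dots> = prod_list (diag_mat (1\<^sub>m n - z \<cdot>\<^sub>m B))"
    proof (rule det_upper_triangular)
      show "upper_triangular (1\<^sub>m n - z \<cdot>\<^sub>m B)"
        using B upper_triangularD[OF ut] by (intro upper_triangularI) auto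
    qed (use B in auto)
    also have "diag_mat (1\<^sub>m n - z \<cdot>\<^sub>m B) = map (\<lambda>e. 1 - z * e) es"
      using B by (auto simp: diag_mat_def es_def)
    also have "prod_list (map (\<lambda>e. 1 - z * e) es) = poly (\<Prod>e\<leftarrow>es. [:1, - e:]) z"
      by (induction es) (auto simp: algebra_simps)
    also have "Determinant.det (1\<^sub>m n - z \<cdot>\<^sub>m A) = (\<Sum>k\<le>n. minor_coeff n W k * z ^ k)"
      unfolding A_def by (rule det_one_minus_smult)
    finally show ?thesis by (simp add: poly_sum poly_monom)
  qed
  then have "(\<Sum>k\<le>n. Polynomial.monom (minor_coeff n W k) k) = (\<Prod>e\<leftarrow>es. [:1, - e:])"
    by (simp add: poly_eq_poly_eq_iff[symmetric] fun_eq_iff)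
  then have "coeff (\<Sum>k\<le>n. Polynomial.monom (minor_coeff n W k) k) k = newton (\<lambda>k. \<Sum>e\<leftarrow>es. e ^ k) k"
    by (simp only: newton_prod_list)
  also have "coeff (\<Sum>k\<le>n. Polynomial.monom (minor_coeff n W k) k) k = minor_coeff n W k"
    using minor_coeff_eq_0[of n k W] by (cases "k \<le> n") (simp_all add: coeff_sum)
  finally show ?thesis by (simp add: tr A_def[symmetric])
qed

lemma minor_coeff_eq_newton:
  fixes W :: "nat \<Rightarrow> nat \<Rightarrow> real"
  shows "minor_coeff n W k = newton (\<lambda>k. mat_trace (Matrix.mat n n (\<lambda>(i, j). W i j) ^\<^sub>m k)) k"
proof -
  let ?A = "Matrix.mat n n (\<lambda>(i, j). W i j)"
  have hom: "mat_trace (map_mat complex_of_real C) = complex_of_real (mat_trace C)" if "C \<in> carrier_mat n n" for C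
    using that by (simp add: mat_trace_def)
  have A: "?A \<in> carrier_mat n n" by simp
  have "Matrix.mat n n (\<lambda>(i, j). complex_of_real (W i j)) = map_mat complex_of_real ?A"
    by (rule eq_matI) auto
  then have "mat_trace (Matrix.mat n n (\<lambda>(i, j). complex_of_real (W i j)) ^\<^sub>m k) = complex_of_real (mat_trace (?A ^\<^sub>m k))" for k
    by (simp add: of_real_hom.mat_hom_pow[OF A, symmetric] hom)
  then have "complex_of_real (minor_coeff n W k) = complex_of_real (newton (\<lambda>k. mat_trace (?A ^\<^sub>m k)) k)"
    unfolding minor_coeff_of_real[symmetric] minor_coeff_eq_newton_complex newton_of_real[symmetric] by simp
  then show ?thesis by simp
qed

subsection \<open>Orthogonality of the minors of a sign-symmetric random matrix\<close>

text \<open>Restricted to \<open>{..<n}\<close> so that it lies in the product space carrying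
  \<open>row_law n\<close>.\<close>

definition row_vec :: "(nat \<Rightarrow> nat \<Rightarrow> 'a \<Rightarrow> real) \<Rightarrow> nat \<Rightarrow> nat \<Rightarrow> 'a \<Rightarrow> nat \<Rightarrow> real" where
  "row_vec X n i \<omega> = (\<lambda>j\<in>{..<n}. X (Suc i) (Suc j) \<omega>)"

text \<open>
  The normalized entries and their roundings to \<open>{-1, 0, 1}\<close> are treated simultaneously as functions
  \<open>U j\<close> of a row that change sign with its \<open>j\<close>-th coordinate and depend evenly on the others.
\<close>

definition odd_entry :: "nat \<Rightarrow> (nat \<Rightarrow> (nat \<Rightarrow> real) \<Rightarrow> real) \<Rightarrow> bool" where
  "odd_entry n U \<longleftrightarrow> (\<forall>j<n. U j \<in> borel_measurable (\<Pi>\<^sub>M j\<in>{..<n}. borel) \<and> (\<forall>x. \<bar>U j x\<bar> \<le> 1) \<and>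
     (\<forall>i<n. \<forall>x. U i (x(j := - x j)) = (if i = j then - U i x else U i x)))"

lemma odd_entry_norm: "odd_entry n (norm_entry n)"
  by (auto simp: odd_entry_def norm_entry_flip abs_norm_entry_le_1)

lemma odd_entry_peak: "odd_entry n (peak_entry n)"
  by (auto simp: odd_entry_def peak_entry_flip abs_peak_entry_le_1)

lemma odd_entryD:
  assumes "odd_entry n U" "j < n"
  shows "U j \<in> borel_measurable (\<Pi>\<^sub>M j\<in>{..<n}. borel)" "\<bar>U j x\<bar> \<le> 1"
    "i < n \<Longrightarrow> U i (x(j := - x j)) = (if i = j then - U i x else U i x)"
  using assms unfolding odd_entry_def by blast+

text \<open>The array enters through its rows, which are independent with law
  \<open>row_law n\<close>; \<open>n > 0\<close> keeps a row from having no coordinates.\<close>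

locale row_array = M: prob_space M + symmetric_slowly_varying_law \<mu>
  for M :: "'a measure" and \<mu> :: "real measure" and X :: "nat \<Rightarrow> nat \<Rightarrow> 'a \<Rightarrow> real" +
  assumes rows_indep: "n > 0 \<Longrightarrow> M.indep_vars (\<lambda>_. \<Pi>\<^sub>M j\<in>{..<n}. borel) (row_vec X n) UNIV"
    and rows_law: "n > 0 \<Longrightarrow> distr M (\<Pi>\<^sub>M j\<in>{..<n}. borel) (row_vec X n i) = row_law n"
    and measurable_X: "1 \<le> i \<Longrightarrow> 1 \<le> j \<Longrightarrow> X i j \<in> borel_measurable M"
begin

lemma measurable_row_vec [measurable]: "row_vec X n i \<in> measurable M (\<Pi>\<^sub>M j\<in>{..<n}. borel)"
  unfolding row_vec_def[abs_def] by (intro measurable_restrict measurable_X) auto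

lemma integral_prod_rows:
  fixes h :: "nat \<Rightarrow> (nat \<Rightarrow> real) \<Rightarrow> real"
  assumes n: "n > 0" and I: "finite I"
    and h: "\<And>i. i \<in> I \<Longrightarrow> h i \<in> borel_measurable (\<Pi>\<^sub>M j\<in>{..<n}. borel)" "\<And>i x. i \<in> I \<Longrightarrow> \<bar>h i x\<bar> \<le> B"
  shows "(\<integral>\<omega>. (\<Prod>i\<in>I. h i (row_vec X n i \<omega>)) \<partial>M) = (\<Prod>i\<in>I. \<integral>x. h i x \<partial>row_law n)"
    and "integrable M (\<lambda>\<omega>. \<Prod>i\<in>I. h i (row_vec X n i \<omega>))"
proof -
  have ind: "M.indep_vars (\<lambda>_. borel) (\<lambda>i \<omega>. h i (row_vec X n i \<omega>)) I"
    by (rule M.indep_vars_compose2[OF M.indep_vars_subset[OF rows_indep[OF n]]]) (use h in auto)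
  have int: "integrable M (\<lambda>\<omega>. h i (row_vec X n i \<omega>))" if "i \<in> I" for i
    using h[OF that] measurable_compose[OF measurable_row_vec h(1)[OF that]]
    by (intro M.integrable_const_bound[where B = B]) auto
  have "(\<integral>\<omega>. (\<Prod>i\<in>I. h i (row_vec X n i \<omega>)) \<partial>M) = (\<Prod>i\<in>I. \<integral>\<omega>. h i (row_vec X n i \<omega>) \<partial>M)"
    by (rule M.indep_vars_lebesgue_integral[OF I ind int])
  also have "\<dots> = (\<Prod>i\<in>I. \<integral>x. h i x \<partial>row_law n)"
  proof (rule prod.cong[OF refl])
    fix i assume "i \<in> I"
    then have "(\<integral>x. h i x \<partial>distr M (\<Pi>\<^sub>M j\<in>{..<n}. borel) (row_vec X n i)) = (\<integral>\<omega>. h i (row_vec X n i \<omega>) \<partial>M)"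
      by (intro integral_distr h measurable_row_vec)
    then show "(\<integral>\<omega>. h i (row_vec X n i \<omega>) \<partial>M) = (\<integral>x. h i x \<partial>row_law n)"
      by (simp only: rows_law[OF n])
  qed
  finally show "(\<integral>\<omega>. (\<Prod>i\<in>I. h i (row_vec X n i \<omega>)) \<partial>M) = (\<Prod>i\<in>I. \<integral>x. h i x \<partial>row_law n)" .
  show "integrable M (\<lambda>\<omega>. \<Prod>i\<in>I. h i (row_vec X n i \<omega>))"
    by (rule M.indep_vars_integrable[OF I ind int])
qed

definition row_monomial :: "nat \<Rightarrow> (nat \<Rightarrow> (nat \<Rightarrow> real) \<Rightarrow> real) \<Rightarrow> nat set \<times> (nat \<Rightarrow> nat) \<Rightarrow> 'a \<Rightarrow> real" where
  "row_monomial n U p \<omega> = (\<Prod>i\<in>fst p. U (snd p i) (row_vec X n i \<omega>))"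

definition row_minor :: "nat \<Rightarrow> (nat \<Rightarrow> (nat \<Rightarrow> real) \<Rightarrow> real) \<Rightarrow> nat \<Rightarrow> 'a \<Rightarrow> real" where
  "row_minor n U k \<omega> = minor_coeff n (\<lambda>i j. U j (row_vec X n i \<omega>)) k"

text \<open>Distinct monomials differ in some row: either only one of them uses it, or they pick
  different columns there. Flipping the sign of one picked coordinate negates the contribution of
  that row, whose mean is therefore 0, and with it the product over the independent rows.\<close>

lemma monomial_orthogonal:
  assumes n: "n > 0" and U: "odd_entry n U" and V: "odd_entry n V"
    and p: "(S, \<pi>) \<in> minor_index n k" and q: "(T, \<tau>) \<in> minor_index n k"
  shows "(\<integral>\<omega>. row_monomial n U (S, \<pi>) \<omega> * row_monomial n V (T, \<tau>) \<omega> \<partial>M) =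
      (if (S, \<pi>) = (T, \<tau>) then (\<Prod>i\<in>S. \<integral>x. U (\<pi> i) x * V (\<pi> i) x \<partial>row_law n) else 0)"
    and "integrable M (\<lambda>\<omega>. row_monomial n U (S, \<pi>) \<omega> * row_monomial n V (T, \<tau>) \<omega>)"
proof -
  have S: "S \<subseteq> {..<n}" "\<pi> permutes S" "finite S" and T: "T \<subseteq> {..<n}" "\<tau> permutes T" "finite T"
    using p q by (auto simp: minor_index_def dest: finite_subset)
  have \<pi>: "\<pi> i < n" if "i \<in> S" for i using permutes_in_image[OF S(2), of i] that S by auto
  have \<tau>: "\<tau> i < n" if "i \<in> T" for i using permutes_in_image[OF T(2), of i] that T by auto
  \<comment> \<open>The contribution of row \<open>i\<close> to the product of both monomials. As
    each monomial uses a row at most once, this groups the product by rows.\<close>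
  define h where "h = (\<lambda>i x. (if i \<in> S then U (\<pi> i) x else 1) * (if i \<in> T then V (\<tau> i) x else 1))"
  have hm: "h i \<in> borel_measurable (\<Pi>\<^sub>M j\<in>{..<n}. borel)" if "i \<in> S \<union> T" for i
    unfolding h_def using odd_entryD(1)[OF U \<pi>[of i]] odd_entryD(1)[OF V \<tau>[of i]]
    by (cases "i \<in> S"; cases "i \<in> T") auto
  have hb: "\<bar>h i x\<bar> \<le> 1" for i x
    unfolding h_def abs_mult using odd_entryD(2)[OF U \<pi>[of i], of x] odd_entryD(2)[OF V \<tau>[of i], of x]
    by (intro mult_le_one) auto
  have eq: "row_monomial n U (S, \<pi>) \<omega> * row_monomial n V (T, \<tau>) \<omega> = (\<Prod>i\<in>S\<union>T. h i (row_vec X n i \<omega>))" for \<omega>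
  proof -
    have "(\<Prod>i\<in>S\<union>T. if i \<in> S then U (\<pi> i) (row_vec X n i \<omega>) else 1) = (\<Prod>i\<in>S. U (\<pi> i) (row_vec X n i \<omega>))"
      by (rule prod.mono_neutral_cong_right) (use S T in auto)
    moreover have "(\<Prod>i\<in>S\<union>T. if i \<in> T then V (\<tau> i) (row_vec X n i \<omega>) else 1) = (\<Prod>i\<in>T. V (\<tau> i) (row_vec X n i \<omega>))"
      by (rule prod.mono_neutral_cong_right) (use S T in auto)
    ultimately show ?thesis by (simp add: row_monomial_def h_def prod.distrib)
  qed
  have fin: "finite (S \<union> T)" using S T by simp
  show "integrable M (\<lambda>\<omega>. row_monomial n U (S, \<pi>) \<omega> * row_monomial n V (T, \<tau>) \<omega>)"
    unfolding eq by (rule integral_prod_rows(2)[OF n fin hm hb])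
  have "(\<integral>\<omega>. row_monomial n U (S, \<pi>) \<omega> * row_monomial n V (T, \<tau>) \<omega> \<partial>M) = (\<Prod>i\<in>S\<union>T. \<integral>x. h i x \<partial>row_law n)"
    unfolding eq by (rule integral_prod_rows(1)[OF n fin hm hb])
  also have "\<dots> = (if (S, \<pi>) = (T, \<tau>) then (\<Prod>i\<in>S. \<integral>x. U (\<pi> i) x * V (\<pi> i) x \<partial>row_law n) else 0)"
  proof (cases "(S, \<pi>) = (T, \<tau>)")
    case True
    then show ?thesis by (auto simp: h_def intro!: prod.cong Bochner_Integration.integral_cong)
  next
    case False
    have "\<exists>i\<in>S\<union>T. i \<notin> S \<or> i \<notin> T \<or> \<pi> i \<noteq> \<tau> i"
    proof (rule ccontr)
      assume a: "\<not> ?thesis"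
      then have "S = T" by blast
      \<comment> \<open>Outside \<open>S\<close> both permutations are the identity, so agreement on
        \<open>S\<close> would make the index pairs equal.\<close>
      moreover have "\<pi> i = \<tau> i" for i
        using a S(2) T(2) \<open>S = T\<close> by (cases "i \<in> S") (auto simp: permutes_not_in)
      ultimately show False using False by auto
    qed
    then obtain i where i: "i \<in> S \<union> T" "i \<notin> S \<or> i \<notin> T \<or> \<pi> i \<noteq> \<tau> i" by blast
    have "\<exists>j<n. \<forall>x. h i (x(j := - x j)) = - h i x"
    proof (cases "i \<in> S")
      case True
      have "h i (x(\<pi> i := - x (\<pi> i))) = - h i x" for x
        using True i odd_entryD(3)[OF U \<pi> \<pi>, of i i x] odd_entryD(3)[OF V \<pi> \<tau>, of i i x] by (auto simp: h_def)
      then show ?thesis using \<pi>[OF True] by blast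
    next
      case f: False
      then have "i \<in> T" using i by auto
      have "h i (x(\<tau> i := - x (\<tau> i))) = - h i x" for x
        using f \<open>i \<in> T\<close> odd_entryD(3)[OF V \<tau> \<tau>, of i i x] by (auto simp: h_def)
      then show ?thesis using \<tau>[OF \<open>i \<in> T\<close>] by blast
    qed
    then obtain j where j: "j < n" "\<And>x. h i (x(j := - x j)) = - h i x" by blast
    have "(\<integral>x. h i x \<partial>row_law n) = 0"
      using row_integral_odd[where f = "h i", OF j(1) hm[OF i(1)]] j(2) by blast
    then have "(\<Prod>i\<in>S\<union>T. \<integral>x. h i x \<partial>row_law n) = 0" using i(1) fin by (intro prod_zero) auto
    then show ?thesis using False by (simp only: if_False)
  qed
  finally show "(\<integral>\<omega>. row_monomial n U (S, \<pi>) \<omega> * row_monomial n V (T, \<tau>) \<omega> \<partial>M) = \<dots>" .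
qed

text \<open>By orthogonality only the diagonal of the double sum survives; there the signs square to
  1 and each monomial contributes \<open>c ^ k\<close>.\<close>

lemma row_minor_inner:
  assumes n: "n > 0" and U: "odd_entry n U" and V: "odd_entry n V"
    and c: "\<And>j. j < n \<Longrightarrow> (\<integral>x. U j x * V j x \<partial>row_law n) = c"
  shows "(\<integral>\<omega>. row_minor n U k \<omega> * row_minor n V k \<omega> \<partial>M) = real (card (minor_index n k)) * c ^ k"
    and "integrable M (\<lambda>\<omega>. row_minor n U k \<omega> * row_minor n V k \<omega>)"
proof -
  define s :: "nat set \<times> (nat \<Rightarrow> nat) \<Rightarrow> real" where "s = (\<lambda>p. of_int (sign (snd p)))"
  let ?P = "minor_index n k"
  have m: "row_minor n U k \<omega> = (-1) ^ k * (\<Sum>p\<in>?P. s p * row_monomial n U p \<omega>)" for U \<omega>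
    by (simp add: row_minor_def minor_coeff_def s_def row_monomial_def split_def)
  have eq: "row_minor n U k \<omega> * row_minor n V k \<omega> =
      (\<Sum>p\<in>?P. \<Sum>q\<in>?P. s p * s q * (row_monomial n U p \<omega> * row_monomial n V q \<omega>))" for \<omega>
  proof -
    have "(-1::real) ^ k * (-1) ^ k = 1" by (simp add: power_mult_distrib[symmetric])
    moreover have "(c * a) * (c * b) = (c * c) * (a * b)" for a b c :: real by (simp only: mult_ac)
    ultimately have "row_minor n U k \<omega> * row_minor n V k \<omega> =
      (\<Sum>p\<in>?P. s p * row_monomial n U p \<omega>) * (\<Sum>p\<in>?P. s p * row_monomial n V p \<omega>)"
      unfolding m by (simp only: mult_1)
    then show ?thesis by (simp add: sum_product mult_ac)
  qed
  have int: "integrable M (\<lambda>\<omega>. row_monomial n U p \<omega> * row_monomial n V q \<omega>)" if "p \<in> ?P" "q \<in> ?P" for p q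
    using monomial_orthogonal(2)[OF n U V, of "fst p" "snd p" k "fst q" "snd q"] that by simp
  have val: "(\<integral>\<omega>. row_monomial n U p \<omega> * row_monomial n V q \<omega> \<partial>M) = (if p = q then c ^ k else 0)"
    if "p \<in> ?P" "q \<in> ?P" for p q
  proof -
    have "fst p \<subseteq> {..<n}" "card (fst p) = k" "snd p permutes fst p" using that by (auto simp: minor_index_def)
    then have pc: "(\<Prod>i\<in>fst p. \<integral>x. U (snd p i) x * V (snd p i) x \<partial>row_law n) = c ^ k"
      using permutes_in_image[of "snd p" "fst p"] by (subst prod.cong[OF refl c]) auto
    have "(fst p, snd p) \<in> ?P" "(fst q, snd q) \<in> ?P" using that by simp_all
    from monomial_orthogonal(1)[OF n U V this] show ?thesis by (simp only: prod.collapse pc)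
  qed
  show "integrable M (\<lambda>\<omega>. row_minor n U k \<omega> * row_minor n V k \<omega>)"
    unfolding eq using int by (intro Bochner_Integration.integrable_sum integrable_mult_right) auto
  have "(\<integral>\<omega>. row_minor n U k \<omega> * row_minor n V k \<omega> \<partial>M) =
    (\<Sum>p\<in>?P. \<Sum>q\<in>?P. s p * s q * (\<integral>\<omega>. row_monomial n U p \<omega> * row_monomial n V q \<omega> \<partial>M))"
    unfolding eq using int
    by (simp add: Bochner_Integration.integral_sum Bochner_Integration.integrable_sum)
  also have "\<dots> = (\<Sum>p\<in>?P. \<Sum>q\<in>?P. if q = p then c ^ k else 0)"
  proof (intro sum.cong refl)
    fix p q assume "p \<in> ?P" "q \<in> ?P"
    moreover have "s p * s p = 1" by (simp add: s_def of_int_mult[symmetric] del: of_int_mult)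
    ultimately show "s p * s q * (\<integral>\<omega>. row_monomial n U p \<omega> * row_monomial n V q \<omega> \<partial>M) = (if q = p then c ^ k else 0)"
      by (auto simp: val)
  qed
  also have "\<dots> = real (card ?P) * c ^ k"
    using finite_minor_index[of n k] by (simp add: sum.delta)
  finally show "(\<integral>\<omega>. row_minor n U k \<omega> * row_minor n V k \<omega> \<partial>M) = real (card ?P) * c ^ k" .
qed

lemma card_minor_index_power_le:
  assumes "n > 0" "0 \<le> c" "c \<le> 1 / real n"
  shows "real (card (minor_index n k)) * c ^ k \<le> 1"
proof -
  have "real (card (minor_index n k)) * c ^ k \<le> real (n ^ k) * (1 / real n) ^ k"
    using assms card_minor_index[of n k] by (intro mult_mono power_mono) (auto simp del: of_nat_power)
  also have "\<dots> = 1" using assms by (simp add: power_divide)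
  finally show ?thesis .
qed

lemma measurable_row_minor:
  assumes "odd_entry n U"
  shows "row_minor n U k \<in> borel_measurable M"
proof -
  have "(\<lambda>\<omega>. U (snd p i) (row_vec X n i \<omega>)) \<in> borel_measurable M" if "p \<in> minor_index n k" "i \<in> fst p" for p i
  proof -
    have "snd p i < n" using that permutes_in_image[of "snd p" "fst p" i] by (auto simp: minor_index_def)
    from measurable_compose[OF measurable_row_vec odd_entryD(1)[OF assms this]] show ?thesis .
  qed
  then show ?thesis
    unfolding row_minor_def minor_coeff_def split_def
    by (intro borel_measurable_times borel_measurable_const borel_measurable_sum borel_measurable_prod) auto
qed

lemma peak_corr_nonneg: "0 \<le> peak_corr n"
  unfolding peak_corr_def by (intro integral_nonneg_AE AE_I2 sum_nonneg norm_peak_nonneg)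

text \<open>The bounds by 1 hold for all \<open>k\<close> and all \<open>n > 0\<close>, which later
  yields tightness. The distance expands into three instances of \<open>row_minor_inner\<close>,
  with \<open>c\<close> equal to the second moment of a normalized entry, to
  \<open>peak_prob n / n\<close> and to \<open>peak_corr n / n\<close>.\<close>

lemma row_minor_second_moment:
  assumes n: "n > 0"
  shows "(\<integral>\<omega>. (row_minor n (norm_entry n) k \<omega>)\<^sup>2 \<partial>M) \<le> 1"
    and "integrable M (\<lambda>\<omega>. (row_minor n (norm_entry n) k \<omega>)\<^sup>2)"
    and "(\<integral>\<omega>. (row_minor n (peak_entry n) k \<omega>)\<^sup>2 \<partial>M) \<le> 1"
    and "integrable M (\<lambda>\<omega>. (row_minor n (peak_entry n) k \<omega>)\<^sup>2)"
    and "(\<integral>\<omega>. (row_minor n (norm_entry n) k \<omega> - row_minor n (peak_entry n) k \<omega>)\<^sup>2 \<partial>M) \<le>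
      2 * (1 - peak_corr n ^ k)"
    and "integrable M (\<lambda>\<omega>. (row_minor n (norm_entry n) k \<omega> - row_minor n (peak_entry n) k \<omega>)\<^sup>2)"
proof -
  define y where "y = (\<integral>x. (norm_entry n 0 x)\<^sup>2 \<partial>row_law n)"
  let ?m = "real (card (minor_index n k))"
  let ?Y = "row_minor n (norm_entry n) k" and ?A = "row_minor n (peak_entry n) k"
  have y: "(\<integral>x. norm_entry n j x * norm_entry n j x \<partial>row_law n) = y" if "j < n" for j
    using row_entry_exchange[OF that n, of "\<lambda>y a. y\<^sup>2"] by (simp add: y_def power2_eq_square)
  have y0: "0 \<le> y" "y \<le> 1 / real n"
    using row_norm_entry_sq[OF n] by (auto simp: y_def intro: integral_nonneg_AE)
  have t: "(\<integral>x. peak_entry n j x * peak_entry n j x \<partial>row_law n) = peak_prob n / real n" if "j < n" for j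
    using row_peak_entry_sq[OF that] by (simp add: power2_eq_square)
  have t0: "0 \<le> peak_prob n / real n" "peak_prob n / real n \<le> 1 / real n"
    using peak_prob_le_1[of n] peak_corr_le_prob[of n] peak_corr_nonneg[of n] by (auto intro: divide_right_mono)
  note YY = row_minor_inner[OF n odd_entry_norm odd_entry_norm y, of k]
  note AA = row_minor_inner[OF n odd_entry_peak odd_entry_peak t, of k]
  note YA = row_minor_inner[OF n odd_entry_norm odd_entry_peak row_norm_peak, of k]
  show iY: "integrable M (\<lambda>\<omega>. (?Y \<omega>)\<^sup>2)" and iA: "integrable M (\<lambda>\<omega>. (?A \<omega>)\<^sup>2)"
    using YY(2) AA(2) by (simp_all add: power2_eq_square)
  show EY: "(\<integral>\<omega>. (?Y \<omega>)\<^sup>2 \<partial>M) \<le> 1"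
    unfolding power2_eq_square using YY(1) card_minor_index_power_le[OF n y0] by simp
  show EA: "(\<integral>\<omega>. (?A \<omega>)\<^sup>2 \<partial>M) \<le> 1"
    unfolding power2_eq_square using AA(1) card_minor_index_power_le[OF n t0] by simp
  have sq: "(?Y \<omega> - ?A \<omega>)\<^sup>2 = (?Y \<omega>)\<^sup>2 + (?A \<omega>)\<^sup>2 - 2 * (?Y \<omega> * ?A \<omega>)" for \<omega>
    by (simp add: power2_diff)
  show "integrable M (\<lambda>\<omega>. (?Y \<omega> - ?A \<omega>)\<^sup>2)"
    unfolding sq using iY iA YA(2) by (intro Bochner_Integration.integrable_diff Bochner_Integration.integrable_add integrable_mult_right)
  have "(\<integral>\<omega>. (?Y \<omega> - ?A \<omega>)\<^sup>2 \<partial>M) = ?m * y ^ k + ?m * (peak_prob n / real n) ^ k - 2 * (?m * (peak_corr n / real n) ^ k)"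
    unfolding sq using iY iA YA AA(1) YY(1) by (simp add: power2_eq_square)
  also have "\<dots> \<le> ?m * (1 / real n) ^ k + ?m * (1 / real n) ^ k - 2 * (?m * (peak_corr n / real n) ^ k)"
    using y0 t0 by (intro diff_right_mono add_mono mult_left_mono power_mono) auto
  also have "\<dots> = ?m * (1 / real n) ^ k * (2 * (1 - peak_corr n ^ k))"
    by (simp add: power_divide algebra_simps)
  also have "\<dots> \<le> 1 * (2 * (1 - peak_corr n ^ k))"
    using card_minor_index_power_le[OF n _ order_refl] peak_corr_nonneg[of n]
      order_trans[OF peak_corr_le_prob peak_prob_le_1, of n]
    by (intro mult_right_mono) (auto simp: power_le_one)
  finally show "(\<integral>\<omega>. (?Y \<omega> - ?A \<omega>)\<^sup>2 \<partial>M) \<le> 2 * (1 - peak_corr n ^ k)" by simp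
qed

end

subsection \<open>Cycles of signed partial maps\<close>

definition sgn_of :: "bool \<Rightarrow> real" where "sgn_of s = (if s then 1 else - 1)"

text \<open>The cyclic successor as a function of the element rather than of its position, so that
  products along a cycle become products over rows of the matrix.\<close>

definition next_in :: "nat list \<Rightarrow> nat \<Rightarrow> nat" where
  "next_in b i = b ! (Suc (inv_into {..<length b} ((!) b) i) mod length b)"

text \<open>For \<open>x\<close> in \<open>{-1, 0, 1}\<close> and a sign \<open>s\<close>, the
  polynomial \<open>(x\<^sup>2 + s * x) / 2\<close> is the indicator of \<open>x = s\<close>. The
  polynomial form suits expectations taken row by row: the part linear in \<open>x\<close> is odd
  and averages to 0.\<close>

definition cycle_indicator :: "(nat \<Rightarrow> nat \<Rightarrow> real) \<Rightarrow> bool \<Rightarrow> nat list \<Rightarrow> real" where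
  "cycle_indicator A s b =
     ((\<Prod>i\<in>set b. (A i (next_in b i))\<^sup>2) + sgn_of s * (\<Prod>i\<in>set b. A i (next_in b i))) / 2"

definition avoiding_lists :: "nat \<Rightarrow> nat \<Rightarrow> nat set \<Rightarrow> nat list set" where
  "avoiding_lists n q V = {b. length b = q \<and> distinct b \<and> set b \<subseteq> {..<n} - V}"

text \<open>
  Sums over tuples of disjoint closed paths of prescribed lengths and signs: the point of the
  recursion is that each summand is a polynomial in entries of distinct rows.
\<close>

fun cycle_sum :: "(nat \<Rightarrow> nat \<Rightarrow> real) \<Rightarrow> nat \<Rightarrow> nat set \<Rightarrow> (nat \<times> bool) list \<Rightarrow> real" where
  "cycle_sum A n V [] = 1"
| "cycle_sum A n V (\<tau> # ts) =
     (\<Sum>b\<in>avoiding_lists n (fst \<tau>) V. cycle_indicator A (snd \<tau>) b * cycle_sum A n (V \<union> set b) ts)"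

lemma finite_avoiding_lists: "finite (avoiding_lists n q V)"
  unfolding avoiding_lists_def
  by (rule finite_subset[OF _ finite_lists_length_eq[of "{..<n}" q]]) auto

lemma next_in_nth: "distinct b \<Longrightarrow> l < length b \<Longrightarrow> next_in b (b ! l) = b ! (Suc l mod length b)"
  unfolding next_in_def by (subst inv_into_f_f) (auto simp: inj_on_nth)

lemma prod_set_next_in:
  assumes "distinct b"
  shows "(\<Prod>i\<in>set b. f i (next_in b i)) = (\<Prod>l<length b. f (b ! l) (b ! (Suc l mod length b)))"
proof -
  have "(\<Prod>i\<in>set b. f i (next_in b i)) = (\<Prod>l<length b. f (b ! l) (next_in b (b ! l)))"
    using prod.reindex_bij_betw[OF bij_betw_nth[OF assms refl refl], of "\<lambda>i. f i (next_in b i)"] by simp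
  then show ?thesis using assms by (simp add: next_in_nth)
qed

locale signed_partial_map =
  fixes n :: nat and A :: "nat \<Rightarrow> nat \<Rightarrow> real"
  assumes entries: "A i j \<in> {-1, 0, 1}"
    and unique: "i < n \<Longrightarrow> j < n \<Longrightarrow> j' < n \<Longrightarrow> A i j \<noteq> 0 \<Longrightarrow> A i j' \<noteq> 0 \<Longrightarrow> j = j'"
begin

text \<open>The index \<open>n\<close> serves as an absorbing state for rows without a nonzero entry.\<close>

definition succ :: "nat \<Rightarrow> nat" where
  "succ i = (if i < n \<and> (\<exists>j<n. A i j \<noteq> 0) then (SOME j. j < n \<and> A i j \<noteq> 0) else n)"

definition weight :: "nat \<Rightarrow> real" where
  "weight i = (if i < n \<and> succ i < n then A i (succ i) else 0)"

definition path_weight :: "nat \<Rightarrow> nat \<Rightarrow> real" where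
  "path_weight k i = (\<Prod>l<k. weight ((succ ^^ l) i))"

lemma succ_le: "succ i \<le> n"
proof (cases "i < n \<and> (\<exists>j<n. A i j \<noteq> 0)")
  case True
  then have "\<exists>j. j < n \<and> A i j \<noteq> 0" by blast
  from someI_ex[OF this] show ?thesis using True by (simp add: succ_def)
next
  case False
  then have "succ i = n" unfolding succ_def by (rule if_not_P)
  then show ?thesis by simp
qed

lemma succ_n [simp]: "succ n = n" by (simp add: succ_def)

lemma funpow_succ_n [simp]: "(succ ^^ k) n = n" by (induction k) auto

lemma entry_eq:
  assumes "i < n" "j < n"
  shows "A i j = (if succ i = j then weight i else 0)"
proof (cases "\<exists>j<n. A i j \<noteq> 0")
  case True
  then have "\<exists>j. j < n \<and> A i j \<noteq> 0" by blast
  from someI_ex[OF this] have s: "succ i < n" "A i (succ i) \<noteq> 0" using True assms by (auto simp: succ_def)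
  then show ?thesis using unique[OF assms(1,2) s(1)] assms by (auto simp: weight_def)
next
  case False
  then have "A i j = 0" using assms by blast
  moreover have "succ i = n" unfolding succ_def using False by auto
  ultimately show ?thesis using assms by auto
qed

lemma weight_cases: "weight i \<in> {-1, 0, 1}"
  using entries by (simp add: weight_def)

lemma weight_nonzero: "i < n \<Longrightarrow> succ i < n \<Longrightarrow> weight i \<noteq> 0"
proof -
  assume i: "i < n" "succ i < n"
  then have ex: "\<exists>j. j < n \<and> A i j \<noteq> 0" unfolding succ_def by (auto split: if_splits)
  from someI_ex[OF this] have "A i (succ i) \<noteq> 0" using i ex by (auto simp: succ_def)
  then show ?thesis using i by (simp add: weight_def)
qed

lemma path_weight_cases: "path_weight k i \<in> {-1, 0, 1}"
proof (induction k)
  case (Suc k)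
  then show ?case using weight_cases[of "(succ ^^ k) i"] by (auto simp: path_weight_def)
qed (simp add: path_weight_def)

lemma path_weight_add: "path_weight (a + b) i = path_weight a i * path_weight b ((succ ^^ a) i)"
proof (induction b)
  case (Suc b)
  have "(succ ^^ (a + b)) i = (succ ^^ b) ((succ ^^ a) i)"
    by (metis add.commute comp_apply funpow_add)
  then show ?case using Suc by (simp add: path_weight_def)
qed (simp add: path_weight_def)

lemma path_weight_mult:
  assumes "(succ ^^ q) x = x"
  shows "path_weight (q * m) x = path_weight q x ^ m"
proof (induction m)
  case (Suc m)
  have "path_weight (q * Suc m) x = path_weight q x * path_weight (q * m) x"
    using path_weight_add[of q "q * m" x] assms by simp
  then show ?case using Suc by simp
qed (simp add: path_weight_def)

text \<open>From \<open>i\<close> there is a single walk of \<open>k\<close> steps. A walk that runs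
  out of arrows is absorbed in \<open>n\<close>, where the weight is 0.\<close>

lemma matrix_power_entry:
  assumes "i < n" "j < n"
  shows "(Matrix.mat n n (\<lambda>(i, j). A i j) ^\<^sub>m k) $$ (i, j) = (if (succ ^^ k) i = j then path_weight k i else 0)"
  using assms
proof (induction k arbitrary: j)
  case 0
  then show ?case by (simp add: path_weight_def)
next
  case (Suc k)
  let ?M = "Matrix.mat n n (\<lambda>(i, j). A i j)"
  have M: "?M ^\<^sub>m k \<in> carrier_mat n n" by simp
  have "(?M ^\<^sub>m Suc k) $$ (i, j) = (\<Sum>l<n. (?M ^\<^sub>m k) $$ (i, l) * A l j)"
    using M Suc.prems by (auto simp: scalar_prod_def atLeast0LessThan intro!: sum.cong)
  also have "\<dots> = (\<Sum>l<n. if l = (succ ^^ k) i then path_weight k i * A l j else 0)"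
    using Suc by (intro sum.cong refl) auto
  also have "\<dots> = (if (succ ^^ k) i < n then path_weight k i * A ((succ ^^ k) i) j else 0)"
    by (simp add: sum.delta)
  also have "\<dots> = (if (succ ^^ Suc k) i = j then path_weight (Suc k) i else 0)"
  proof (cases "(succ ^^ k) i < n")
    case True
    then show ?thesis using entry_eq[OF True Suc.prems(2)] by (simp add: path_weight_def)
  next
    case False
    then have "weight ((succ ^^ k) i) = 0" by (simp add: weight_def)
    then show ?thesis using False by (simp add: path_weight_def)
  qed
  finally show ?case .
qed

text \<open>The minimality clause makes \<open>fst \<tau>\<close> the exact period, so that no point
  belongs to two types.\<close>

definition cyc_points :: "nat \<times> bool \<Rightarrow> nat set" where
  "cyc_points \<tau> = {x. x < n \<and> fst \<tau> > 0 \<and> (succ ^^ fst \<tau>) x = x \<and> (\<forall>r. 0 < r \<and> r < fst \<tau> \<longrightarrow> (succ ^^ r) x \<noteq> x) \<and>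
      path_weight (fst \<tau>) x = sgn_of (snd \<tau>)}"

definition orbit_of :: "nat \<Rightarrow> nat \<Rightarrow> nat set" where
  "orbit_of q x = (\<lambda>l. (succ ^^ l) x) ` {..<q}"

definition cycles :: "nat \<times> bool \<Rightarrow> nat set set" where
  "cycles \<tau> = orbit_of (fst \<tau>) ` cyc_points \<tau>"

lemma finite_cyc_points [simp]: "finite (cyc_points \<tau>)"
  unfolding cyc_points_def by (rule finite_subset[of _ "{..<n}"]) auto

lemma finite_cycles [simp]: "finite (cycles \<tau>)"
  unfolding cycles_def by simp

text \<open>A walk that has reached the absorbing state \<open>n\<close> stays there and cannot
  return to \<open>x < n\<close>.\<close>

lemma periodic_less:
  assumes "x < n" "(succ ^^ q) x = x" "q > 0"
  shows "(succ ^^ l) x < n"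
proof (rule ccontr)
  assume a: "\<not> ?thesis"
  have le: "(succ ^^ l) x \<le> n" for l
    using succ_le assms(1) by (cases l) auto
  with a have e: "(succ ^^ l) x = n" by (metis le_neq_implies_less)
  have "(succ ^^ (l + q * l)) x = n"
    using e by (metis add.commute comp_apply funpow_add funpow_succ_n)
  then have "(succ ^^ (q * Suc l)) x = n \<or> l \<le> q * l"
    using assms(3) by simp
  have per: "(succ ^^ (q * m)) x = x" for m
    by (induction m) (simp_all add: funpow_add assms(2))
  have "l \<le> q * l" using assms(3) by simp
  then have "(succ ^^ (q * l)) x = (succ ^^ (q * l - l)) ((succ ^^ l) x)"
    by (metis comp_apply funpow_add le_add_diff_inverse2)
  then have "x = n" using e per by simp
  then show False using assms(1) by simp
qed

lemma periodic_weight: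
  assumes "x < n" "(succ ^^ q) x = x" "q > 0"
  shows "path_weight l x \<in> {-1, 1}"
proof -
  have "path_weight l x \<noteq> 0"
    unfolding path_weight_def
  proof (subst prod_zero_iff, simp, rule notI)
    assume "\<exists>l\<in>{..<l}. weight ((succ ^^ l) x) = 0"
    then obtain l where "weight ((succ ^^ l) x) = 0" by blast
    moreover have "succ ((succ ^^ l) x) < n"
      using periodic_less[OF assms, of "Suc l"] by simp
    ultimately show False using weight_nonzero periodic_less[OF assms, of l] by blast
  qed
  then show ?thesis using path_weight_cases[of l x] by blast
qed

lemma cyc_pointsD:
  assumes "x \<in> cyc_points \<tau>"
  shows "x < n" "fst \<tau> > 0" "(succ ^^ fst \<tau>) x = x" "\<And>r. 0 < r \<Longrightarrow> r < fst \<tau> \<Longrightarrow> (succ ^^ r) x \<noteq> x"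
    "path_weight (fst \<tau>) x = sgn_of (snd \<tau>)"
  using assms by (auto simp: cyc_points_def)

lemma cyc_points_disjoint: "x \<in> cyc_points \<tau> \<Longrightarrow> x \<in> cyc_points \<sigma> \<Longrightarrow> \<tau> = \<sigma>"
proof -
  assume x: "x \<in> cyc_points \<tau>" "x \<in> cyc_points \<sigma>"
  then have "\<not> fst \<tau> < fst \<sigma>" "\<not> fst \<sigma> < fst \<tau>"
    using cyc_pointsD[OF x(1)] cyc_pointsD[OF x(2)] by metis+
  then have e: "fst \<tau> = fst \<sigma>" by simp
  then have "sgn_of (snd \<tau>) = sgn_of (snd \<sigma>)" using cyc_pointsD(5)[OF x(1)] cyc_pointsD(5)[OF x(2)] by simp
  then have "snd \<tau> = snd \<sigma>" by (auto simp: sgn_of_def split: if_splits)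
  with e show ?thesis by (rule prod_eqI)
qed

lemma funpow_succ_swap: "(succ ^^ a) ((succ ^^ b) x) = (succ ^^ b) ((succ ^^ a) x)"
  by (metis add.commute comp_apply funpow_add)

lemma cyc_points_orbit:
  assumes x: "x \<in> cyc_points \<tau>" and y: "y \<in> orbit_of (fst \<tau>) x"
  shows "y \<in> cyc_points \<tau>" "orbit_of (fst \<tau>) y = orbit_of (fst \<tau>) x"
proof -
  let ?q = "fst \<tau>"
  note X = cyc_pointsD[OF x]
  from y obtain l where l: "l < ?q" "y = (succ ^^ l) x" by (auto simp: orbit_of_def)
  have ret: "(succ ^^ (?q - l)) y = x"
    using l X(3) by (metis comp_apply funpow_add le_add_diff_inverse2 less_imp_le)
  have per: "(succ ^^ ?q) y = y" unfolding l(2) by (subst funpow_succ_swap) (simp add: X(3))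
  have min: "(succ ^^ r) y \<noteq> y" if r: "0 < r" "r < ?q" for r
  proof
    assume "(succ ^^ r) y = y"
    then have "(succ ^^ r) x = x" using ret funpow_succ_swap[of r "?q - l" y] by simp
    then show False using X(4)[OF r] by simp
  qed
  \<comment> \<open>Both sides are the weight of a walk of \<open>l + fst \<tau>\<close> steps from
    \<open>x\<close>, split in two ways. The factor \<open>path_weight l x\<close> is nonzero and
    cancels, so the sign is the same at every point of the cycle.\<close>
  have "path_weight l x * path_weight ?q y = path_weight ?q x * path_weight l x"
    using path_weight_add[of l ?q x] path_weight_add[of ?q l x] l X(3) by (simp add: add.commute)
  then have "path_weight ?q y = path_weight ?q x" using periodic_weight[OF X(1,3,2), of l] by auto
  then show yc: "y \<in> cyc_points \<tau>"
    using per min X periodic_less[OF X(1,3,2), of l] l(2) by (auto simp: cyc_points_def)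
  have sub: "orbit_of ?q ((succ ^^ l) x) \<subseteq> orbit_of ?q x" if "(succ ^^ ?q) x = x" for l x
  proof
    fix z assume "z \<in> orbit_of ?q ((succ ^^ l) x)"
    then obtain m where "z = (succ ^^ m) ((succ ^^ l) x)" by (auto simp: orbit_of_def)
    then have "z = (succ ^^ (m + l)) x" by (simp add: funpow_add)
    also have "\<dots> = (succ ^^ ((m + l) mod ?q)) x" using funpow_mod_eq[OF that] by metis
    finally show "z \<in> orbit_of ?q x" using X(2) by (auto simp: orbit_of_def)
  qed
  show "orbit_of ?q y = orbit_of ?q x"
    using sub[OF X(3), of l] sub[OF per, of "?q - l"] ret l by auto
qed

lemma orbit_self: "x \<in> cyc_points \<tau> \<Longrightarrow> x \<in> orbit_of (fst \<tau>) x"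
  using cyc_pointsD(2)[of x \<tau>] unfolding orbit_of_def by (intro image_eqI[of _ _ 0]) auto

lemma inj_on_orbit:
  assumes x: "x \<in> cyc_points \<tau>"
  shows "inj_on (\<lambda>l. (succ ^^ l) x) {..<fst \<tau>}"
proof -
  note X = cyc_pointsD[OF x]
  have False if "l < m" "m < fst \<tau>" "(succ ^^ l) x = (succ ^^ m) x" for l m
  proof -
    have "(succ ^^ l) x \<in> cyc_points \<tau>"
      using that by (intro cyc_points_orbit(1)[OF x]) (auto simp: orbit_of_def)
    moreover have "(succ ^^ (m - l)) ((succ ^^ l) x) = (succ ^^ l) x"
      using that by (metis comp_apply funpow_add le_add_diff_inverse2 less_imp_le)
    ultimately show False using cyc_pointsD(4)[of _ \<tau> "m - l"] that by auto
  qed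
  then show ?thesis by (intro linorder_inj_onI) auto
qed

lemma card_cycle: "c \<in> cycles \<tau> \<Longrightarrow> card c = fst \<tau>"
  unfolding cycles_def by (elim imageE) (simp add: orbit_of_def card_image inj_on_orbit)

lemma cycles_eq_orbit: "c \<in> cycles \<tau> \<Longrightarrow> x \<in> c \<Longrightarrow> x \<in> cyc_points \<tau> \<and> c = orbit_of (fst \<tau>) x"
  unfolding cycles_def using cyc_points_orbit by blast

lemma cycles_disjoint:
  assumes "c \<in> cycles \<tau>" "d \<in> cycles \<sigma>" "c \<inter> d \<noteq> {}"
  shows "\<tau> = \<sigma> \<and> c = d"
proof -
  obtain x where "x \<in> c" "x \<in> d" using assms by blast
  then have "x \<in> cyc_points \<tau>" "c = orbit_of (fst \<tau>) x" "x \<in> cyc_points \<sigma>" "d = orbit_of (fst \<sigma>) x"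
    using cycles_eq_orbit assms by blast+
  then show ?thesis using cyc_points_disjoint[of x \<tau> \<sigma>] by simp
qed

lemma Union_cycles: "\<Union>(cycles \<tau>) = cyc_points \<tau>"
  unfolding cycles_def using orbit_self cyc_points_orbit(1) by blast

lemma card_cyc_points: "card (cyc_points \<tau>) = fst \<tau> * card (cycles \<tau>)"
proof -
  have "fst \<tau> * card (cycles \<tau>) = card (\<Union>(cycles \<tau>))"
  proof (rule card_partition)
    show "c \<inter> d = {}" if "c \<in> cycles \<tau>" "d \<in> cycles \<tau>" "c \<noteq> d" for c d
      using cycles_disjoint[OF that(1,2)] that(3) by blast
  qed (simp_all add: Union_cycles card_cycle)
  then show ?thesis by (simp add: Union_cycles)
qed

lemma card_cycles_le: "card (cycles \<tau>) \<le> n"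
proof -
  have "card (cycles \<tau>) \<le> card (cyc_points \<tau>)" unfolding cycles_def by (rule card_image_le) simp
  also have "\<dots> \<le> card {..<n}" by (intro card_mono) (auto simp: cyc_points_def)
  finally show ?thesis by simp
qed

text \<open>A walk of \<open>k\<close> steps closes up exactly at points whose period
  \<open>q\<close> divides \<open>k\<close>. It then traverses the cycle \<open>k div q\<close>
  times and contributes that power of its sign; every cycle supplies \<open>q\<close> starting
  points.\<close>

lemma trace_power_eq:
  assumes k: "k \<ge> 1"
  shows "mat_trace (Matrix.mat n n (\<lambda>(i, j). A i j) ^\<^sub>m k) =
    (\<Sum>q | q dvd k. real q * (real (card (cycles (q, True))) + (-1) ^ (k div q) * real (card (cycles (q, False)))))"
proof -
  let ?P = "\<lambda>q. cyc_points (q, True) \<union> cyc_points (q, False)"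
  have "mat_trace (Matrix.mat n n (\<lambda>(i, j). A i j) ^\<^sub>m k) = (\<Sum>i<n. if (succ ^^ k) i = i then path_weight k i else 0)"
    unfolding mat_trace_def by (simp add: matrix_power_entry)
  also have "\<dots> = (\<Sum>i | i < n \<and> (succ ^^ k) i = i. path_weight k i)"
    by (simp add: sum.If_cases) (rule sum.cong, auto)
  also have "{i. i < n \<and> (succ ^^ k) i = i} = (\<Union>q\<in>{q. q dvd k}. ?P q)"
  proof (intro equalityI subsetI)
    fix x assume x: "x \<in> {i. i < n \<and> (succ ^^ k) i = i}"
    \<comment> \<open>The least period divides \<open>k\<close>, since \<open>k mod q\<close> steps
      also lead back to \<open>x\<close>.\<close>
    define q where "q = (LEAST q. 0 < q \<and> (succ ^^ q) x = x)"
    have q: "0 < q \<and> (succ ^^ q) x = x"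
      unfolding q_def by (rule LeastI[of _ k]) (use x k in auto)
    have min: "(succ ^^ r) x \<noteq> x" if "0 < r" "r < q" for r
      using not_less_Least[of r "\<lambda>q. 0 < q \<and> (succ ^^ q) x = x"] that by (auto simp: q_def)
    have "(succ ^^ (k mod q)) x = (succ ^^ k) x" using q by (intro funpow_mod_eq) auto
    then have "(succ ^^ (k mod q)) x = x" using x by simp
    then have "k mod q = 0" using min[of "k mod q"] q by (metis mod_less_divisor neq0_conv)
    then have "q dvd k" by auto
    have "path_weight q x \<in> {-1, 1}" using periodic_weight[of x q q] q x by auto
    then have "x \<in> ?P q" using q min x by (auto simp: cyc_points_def sgn_of_def)
    then show "x \<in> (\<Union>q\<in>{q. q dvd k}. ?P q)" using \<open>q dvd k\<close> by blast
  next
    fix x assume "x \<in> (\<Union>q\<in>{q. q dvd k}. ?P q)"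
    then obtain q s where q: "q dvd k" "x \<in> cyc_points (q, s)" by blast
    then have "(succ ^^ (k mod q)) x = (succ ^^ k) x"
      using cyc_pointsD[OF q(2)] by (intro funpow_mod_eq) auto
    then show "x \<in> {i. i < n \<and> (succ ^^ k) i = i}" using cyc_pointsD[OF q(2)] q(1) by simp
  qed
  also have "(\<Sum>i\<in>(\<Union>q\<in>{q. q dvd k}. ?P q). path_weight k i) = (\<Sum>q | q dvd k. \<Sum>i\<in>?P q. path_weight k i)"
    using k by (intro sum.UNION_disjoint) (auto dest: cyc_points_disjoint)
  also have "\<dots> = (\<Sum>q | q dvd k. real q * (real (card (cycles (q, True))) + (-1) ^ (k div q) * real (card (cycles (q, False)))))"
  proof (rule sum.cong[OF refl])
    fix q assume q: "q \<in> {q. q dvd k}"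
    have w: "(\<Sum>i\<in>cyc_points (q, s). path_weight k i) = real (card (cyc_points (q, s))) * sgn_of s ^ (k div q)" for s
    proof -
      have "path_weight k i = sgn_of s ^ (k div q)" if "i \<in> cyc_points (q, s)" for i
        using path_weight_mult[of q i "k div q"] cyc_pointsD[OF that] q by auto
      then show ?thesis by simp
    qed
    have "(\<Sum>i\<in>?P q. path_weight k i) = (\<Sum>i\<in>cyc_points (q, True). path_weight k i) + (\<Sum>i\<in>cyc_points (q, False). path_weight k i)"
      by (intro sum.union_disjoint) (auto dest: cyc_points_disjoint)
    then show "(\<Sum>i\<in>?P q. path_weight k i) =
        real q * (real (card (cycles (q, True))) + (-1) ^ (k div q) * real (card (cycles (q, False))))"
      unfolding w card_cyc_points by (simp add: sgn_of_def algebra_simps)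
  qed
  finally show ?thesis .
qed

section \<open>Sums over tuples of disjoint cycles\<close>

definition saturated :: "nat set \<Rightarrow> bool" where
  "saturated V \<longleftrightarrow> (\<forall>\<tau>. \<forall>c\<in>cycles \<tau>. c \<subseteq> V \<or> c \<inter> V = {})"

definition free_cycles :: "nat set \<Rightarrow> nat \<times> bool \<Rightarrow> nat set set" where
  "free_cycles V \<tau> = {c \<in> cycles \<tau>. c \<inter> V = {}}"

lemma cycle_indicator_list:
  assumes "distinct b" "length b = q" "set b \<subseteq> {..<n}"
  shows "cycle_indicator A s b = (if (\<forall>l<q. succ (b ! l) = b ! (Suc l mod q)) \<and> (\<Prod>l<q. weight (b ! l)) = sgn_of s then 1 else 0)"
proof -
  have bl: "b ! l < n" if "l < q" for l
  proof -
    have "b ! l \<in> set b" using assms(2) that by simp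
    then show ?thesis using assms(3) by blast
  qed
  have ci: "cycle_indicator A s b = ((\<Prod>l<q. A (b ! l) (b ! (Suc l mod q)))\<^sup>2 + sgn_of s * (\<Prod>l<q. A (b ! l) (b ! (Suc l mod q)))) / 2"
    using assms(1,2) by (simp add: cycle_indicator_def prod_set_next_in[where f = A]
        prod_set_next_in[where f = "\<lambda>i j. (A i j)\<^sup>2"] prod_power_distrib)
  show ?thesis
  proof (cases "\<forall>l<q. succ (b ! l) = b ! (Suc l mod q)")
    case True
    have e: "(\<Prod>l<q. A (b ! l) (b ! (Suc l mod q))) = (\<Prod>l<q. weight (b ! l))"
      using True bl by (intro prod.cong refl) (auto simp: entry_eq)
    have wt: "weight (b ! l) \<in> {-1, 1}" if "l < q" for l
      using weight_nonzero[of "b ! l"] weight_cases[of "b ! l"] bl[OF that] bl[of "Suc l mod q"] True that by auto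
    have "(\<Prod>l<q'. weight (b ! l)) \<in> {-1, 1}" if "q' \<le> q" for q' using that
    proof (induction q')
      case (Suc q')
      then show ?case using Suc.IH wt[of q'] by auto
    qed simp
    then have "(\<Prod>l<q. weight (b ! l)) \<in> {-1, 1}" by blast
    then show ?thesis unfolding ci e using True by (auto simp: sgn_of_def)
  next
    case False
    then obtain l where l: "l < q" "succ (b ! l) \<noteq> b ! (Suc l mod q)" by blast
    then have "A (b ! l) (b ! (Suc l mod q)) = 0"
      using entry_eq[OF bl bl, of l "Suc l mod q"] by simp
    then have z: "(\<Prod>l<q. A (b ! l) (b ! (Suc l mod q))) = 0" using l(1) by (intro prod_zero) auto
    show ?thesis unfolding ci z using False by auto
  qed
qed

text \<open>A cycle of length \<open>q\<close> is traversed by exactly \<open>q\<close> lists, one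
  for each starting point, hence the factor \<open>fst \<tau>\<close>. The weight \<open>g\<close>
  sees only the set of visited points, as the recursion of \<open>cycle_sum\<close>
  requires.\<close>

lemma sum_cycle_indicator:
  assumes q: "fst \<tau> > 0"
  shows "(\<Sum>b\<in>avoiding_lists n (fst \<tau>) V. cycle_indicator A (snd \<tau>) b * g (set b)) =
    (\<Sum>c\<in>free_cycles V \<tau>. real (fst \<tau>) * g c)"
proof -
  let ?q = "fst \<tau>"
  define P where "P = {x \<in> cyc_points \<tau>. orbit_of ?q x \<inter> V = {}}"
  \<comment> \<open>The list that follows the map from \<open>x\<close> for one period; every
    admissible list not of this form has indicator 0.\<close>
  define L where "L = (\<lambda>x. map (\<lambda>l. (succ ^^ l) x) [0..<?q])"
  have setL: "set (L x) = orbit_of ?q x" for x by (auto simp: L_def orbit_of_def)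
  have "(\<Sum>b\<in>avoiding_lists n ?q V. cycle_indicator A (snd \<tau>) b * g (set b)) = (\<Sum>b\<in>L ` P. g (set b))"
  proof (rule sum.mono_neutral_cong_right)
    show sub: "L ` P \<subseteq> avoiding_lists n ?q V"
    proof
      fix b assume "b \<in> L ` P"
      then obtain x where x: "x \<in> cyc_points \<tau>" "orbit_of ?q x \<inter> V = {}" "b = L x" by (auto simp: P_def)
      have "distinct b" unfolding x(3) L_def using inj_on_orbit[OF x(1)] by (simp add: distinct_map atLeast0LessThan)
      moreover have "set b \<subseteq> {..<n} - V"
        unfolding x(3) setL using x(2) cyc_pointsD(1)[OF cyc_points_orbit(1)[OF x(1)]] by blast
      ultimately show "b \<in> avoiding_lists n ?q V" by (simp add: avoiding_lists_def x(3) L_def)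
    qed
    show "\<forall>b\<in>avoiding_lists n ?q V - L ` P. cycle_indicator A (snd \<tau>) b * g (set b) = 0"
    proof
      fix b assume b: "b \<in> avoiding_lists n ?q V - L ` P"
      then have B: "length b = ?q" "distinct b" "set b \<subseteq> {..<n}" "set b \<inter> V = {}" by (auto simp: avoiding_lists_def)
      show "cycle_indicator A (snd \<tau>) b * g (set b) = 0"
      proof (rule ccontr)
        assume "cycle_indicator A (snd \<tau>) b * g (set b) \<noteq> 0"
        then have s: "\<And>l. l < ?q \<Longrightarrow> succ (b ! l) = b ! (Suc l mod ?q)" and w: "(\<Prod>l<?q. weight (b ! l)) = sgn_of (snd \<tau>)"
          using cycle_indicator_list[OF B(2,1,3), of "snd \<tau>"] by (auto split: if_splits)
        define x where "x = b ! 0"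
        have it: "(succ ^^ l) x = b ! l" if "l < ?q" for l
          using that
        proof (induction l)
          case (Suc l)
          then show ?case using s[of l] by simp
        qed (simp add: x_def)
        have bL: "b = L x" using B(1) it by (intro nth_equalityI) (auto simp: L_def)
        have "(succ ^^ ?q) x = succ ((succ ^^ (?q - 1)) x)" using q by (metis Suc_diff_1 funpow.simps(2) comp_apply)
        also have "\<dots> = x" using it[of "?q - 1"] s[of "?q - 1"] q by (simp add: x_def)
        finally have per: "(succ ^^ ?q) x = x" .
        have min: "(succ ^^ r) x \<noteq> x" if "0 < r" "r < ?q" for r
          using it[OF that(2)] B(1,2) that q nth_eq_iff_index_eq[of b r 0] by (auto simp: x_def)
        have "path_weight ?q x = sgn_of (snd \<tau>)"
          unfolding path_weight_def w[symmetric] using it by (intro prod.cong refl) auto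
        moreover have "x \<in> set b" using B(1) q by (simp add: x_def)
        then have "x < n" using B(3) by blast
        ultimately have "x \<in> cyc_points \<tau>" using per min q by (auto simp: cyc_points_def)
        moreover have "orbit_of ?q x \<inter> V = {}" using B(4) setL[of x] bL by simp
        ultimately have "b \<in> L ` P" using bL by (auto simp: P_def)
        then show False using b by blast
      qed
    qed
    fix b assume b: "b \<in> L ` P"
    then obtain x where x: "x \<in> cyc_points \<tau>" "b = L x" by (auto simp: P_def)
    have B: "length b = ?q" "distinct b" "set b \<subseteq> {..<n}" using sub b by (auto simp: avoiding_lists_def)
    have "succ (b ! l) = b ! (Suc l mod ?q)" if "l < ?q" for l
    proof (cases "Suc l < ?q")
      case True
      then show ?thesis using that by (simp add: x(2) L_def)
    next
      case False
      then have "Suc l = ?q" using that by simp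
      then show ?thesis using that cyc_pointsD(3)[OF x(1)] q by (simp add: x(2) L_def) (metis comp_apply funpow.simps(2))
    qed
    moreover have "(\<Prod>l<?q. weight (b ! l)) = sgn_of (snd \<tau>)"
      using cyc_pointsD(5)[OF x(1)] by (simp add: x(2) L_def path_weight_def)
    ultimately show "cycle_indicator A (snd \<tau>) b * g (set b) = g (set b)"
      using cycle_indicator_list[OF B(2,1,3), of "snd \<tau>"] by simp
  qed (rule finite_avoiding_lists)
  also have "\<dots> = (\<Sum>x\<in>P. g (orbit_of ?q x))"
  proof (subst sum.reindex)
    show "inj_on L P"
    proof (rule inj_onI)
      fix x y assume "L x = L y"
      then have "L x ! 0 = L y ! 0" by simp
      then show "x = y" using q by (simp add: L_def)
    qed
  qed (simp add: setL)
  also have "P = \<Union>(free_cycles V \<tau>)"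
  proof (intro equalityI subsetI)
    fix x assume "x \<in> P"
    then have "orbit_of ?q x \<in> free_cycles V \<tau>" "x \<in> orbit_of ?q x"
      unfolding P_def free_cycles_def cycles_def using orbit_self by blast+
    then show "x \<in> \<Union>(free_cycles V \<tau>)" by blast
  next
    fix x assume "x \<in> \<Union>(free_cycles V \<tau>)"
    then obtain c where c: "c \<in> cycles \<tau>" "c \<inter> V = {}" "x \<in> c" by (auto simp: free_cycles_def)
    from cycles_eq_orbit[OF c(1,3)] c(2) show "x \<in> P" by (simp add: P_def)
  qed
  also have "(\<Sum>x\<in>\<Union>(free_cycles V \<tau>). g (orbit_of ?q x)) = (\<Sum>c\<in>free_cycles V \<tau>. \<Sum>x\<in>c. g (orbit_of ?q x))"
  proof (subst sum.Union_disjoint)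
    show "\<forall>c\<in>free_cycles V \<tau>. finite c"
      unfolding free_cycles_def cycles_def orbit_of_def by blast
    show "\<forall>c\<in>free_cycles V \<tau>. \<forall>d\<in>free_cycles V \<tau>. c \<noteq> d \<longrightarrow> c \<inter> d = {}"
      unfolding free_cycles_def using cycles_disjoint[of _ \<tau> _ \<tau>] by blast
  qed (simp add: comp_def)
  also have "\<dots> = (\<Sum>c\<in>free_cycles V \<tau>. real ?q * g c)"
  proof (rule sum.cong[OF refl])
    fix c assume "c \<in> free_cycles V \<tau>"
    then have c: "c \<in> cycles \<tau>" by (simp add: free_cycles_def)
    then have "(\<Sum>x\<in>c. g (orbit_of ?q x)) = (\<Sum>x\<in>c. g c)"
      using cycles_eq_orbit[OF c] by (intro sum.cong refl) auto
    then show "(\<Sum>x\<in>c. g (orbit_of ?q x)) = real ?q * g c" using card_cycle[OF c] by simp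
  qed
  finally show ?thesis .
qed

lemma saturated_Un_cycle:
  assumes "saturated V" "c \<in> cycles \<tau>"
  shows "saturated (V \<union> c)"
  unfolding saturated_def
proof (intro allI ballI)
  fix \<sigma> d assume d: "d \<in> cycles \<sigma>"
  show "d \<subseteq> V \<union> c \<or> d \<inter> (V \<union> c) = {}"
    using assms d cycles_disjoint[OF assms(2) d] unfolding saturated_def by blast
qed

lemma card_free_cycles_Un:
  assumes "c \<in> free_cycles V \<tau>" "fst \<tau> > 0"
  shows "card (free_cycles (V \<union> c) \<sigma>) = card (free_cycles V \<sigma>) - (if \<sigma> = \<tau> then 1 else 0)"
proof -
  have c: "c \<in> cycles \<tau>" "c \<inter> V = {}" using assms by (auto simp: free_cycles_def)
  have "c \<noteq> {}" using card_cycle[OF c(1)] assms(2) by auto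
  have d: "d \<inter> c = {}" if "d \<in> cycles \<sigma>" "\<sigma> \<noteq> \<tau> \<or> d \<noteq> c" for d \<sigma>
    using cycles_disjoint[OF that(1) c(1)] that(2) by blast
  show ?thesis
  proof (cases "\<sigma> = \<tau>")
    case True
    have "free_cycles (V \<union> c) \<tau> = free_cycles V \<tau> - {c}"
      unfolding free_cycles_def using d[of _ \<tau>] \<open>c \<noteq> {}\<close> by blast
    then show ?thesis using True assms(1) by (simp add: card_Diff_singleton)
  next
    case False
    have "free_cycles (V \<union> c) \<sigma> = free_cycles V \<sigma>"
      unfolding free_cycles_def using d[of _ \<sigma>] False by blast
    then show ?thesis using False by simp
  qed
qed

end

text \<open>The value of \<open>cycle_sum\<close> in terms of cycle counts alone: a chosen cycle is
  no longer available to later entries of the same type, and other types are unaffected.\<close>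

fun cycle_product :: "(nat \<times> bool \<Rightarrow> nat) \<Rightarrow> (nat \<times> bool) list \<Rightarrow> real" where
  "cycle_product c [] = 1"
| "cycle_product c (\<tau> # ts) = real (fst \<tau>) * real (c \<tau>) * cycle_product (c(\<tau> := c \<tau> - 1)) ts"

text \<open>Repetitions of a type give descending factors of its count; \<open>r\<close> of them
  form \<open>fact r\<close> times a binomial coefficient, by absorption.\<close>

lemma cycle_product_eq:
  assumes "finite Q" "set ts \<subseteq> Q"
  shows "cycle_product c ts = (\<Prod>\<tau>\<in>Q. real (fst \<tau>) ^ count_list ts \<tau> * fact (count_list ts \<tau>) * real (c \<tau> choose count_list ts \<tau>))"
  using assms(2)
proof (induction ts arbitrary: c)
  case (Cons \<tau> ts)
  let ?f = "\<lambda>c ts \<sigma>. real (fst \<sigma>) ^ count_list ts \<sigma> * fact (count_list ts \<sigma>) * real (c \<sigma> choose count_list ts \<sigma>)"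
  have \<tau>: "\<tau> \<in> Q" using Cons by simp
  have Q: "(\<Prod>\<sigma>\<in>Q. h \<sigma>) = h \<tau> * (\<Prod>\<sigma>\<in>Q - {\<tau>}. h \<sigma>)" for h :: "_ \<Rightarrow> real"
    using \<tau> assms(1) by (simp add: prod.remove)
  have "real (c \<tau>) * real ((c \<tau> - 1) choose r) = real (Suc r) * real (c \<tau> choose Suc r)" for r
    using binomial_absorption[of r "c \<tau>"] by (metis of_nat_mult)
  then have 1: "real (fst \<tau>) * real (c \<tau>) * ?f (c(\<tau> := c \<tau> - 1)) ts \<tau> = ?f c (\<tau> # ts) \<tau>"
    by (simp add: mult_ac del: of_nat_Suc)
  have 2: "(\<Prod>\<sigma>\<in>Q - {\<tau>}. ?f (c(\<tau> := c \<tau> - 1)) ts \<sigma>) = (\<Prod>\<sigma>\<in>Q - {\<tau>}. ?f c (\<tau> # ts) \<sigma>)"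
    by (intro prod.cong) auto
  have "cycle_product c (\<tau> # ts) = real (fst \<tau>) * real (c \<tau>) * (\<Prod>\<sigma>\<in>Q. ?f (c(\<tau> := c \<tau> - 1)) ts \<sigma>)"
    using Cons by simp
  also have "\<dots> = (real (fst \<tau>) * real (c \<tau>) * ?f (c(\<tau> := c \<tau> - 1)) ts \<tau>) * (\<Prod>\<sigma>\<in>Q - {\<tau>}. ?f (c(\<tau> := c \<tau> - 1)) ts \<sigma>)"
    by (subst Q) (simp only: mult.assoc)
  also have "\<dots> = (\<Prod>\<sigma>\<in>Q. ?f c (\<tau> # ts) \<sigma>)" unfolding 1 2 by (rule Q[symmetric])
  finally show ?case .
qed simp

context signed_partial_map
begin

lemma cycle_sum_eq_product:
  assumes "saturated V" "\<And>\<tau>. \<tau> \<in> set ts \<Longrightarrow> fst \<tau> > 0"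
  shows "cycle_sum A n V ts = cycle_product (\<lambda>\<tau>. card (free_cycles V \<tau>)) ts"
  using assms
proof (induction ts arbitrary: V)
  case (Cons \<tau> ts)
  have q: "fst \<tau> > 0" using Cons by simp
  have "cycle_sum A n V (\<tau> # ts) = (\<Sum>c\<in>free_cycles V \<tau>. real (fst \<tau>) * cycle_sum A n (V \<union> c) ts)"
    by (simp add: sum_cycle_indicator[OF q, where V = V and g = "\<lambda>c. cycle_sum A n (V \<union> c) ts"])
  also have "\<dots> = (\<Sum>c\<in>free_cycles V \<tau>. real (fst \<tau>) *
      cycle_product ((\<lambda>\<sigma>. card (free_cycles V \<sigma>))(\<tau> := card (free_cycles V \<tau>) - 1)) ts)"
  proof (intro sum.cong refl arg_cong2[where f = "(*)"])
    fix c assume c: "c \<in> free_cycles V \<tau>"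
    then have "saturated (V \<union> c)"
      using saturated_Un_cycle[OF Cons.prems(1)] unfolding free_cycles_def by blast
    then have "cycle_sum A n (V \<union> c) ts = cycle_product (\<lambda>\<sigma>. card (free_cycles (V \<union> c) \<sigma>)) ts"
      by (rule Cons.IH) (use Cons.prems in simp)
    also have "(\<lambda>\<sigma>. card (free_cycles (V \<union> c) \<sigma>)) = (\<lambda>\<sigma>. card (free_cycles V \<sigma>))(\<tau> := card (free_cycles V \<tau>) - 1)"
      by (rule ext) (simp add: card_free_cycles_Un[OF c q])
    finally show "cycle_sum A n (V \<union> c) ts =
      cycle_product ((\<lambda>\<sigma>. card (free_cycles V \<sigma>))(\<tau> := card (free_cycles V \<tau>) - 1)) ts" .
  qed
  finally show ?case by simp
qed simp

lemma cycle_sum_eq: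
  assumes "finite Q" "set ts \<subseteq> Q" "\<And>\<tau>. \<tau> \<in> Q \<Longrightarrow> fst \<tau> > 0"
  shows "cycle_sum A n {} ts =
    (\<Prod>\<tau>\<in>Q. real (fst \<tau>) ^ count_list ts \<tau> * fact (count_list ts \<tau>) * real (card (cycles \<tau>) choose count_list ts \<tau>))"
proof -
  have sat: "saturated {}" by (simp add: saturated_def)
  have fc: "free_cycles {} = cycles" by (simp add: free_cycles_def fun_eq_iff)
  have "\<And>\<tau>. \<tau> \<in> set ts \<Longrightarrow> 0 < fst \<tau>" using assms(2,3) by blast
  from cycle_sum_eq_product[OF sat this] show ?thesis
    by (simp only: cycle_product_eq[OF assms(1,2)] fc)
qed

end

subsection \<open>Cycle counts of the rounded matrix\<close>

text \<open>Truncated subtraction keeps the product formula valid when fewer than \<open>q\<close>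
  points remain: one factor is then 0.\<close>

lemma card_avoiding_lists:
  assumes "V \<subseteq> {..<n}"
  shows "card (avoiding_lists n q V) = (\<Prod>i<q. n - card V - i)"
proof -
  let ?m = "n - card V"
  have fin: "finite ({..<n} - V)" by simp
  have c: "card ({..<n} - V) = ?m" using assms by (subst card_Diff_subset) (auto dest: finite_subset)
  show ?thesis
  proof (cases "q \<le> ?m")
    case True
    have "card (avoiding_lists n q V) = \<Prod>{?m - q + 1..?m}"
      unfolding avoiding_lists_def using card_lists_distinct_length_eq[OF fin, of q] True c by simp
    also have "\<dots> = (\<Prod>i<q. ?m - i)"
      by (rule prod.reindex_bij_witness[of _ "\<lambda>i. ?m - i" "\<lambda>i. ?m - i"]) (use True in auto)
    finally show ?thesis .
  next
    case False
    have "avoiding_lists n q V = {}"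
    proof (rule ccontr)
      assume "avoiding_lists n q V \<noteq> {}"
      then obtain b where b: "length b = q" "distinct b" "set b \<subseteq> {..<n} - V" by (auto simp: avoiding_lists_def)
      then have "q \<le> ?m" using card_mono[OF fin b(3)] distinct_card[OF b(2)] c by simp
      with False show False by simp
    qed
    moreover have "(\<Prod>i<q. ?m - i) = 0" using False by (intro prod_zero) (auto intro!: bexI[of _ ?m])
    ultimately show ?thesis by simp
  qed
qed

lemma next_in_mem:
  assumes "i \<in> set b"
  shows "next_in b i \<in> set b"
proof -
  have "length b > 0" using assms by (cases b) auto
  then show ?thesis unfolding next_in_def by (intro nth_mem) simp
qed

fun cycle_mean :: "real \<Rightarrow> nat \<Rightarrow> (nat \<times> bool) list \<Rightarrow> real" where
  "cycle_mean p m [] = 1"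
| "cycle_mean p m (\<tau> # ts) = real (\<Prod>i<fst \<tau>. m - i) * (p ^ fst \<tau> / 2) * cycle_mean p (m - fst \<tau>) ts"

lemma prod_diff_add: "(\<Prod>i<a + b. (m::nat) - i) = (\<Prod>i<a. m - i) * (\<Prod>i<b. m - a - i)"
proof (induction b)
  case (Suc b)
  then show ?case by (simp add: diff_diff_left)
qed simp

lemma cycle_mean_eq:
  "cycle_mean p m ts = real (\<Prod>i<sum_list (map fst ts). m - i) * p ^ sum_list (map fst ts) / 2 ^ length ts"
proof (induction ts arbitrary: m)
  case (Cons \<tau> ts)
  then show ?case by (simp only: cycle_mean.simps list.map sum_list.Cons prod_diff_add list.size power_add of_nat_mult) (simp add: field_simps)
qed simp

context row_array
begin

definition peak_matrix :: "nat \<Rightarrow> 'a \<Rightarrow> nat \<Rightarrow> nat \<Rightarrow> real" where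
  "peak_matrix n \<omega> i j = peak_entry n j (row_vec X n i \<omega>)"

lemma signed_partial_map_peak: "signed_partial_map n (peak_matrix n \<omega>)"
  by unfold_locales (auto simp: peak_matrix_def peak_entry_cases[simplified] dest: peak_entry_unique)

definition cycle_count :: "nat \<Rightarrow> nat \<times> bool \<Rightarrow> 'a \<Rightarrow> nat" where
  "cycle_count n \<tau> \<omega> = card (signed_partial_map.cycles n (peak_matrix n \<omega>) \<tau>)"

text \<open>The remaining sum does not read the rows in \<open>V\<close>, so bounded functions
  \<open>h\<close> of rows in \<open>I \<subseteq> V\<close> can be carried along as independent
  factors. The induction needs this generality: the indicator of the first list is absorbed into
  \<open>h\<close>.\<close>

lemma expectation_cycle_sum:
  assumes n: "n > 0" and V: "V \<subseteq> {..<n}" "I \<subseteq> V" and ts: "\<And>\<tau>. \<tau> \<in> set ts \<Longrightarrow> fst \<tau> > 0"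
    and h: "\<And>i. i \<in> I \<Longrightarrow> h i \<in> borel_measurable (\<Pi>\<^sub>M j\<in>{..<n}. borel)" "\<And>i x. i \<in> I \<Longrightarrow> \<bar>h i x\<bar> \<le> 1"
  shows "integrable M (\<lambda>\<omega>. (\<Prod>i\<in>I. h i (row_vec X n i \<omega>)) * cycle_sum (peak_matrix n \<omega>) n V ts) \<and>
    (\<integral>\<omega>. (\<Prod>i\<in>I. h i (row_vec X n i \<omega>)) * cycle_sum (peak_matrix n \<omega>) n V ts \<partial>M) =
      (\<Prod>i\<in>I. \<integral>x. h i x \<partial>row_law n) * cycle_mean (peak_prob n / real n) (n - card V) ts"
  using V ts h
proof (induction ts arbitrary: V I h)
  case Nil
  have I: "finite I" using Nil by (meson finite_lessThan finite_subset)
  show ?case using integral_prod_rows[OF n I Nil.prems(4,5)] by simp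
next
  case (Cons \<tau> ts)
  let ?q = "fst \<tau>" and ?B = "avoiding_lists n (fst \<tau>) V" and ?p = "peak_prob n / real n"
  let ?row = "\<lambda>i \<omega>. row_vec X n i \<omega>"
  let ?H = "\<Prod>i\<in>I. \<integral>x. h i x \<partial>row_law n"
  have I: "finite I" and finV: "finite V" using Cons.prems by (meson finite_lessThan finite_subset)+
  have q: "?q > 0" using Cons.prems by simp
  \<comment> \<open>\<open>h1\<close> and \<open>h2\<close> extend \<open>h\<close> to the rows of
    \<open>b\<close>, one for each of the two summands of \<open>cycle_indicator\<close>.\<close>
  define h1 where "h1 = (\<lambda>b i x. if i \<in> I then h i x else (peak_entry n (next_in b i) x)\<^sup>2)"
  define h2 where "h2 = (\<lambda>b i x. if i \<in> I then h i x else peak_entry n (next_in b i) x)"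
  have step: "integrable M (\<lambda>\<omega>. (\<Prod>i\<in>I. h i (?row i \<omega>)) * (cycle_indicator (peak_matrix n \<omega>) (snd \<tau>) b * cycle_sum (peak_matrix n \<omega>) n (V \<union> set b) ts)) \<and>
    (\<integral>\<omega>. (\<Prod>i\<in>I. h i (?row i \<omega>)) * (cycle_indicator (peak_matrix n \<omega>) (snd \<tau>) b * cycle_sum (peak_matrix n \<omega>) n (V \<union> set b) ts) \<partial>M) =
      ?H * (?p ^ ?q / 2) * cycle_mean ?p (n - card V - ?q) ts" if b: "b \<in> ?B" for b
  proof -
    have B: "length b = ?q" "distinct b" "set b \<subseteq> {..<n}" "set b \<inter> V = {}" using b by (auto simp: avoiding_lists_def)
    have disj: "I \<inter> set b = {}" using B(4) Cons.prems(2) by blast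
    have nx: "next_in b i < n" if "i \<in> set b" for i using next_in_mem[OF that] B(3) by blast
    have cardV: "n - card (V \<union> set b) = n - card V - ?q"
      using B(1,2,4) finV by (subst card_Un_disjoint) (auto simp: distinct_card)
    have prem: "V \<union> set b \<subseteq> {..<n}" "I \<union> set b \<subseteq> V \<union> set b" "\<And>\<sigma>. \<sigma> \<in> set ts \<Longrightarrow> fst \<sigma> > 0"
      using Cons.prems B(3) by auto
    have m1: "h1 b i \<in> borel_measurable (\<Pi>\<^sub>M j\<in>{..<n}. borel)" and m2: "h2 b i \<in> borel_measurable (\<Pi>\<^sub>M j\<in>{..<n}. borel)"
      if "i \<in> I \<union> set b" for i
      using that nx[of i] Cons.prems(4)[of i] by (cases "i \<in> I"; simp add: h1_def h2_def)+
    have b1: "\<bar>h1 b i x\<bar> \<le> 1" and b2: "\<bar>h2 b i x\<bar> \<le> 1" if "i \<in> I \<union> set b" for i x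
      using Cons.prems(5)[of i x] abs_peak_entry_le_1[of n "next_in b i" x]
      by (auto simp: h1_def h2_def abs_square_le_1)
    have IH1: "integrable M (\<lambda>\<omega>. (\<Prod>i\<in>I \<union> set b. h1 b i (?row i \<omega>)) * cycle_sum (peak_matrix n \<omega>) n (V \<union> set b) ts) \<and>
      (\<integral>\<omega>. (\<Prod>i\<in>I \<union> set b. h1 b i (?row i \<omega>)) * cycle_sum (peak_matrix n \<omega>) n (V \<union> set b) ts \<partial>M) =
        (\<Prod>i\<in>I \<union> set b. \<integral>x. h1 b i x \<partial>row_law n) * cycle_mean ?p (n - card (V \<union> set b)) ts"
      by (rule Cons.IH[OF prem(1,2)]) (use prem(3) m1 b1 in blast)+
    have IH2: "integrable M (\<lambda>\<omega>. (\<Prod>i\<in>I \<union> set b. h2 b i (?row i \<omega>)) * cycle_sum (peak_matrix n \<omega>) n (V \<union> set b) ts) \<and>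
      (\<integral>\<omega>. (\<Prod>i\<in>I \<union> set b. h2 b i (?row i \<omega>)) * cycle_sum (peak_matrix n \<omega>) n (V \<union> set b) ts \<partial>M) =
        (\<Prod>i\<in>I \<union> set b. \<integral>x. h2 b i x \<partial>row_law n) * cycle_mean ?p (n - card (V \<union> set b)) ts"
      by (rule Cons.IH[OF prem(1,2)]) (use prem(3) m2 b2 in blast)+
    have P1: "(\<Prod>i\<in>I \<union> set b. f (h1 b i) i) = (\<Prod>i\<in>I. f (h i) i) * (\<Prod>i\<in>set b. f (\<lambda>x. (peak_entry n (next_in b i) x)\<^sup>2) i)"
      and P2: "(\<Prod>i\<in>I \<union> set b. f (h2 b i) i) = (\<Prod>i\<in>I. f (h i) i) * (\<Prod>i\<in>set b. f (peak_entry n (next_in b i)) i)"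
      for f :: "((nat \<Rightarrow> real) \<Rightarrow> real) \<Rightarrow> nat \<Rightarrow> real"
    proof -
      have *: "i \<in> set b \<Longrightarrow> i \<notin> I" for i using disj by blast
      show "(\<Prod>i\<in>I \<union> set b. f (h1 b i) i) = (\<Prod>i\<in>I. f (h i) i) * (\<Prod>i\<in>set b. f (\<lambda>x. (peak_entry n (next_in b i) x)\<^sup>2) i)"
        using disj I * by (subst prod.union_disjoint) (auto simp: h1_def intro!: arg_cong2[where f="(*)"] prod.cong)
      show "(\<Prod>i\<in>I \<union> set b. f (h2 b i) i) = (\<Prod>i\<in>I. f (h i) i) * (\<Prod>i\<in>set b. f (peak_entry n (next_in b i)) i)"
        using disj I * by (subst prod.union_disjoint) (auto simp: h2_def intro!: arg_cong2[where f="(*)"] prod.cong)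
    qed
    have eq: "(\<Prod>i\<in>I. h i (?row i \<omega>)) * (cycle_indicator (peak_matrix n \<omega>) (snd \<tau>) b * cycle_sum (peak_matrix n \<omega>) n (V \<union> set b) ts) =
      1/2 * ((\<Prod>i\<in>I \<union> set b. h1 b i (?row i \<omega>)) * cycle_sum (peak_matrix n \<omega>) n (V \<union> set b) ts) +
      sgn_of (snd \<tau>) / 2 * ((\<Prod>i\<in>I \<union> set b. h2 b i (?row i \<omega>)) * cycle_sum (peak_matrix n \<omega>) n (V \<union> set b) ts)" for \<omega>
      unfolding P1[of "\<lambda>g i. g (?row i \<omega>)"] P2[of "\<lambda>g i. g (?row i \<omega>)"]
      by (simp add: cycle_indicator_def peak_matrix_def field_simps)
    have e1: "(\<Prod>i\<in>set b. \<integral>x. (peak_entry n (next_in b i) x)\<^sup>2 \<partial>row_law n) = ?p ^ ?q"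
      using nx B(1,2) by (simp add: row_peak_entry_sq distinct_card)
    \<comment> \<open>Rounded entries are odd in one coordinate and have mean 0, so only half of the
      squared product survives.\<close>
    have e2: "(\<Prod>i\<in>set b. \<integral>x. peak_entry n (next_in b i) x \<partial>row_law n) = 0"
    proof (rule prod_zero)
      have i: "b ! 0 \<in> set b" using B(1) q by simp
      have "(\<integral>x. peak_entry n (next_in b (b ! 0)) x \<partial>row_law n) = 0"
        by (rule row_integral_odd[OF nx[OF i]]) (use odd_entryD[OF odd_entry_peak nx[OF i]] nx[OF i] in auto)
      then show "\<exists>i\<in>set b. (\<integral>x. peak_entry n (next_in b i) x \<partial>row_law n) = 0" using i by blast
    qed simp
    have v1: "(\<integral>\<omega>. (\<Prod>i\<in>I \<union> set b. h1 b i (?row i \<omega>)) * cycle_sum (peak_matrix n \<omega>) n (V \<union> set b) ts \<partial>M) =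
        ?H * ?p ^ ?q * cycle_mean ?p (n - card V - ?q) ts"
    proof -
      have "(\<Prod>i\<in>I \<union> set b. \<integral>x. h1 b i x \<partial>row_law n) = ?H * (\<Prod>i\<in>set b. \<integral>x. (peak_entry n (next_in b i) x)\<^sup>2 \<partial>row_law n)"
        by (rule P1)
      then have p: "(\<Prod>i\<in>I \<union> set b. \<integral>x. h1 b i x \<partial>row_law n) = ?H * ?p ^ ?q" by (rule trans) (rule arg_cong[OF e1])
      show ?thesis by (rule trans[OF conjunct2[OF IH1]]) (rule arg_cong2[where f = "(*)", OF p arg_cong[OF cardV]])
    qed
    have v2: "(\<integral>\<omega>. (\<Prod>i\<in>I \<union> set b. h2 b i (?row i \<omega>)) * cycle_sum (peak_matrix n \<omega>) n (V \<union> set b) ts \<partial>M) = 0"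
    proof -
      have "(\<Prod>i\<in>I \<union> set b. \<integral>x. h2 b i x \<partial>row_law n) = ?H * (\<Prod>i\<in>set b. \<integral>x. peak_entry n (next_in b i) x \<partial>row_law n)"
        by (rule P2)
      then have p: "(\<Prod>i\<in>I \<union> set b. \<integral>x. h2 b i x \<partial>row_law n) = 0" using e2 by simp
      show ?thesis by (rule trans[OF conjunct2[OF IH2]]) (use p in simp)
    qed
    show ?thesis
      unfolding eq
      by (rule conjI, intro Bochner_Integration.integrable_add integrable_mult_right conjunct1[OF IH1] conjunct1[OF IH2])
        (subst Bochner_Integration.integral_add, intro integrable_mult_right conjunct1[OF IH1],
          intro integrable_mult_right conjunct1[OF IH2], simp add: v1 v2)
  qed
  have eq: "(\<Prod>i\<in>I. h i (?row i \<omega>)) * cycle_sum (peak_matrix n \<omega>) n V (\<tau> # ts) =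
    (\<Sum>b\<in>?B. (\<Prod>i\<in>I. h i (?row i \<omega>)) * (cycle_indicator (peak_matrix n \<omega>) (snd \<tau>) b * cycle_sum (peak_matrix n \<omega>) n (V \<union> set b) ts))" for \<omega>
    by (simp add: sum_distrib_left)
  have "(\<integral>\<omega>. (\<Prod>i\<in>I. h i (?row i \<omega>)) * cycle_sum (peak_matrix n \<omega>) n V (\<tau> # ts) \<partial>M) =
    (\<Sum>b\<in>?B. \<integral>\<omega>. (\<Prod>i\<in>I. h i (?row i \<omega>)) * (cycle_indicator (peak_matrix n \<omega>) (snd \<tau>) b * cycle_sum (peak_matrix n \<omega>) n (V \<union> set b) ts) \<partial>M)"
    unfolding eq using step by (intro Bochner_Integration.integral_sum) blast
  also have "\<dots> = (\<Sum>b\<in>?B. ?H * (?p ^ ?q / 2) * cycle_mean ?p (n - card V - ?q) ts)"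
    using step by (intro sum.cong refl) blast
  also have "\<dots> = ?H * cycle_mean ?p (n - card V) (\<tau> # ts)"
    using card_avoiding_lists[OF Cons.prems(1), of ?q] by simp
  finally have E: "(\<integral>\<omega>. (\<Prod>i\<in>I. h i (?row i \<omega>)) * cycle_sum (peak_matrix n \<omega>) n V (\<tau> # ts) \<partial>M) =
    ?H * cycle_mean ?p (n - card V) (\<tau> # ts)" .
  have "integrable M (\<lambda>\<omega>. (\<Prod>i\<in>I. h i (?row i \<omega>)) * cycle_sum (peak_matrix n \<omega>) n V (\<tau> # ts))"
    unfolding eq using step by (intro Bochner_Integration.integrable_sum) blast
  with E show ?case by blast
qed

lemma expectation_cycle_sum_empty:
  assumes n: "n > 0" and ts: "\<forall>\<tau>\<in>set ts. fst \<tau> > 0"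
  shows "integrable M (\<lambda>\<omega>. cycle_sum (peak_matrix n \<omega>) n {} ts)"
    and "(\<integral>\<omega>. cycle_sum (peak_matrix n \<omega>) n {} ts \<partial>M) =
      real (\<Prod>i<sum_list (map fst ts). n - i) / real n ^ sum_list (map fst ts) * peak_prob n ^ sum_list (map fst ts) / 2 ^ length ts"
  using expectation_cycle_sum[OF n, of "{}" "{}" ts] ts
  by (auto simp: cycle_mean_eq power_divide)

lemma cycle_sum_count:
  assumes "finite Q" "set ts \<subseteq> Q" "\<forall>\<tau>\<in>Q. fst \<tau> > 0"
  shows "cycle_sum (peak_matrix n \<omega>) n {} ts =
    (\<Prod>\<tau>\<in>Q. real (fst \<tau>) ^ count_list ts \<tau> * fact (count_list ts \<tau>) * real (cycle_count n \<tau> \<omega> choose count_list ts \<tau>))"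
  unfolding cycle_count_def
  by (rule signed_partial_map.cycle_sum_eq[OF signed_partial_map_peak assms(1,2)]) (use assms(3) in blast)

lemma cycle_count_le: "cycle_count n \<tau> \<omega> \<le> n"
  unfolding cycle_count_def by (rule signed_partial_map.card_cycles_le[OF signed_partial_map_peak])

section \<open>Binomial moments and generating functions of the cycle counts\<close>

definition falling_ratio :: "nat \<Rightarrow> nat \<Rightarrow> real" where
  "falling_ratio n N = (\<Prod>i<N. real (n - i) / real n * peak_prob n)"

lemma peak_prob_nonneg: "0 \<le> peak_prob n"
  using peak_corr_nonneg[of n] peak_corr_le_prob[of n] by linarith

lemma falling_ratio_eq: "falling_ratio n N = real (\<Prod>i<N. n - i) / real n ^ N * peak_prob n ^ N"
  by (simp add: falling_ratio_def prod.distrib prod_dividef)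

lemma one_minus_prod_le:
  fixes x :: "nat \<Rightarrow> real"
  assumes "\<And>i. i < N \<Longrightarrow> 0 \<le> x i" "\<And>i. i < N \<Longrightarrow> x i \<le> 1"
  shows "1 - (\<Prod>i<N. x i) \<le> (\<Sum>i<N. 1 - x i)"
  using assms
proof (induction N)
  case (Suc N)
  have p: "0 \<le> (\<Prod>i<N. x i)" "(\<Prod>i<N. x i) \<le> 1" using Suc.prems by (auto intro!: prod_nonneg prod_le_1)
  have "1 - (\<Prod>i<Suc N. x i) = 1 - (\<Prod>i<N. x i) + (\<Prod>i<N. x i) * (1 - x N)" by (simp add: algebra_simps)
  also have "\<dots> \<le> (\<Sum>i<N. 1 - x i) + 1 * (1 - x N)"
    using Suc p by (intro add_mono mult_right_mono) auto
  finally show ?case by simp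
qed simp

text \<open>The error is polynomial in \<open>N\<close>. It is weakened to \<open>4 ^ N\<close>
  because an exponential factorizes over the cycle types and can then be absorbed by exponential
  series in \<open>pgf_tendsto\<close>.\<close>

lemma falling_ratio_bounds:
  assumes n: "n > 0"
  shows "0 \<le> falling_ratio n N" "falling_ratio n N \<le> 1"
    "1 - falling_ratio n N \<le> 4 ^ N * (1 / real n + (1 - peak_prob n))"
proof -
  have f: "0 \<le> real (n - i) / real n * peak_prob n" "real (n - i) / real n * peak_prob n \<le> 1" for i
  proof -
    have "real (n - i) / real n \<le> 1" using n by simp
    then show "real (n - i) / real n * peak_prob n \<le> 1"
      by (rule mult_le_one) (use peak_prob_le_1 peak_prob_nonneg in auto)
  qed (simp add: peak_prob_nonneg)
  then show "0 \<le> falling_ratio n N" "falling_ratio n N \<le> 1"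
    unfolding falling_ratio_def by (auto intro!: prod_nonneg prod_le_1)
  have "1 - falling_ratio n N \<le> (\<Sum>i<N. 1 - real (n - i) / real n * peak_prob n)"
    unfolding falling_ratio_def using f by (intro one_minus_prod_le) auto
  also have "\<dots> \<le> (\<Sum>i<N. real N / real n + (1 - peak_prob n))"
  proof (rule sum_mono)
    fix i assume "i \<in> {..<N}"
    have "(real n - real i) / real n * peak_prob n \<le> real (n - i) / real n * peak_prob n"
      using n peak_prob_nonneg[of n] by (intro mult_right_mono divide_right_mono) auto
    moreover have "(real n - real i) / real n * peak_prob n = peak_prob n - real i / real n * peak_prob n"
      using n by (simp add: diff_divide_distrib algebra_simps)
    moreover have "real i / real n * peak_prob n \<le> real N / real n * 1"
      using \<open>i \<in> {..<N}\<close> n peak_prob_le_1[of n] peak_prob_nonneg[of n]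
      by (intro mult_mono divide_right_mono) auto
    ultimately show "1 - real (n - i) / real n * peak_prob n \<le> real N / real n + (1 - peak_prob n)" by linarith
  qed
  also have "\<dots> = real N * real N * (1 / real n) + real N * (1 - peak_prob n)"
    by (simp add: algebra_simps)
  also have "\<dots> \<le> 4 ^ N * (1 / real n) + 4 ^ N * (1 - peak_prob n)"
  proof -
    have a: "real N \<le> 2 ^ N" by (rule less_imp_le[OF of_nat_less_two_power])
    then have "real N * real N \<le> 2 ^ N * 2 ^ N" by (intro mult_mono) auto
    then have "real N * real N \<le> 4 ^ N" by (simp add: power_mult_distrib[symmetric])
    moreover have "real N \<le> 4 ^ N" using a power_mono[of 2 "4::real" N] by linarith
    ultimately show ?thesis using n peak_prob_le_1[of n] by (intro add_mono mult_right_mono) auto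
  qed
  finally show "1 - falling_ratio n N \<le> 4 ^ N * (1 / real n + (1 - peak_prob n))"
    by (simp add: distrib_left)
qed

end

lemma ex_list_count:
  assumes "finite Q"
  shows "\<exists>ts. set ts \<subseteq> Q \<and> (\<forall>\<tau>\<in>Q. count_list ts \<tau> = r \<tau>)"
  using assms
proof (induction Q rule: finite_induct)
  case (insert x Q)
  then obtain ts where ts: "set ts \<subseteq> Q" "\<forall>\<tau>\<in>Q. count_list ts \<tau> = r \<tau>" by blast
  have rep: "count_list (replicate m x) y = (if x = y then m else 0)" for m y by (induction m) auto
  have "count_list ts x = 0" using ts(1) insert(2) by (auto simp: count_list_0_iff)
  then show ?case using ts insert(2)
    by (intro exI[of _ "replicate (r x) x @ ts"]) (auto simp: rep)
qed simp

context row_array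
begin

text \<open>Dividing the mean of \<open>cycle_sum\<close> by \<open>q ^ r * fact r\<close> for each
  type leaves the joint binomial moments of independent Poisson variables with means
  \<open>1 / (2 * q)\<close>, up to the factor \<open>falling_ratio\<close>.\<close>

lemma expectation_binomials:
  assumes n: "n > 0" and Q: "finite Q" "\<forall>\<tau>\<in>Q. fst \<tau> > 0"
  shows "integrable M (\<lambda>\<omega>. \<Prod>\<tau>\<in>Q. real (cycle_count n \<tau> \<omega> choose r \<tau>))"
    and "(\<integral>\<omega>. (\<Prod>\<tau>\<in>Q. real (cycle_count n \<tau> \<omega> choose r \<tau>)) \<partial>M) =
      (\<Prod>\<tau>\<in>Q. (1 / (2 * real (fst \<tau>))) ^ r \<tau> / fact (r \<tau>)) * falling_ratio n (\<Sum>\<tau>\<in>Q. fst \<tau> * r \<tau>)"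
proof -
  obtain ts where ts: "set ts \<subseteq> Q" "\<forall>\<tau>\<in>Q. count_list ts \<tau> = r \<tau>" using ex_list_count[OF Q(1)] by blast
  define c where "c = (\<Prod>\<tau>\<in>Q. real (fst \<tau>) ^ r \<tau> * fact (r \<tau>))"
  have c: "c \<noteq> 0" using Q by (auto simp: c_def)
  have S: "cycle_sum (peak_matrix n \<omega>) n {} ts = c * (\<Prod>\<tau>\<in>Q. real (cycle_count n \<tau> \<omega> choose r \<tau>))" for \<omega>
  proof -
    have "cycle_sum (peak_matrix n \<omega>) n {} ts =
      (\<Prod>\<tau>\<in>Q. real (fst \<tau>) ^ r \<tau> * fact (r \<tau>) * real (cycle_count n \<tau> \<omega> choose r \<tau>))"
      unfolding cycle_sum_count[OF Q(1) ts(1) Q(2)] using ts(2) by (intro prod.cong) auto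
    then show ?thesis unfolding c_def by (simp only: prod.distrib)
  qed
  have N: "sum_list (map fst ts) = (\<Sum>\<tau>\<in>Q. fst \<tau> * r \<tau>)"
    unfolding sum_list_map_eq_sum_count2[OF ts(1) Q(1)] using ts(2) by (intro sum.cong) (auto simp: mult.commute)
  have L: "length ts = (\<Sum>\<tau>\<in>Q. r \<tau>)"
    using sum_list_map_eq_sum_count2[OF ts(1) Q(1), of "\<lambda>_. 1::nat"] ts(2) by (simp add: sum_list_triv)
  have tp: "\<forall>\<tau>\<in>set ts. fst \<tau> > 0" using ts(1) Q(2) by blast
  show "integrable M (\<lambda>\<omega>. \<Prod>\<tau>\<in>Q. real (cycle_count n \<tau> \<omega> choose r \<tau>))"
    using expectation_cycle_sum_empty(1)[OF n tp] c unfolding S by simp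
  have cE: "c * (\<integral>\<omega>. (\<Prod>\<tau>\<in>Q. real (cycle_count n \<tau> \<omega> choose r \<tau>)) \<partial>M) = falling_ratio n (\<Sum>\<tau>\<in>Q. fst \<tau> * r \<tau>) / 2 ^ (\<Sum>\<tau>\<in>Q. r \<tau>)"
    using expectation_cycle_sum_empty(2)[OF n tp] unfolding S N L falling_ratio_eq by simp
  have Peq: "(\<Prod>\<tau>\<in>Q. (1 / (2 * real (fst \<tau>))) ^ r \<tau> / fact (r \<tau>)) = 1 / (c * 2 ^ (\<Sum>\<tau>\<in>Q. r \<tau>))"
    unfolding c_def power_sum by (simp add: power_divide power_mult_distrib prod_dividef prod.distrib mult_ac)
  have "(\<integral>\<omega>. (\<Prod>\<tau>\<in>Q. real (cycle_count n \<tau> \<omega> choose r \<tau>)) \<partial>M) =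
      falling_ratio n (\<Sum>\<tau>\<in>Q. fst \<tau> * r \<tau>) / 2 ^ (\<Sum>\<tau>\<in>Q. r \<tau>) / c"
    using c cE by (subst eq_divide_eq) (simp only: mult.commute not_False_eq_True if_True)
  also have "\<dots> = 1 / (c * 2 ^ (\<Sum>\<tau>\<in>Q. r \<tau>)) * falling_ratio n (\<Sum>\<tau>\<in>Q. fst \<tau> * r \<tau>)"
    by simp
  finally show "(\<integral>\<omega>. (\<Prod>\<tau>\<in>Q. real (cycle_count n \<tau> \<omega> choose r \<tau>)) \<partial>M) =
      (\<Prod>\<tau>\<in>Q. (1 / (2 * real (fst \<tau>))) ^ r \<tau> / fact (r \<tau>)) * falling_ratio n (\<Sum>\<tau>\<in>Q. fst \<tau> * r \<tau>)"
    unfolding Peq .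
qed

lemma expectation_cycle_count:
  assumes n: "n > 0" and q: "fst \<tau> > 0"
  shows "integrable M (\<lambda>\<omega>. real (cycle_count n \<tau> \<omega>))"
    and "(\<integral>\<omega>. real (cycle_count n \<tau> \<omega>) \<partial>M) \<le> 1 / (2 * real (fst \<tau>))"
proof -
  have *: "\<forall>\<sigma>\<in>{\<tau>}. fst \<sigma> > 0" using q by simp
  show "integrable M (\<lambda>\<omega>. real (cycle_count n \<tau> \<omega>))"
    using expectation_binomials(1)[OF n _ *, where r = "\<lambda>_. 1"] by simp
  have "1 / (2 * real (fst \<tau>)) * falling_ratio n (fst \<tau>) \<le> 1 / (2 * real (fst \<tau>)) * 1"
    by (intro mult_left_mono falling_ratio_bounds n) simp
  then show "(\<integral>\<omega>. real (cycle_count n \<tau> \<omega>) \<partial>M) \<le> 1 / (2 * real (fst \<tau>))"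
    using expectation_binomials(2)[OF n _ *, where r = "\<lambda>_. 1"] by simp
qed

text \<open>The binomial expansion of \<open>(1 + t) ^ count\<close> turns binomial moments into
  generating functions. A count is at most \<open>n\<close>, so the sums are finite.\<close>

lemma pgf_finite:
  assumes n: "n > 0" and Q: "finite Q" "\<forall>\<tau>\<in>Q. fst \<tau> > 0"
  shows "(\<integral>\<omega>. (\<Prod>\<tau>\<in>Q. (1 + t \<tau>) ^ cycle_count n \<tau> \<omega>) \<partial>M) =
    (\<Sum>r\<in>PiE Q (\<lambda>_. {..n}). (\<Prod>\<tau>\<in>Q. (t \<tau> / (2 * real (fst \<tau>))) ^ r \<tau> / fact (r \<tau>)) * falling_ratio n (\<Sum>\<tau>\<in>Q. fst \<tau> * r \<tau>))"
proof -
  have b: "(1 + t \<tau>) ^ cycle_count n \<tau> \<omega> = (\<Sum>r\<le>n. t \<tau> ^ r * real (cycle_count n \<tau> \<omega> choose r))" for \<tau> \<omega>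
  proof -
    have "(1 + t \<tau>) ^ cycle_count n \<tau> \<omega> = (\<Sum>r\<le>cycle_count n \<tau> \<omega>. t \<tau> ^ r * real (cycle_count n \<tau> \<omega> choose r))"
      using binomial_ring[of "t \<tau>" 1 "cycle_count n \<tau> \<omega>"] by (simp add: add.commute mult.commute)
    also have "\<dots> = (\<Sum>r\<le>n. t \<tau> ^ r * real (cycle_count n \<tau> \<omega> choose r))"
      using cycle_count_le[of n \<tau> \<omega>] by (intro sum.mono_neutral_left) (auto simp: binomial_eq_0)
    finally show ?thesis .
  qed
  have e: "(\<Prod>\<tau>\<in>Q. (1 + t \<tau>) ^ cycle_count n \<tau> \<omega>) =
    (\<Sum>r\<in>PiE Q (\<lambda>_. {..n}). (\<Prod>\<tau>\<in>Q. t \<tau> ^ r \<tau>) * (\<Prod>\<tau>\<in>Q. real (cycle_count n \<tau> \<omega> choose r \<tau>)))" for \<omega>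
    unfolding b using Q(1) by (subst prod_sum_PiE) (auto simp: prod.distrib)
  have "(\<integral>\<omega>. (\<Prod>\<tau>\<in>Q. (1 + t \<tau>) ^ cycle_count n \<tau> \<omega>) \<partial>M) =
    (\<Sum>r\<in>PiE Q (\<lambda>_. {..n}). (\<Prod>\<tau>\<in>Q. t \<tau> ^ r \<tau>) * (\<integral>\<omega>. (\<Prod>\<tau>\<in>Q. real (cycle_count n \<tau> \<omega> choose r \<tau>)) \<partial>M))"
    unfolding e using expectation_binomials(1)[OF n Q]
    by (subst Bochner_Integration.integral_sum) auto
  also have "\<dots> = (\<Sum>r\<in>PiE Q (\<lambda>_. {..n}). (\<Prod>\<tau>\<in>Q. (t \<tau> / (2 * real (fst \<tau>))) ^ r \<tau> / fact (r \<tau>)) * falling_ratio n (\<Sum>\<tau>\<in>Q. fst \<tau> * r \<tau>))"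
  proof (rule sum.cong[OF refl])
    fix r
    show "(\<Prod>\<tau>\<in>Q. t \<tau> ^ r \<tau>) * (\<integral>\<omega>. (\<Prod>\<tau>\<in>Q. real (cycle_count n \<tau> \<omega> choose r \<tau>)) \<partial>M) =
      (\<Prod>\<tau>\<in>Q. (t \<tau> / (2 * real (fst \<tau>))) ^ r \<tau> / fact (r \<tau>)) * falling_ratio n (\<Sum>\<tau>\<in>Q. fst \<tau> * r \<tau>)"
      unfolding expectation_binomials(2)[OF n Q, where r = r] mult.assoc[symmetric] prod.distrib[symmetric]
      by (intro arg_cong2[where f = "(*)"] prod.cong refl) (simp add: power_divide)
  qed
  finally show ?thesis .
qed

text \<open>Without \<open>falling_ratio\<close> the sum is a product of partial exponential series.
  The correction is dominated by a product of exponentials with enlarged arguments times the null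
  sequence \<open>d\<close>.\<close>

lemma pgf_tendsto:
  assumes Q: "finite Q" "\<forall>\<tau>\<in>Q. fst \<tau> > 0"
  shows "(\<lambda>n. \<integral>\<omega>. (\<Prod>\<tau>\<in>Q. (1 + t \<tau>) ^ cycle_count n \<tau> \<omega>) \<partial>M) \<longlonglongrightarrow> (\<Prod>\<tau>\<in>Q. exp (t \<tau> / (2 * real (fst \<tau>))))"
proof -
  define u where "u = (\<lambda>\<tau>::nat \<times> bool. t \<tau> / (2 * real (fst \<tau>)))"
  \<comment> \<open>The factor \<open>4 ^ fst \<tau>\<close> takes up the exponential bound of
    \<open>falling_ratio_bounds\<close>.\<close>
  define w where "w = (\<lambda>\<tau>::nat \<times> bool. 4 ^ fst \<tau> * \<bar>u \<tau>\<bar>)"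
  define d where "d = (\<lambda>n. 1 / real n + (1 - peak_prob n))"
  have partial: "(\<Sum>r\<in>PiE Q (\<lambda>_. {..n}). \<Prod>\<tau>\<in>Q. v \<tau> ^ r \<tau> / fact (r \<tau>)) = (\<Prod>\<tau>\<in>Q. \<Sum>r\<le>n. v \<tau> ^ r / fact r)"
    for n and v :: "nat \<times> bool \<Rightarrow> real"
    using Q(1) by (subst prod_sum_PiE) auto
  have sums: "(\<lambda>n. \<Sum>r\<le>n. v ^ r / fact r) \<longlonglongrightarrow> exp v" for v :: real
    using exp_converges[of v] unfolding sums_def_le by (simp add: scaleR_conv_of_real divide_inverse mult.commute)
  have main: "(\<lambda>n. \<Sum>r\<in>PiE Q (\<lambda>_. {..n}). \<Prod>\<tau>\<in>Q. u \<tau> ^ r \<tau> / fact (r \<tau>)) \<longlonglongrightarrow> (\<Prod>\<tau>\<in>Q. exp (u \<tau>))"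
    unfolding partial by (intro tendsto_prod sums)
  have "(\<lambda>n. (\<Prod>\<tau>\<in>Q. exp (w \<tau>)) * d n) \<longlonglongrightarrow> (\<Prod>\<tau>\<in>Q. exp (w \<tau>)) * (0 + (1 - 1))"
    unfolding d_def by (intro tendsto_mult tendsto_const tendsto_add lim_1_over_n tendsto_diff peak_prob_tendsto)
  then have dz: "(\<lambda>n. (\<Prod>\<tau>\<in>Q. exp (w \<tau>)) * d n) \<longlonglongrightarrow> 0" by simp
  have "(\<lambda>n. (\<integral>\<omega>. (\<Prod>\<tau>\<in>Q. (1 + t \<tau>) ^ cycle_count n \<tau> \<omega>) \<partial>M) -
     (\<Sum>r\<in>PiE Q (\<lambda>_. {..n}). \<Prod>\<tau>\<in>Q. u \<tau> ^ r \<tau> / fact (r \<tau>))) \<longlonglongrightarrow> 0"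
  proof (rule Lim_null_comparison[OF _ dz])
    show "\<forall>\<^sub>F n in sequentially. norm ((\<integral>\<omega>. (\<Prod>\<tau>\<in>Q. (1 + t \<tau>) ^ cycle_count n \<tau> \<omega>) \<partial>M) -
       (\<Sum>r\<in>PiE Q (\<lambda>_. {..n}). \<Prod>\<tau>\<in>Q. u \<tau> ^ r \<tau> / fact (r \<tau>))) \<le> (\<Prod>\<tau>\<in>Q. exp (w \<tau>)) * d n"
      using eventually_gt_at_top[of 0]
    proof eventually_elim
      case (elim n)
      have "norm ((\<integral>\<omega>. (\<Prod>\<tau>\<in>Q. (1 + t \<tau>) ^ cycle_count n \<tau> \<omega>) \<partial>M) -
         (\<Sum>r\<in>PiE Q (\<lambda>_. {..n}). \<Prod>\<tau>\<in>Q. u \<tau> ^ r \<tau> / fact (r \<tau>))) =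
        \<bar>\<Sum>r\<in>PiE Q (\<lambda>_. {..n}). (\<Prod>\<tau>\<in>Q. u \<tau> ^ r \<tau> / fact (r \<tau>)) * (falling_ratio n (\<Sum>\<tau>\<in>Q. fst \<tau> * r \<tau>) - 1)\<bar>"
        by (simp add: pgf_finite[OF elim Q] u_def sum_subtractf[symmetric] right_diff_distrib)
      also have "\<dots> \<le> (\<Sum>r\<in>PiE Q (\<lambda>_. {..n}). (\<Prod>\<tau>\<in>Q. w \<tau> ^ r \<tau> / fact (r \<tau>)) * d n)"
      proof (rule order_trans[OF sum_abs], rule sum_mono)
        fix r
        let ?N = "\<Sum>\<tau>\<in>Q. fst \<tau> * r \<tau>"
        have d0: "0 \<le> d n" using peak_prob_le_1[of n] by (simp add: d_def)
        have "\<bar>(\<Prod>\<tau>\<in>Q. u \<tau> ^ r \<tau> / fact (r \<tau>)) * (falling_ratio n ?N - 1)\<bar> =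
          (\<Prod>\<tau>\<in>Q. \<bar>u \<tau>\<bar> ^ r \<tau> / fact (r \<tau>)) * (1 - falling_ratio n ?N)"
          using falling_ratio_bounds(2)[OF elim, of ?N] by (simp add: abs_mult abs_prod power_abs)
        also have "\<dots> \<le> (\<Prod>\<tau>\<in>Q. \<bar>u \<tau>\<bar> ^ r \<tau> / fact (r \<tau>)) * (4 ^ ?N * d n)"
          unfolding d_def by (intro mult_left_mono falling_ratio_bounds(3)[OF elim] prod_nonneg) auto
        also have "\<dots> = (\<Prod>\<tau>\<in>Q. w \<tau> ^ r \<tau> / fact (r \<tau>)) * d n"
        proof -
          have "(\<Prod>\<tau>\<in>Q. w \<tau> ^ r \<tau> / fact (r \<tau>)) = (\<Prod>\<tau>\<in>Q. \<bar>u \<tau>\<bar> ^ r \<tau> / fact (r \<tau>) * 4 ^ (fst \<tau> * r \<tau>))"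
            by (intro prod.cong refl) (simp add: w_def power_mult_distrib power_mult)
          also have "\<dots> = (\<Prod>\<tau>\<in>Q. \<bar>u \<tau>\<bar> ^ r \<tau> / fact (r \<tau>)) * 4 ^ ?N"
            by (simp only: prod.distrib power_sum)
          finally show ?thesis by (simp only: mult.assoc)
        qed
        finally show "\<bar>(\<Prod>\<tau>\<in>Q. u \<tau> ^ r \<tau> / fact (r \<tau>)) * (falling_ratio n ?N - 1)\<bar> \<le> (\<Prod>\<tau>\<in>Q. w \<tau> ^ r \<tau> / fact (r \<tau>)) * d n" .
      qed
      also have "\<dots> = (\<Prod>\<tau>\<in>Q. \<Sum>r\<le>n. w \<tau> ^ r / fact r) * d n"
        by (simp only: sum_distrib_right[symmetric] partial)
      also have "\<dots> \<le> (\<Prod>\<tau>\<in>Q. exp (w \<tau>)) * d n"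
      proof (intro mult_right_mono prod_mono conjI)
        fix \<tau>
        have w0: "0 \<le> w \<tau>" by (simp add: w_def)
        then show "0 \<le> (\<Sum>r\<le>n. w \<tau> ^ r / fact r)" by (intro sum_nonneg) auto
        have "incseq (\<lambda>n. \<Sum>r\<le>n. w \<tau> ^ r / fact r)" using w0 by (intro incseq_SucI) auto
        then show "(\<Sum>r\<le>n. w \<tau> ^ r / fact r) \<le> exp (w \<tau>)" by (rule incseq_le[OF _ sums])
      next
        show "0 \<le> d n" using peak_prob_le_1[of n] by (simp add: d_def)
      qed
      finally show ?case .
    qed
  qed
  from tendsto_add[OF this main] show ?thesis by (simp add: u_def)
qed

end

subsection \<open>Weak convergence of sequences of counts\<close>

lemma compact_box: "compact {x :: nat \<Rightarrow> real. \<forall>k. x k \<in> {l k..u k}}"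
proof -
  have "compactin (product_topology (\<lambda>_::nat. euclidean) UNIV) (PiE UNIV (\<lambda>k. {l k..u k}))"
    by (subst compactin_PiE) auto
  moreover have "PiE UNIV (\<lambda>k. {l k..u k}) = {x :: nat \<Rightarrow> real. \<forall>k. x k \<in> {l k..u k}}"
    by (auto simp: PiE_def Pi_def)
  ultimately show ?thesis by (simp add: euclidean_product_topology)
qed

lemma borel_measurable_continuous_seq:
  fixes g :: "(nat \<Rightarrow> real) \<Rightarrow> real"
  assumes g: "continuous_on UNIV g" and x: "\<And>k. x k \<in> borel_measurable M"
  shows "(\<lambda>\<omega>. g (\<lambda>k. x k \<omega>)) \<in> borel_measurable M"
proof -
  have "(\<lambda>\<omega> k. x k \<omega>) \<in> borel_measurable M"
    by (rule measurable_coordinatewise_then_product) (rule x)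
  then show ?thesis by (rule measurable_compose[OF _ borel_measurable_continuous_onI[OF g]])
qed

lemma sums_half_power: "(\<lambda>k. 1 / 2 ^ Suc k :: real) sums 1"
  using power_half_series by (simp add: power_one_over)

context prob_space
begin

lemma integrable_bounded:
  fixes f :: "'a \<Rightarrow> real"
  assumes "f \<in> borel_measurable M" "\<And>\<omega>. \<bar>f \<omega>\<bar> \<le> B"
  shows "integrable M f"
  by (rule integrable_const_bound[of _ B]) (use assms in auto)

text \<open>Markov's inequality in each coordinate and a union bound. Reciprocal weights that sum to
  1 turn a uniform bound on means into tightness of a whole sequence.\<close>

lemma prob_outside_box:
  assumes u: "\<And>k. integrable M (u k)" "\<And>k \<omega>. 0 \<le> u k \<omega>" "\<And>k. (\<integral>\<omega>. u k \<omega> \<partial>M) \<le> K" and c: "c > 0"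
    and w: "\<And>k. 0 < w k" "(\<lambda>k. 1 / w k) sums 1"
  shows "{\<omega> \<in> space M. \<exists>k. c * w k \<le> u k \<omega>} \<in> sets M"
    and "prob {\<omega> \<in> space M. \<exists>k. c * w k \<le> u k \<omega>} \<le> K / c"
proof -
  define A where "A = (\<lambda>k. {\<omega> \<in> space M. c * w k \<le> u k \<omega>})"
  have [measurable]: "u k \<in> borel_measurable M" for k using u(1) by auto
  have A: "A k \<in> sets M" for k unfolding A_def by measurable
  have eq: "{\<omega> \<in> space M. \<exists>k. c * w k \<le> u k \<omega>} = (\<Union>k. A k)" by (auto simp: A_def)
  show "{\<omega> \<in> space M. \<exists>k. c * w k \<le> u k \<omega>} \<in> sets M" unfolding eq using A by auto
  have PA: "prob (A k) \<le> K / c * (1 / w k)" for k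
  proof -
    have "prob (A k) \<le> (\<integral>\<omega>. u k \<omega> \<partial>M) / (c * w k)"
      unfolding A_def by (rule integral_Markov_inequality_measure[where A = "space M"]) (use u c w in auto)
    also have "\<dots> \<le> K / (c * w k)" using u(3) c w(1)[of k] by (intro divide_right_mono) auto
    finally show ?thesis by simp
  qed
  have s: "(\<lambda>k. K / c * (1 / w k)) sums (K / c * 1)" by (intro sums_mult w)
  have sA: "summable (\<lambda>k. prob (A k))"
    by (rule summable_comparison_test'[OF sums_summable[OF s]]) (use PA in auto)
  have "prob (\<Union>k. A k) \<le> (\<Sum>k. prob (A k))"
    by (rule finite_measure_subadditive_countably) (use A sA in auto)
  also have "\<dots> \<le> (\<Sum>k. K / c * (1 / w k))" by (intro suminf_le PA sA sums_summable[OF s])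
  also have "\<dots> = K / c" by (simp only: sums_unique[OF s, symmetric] mult_1_right)
  finally show "prob {\<omega> \<in> space M. \<exists>k. c * w k \<le> u k \<omega>} \<le> K / c" unfolding eq .
qed

lemma integral_diff_bound:
  fixes f g :: "'a \<Rightarrow> real"
  assumes f: "f \<in> borel_measurable M" "\<And>\<omega>. \<bar>f \<omega>\<bar> \<le> B" and g: "g \<in> borel_measurable M" "\<And>\<omega>. \<bar>g \<omega>\<bar> \<le> B"
    and A: "A \<in> sets M" and eq: "\<And>\<omega>. \<omega> \<in> space M - A \<Longrightarrow> \<bar>f \<omega> - g \<omega>\<bar> \<le> e" and e: "0 \<le> e"
  shows "\<bar>(\<integral>\<omega>. f \<omega> \<partial>M) - (\<integral>\<omega>. g \<omega> \<partial>M)\<bar> \<le> e + 2 * B * prob A"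
proof -
  have int: "integrable M f" "integrable M g" using f g by (auto intro: integrable_bounded)
  have "\<bar>(\<integral>\<omega>. f \<omega> \<partial>M) - (\<integral>\<omega>. g \<omega> \<partial>M)\<bar> = \<bar>\<integral>\<omega>. f \<omega> - g \<omega> \<partial>M\<bar>" using int by simp
  also have "\<dots> \<le> (\<integral>\<omega>. \<bar>f \<omega> - g \<omega>\<bar> \<partial>M)" by (rule integral_abs_bound)
  also have "\<dots> \<le> (\<integral>\<omega>. e + 2 * B * indicator A \<omega> \<partial>M)"
  proof (rule integral_mono)
    fix \<omega> assume \<omega>: "\<omega> \<in> space M"
    show "\<bar>f \<omega> - g \<omega>\<bar> \<le> e + 2 * B * indicator A \<omega>"
    proof (cases "\<omega> \<in> A")
      case True
      then show ?thesis using f(2)[of \<omega>] g(2)[of \<omega>] e by simp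
    qed (use eq \<omega> in simp)
  qed (use int A in \<open>auto simp: emeasure_eq_measure\<close>)
  also have "\<dots> = e + 2 * B * prob A" using A by (simp add: emeasure_eq_measure prob_space)
  finally show ?thesis .
qed

end

text \<open>Only multiplication by single coordinates is built in, so that an induction can collect
  the coordinates in a monomial; closure under products is derived.\<close>

inductive_set seq_poly :: "((nat \<Rightarrow> real) \<Rightarrow> real) set" where
  const: "(\<lambda>_. c) \<in> seq_poly"
| coord: "f \<in> seq_poly \<Longrightarrow> (\<lambda>y. y i * f y) \<in> seq_poly"
| add: "f \<in> seq_poly \<Longrightarrow> g \<in> seq_poly \<Longrightarrow> (\<lambda>y. f y + g y) \<in> seq_poly"

lemma seq_poly_scale: "f \<in> seq_poly \<Longrightarrow> (\<lambda>y. c * f y) \<in> seq_poly"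
proof (induction rule: seq_poly.induct)
  case (coord f i)
  from seq_poly.coord[OF this(2), of i] show ?case by (simp add: mult.left_commute)
qed (auto intro: seq_poly.intros simp: distrib_left)

lemma seq_poly_mult: "f \<in> seq_poly \<Longrightarrow> g \<in> seq_poly \<Longrightarrow> (\<lambda>y. f y * g y) \<in> seq_poly"
proof (induction rule: seq_poly.induct)
  case (coord f i)
  from seq_poly.coord[OF coord.IH[OF coord.prems], of i] show ?case by (simp add: mult.assoc)
qed (auto intro: seq_poly.intros seq_poly_scale simp: distrib_right)

lemma seq_poly_continuous: "f \<in> seq_poly \<Longrightarrow> continuous_on UNIV f"
  by (induction rule: seq_poly.induct)
    (auto intro!: continuous_intros continuous_on_product_coordinates)

lemma seq_poly_dense:
  fixes h :: "(nat \<Rightarrow> real) \<Rightarrow> real"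
  assumes h: "continuous_on UNIV h" and e: "e > 0"
  shows "\<exists>f\<in>seq_poly. \<forall>y. (\<forall>k. y k \<in> {0..1}) \<longrightarrow> \<bar>h y - f y\<bar> < e"
proof -
  interpret function_ring_on seq_poly "{y :: nat \<Rightarrow> real. \<forall>k. y k \<in> {0..1}}"
  proof
    show "compact {y :: nat \<Rightarrow> real. \<forall>k. y k \<in> {0..1}}"
      using compact_box[of "\<lambda>_. 0" "\<lambda>_. 1"] by simp
    show "\<exists>f\<in>seq_poly. f x \<noteq> f y" if xy: "x \<noteq> y" for x y :: "nat \<Rightarrow> real"
    proof -
      obtain i where "x i \<noteq> y i" using xy by (auto simp: fun_eq_iff)
      then show ?thesis using seq_poly.coord[OF seq_poly.const[of 1], of i] by (intro bexI[of _ "\<lambda>y. y i * 1"]) auto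
    qed
  qed (auto intro: seq_poly.intros seq_poly_mult continuous_on_subset[OF seq_poly_continuous])
  from Stone_Weierstrass_basic[OF continuous_on_subset[OF h] e] show ?thesis by blast
qed

lemma prod_list_eq_prod_count:
  fixes y :: "nat \<Rightarrow> real"
  assumes "set xs \<subseteq> {..<m}"
  shows "(\<Prod>i\<leftarrow>xs. y i) = (\<Prod>i<m. y i ^ count_list xs i)"
  using assms
proof (induction xs)
  case (Cons j xs)
  have "(\<Prod>i<m. y i ^ count_list (j # xs) i) = (\<Prod>i<m. (if i = j then y i else 1) * y i ^ count_list xs i)"
    by (intro prod.cong) auto
  also have "\<dots> = y j * (\<Prod>i<m. y i ^ count_list xs i)"
    using Cons.prems by (simp add: prod.distrib prod.delta)
  finally show ?case using Cons by simp
qed simp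

text \<open>Sends counts into the compact interval from 0 to 1; monomials in these images are
  generating functions at powers of 1/2.\<close>

definition half_pow :: "('c \<Rightarrow> nat) \<Rightarrow> 'c \<Rightarrow> real" where "half_pow Z \<omega> = (1/2) ^ Z \<omega>"

lemma half_pow_powr: "half_pow Z \<omega> = 2 powr (- real (Z \<omega>))"
  by (simp add: half_pow_def powr_minus powr_realpow power_divide inverse_eq_divide)

lemma half_pow_box: "half_pow Z \<omega> \<in> {0..1}"
  by (simp add: half_pow_def power_le_one)

text \<open>The generating functions identify the limit law, and the common bound \<open>K\<close>
  on the means supplies tightness.\<close>

locale count_convergence = M: prob_space M + M': prob_space M'
  for M :: "'a measure" and M' :: "'b measure" +
  fixes C :: "nat \<Rightarrow> nat \<Rightarrow> 'a \<Rightarrow> nat" and N :: "nat \<Rightarrow> 'b \<Rightarrow> nat" and K :: real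
  assumes measurable_C: "n > 0 \<Longrightarrow> (\<lambda>\<omega>. real (C n i \<omega>)) \<in> borel_measurable M"
    and measurable_N: "(\<lambda>\<omega>. real (N i \<omega>)) \<in> borel_measurable M'"
    and mean_C: "n > 0 \<Longrightarrow> integrable M (\<lambda>\<omega>. real (C n i \<omega>)) \<and> (\<integral>\<omega>. real (C n i \<omega>) \<partial>M) \<le> K"
    and mean_N: "integrable M' (\<lambda>\<omega>. real (N i \<omega>)) \<and> (\<integral>\<omega>. real (N i \<omega>) \<partial>M') \<le> K"
    and pgf: "\<And>(x :: nat \<Rightarrow> real) m. (\<And>i. 0 < x i \<and> x i \<le> 1) \<Longrightarrow>
      (\<lambda>n. \<integral>\<omega>. (\<Prod>i<m. x i ^ C n i \<omega>) \<partial>M) \<longlonglongrightarrow> (\<integral>\<omega>. (\<Prod>i<m. x i ^ N i \<omega>) \<partial>M')"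
begin

lemma measurable_half_pow_C: "n > 0 \<Longrightarrow> half_pow (C n i) \<in> borel_measurable M"
  unfolding half_pow_powr[abs_def] using measurable_C[of n i] by simp

lemma measurable_half_pow_N: "half_pow (N i) \<in> borel_measurable M'"
  unfolding half_pow_powr[abs_def] using measurable_N[of i] by simp

lemma bounded_on_box:
  fixes h :: "(nat \<Rightarrow> real) \<Rightarrow> real"
  assumes "continuous_on UNIV h"
  obtains b where "\<And>y. (\<forall>k. y k \<in> {0..1}) \<Longrightarrow> \<bar>h y\<bar> \<le> b"
proof -
  have "compact (h ` {y. \<forall>k. y k \<in> {0..1}})"
    using compact_box[of "\<lambda>_. 0" "\<lambda>_. 1"] by (intro compact_continuous_image continuous_on_subset[OF assms]) auto
  then have "bounded (h ` {y. \<forall>k. y k \<in> {0..1}})" by (rule compact_imp_bounded)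
  then show ?thesis using that unfolding bounded_iff by auto
qed

lemma integrable_half_pow_C:
  assumes "continuous_on UNIV h" "n > 0"
  shows "integrable M (\<lambda>\<omega>. h (\<lambda>i. half_pow (C n i) \<omega>) :: real)"
proof -
  obtain b where b: "\<And>y. (\<forall>k. y k \<in> {0..1}) \<Longrightarrow> \<bar>h y\<bar> \<le> b" using bounded_on_box[OF assms(1)] by blast
  show ?thesis
  proof (rule M.integrable_bounded)
    show "(\<lambda>\<omega>. h (\<lambda>i. half_pow (C n i) \<omega>)) \<in> borel_measurable M"
      by (rule borel_measurable_continuous_seq[OF assms(1)]) (rule measurable_half_pow_C[OF assms(2)])
    show "\<bar>h (\<lambda>i. half_pow (C n i) \<omega>)\<bar> \<le> b" for \<omega>
      by (rule b) (simp only: half_pow_box simp_thms)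
  qed
qed

lemma integrable_half_pow_N:
  assumes "continuous_on UNIV h"
  shows "integrable M' (\<lambda>\<omega>. h (\<lambda>i. half_pow (N i) \<omega>) :: real)"
proof -
  obtain b where b: "\<And>y. (\<forall>k. y k \<in> {0..1}) \<Longrightarrow> \<bar>h y\<bar> \<le> b" using bounded_on_box[OF assms(1)] by blast
  show ?thesis
  proof (rule M'.integrable_bounded)
    show "(\<lambda>\<omega>. h (\<lambda>i. half_pow (N i) \<omega>)) \<in> borel_measurable M'"
      by (rule borel_measurable_continuous_seq[OF assms(1)]) (rule measurable_half_pow_N)
    show "\<bar>h (\<lambda>i. half_pow (N i) \<omega>)\<bar> \<le> b" for \<omega>
      by (rule b) (simp only: half_pow_box simp_thms)
  qed
qed

text \<open>The extra monomial \<open>xs\<close> settles the case \<open>coord\<close>: the new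
  coordinate is moved into \<open>xs\<close>.\<close>

lemma tendsto_poly:
  assumes "f \<in> seq_poly"
  shows "(\<lambda>n. \<integral>\<omega>. f (\<lambda>i. half_pow (C n i) \<omega>) * (\<Prod>i\<leftarrow>xs. half_pow (C n i) \<omega>) \<partial>M) \<longlonglongrightarrow>
    (\<integral>\<omega>. f (\<lambda>i. half_pow (N i) \<omega>) * (\<Prod>i\<leftarrow>xs. half_pow (N i) \<omega>) \<partial>M')"
  using assms
proof (induction arbitrary: xs rule: seq_poly.induct)
  case (const c)
  obtain m where m: "set xs \<subseteq> {..<m}" using finite_nat_iff_bounded[of "set xs"] by auto
  \<comment> \<open>The monomial is a generating function at the point
    \<open>x i = (1/2) ^ count_list xs i\<close>.\<close>
  have p: "(\<Prod>i\<leftarrow>xs. (1/2::real) ^ z i) = (\<Prod>i<m. ((1/2) ^ count_list xs i) ^ z i)" for z :: "nat \<Rightarrow> nat"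
    unfolding prod_list_eq_prod_count[OF m, of "\<lambda>i. (1/2) ^ z i"]
    by (simp add: power_mult[symmetric] mult.commute)
  have "(\<lambda>n. \<integral>\<omega>. (\<Prod>i<m. ((1/2::real) ^ count_list xs i) ^ C n i \<omega>) \<partial>M) \<longlonglongrightarrow>
    (\<integral>\<omega>. (\<Prod>i<m. ((1/2) ^ count_list xs i) ^ N i \<omega>) \<partial>M')"
    by (rule pgf) (simp add: power_le_one)
  then show ?case unfolding half_pow_def p by (simp add: tendsto_mult_left)
next
  case (coord f i)
  from coord.IH[of "i # xs"] show ?case by (simp add: mult_ac)
next
  case (add f g)
  have c: "continuous_on UNIV (\<lambda>y. f y * (\<Prod>i\<leftarrow>xs. y i))" if "f \<in> seq_poly" for f :: "(nat \<Rightarrow> real) \<Rightarrow> real"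
  proof -
    have "continuous_on UNIV (\<lambda>y::nat \<Rightarrow> real. \<Prod>i\<leftarrow>xs. y i)"
      by (induction xs) (auto intro!: continuous_intros continuous_on_product_coordinates)
    then show ?thesis using seq_poly_continuous[OF that] by (intro continuous_intros)
  qed
  note iC = integrable_half_pow_C[OF c[OF add.hyps(1)]] integrable_half_pow_C[OF c[OF add.hyps(2)]]
  note iN = integrable_half_pow_N[OF c[OF add.hyps(1)]] integrable_half_pow_N[OF c[OF add.hyps(2)]]
  have "(\<lambda>n. (\<integral>\<omega>. f (\<lambda>i. half_pow (C n i) \<omega>) * (\<Prod>i\<leftarrow>xs. half_pow (C n i) \<omega>) \<partial>M) +
      (\<integral>\<omega>. g (\<lambda>i. half_pow (C n i) \<omega>) * (\<Prod>i\<leftarrow>xs. half_pow (C n i) \<omega>) \<partial>M)) \<longlonglongrightarrow>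
    (\<integral>\<omega>. f (\<lambda>i. half_pow (N i) \<omega>) * (\<Prod>i\<leftarrow>xs. half_pow (N i) \<omega>) \<partial>M') +
    (\<integral>\<omega>. g (\<lambda>i. half_pow (N i) \<omega>) * (\<Prod>i\<leftarrow>xs. half_pow (N i) \<omega>) \<partial>M')"
    by (intro tendsto_add add.IH)
  moreover have "(\<integral>\<omega>. f (\<lambda>i. half_pow (N i) \<omega>) * (\<Prod>i\<leftarrow>xs. half_pow (N i) \<omega>) \<partial>M') +
    (\<integral>\<omega>. g (\<lambda>i. half_pow (N i) \<omega>) * (\<Prod>i\<leftarrow>xs. half_pow (N i) \<omega>) \<partial>M') =
    (\<integral>\<omega>. (f (\<lambda>i. half_pow (N i) \<omega>) + g (\<lambda>i. half_pow (N i) \<omega>)) * (\<Prod>i\<leftarrow>xs. half_pow (N i) \<omega>) \<partial>M')"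
    using iN by (simp add: distrib_right)
  moreover have "\<forall>\<^sub>F n in sequentially. (\<integral>\<omega>. f (\<lambda>i. half_pow (C n i) \<omega>) * (\<Prod>i\<leftarrow>xs. half_pow (C n i) \<omega>) \<partial>M) +
      (\<integral>\<omega>. g (\<lambda>i. half_pow (C n i) \<omega>) * (\<Prod>i\<leftarrow>xs. half_pow (C n i) \<omega>) \<partial>M) =
    (\<integral>\<omega>. (f (\<lambda>i. half_pow (C n i) \<omega>) + g (\<lambda>i. half_pow (C n i) \<omega>)) * (\<Prod>i\<leftarrow>xs. half_pow (C n i) \<omega>) \<partial>M)"
    using eventually_gt_at_top[of 0]
    by eventually_elim (use iC in \<open>simp add: distrib_right\<close>)
  ultimately show ?case using Lim_transform_eventually by fastforce
qed

lemma tendsto_half_pow: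
  fixes h :: "(nat \<Rightarrow> real) \<Rightarrow> real"
  assumes h: "continuous_on UNIV h"
  shows "(\<lambda>n. \<integral>\<omega>. h (\<lambda>i. half_pow (C n i) \<omega>) \<partial>M) \<longlonglongrightarrow> (\<integral>\<omega>. h (\<lambda>i. half_pow (N i) \<omega>) \<partial>M')"
proof (rule LIMSEQ_I)
  fix e :: real assume e: "e > 0"
  then obtain f where f: "f \<in> seq_poly" "\<And>y. (\<forall>k. y k \<in> {0..1}) \<Longrightarrow> \<bar>h y - f y\<bar> < e/4"
    using seq_poly_dense[OF h, of "e/4"] by auto
  note fc = seq_poly_continuous[OF f(1)]
  have "(\<lambda>n. \<integral>\<omega>. f (\<lambda>i. half_pow (C n i) \<omega>) \<partial>M) \<longlonglongrightarrow> (\<integral>\<omega>. f (\<lambda>i. half_pow (N i) \<omega>) \<partial>M')"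
    using tendsto_poly[OF f(1), of "[]"] by simp
  then obtain n0 where n0: "\<And>n. n \<ge> n0 \<Longrightarrow> \<bar>(\<integral>\<omega>. f (\<lambda>i. half_pow (C n i) \<omega>) \<partial>M) - (\<integral>\<omega>. f (\<lambda>i. half_pow (N i) \<omega>) \<partial>M')\<bar> < e/4"
    using LIMSEQ_D[of _ _ "e/4"] e by (metis divide_pos_pos real_norm_def zero_less_numeral)
  have dN: "\<bar>(\<integral>\<omega>. h (\<lambda>i. half_pow (N i) \<omega>) \<partial>M') - (\<integral>\<omega>. f (\<lambda>i. half_pow (N i) \<omega>) \<partial>M')\<bar> \<le> e/4"
  proof -
    have f2: "\<bar>h (\<lambda>i. half_pow (N i) \<omega>) - f (\<lambda>i. half_pow (N i) \<omega>)\<bar> \<le> e/4" for \<omega>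
      by (rule less_imp_le[OF f(2)]) (simp only: half_pow_box simp_thms)
    have "\<bar>(\<integral>\<omega>. h (\<lambda>i. half_pow (N i) \<omega>) \<partial>M') - (\<integral>\<omega>. f (\<lambda>i. half_pow (N i) \<omega>) \<partial>M')\<bar> =
      \<bar>\<integral>\<omega>. h (\<lambda>i. half_pow (N i) \<omega>) - f (\<lambda>i. half_pow (N i) \<omega>) \<partial>M'\<bar>"
      using integrable_half_pow_N[OF h] integrable_half_pow_N[OF fc] by simp
    also have "\<dots> \<le> (\<integral>\<omega>. \<bar>h (\<lambda>i. half_pow (N i) \<omega>) - f (\<lambda>i. half_pow (N i) \<omega>)\<bar> \<partial>M')" by (rule integral_abs_bound)
    also have "\<dots> \<le> (\<integral>\<omega>. e/4 \<partial>M')"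
      using integrable_half_pow_N[OF h] integrable_half_pow_N[OF fc] f2
      by (intro integral_mono) auto
    finally show ?thesis by (simp add: M'.prob_space)
  qed
  have dC: "\<bar>(\<integral>\<omega>. h (\<lambda>i. half_pow (C n i) \<omega>) \<partial>M) - (\<integral>\<omega>. f (\<lambda>i. half_pow (C n i) \<omega>) \<partial>M)\<bar> \<le> e/4" if n: "n > 0" for n
  proof -
    have f2: "\<bar>h (\<lambda>i. half_pow (C n i) \<omega>) - f (\<lambda>i. half_pow (C n i) \<omega>)\<bar> \<le> e/4" for \<omega>
      by (rule less_imp_le[OF f(2)]) (simp only: half_pow_box simp_thms)
    have "\<bar>(\<integral>\<omega>. h (\<lambda>i. half_pow (C n i) \<omega>) \<partial>M) - (\<integral>\<omega>. f (\<lambda>i. half_pow (C n i) \<omega>) \<partial>M)\<bar> =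
      \<bar>\<integral>\<omega>. h (\<lambda>i. half_pow (C n i) \<omega>) - f (\<lambda>i. half_pow (C n i) \<omega>) \<partial>M\<bar>"
      using integrable_half_pow_C[OF h n] integrable_half_pow_C[OF fc n] by simp
    also have "\<dots> \<le> (\<integral>\<omega>. \<bar>h (\<lambda>i. half_pow (C n i) \<omega>) - f (\<lambda>i. half_pow (C n i) \<omega>)\<bar> \<partial>M)" by (rule integral_abs_bound)
    also have "\<dots> \<le> (\<integral>\<omega>. e/4 \<partial>M)"
      using integrable_half_pow_C[OF h n] integrable_half_pow_C[OF fc n] f2
      by (intro integral_mono) auto
    finally show ?thesis by (simp add: M.prob_space)
  qed
  show "\<exists>n0. \<forall>n\<ge>n0. norm ((\<integral>\<omega>. h (\<lambda>i. half_pow (C n i) \<omega>) \<partial>M) - (\<integral>\<omega>. h (\<lambda>i. half_pow (N i) \<omega>) \<partial>M')) < e"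
  proof (intro exI allI impI)
    fix n assume "n \<ge> max n0 1"
    then have "n \<ge> n0" "n > 0" by auto
    with n0[of n] dC[of n] dN e show "norm ((\<integral>\<omega>. h (\<lambda>i. half_pow (C n i) \<omega>) \<partial>M) - (\<integral>\<omega>. h (\<lambda>i. half_pow (N i) \<omega>) \<partial>M')) < e"
      unfolding real_norm_def by linarith
  qed
qed

text \<open>A continuous left inverse of \<open>half_pow\<close> for counts up to
  \<open>B * 2 ^ Suc i\<close>; the maximum keeps the logarithm away from 0.\<close>

definition cut :: "nat \<Rightarrow> (nat \<Rightarrow> real) \<Rightarrow> nat \<Rightarrow> real" where
  "cut B y i = - log 2 (max (y i) ((1/2) ^ (B * 2 ^ Suc i)))"

lemma continuous_on_cut: "continuous_on UNIV (cut B)"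
proof (rule continuous_on_coordinatewise_then_product)
  fix i
  have "max ((y::nat \<Rightarrow> real) i) ((1/2) ^ (B * 2 ^ Suc i)) \<noteq> 0" for y
    by (metis max.cobounded2 not_le zero_less_divide_1_iff zero_less_numeral zero_less_power)
  moreover have "0 < max ((y::nat \<Rightarrow> real) i) ((1/2) ^ (B * 2 ^ Suc i))" for y
    by (simp add: less_max_iff_disj)
  ultimately show "continuous_on UNIV (\<lambda>y. cut B y i)"
    unfolding cut_def by (intro continuous_intros continuous_on_product_coordinates continuous_on_max) auto
qed

lemma cut_half_pow:
  "Z i \<omega> \<le> B * 2 ^ Suc i \<Longrightarrow> cut B (\<lambda>i. half_pow (Z i) \<omega>) i = real (Z i \<omega>)"
proof -
  assume "Z i \<omega> \<le> B * 2 ^ Suc i"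
  then have "(1/2::real) ^ (B * 2 ^ Suc i) \<le> (1/2) ^ Z i \<omega>" by (intro power_decreasing) auto
  then have m: "max ((1/2::real) ^ Z i \<omega>) ((1/2) ^ (B * 2 ^ Suc i)) = (1/2) ^ Z i \<omega>"
    by (rule max_absorb1)
  have "(1/2::real) ^ Z i \<omega> = 2 powr (- real (Z i \<omega>))"
    using half_pow_powr[of "Z i" \<omega>] by (simp add: half_pow_def)
  then show ?thesis unfolding cut_def half_pow_def m by simp
qed

text \<open>Composed with \<open>cut\<close>, the functional \<open>g\<close> becomes continuous on
  the cube and \<open>tendsto_half_pow\<close> applies. This changes its value only when some count
  leaves a box, an event of probability at most \<open>K / b\<close>.\<close>

theorem counts_tendsto:
  fixes g :: "(nat \<Rightarrow> real) \<Rightarrow> real"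
  assumes g: "continuous_on UNIV g" and G: "\<And>x. \<bar>g x\<bar> \<le> G"
  shows "(\<lambda>n. \<integral>\<omega>. g (\<lambda>i. real (C n i \<omega>)) \<partial>M) \<longlonglongrightarrow> (\<integral>\<omega>. g (\<lambda>i. real (N i \<omega>)) \<partial>M')"
proof (rule LIMSEQ_I)
  fix e :: real assume e: "e > 0"
  have G0: "0 \<le> G" using G[of undefined] by linarith
  \<comment> \<open>Chosen so that leaving the box costs at most \<open>e / 4\<close> on either
    probability space.\<close>
  obtain B :: nat where "2 * G * K / (e/4) < B" using reals_Archimedean2 by blast
  then have "2 * G * K < e/4 * real B" using e by (simp add: pos_divide_less_eq mult.commute)
  also have "\<dots> \<le> e/4 * real (Suc B)" using e by (intro mult_left_mono) auto
  finally have "2 * G * K / real (Suc B) \<le> e/4" by (subst pos_divide_le_eq) auto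
  then have B: "2 * G * (K / real (Suc B)) \<le> e/4" by simp
  define b where "b = Suc B"
  have hc: "continuous_on UNIV (\<lambda>y. g (cut b y))"
    by (intro continuous_on_compose2[OF g continuous_on_cut]) auto
  have gC: "\<bar>(\<integral>\<omega>. g (\<lambda>i. real (C n i \<omega>)) \<partial>M) - (\<integral>\<omega>. g (cut b (\<lambda>i. half_pow (C n i) \<omega>)) \<partial>M)\<bar> \<le> e/4" if n: "n > 0" for n
  proof -
    let ?A = "{\<omega> \<in> space M. \<exists>k. real b * 2 ^ Suc k \<le> real (C n k \<omega>)}"
    have A: "?A \<in> sets M" "M.prob ?A \<le> K / real b"
      by (rule M.prob_outside_box[where u = "\<lambda>k \<omega>. real (C n k \<omega>)" and K = K and c = "real b" and w = "\<lambda>k. 2 ^ Suc k", OF _ _ _ _ _ sums_half_power]; use mean_C[OF n] in \<open>simp add: b_def\<close>)+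
    have "\<bar>(\<integral>\<omega>. g (\<lambda>i. real (C n i \<omega>)) \<partial>M) - (\<integral>\<omega>. g (cut b (\<lambda>i. half_pow (C n i) \<omega>)) \<partial>M)\<bar> \<le> 0 + 2 * G * M.prob ?A"
    proof (rule M.integral_diff_bound)
      fix \<omega> assume "\<omega> \<in> space M - ?A"
      then have "\<not> real b * 2 ^ Suc k \<le> real (C n k \<omega>)" for k by blast
      then have "real (C n k \<omega>) \<le> real (b * 2 ^ Suc k)" for k
        unfolding of_nat_mult of_nat_power of_nat_numeral by (meson less_imp_le not_le)
      then have "C n k \<omega> \<le> b * 2 ^ Suc k" for k by (simp only: of_nat_le_iff)
      then have "cut b (\<lambda>i. half_pow (C n i) \<omega>) = (\<lambda>i. real (C n i \<omega>))"
        by (intro ext cut_half_pow)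
      then show "\<bar>g (\<lambda>i. real (C n i \<omega>)) - g (cut b (\<lambda>i. half_pow (C n i) \<omega>))\<bar> \<le> 0" by simp
    qed (use G A borel_measurable_continuous_seq[OF g measurable_C[OF n]]
        borel_measurable_continuous_seq[OF hc measurable_half_pow_C[OF n]] in auto)
    also have "\<dots> \<le> 2 * G * (K / real b)" unfolding add_0 by (rule mult_left_mono[OF A(2)]) (use G0 in simp)
    finally show ?thesis using B by (simp add: b_def)
  qed
  have gN: "\<bar>(\<integral>\<omega>. g (\<lambda>i. real (N i \<omega>)) \<partial>M') - (\<integral>\<omega>. g (cut b (\<lambda>i. half_pow (N i) \<omega>)) \<partial>M')\<bar> \<le> e/4"
  proof -
    let ?A = "{\<omega> \<in> space M'. \<exists>k. real b * 2 ^ Suc k \<le> real (N k \<omega>)}"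
    have A: "?A \<in> sets M'" "M'.prob ?A \<le> K / real b"
      by (rule M'.prob_outside_box[where u = "\<lambda>k \<omega>. real (N k \<omega>)" and K = K and c = "real b" and w = "\<lambda>k. 2 ^ Suc k", OF _ _ _ _ _ sums_half_power]; use mean_N in \<open>simp add: b_def\<close>)+
    have "\<bar>(\<integral>\<omega>. g (\<lambda>i. real (N i \<omega>)) \<partial>M') - (\<integral>\<omega>. g (cut b (\<lambda>i. half_pow (N i) \<omega>)) \<partial>M')\<bar> \<le> 0 + 2 * G * M'.prob ?A"
    proof (rule M'.integral_diff_bound)
      fix \<omega> assume "\<omega> \<in> space M' - ?A"
      then have "\<not> real b * 2 ^ Suc k \<le> real (N k \<omega>)" for k by blast
      then have "real (N k \<omega>) \<le> real (b * 2 ^ Suc k)" for k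
        unfolding of_nat_mult of_nat_power of_nat_numeral by (meson less_imp_le not_le)
      then have "N k \<omega> \<le> b * 2 ^ Suc k" for k by (simp only: of_nat_le_iff)
      then have "cut b (\<lambda>i. half_pow (N i) \<omega>) = (\<lambda>i. real (N i \<omega>))"
        by (intro ext cut_half_pow)
      then show "\<bar>g (\<lambda>i. real (N i \<omega>)) - g (cut b (\<lambda>i. half_pow (N i) \<omega>))\<bar> \<le> 0" by simp
    qed (use G A borel_measurable_continuous_seq[OF g measurable_N]
        borel_measurable_continuous_seq[OF hc measurable_half_pow_N] in auto)
    also have "\<dots> \<le> 2 * G * (K / real b)" unfolding add_0 by (rule mult_left_mono[OF A(2)]) (use G0 in simp)
    finally show ?thesis using B by (simp add: b_def)
  qed
  from LIMSEQ_D[OF tendsto_half_pow[OF hc], of "e/4"] e obtain n0 where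
    n0: "\<And>n. n \<ge> n0 \<Longrightarrow> \<bar>(\<integral>\<omega>. g (cut b (\<lambda>i. half_pow (C n i) \<omega>)) \<partial>M) - (\<integral>\<omega>. g (cut b (\<lambda>i. half_pow (N i) \<omega>)) \<partial>M')\<bar> < e/4"
    by (auto simp: real_norm_def)
  show "\<exists>n0. \<forall>n\<ge>n0. norm ((\<integral>\<omega>. g (\<lambda>i. real (C n i \<omega>)) \<partial>M) - (\<integral>\<omega>. g (\<lambda>i. real (N i \<omega>)) \<partial>M')) < e"
  proof (intro exI allI impI)
    fix n assume "n \<ge> max n0 1"
    then have "n \<ge> n0" "n > 0" by auto
    with n0[of n] gC[of n] gN e show "norm ((\<integral>\<omega>. g (\<lambda>i. real (C n i \<omega>)) \<partial>M) - (\<integral>\<omega>. g (\<lambda>i. real (N i \<omega>)) \<partial>M')) < e"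
      unfolding real_norm_def by linarith
  qed
qed

end

text \<open>
  A coordinatewise perturbation does not affect weak convergence of tight sequences in
  \<open>nat \<Rightarrow> real\<close>, because bounded continuous functions are uniformly continuous on compact boxes.
\<close>

lemma (in prob_space) integral_perturbation:
  fixes g :: "(nat \<Rightarrow> real) \<Rightarrow> real"
  assumes g: "continuous_on UNIV g" and G: "\<And>x. \<bar>g x\<bar> \<le> G"
    and mx: "\<And>n k. x n k \<in> borel_measurable M" and my: "\<And>n k. y n k \<in> borel_measurable M"
    and ix: "\<And>n k. n > 0 \<Longrightarrow> integrable M (\<lambda>\<omega>. (x n k \<omega>)\<^sup>2) \<and> (\<integral>\<omega>. (x n k \<omega>)\<^sup>2 \<partial>M) \<le> 1"
    and iy: "\<And>n k. n > 0 \<Longrightarrow> integrable M (\<lambda>\<omega>. (y n k \<omega>)\<^sup>2) \<and> (\<integral>\<omega>. (y n k \<omega>)\<^sup>2 \<partial>M) \<le> 1"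
    and id: "\<And>n k. n > 0 \<Longrightarrow> integrable M (\<lambda>\<omega>. (x n k \<omega> - y n k \<omega>)\<^sup>2)"
    and d: "\<And>k. (\<lambda>n. \<integral>\<omega>. (x n k \<omega> - y n k \<omega>)\<^sup>2 \<partial>M) \<longlonglongrightarrow> 0"
  shows "(\<lambda>n. (\<integral>\<omega>. g (\<lambda>k. x n k \<omega>) \<partial>M) - (\<integral>\<omega>. g (\<lambda>k. y n k \<omega>) \<partial>M)) \<longlonglongrightarrow> 0"
proof (rule LIMSEQ_I)
  fix e :: real assume e: "e > 0"
  have G0: "0 \<le> G" using G[of undefined] by linarith
  \<comment> \<open>Each of the two sequences leaves the box with probability at most
    \<open>1 / c\<close>, and their joint cost must stay below \<open>e / 4\<close>. The added 1
    keeps \<open>c\<close> positive when \<open>G = 0\<close>.\<close>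
  define c where "c = (16 * G + 1) / e"
  have c: "c > 0" "2 * G * (2 * (1 / c)) \<le> e / 4" using e G0 by (auto simp: c_def field_simps)
  define S where "S = {z :: nat \<Rightarrow> real. \<forall>k. z k \<in> {- sqrt (c * 2 ^ Suc k)..sqrt (c * 2 ^ Suc k)}}"
  have "compact S" unfolding S_def by (rule compact_box)
  then have "uniformly_continuous_on S g"
    by (intro compact_uniformly_continuous continuous_on_subset[OF g]) auto
  then obtain \<delta> where \<delta>: "\<delta> > 0" "\<And>u v. u \<in> S \<Longrightarrow> v \<in> S \<Longrightarrow> dist u v < \<delta> \<Longrightarrow> \<bar>g u - g v\<bar> < e/4"
    unfolding uniformly_continuous_on_def dist_real_def using e by (metis divide_pos_pos dist_commute zero_less_numeral)
  \<comment> \<open>The metric on sequences is at most twice the largest distance among the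
    coordinates enumerated up to \<open>m\<close>, plus \<open>(1/2) ^ m\<close>. Coordinate errors
    of \<open>\<delta> / 4\<close> therefore give a distance below \<open>\<delta>\<close>.\<close>
  obtain m where m: "(1/2::real) ^ m < \<delta> / 2" using real_arch_pow_inv[of "\<delta>/2" "1/2"] \<delta> by auto
  define J where "J = (from_nat :: nat \<Rightarrow> nat) ` {..m}"
  have J: "finite J" by (simp add: J_def)
  have close: "dist u v < \<delta>" if "\<And>k. k \<in> J \<Longrightarrow> \<bar>u k - v k\<bar> \<le> \<delta> / 4" for u v :: "nat \<Rightarrow> real"
  proof -
    have "Max {dist (u (from_nat n)) (v (from_nat n)) |n. n \<le> m} \<le> \<delta> / 4"
      using that by (subst Max_le_iff) (auto simp: dist_real_def J_def)
    then show ?thesis using dist_fun_le_dist_first_terms[of u v m] m by linarith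
  qed
  define D where "D = (\<lambda>n. \<Sum>k\<in>J. \<integral>\<omega>. (x n k \<omega> - y n k \<omega>)\<^sup>2 \<partial>M)"
  have "D \<longlonglongrightarrow> (\<Sum>k\<in>J. 0)" unfolding D_def by (intro tendsto_sum d)
  then have "(\<lambda>n. 2 * G * (D n / (\<delta>/4)\<^sup>2)) \<longlonglongrightarrow> 2 * G * (0 / (\<delta>/4)\<^sup>2)"
    using \<delta> by (intro tendsto_intros) auto
  then have "eventually (\<lambda>n. 2 * G * (D n / (\<delta>/4)\<^sup>2) < e/4) sequentially"
    using e by (intro order_tendstoD) auto
  then obtain n0 where n0: "\<And>n. n \<ge> n0 \<Longrightarrow> 2 * G * (D n / (\<delta>/4)\<^sup>2) < e/4" by (auto simp: eventually_sequentially)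
  have inS: "z \<in> S" if "\<And>k. \<not> c * 2 ^ Suc k \<le> (z k)\<^sup>2" for z :: "nat \<Rightarrow> real"
  proof -
    have "\<bar>z k\<bar> \<le> sqrt (c * 2 ^ Suc k)" for k
      using that[of k] by (metis less_imp_le not_le real_sqrt_abs real_sqrt_le_iff)
    then have "z k \<in> {- sqrt (c * 2 ^ Suc k)..sqrt (c * 2 ^ Suc k)}" for k
      using abs_le_iff[of "z k" "sqrt (c * 2 ^ Suc k)"] by (simp add: minus_le_iff)
    then show ?thesis by (simp add: S_def)
  qed
  show "\<exists>n0. \<forall>n\<ge>n0. norm ((\<integral>\<omega>. g (\<lambda>k. x n k \<omega>) \<partial>M) - (\<integral>\<omega>. g (\<lambda>k. y n k \<omega>) \<partial>M) - 0) < e"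
  proof (intro exI allI impI)
    fix n assume "n \<ge> max n0 1"
    then have n: "n \<ge> n0" "n > 0" by auto
    let ?X = "{\<omega> \<in> space M. \<exists>k. c * 2 ^ Suc k \<le> (x n k \<omega>)\<^sup>2}"
    let ?Y = "{\<omega> \<in> space M. \<exists>k. c * 2 ^ Suc k \<le> (y n k \<omega>)\<^sup>2}"
    define F where "F = (\<lambda>k. {\<omega> \<in> space M. (\<delta>/4)\<^sup>2 \<le> (x n k \<omega> - y n k \<omega>)\<^sup>2})"
    have X: "?X \<in> sets M" "prob ?X \<le> 1 / c"
      by (rule prob_outside_box[where u = "\<lambda>k \<omega>. (x n k \<omega>)\<^sup>2" and K = 1 and c = c and w = "\<lambda>k. 2 ^ Suc k", OF _ _ _ _ _ sums_half_power]; use ix[OF n(2)] c(1) in simp)+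
    have Y: "?Y \<in> sets M" "prob ?Y \<le> 1 / c"
      by (rule prob_outside_box[where u = "\<lambda>k \<omega>. (y n k \<omega>)\<^sup>2" and K = 1 and c = c and w = "\<lambda>k. 2 ^ Suc k", OF _ _ _ _ _ sums_half_power]; use iy[OF n(2)] c(1) in simp)+
    have F: "F k \<in> sets M" for k unfolding F_def using mx[of n k] my[of n k] by measurable
    have "prob (\<Union>k\<in>J. F k) \<le> (\<Sum>k\<in>J. prob (F k))"
      using F J by (intro finite_measure_subadditive_finite) auto
    also have "\<dots> \<le> (\<Sum>k\<in>J. (\<integral>\<omega>. (x n k \<omega> - y n k \<omega>)\<^sup>2 \<partial>M) / (\<delta>/4)\<^sup>2)"
      unfolding F_def using \<delta> id[OF n(2)]
      by (intro sum_mono integral_Markov_inequality_measure[where A = "space M"]) auto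
    also have "\<dots> = D n / (\<delta>/4)\<^sup>2" by (simp add: D_def sum_divide_distrib)
    finally have PF: "prob (\<Union>k\<in>J. F k) \<le> D n / (\<delta>/4)\<^sup>2" .
    let ?A = "?X \<union> ?Y \<union> (\<Union>k\<in>J. F k)"
    have u: "(\<Union>k\<in>J. F k) \<in> sets M" using F by (intro sets.finite_UN J)
    have A: "?A \<in> sets M" by (intro sets.Un X(1) Y(1) u)
    have "prob ?A \<le> prob ?X + prob ?Y + prob (\<Union>k\<in>J. F k)"
    proof -
      have "prob ?A \<le> prob (?X \<union> ?Y) + prob (\<Union>k\<in>J. F k)"
        by (intro measure_Un_le sets.Un X(1) Y(1) u)
      also have "prob (?X \<union> ?Y) \<le> prob ?X + prob ?Y" by (intro measure_Un_le X(1) Y(1))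
      finally show ?thesis by simp
    qed
    also have "\<dots> \<le> 2 * (1 / c) + D n / (\<delta>/4)\<^sup>2" using X(2) Y(2) PF by simp
    finally have PA: "prob ?A \<le> 2 * (1 / c) + D n / (\<delta>/4)\<^sup>2" .
    have "\<bar>(\<integral>\<omega>. g (\<lambda>k. x n k \<omega>) \<partial>M) - (\<integral>\<omega>. g (\<lambda>k. y n k \<omega>) \<partial>M)\<bar> \<le> e/4 + 2 * G * prob ?A"
    proof (rule integral_diff_bound)
      fix \<omega> assume \<omega>: "\<omega> \<in> space M - ?A"
      have "(\<lambda>k. x n k \<omega>) \<in> S" "(\<lambda>k. y n k \<omega>) \<in> S" by (rule inS; use \<omega> in blast)+
      moreover have "dist (\<lambda>k. x n k \<omega>) (\<lambda>k. y n k \<omega>) < \<delta>"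
      proof (rule close)
        fix k assume "k \<in> J"
        then have "\<not> (\<delta>/4)\<^sup>2 \<le> (x n k \<omega> - y n k \<omega>)\<^sup>2" using \<omega> unfolding F_def by blast
        then show "\<bar>x n k \<omega> - y n k \<omega>\<bar> \<le> \<delta> / 4"
          using \<delta>(1) abs_le_square_iff[of "x n k \<omega> - y n k \<omega>" "\<delta>/4"] by linarith
      qed
      ultimately show "\<bar>g (\<lambda>k. x n k \<omega>) - g (\<lambda>k. y n k \<omega>)\<bar> \<le> e/4" using \<delta>(2) by (simp add: less_imp_le)
    qed (rule borel_measurable_continuous_seq[OF g mx] borel_measurable_continuous_seq[OF g my] G A | use e in simp)+
    also have "\<dots> \<le> e/4 + 2 * G * (2 * (1 / c) + D n / (\<delta>/4)\<^sup>2)"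
      using PA G0 by (intro add_left_mono mult_left_mono) auto
    also have "\<dots> < e" using c(2) n0[OF n(1)] e by (simp add: distrib_left)
    finally show "norm ((\<integral>\<omega>. g (\<lambda>k. x n k \<omega>) \<partial>M) - (\<integral>\<omega>. g (\<lambda>k. y n k \<omega>) \<partial>M) - 0) < e" by simp
  qed
qed

subsection \<open>Power series with random coefficients\<close>

abbreviation disc :: "complex set" where "disc \<equiv> ball 0 1"

definition power_sum :: "(nat \<Rightarrow> real) \<Rightarrow> complex \<Rightarrow> complex" where
  "power_sum a = (\<lambda>z\<in>disc. \<Sum>k. of_real (a k) * z ^ k)"

definition trunc_seq :: "nat \<Rightarrow> (nat \<Rightarrow> real) \<Rightarrow> nat \<Rightarrow> real" where
  "trunc_seq m a k = (if k \<le> m then a k else 0)"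

text \<open>A majorant whose power series converges in the unit disc; under it, coefficientwise
  convergence implies locally uniform convergence.\<close>

definition dominating :: "(nat \<Rightarrow> real) \<Rightarrow> bool" where
  "dominating b \<longleftrightarrow> (\<forall>k. 0 \<le> b k) \<and> (\<forall>r\<in>{0..<1}. summable (\<lambda>k. b k * r ^ k))"

lemma compact_in_disc:
  assumes "compact K" "K \<subseteq> disc"
  obtains r where "0 \<le> r" "r < 1" "K \<subseteq> cball 0 r"
proof (cases "K = {}")
  case False
  obtain z where z: "z \<in> K" "\<And>w. w \<in> K \<Longrightarrow> norm w \<le> norm z"
    using continuous_attains_sup[OF assms(1) False continuous_on_norm_id] by blast
  show ?thesis by (rule that[of "norm z"]) (use z assms(2) in auto)
qed (use that[of 0] in auto)

lemma dominating_summable: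
  assumes "dominating b" "\<And>k. \<bar>a k\<bar> \<le> b k" "norm z < 1"
  shows "summable (\<lambda>k. norm (complex_of_real (a k) * z ^ k))"
proof (rule summable_comparison_test')
  show "summable (\<lambda>k. b k * norm z ^ k)" using assms by (auto simp: dominating_def)
  show "norm (norm (complex_of_real (a k) * z ^ k)) \<le> b k * norm z ^ k" for k
    using assms(2)[of k] by (simp add: norm_mult norm_power mult_right_mono)
qed

lemma power_sum_holomorphic:
  assumes "dominating b" "\<And>k. \<bar>a k\<bar> \<le> b k"
  shows "power_sum a \<in> holomorphic_space disc"
proof -
  have "power_sum a holomorphic_on disc"
  proof (rule power_series_holomorphic)
    fix w :: complex assume w: "w \<in> disc"
    have "summable (\<lambda>k. complex_of_real (a k) * w ^ k)"
      by (rule summable_norm_cancel, rule dominating_summable[OF assms]) (use w in simp)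
    then show "(\<lambda>k. complex_of_real (a k) * (w - 0) ^ k) sums power_sum a w"
      using w by (simp add: power_sum_def summable_sums)
  qed
  then show ?thesis by (simp add: holomorphic_space_def power_sum_def)
qed

text \<open>On a disc of radius \<open>r < 1\<close> the error is at most a series with majorant
  \<open>2 * (b k * r ^ k)\<close>, and Tannery's theorem allows passing to the limit
  termwise.\<close>

lemma power_sum_limit:
  assumes b: "dominating b" and ai: "\<And>i k. \<bar>a i k\<bar> \<le> b k" and lim: "\<And>k. (\<lambda>i. a i k) \<longlonglongrightarrow> l k"
  shows "limitin (holomorphic_topology disc) (\<lambda>i. power_sum (a i)) (power_sum l) sequentially"
proof -
  have l: "\<bar>l k\<bar> \<le> b k" for k
    by (rule LIMSEQ_le_const2[OF tendsto_rabs[OF lim]]) (use ai in auto)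
  show ?thesis
  proof (subst limitin_holomorphic_topology)
    show "power_sum (a i) \<in> holomorphic_space disc" for i by (rule power_sum_holomorphic[OF b ai])
    show "power_sum l \<in> holomorphic_space disc" by (rule power_sum_holomorphic[OF b l])
    show "\<forall>K. compact K \<and> K \<subseteq> disc \<longrightarrow> uniform_limit K (\<lambda>i. power_sum (a i)) (power_sum l) sequentially"
    proof (intro allI impI)
      fix K :: "complex set" assume K: "compact K \<and> K \<subseteq> disc"
      then obtain r where r: "0 \<le> r" "r < 1" "K \<subseteq> cball 0 r" using compact_in_disc by blast
      have sb: "summable (\<lambda>k. b k * r ^ k)" using b r by (simp add: dominating_def)
      define d where "d = (\<lambda>i. \<Sum>k. \<bar>a i k - l k\<bar> * r ^ k)"
      have db: "\<bar>a i k - l k\<bar> * r ^ k \<le> 2 * (b k * r ^ k)" for i k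
      proof -
        have "\<bar>a i k - l k\<bar> \<le> 2 * b k" using ai[of i k] l[of k] by linarith
        then have "\<bar>a i k - l k\<bar> * r ^ k \<le> 2 * b k * r ^ k" using r by (intro mult_right_mono) auto
        then show ?thesis by simp
      qed
      have sd: "summable (\<lambda>k. \<bar>a i k - l k\<bar> * r ^ k)" for i
        by (rule summable_comparison_test'[OF summable_mult[OF sb, of 2]]) (use db r in auto)
      have "(\<forall>\<^sub>F i in sequentially. summable (\<lambda>k. norm (\<bar>a i k - l k\<bar> * r ^ k))) \<and>
        summable (\<lambda>k. norm (0 * r ^ k)) \<and> d \<longlonglongrightarrow> (\<Sum>k. 0 * r ^ k)"
        unfolding d_def
      proof (rule tannerys_theorem)
        show "(\<lambda>i. \<bar>a i k - l k\<bar> * r ^ k) \<longlonglongrightarrow> 0 * r ^ k" for k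
          by (intro tendsto_mult tendsto_const tendsto_rabs_zero) (use lim[of k] in \<open>simp add: LIM_zero_iff\<close>)
        show "\<forall>\<^sub>F (k, i) in sequentially \<times>\<^sub>F sequentially. norm (\<bar>a i k - l k\<bar> * r ^ k) \<le> 2 * (b k * r ^ k)"
          using db r by (intro always_eventually) auto
        show "summable (\<lambda>k. 2 * (b k * r ^ k))" by (rule summable_mult[OF sb])
      qed auto
      then have d0: "d \<longlonglongrightarrow> 0" by simp
      have close: "dist (power_sum (a i) z) (power_sum l z) \<le> d i" if z: "z \<in> K" for i z
      proof -
        have zr: "norm z \<le> r" "norm z < 1" using z r by auto
        note sa = summable_norm_cancel[OF dominating_summable[OF b ai[of i] zr(2)]]
        note sl = summable_norm_cancel[OF dominating_summable[OF b l zr(2)]]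
        have "power_sum (a i) z - power_sum l z = (\<Sum>k. of_real (a i k) * z ^ k - of_real (l k) * z ^ k)"
          using zr suminf_diff[OF sa sl] by (simp add: power_sum_def)
        also have "norm \<dots> \<le> (\<Sum>k. \<bar>a i k - l k\<bar> * r ^ k)"
        proof (rule norm_suminf_le[OF _ sd])
          fix k
          have "norm (complex_of_real (a i k) * z ^ k - of_real (l k) * z ^ k) = \<bar>a i k - l k\<bar> * norm z ^ k"
            by (simp add: left_diff_distrib[symmetric] norm_mult norm_power of_real_diff[symmetric] del: of_real_diff)
          also have "\<dots> \<le> \<bar>a i k - l k\<bar> * r ^ k" using zr r by (intro mult_left_mono power_mono) auto
          finally show "norm (complex_of_real (a i k) * z ^ k - of_real (l k) * z ^ k) \<le> \<bar>a i k - l k\<bar> * r ^ k" .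
        qed
        finally show ?thesis by (simp add: d_def dist_norm)
      qed
      show "uniform_limit K (\<lambda>i. power_sum (a i)) (power_sum l) sequentially"
      proof (rule uniform_limitI)
        fix e :: real assume "e > 0"
        with d0 have "\<forall>\<^sub>F i in sequentially. d i < e" by (rule order_tendstoD)
        then show "\<forall>\<^sub>F i in sequentially. \<forall>z\<in>K. dist (power_sum (a i) z) (power_sum l z) < e"
          by eventually_elim (use close in \<open>auto intro: le_less_trans\<close>)
      qed
    qed
  qed
qed

lemma dominating_finite: "dominating (\<lambda>k. if k \<le> m then B else 0)" if "B \<ge> 0"
proof -
  have "summable (\<lambda>k. (if k \<le> m then B else 0) * r ^ k)" for r :: real
    by (rule summable_finite[of "{..m}"]) auto
  then show ?thesis using that by (simp add: dominating_def)
qed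

lemma power_sum_truncate:
  "power_sum (trunc_seq m a) = (\<lambda>z\<in>disc. \<Sum>k\<le>m. of_real (a k) * z ^ k)"
proof -
  have "(\<Sum>k. of_real (trunc_seq m a k) * z ^ k) = (\<Sum>k\<le>m. of_real (a k) * z ^ k)" for z :: complex
    by (subst suminf_finite[of "{..m}"]) (auto simp: trunc_seq_def)
  then show ?thesis by (simp add: power_sum_def)
qed

lemma truncate_holomorphic: "power_sum (trunc_seq m a) \<in> holomorphic_space disc"
proof (rule power_sum_holomorphic[OF dominating_finite])
  show "0 \<le> (\<Sum>k\<le>m. \<bar>a k\<bar>)" by (rule sum_nonneg) simp
  show "\<bar>trunc_seq m a k\<bar> \<le> (if k \<le> m then \<Sum>k\<le>m. \<bar>a k\<bar> else 0)" for k
    using member_le_sum[of k "{..m}" "\<lambda>k. \<bar>a k\<bar>"] by (simp add: trunc_seq_def)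
qed

text \<open>Only the coordinates up to \<open>m\<close> matter, so the cylinders \<open>A i\<close>
  provide a sequence violating openness if there is any; \<open>power_sum_limit\<close> contradicts
  it.\<close>

lemma open_truncated_preimage:
  assumes U: "openin (holomorphic_topology disc) U"
  shows "open {a. power_sum (trunc_seq m a) \<in> U}"
proof (subst open_subopen, intro ballI, rule ccontr)
  fix a assume "a \<in> {a. power_sum (trunc_seq m a) \<in> U}"
  then have a: "power_sum (trunc_seq m a) \<in> U" by simp
  assume no: "\<not> (\<exists>T. open T \<and> a \<in> T \<and> T \<subseteq> {a. power_sum (trunc_seq m a) \<in> U})"
  define A where "A = (\<lambda>i::nat. {a' :: nat \<Rightarrow> real. \<forall>k\<in>{..m}. \<bar>a' k - a k\<bar> < 1 / real (Suc i)})"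
  have Ao: "open (A i)" for i
  proof -
    have "A i = (\<Inter>k\<in>{..m}. {a'. \<bar>a' k - a k\<bar> < 1 / real (Suc i)})" by (auto simp: A_def)
    moreover have "open {a' :: nat \<Rightarrow> real. \<bar>a' k - a k\<bar> < 1 / real (Suc i)}" for k
      by (intro open_Collect_less continuous_intros continuous_on_product_coordinates)
    ultimately show ?thesis by auto
  qed
  have Aa: "a \<in> A i" for i by (simp add: A_def)
  have "\<exists>a'. a' \<in> A i \<and> power_sum (trunc_seq m a') \<notin> U" for i
    using no Ao[of i] Aa[of i] by blast
  then obtain s where s: "\<And>i. s i \<in> A i" "\<And>i. power_sum (trunc_seq m (s i)) \<notin> U" by metis
  have lim: "(\<lambda>i. trunc_seq m (s i) k) \<longlonglongrightarrow> trunc_seq m a k" for k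
  proof (cases "k \<le> m")
    case True
    have "(\<lambda>i. s i k - a k) \<longlonglongrightarrow> 0"
    proof (rule Lim_null_comparison[OF _ LIMSEQ_inverse_real_of_nat])
      have "norm (s i k - a k) \<le> inverse (real (Suc i))" for i
      proof -
        have "\<bar>s i k - a k\<bar> < 1 / real (Suc i)" using s(1)[of i] True unfolding A_def by blast
        then show ?thesis by (simp add: inverse_eq_divide)
      qed
      then show "\<forall>\<^sub>F i in sequentially. norm (s i k - a k) \<le> inverse (real (Suc i))" by (intro always_eventually allI)
    qed
    then show ?thesis using True by (simp add: trunc_seq_def LIM_zero_iff)
  qed (simp add: trunc_seq_def)
  have bound: "\<bar>trunc_seq m (s i) k\<bar> \<le> (if k \<le> m then (\<Sum>k\<le>m. \<bar>a k\<bar>) + 1 else 0)" for i k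
  proof (cases "k \<le> m")
    case True
    have "\<bar>s i k - a k\<bar> < 1 / real (Suc i)" using s(1)[of i] True unfolding A_def by blast
    also have "\<dots> \<le> 1" by simp
    finally have "\<bar>s i k\<bar> \<le> \<bar>a k\<bar> + 1" by linarith
    moreover have "\<bar>a k\<bar> \<le> (\<Sum>k\<le>m. \<bar>a k\<bar>)" using True by (intro member_le_sum) auto
    ultimately show ?thesis using True by (simp add: trunc_seq_def)
  qed (simp add: trunc_seq_def)
  have "0 \<le> (\<Sum>k\<le>m. \<bar>a k\<bar>) + 1" by (intro add_nonneg_nonneg sum_nonneg) auto
  from power_sum_limit[OF dominating_finite[OF this] bound lim]
  have "\<forall>\<^sub>F i in sequentially. power_sum (trunc_seq m (s i)) \<in> U"
    using U a unfolding limitin_def by blast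
  then show False using s(2) by simp
qed

lemma continuous_map_truncated:
  "continuous_map euclidean (holomorphic_topology disc) (\<lambda>a. power_sum (trunc_seq m a))"
  unfolding continuous_map_def using open_truncated_preimage truncate_holomorphic by auto

lemma continuous_truncated_functional:
  assumes f: "continuous_map (holomorphic_topology disc) euclideanreal f"
  shows "continuous_on UNIV (\<lambda>a. f (power_sum (trunc_seq m a)))"
  using continuous_map_compose[OF continuous_map_truncated f] by (simp add: comp_def)

section \<open>Measurability in the space of holomorphic functions\<close>

lemma openin_disc_nhd:
  assumes K: "compact K" "K \<subseteq> disc" and f: "f \<in> holomorphic_space disc"
  shows "openin (holomorphic_topology disc) {g \<in> holomorphic_space disc. \<forall>z\<in>K. dist (g z) (f z) < e}"
  unfolding openin_holomorphic_topology
proof (intro conjI ballI)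
  fix g assume g: "g \<in> {g \<in> holomorphic_space disc. \<forall>z\<in>K. dist (g z) (f z) < e}"
  show "\<exists>K' d. compact K' \<and> K' \<subseteq> disc \<and> d > 0 \<and>
      {h \<in> holomorphic_space disc. \<forall>z\<in>K'. dist (h z) (g z) < d} \<subseteq> {g \<in> holomorphic_space disc. \<forall>z\<in>K. dist (g z) (f z) < e}"
  proof (cases "K = {}")
    case True
    then show ?thesis by (intro exI[of _ "{}"] exI[of _ 1]) auto
  next
    case False
    have "continuous_on K (\<lambda>z. dist (g z) (f z))"
      using K g f unfolding holomorphic_space_def
      by (intro continuous_on_dist holomorphic_on_imp_continuous_on) (auto intro: holomorphic_on_subset)
    then obtain z where z: "z \<in> K" "\<And>w. w \<in> K \<Longrightarrow> dist (g w) (f w) \<le> dist (g z) (f z)"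
      using continuous_attains_sup[OF K(1) False] by blast
    define d where "d = e - dist (g z) (f z)"
    have "d > 0" using g z(1) by (simp add: d_def)
    moreover have "dist (h w) (f w) < e" if "w \<in> K" "dist (h w) (g w) < d" for h w
      using dist_triangle[of "h w" "f w" "g w"] z(2)[OF that(1)] that(2) by (simp add: d_def)
    ultimately show ?thesis using K by (intro exI[of _ K] exI[of _ d]) auto
  qed
qed auto

lemma measurable_borel_measure_ofI:
  assumes "\<And>\<omega>. \<omega> \<in> space M \<Longrightarrow> W \<omega> \<in> topspace T" "\<And>U. openin T U \<Longrightarrow> W -` U \<inter> space M \<in> sets M"
  shows "W \<in> measurable M (borel_measure_of T)"
  unfolding borel_measure_of_def
proof (rule measurable_measure_of)
  show "{U. openin T U} \<subseteq> Pow (topspace T)" by (auto dest: openin_subset)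
qed (use assms in auto)

lemma measurable_borel_measure_ofD:
  assumes "W \<in> measurable M (borel_measure_of T)" "openin T U"
  shows "W -` U \<inter> space M \<in> sets M"
proof -
  have "U \<in> sets (borel_measure_of T)"
    unfolding borel_measure_of_def using assms(2) openin_subset by (subst sets_measure_of) auto
  then show ?thesis using measurable_sets[OF assms(1)] by blast
qed

lemma measurable_truncated:
  assumes "\<And>k. a k \<in> borel_measurable M"
  shows "(\<lambda>\<omega>. power_sum (trunc_seq m (\<lambda>k. a k \<omega>))) \<in> measurable M (borel_measure_of (holomorphic_topology disc))"
proof (rule measurable_borel_measure_ofI)
  fix U assume U: "openin (holomorphic_topology disc) U"
  have "(\<lambda>\<omega> k. a k \<omega>) \<in> borel_measurable M" by (rule measurable_coordinatewise_then_product) (rule assms)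
  from measurable_sets[OF this borel_open[OF open_truncated_preimage[OF U, of m]]]
  show "(\<lambda>\<omega>. power_sum (trunc_seq m (\<lambda>k. a k \<omega>))) -` U \<inter> space M \<in> sets M"
    by (simp add: vimage_def)
qed (simp add: truncate_holomorphic)

text \<open>The set \<open>B j\<close> collects the functions within \<open>e j / 2\<close> on
  \<open>K j\<close> of some \<open>f\<close> whose neighbourhood of radius \<open>e j\<close> lies
  in \<open>U\<close>. The limit lies in \<open>U\<close> iff the approximations eventually lie in
  one of the open sets \<open>B j\<close>, a countable combination of measurable events.\<close>

lemma measurable_limit_disc:
  assumes W: "\<And>m. W m \<in> measurable M (borel_measure_of (holomorphic_topology disc))"
    and lim: "\<And>\<omega>. \<omega> \<in> space M \<Longrightarrow> limitin (holomorphic_topology disc) (\<lambda>m. W m \<omega>) (V \<omega>) sequentially"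
    and Wh: "\<And>m \<omega>. \<omega> \<in> space M \<Longrightarrow> W m \<omega> \<in> holomorphic_space disc"
    and Vh: "\<And>\<omega>. \<omega> \<in> space M \<Longrightarrow> V \<omega> \<in> holomorphic_space disc"
  shows "V \<in> measurable M (borel_measure_of (holomorphic_topology disc))"
proof (rule measurable_borel_measure_ofI)
  fix U assume U: "openin (holomorphic_topology disc) U"
  define K :: "nat \<Rightarrow> complex set" where "K = (\<lambda>j. cball 0 (1 - 1 / real (Suc j)))"
  define nhd where "nhd = (\<lambda>j e f. {g \<in> holomorphic_space disc. \<forall>z\<in>K j. dist (g z) (f z) < e})"
  define e :: "nat \<Rightarrow> real" where "e = (\<lambda>j. 1 / real (Suc j))"
  \<comment> \<open>The radius is halved because the distances from the limit to
    \<open>W m \<omega>\<close> and from there to \<open>f\<close> must together stay below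
    \<open>e j\<close>.\<close>
  define B where "B = (\<lambda>j. \<Union>f\<in>{f \<in> holomorphic_space disc. nhd j (e j) f \<subseteq> U}. nhd j (e j / 2) f)"
  have Kd: "compact (K j)" "K j \<subseteq> disc" for j
  proof -
    have "1 - 1 / real (Suc j) < 1" by simp
    then show "K j \<subseteq> disc" unfolding K_def by (intro cball_subset_ball_iff[THEN iffD2]) simp
  qed (simp add: K_def)
  have No: "openin (holomorphic_topology disc) (nhd j d f)" if "f \<in> holomorphic_space disc" for j d f
    unfolding nhd_def by (rule openin_disc_nhd[OF Kd that])
  have Bo: "openin (holomorphic_topology disc) (B j)" for j
    unfolding B_def by (rule openin_Union) (use No in blast)
  have iff: "V \<omega> \<in> U \<longleftrightarrow> (\<exists>j. \<exists>m0. \<forall>m\<ge>m0. W m \<omega> \<in> B j)" if \<omega>: "\<omega> \<in> space M" for \<omega>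
  proof -
    have u: "\<exists>m0. \<forall>m\<ge>m0. \<forall>z\<in>K j. dist (W m \<omega> z) (V \<omega> z) < d" if "d > 0" for j d
    proof -
      have "uniform_limit (K j) (\<lambda>m. W m \<omega>) (V \<omega>) sequentially"
        using limitin_holomorphic_topology[of "\<lambda>m. W m \<omega>" disc "V \<omega>" sequentially] Wh[OF \<omega>] Vh[OF \<omega>] lim[OF \<omega>] Kd[of j] by blast
      from uniform_limitD[OF this that] show ?thesis by (simp add: eventually_sequentially)
    qed
    show ?thesis
    proof
      assume "V \<omega> \<in> U"
      then obtain K' d where K': "compact K'" "K' \<subseteq> disc" "d > 0"
        "{g \<in> holomorphic_space disc. \<forall>z\<in>K'. dist (g z) (V \<omega> z) < d} \<subseteq> U"
        using U unfolding openin_holomorphic_topology by blast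
      obtain r where r: "0 \<le> r" "r < 1" "K' \<subseteq> cball 0 r" using compact_in_disc[OF K'(1,2)] by blast
      obtain j where j: "1 / real (Suc j) < min d (1 - r)"
        using reals_Archimedean[of "min d (1 - r)"] K' r by (auto simp: inverse_eq_divide)
      have "K' \<subseteq> K j" using r j unfolding K_def by (intro order_trans[OF r(3)]) auto
      then have sub: "nhd j (e j) (V \<omega>) \<subseteq> U"
        using K'(4) j unfolding nhd_def e_def by (intro order_trans[OF _ K'(4)]) fastforce
      have "e j / 2 > 0" by (simp add: e_def)
      from u[OF this, of j] obtain m0 where "\<forall>m\<ge>m0. \<forall>z\<in>K j. dist (W m \<omega> z) (V \<omega> z) < e j / 2" by blast
      then have "\<forall>m\<ge>m0. W m \<omega> \<in> B j" using Wh[OF \<omega>] Vh[OF \<omega>] sub unfolding B_def nhd_def by blast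
      then show "\<exists>j. \<exists>m0. \<forall>m\<ge>m0. W m \<omega> \<in> B j" by blast
    next
      assume "\<exists>j. \<exists>m0. \<forall>m\<ge>m0. W m \<omega> \<in> B j"
      then obtain j m0 where m0: "\<forall>m\<ge>m0. W m \<omega> \<in> B j" by blast
      have "e j / 2 > 0" by (simp add: e_def)
      from u[OF this, of j] obtain m1 where m1: "\<forall>m\<ge>m1. \<forall>z\<in>K j. dist (W m \<omega> z) (V \<omega> z) < e j / 2" by blast
      define m where "m = max m0 m1"
      have "W m \<omega> \<in> B j" using m0 by (simp add: m_def)
      then obtain f where f: "nhd j (e j) f \<subseteq> U" "\<And>z. z \<in> K j \<Longrightarrow> dist (W m \<omega> z) (f z) < e j / 2"
        unfolding B_def nhd_def by blast
      have "dist (V \<omega> z) (f z) < e j" if "z \<in> K j" for z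
      proof -
        have "dist (W m \<omega> z) (V \<omega> z) < e j / 2" using m1 that by (simp add: m_def)
        with f(2)[OF that] show ?thesis using dist_triangle3[of "V \<omega> z" "f z" "W m \<omega> z"] by linarith
      qed
      then have "V \<omega> \<in> nhd j (e j) f" using Vh[OF \<omega>] by (simp add: nhd_def)
      then show "V \<omega> \<in> U" using f(1) by blast
    qed
  qed
  have WB: "W m -` B j \<inter> space M \<in> sets M" for m j by (rule measurable_borel_measure_ofD[OF W Bo])
  have "V -` U \<inter> space M = (\<Union>j. \<Union>m0. (\<Inter>m\<in>{m0..}. W m -` B j \<inter> space M))"
  proof (rule Set.set_eqI)
    fix \<omega>
    have "\<omega> \<in> V -` U \<inter> space M \<longleftrightarrow> \<omega> \<in> space M \<and> (\<exists>j. \<exists>m0. \<forall>m\<ge>m0. W m \<omega> \<in> B j)"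
      using iff by blast
    also have "\<dots> \<longleftrightarrow> \<omega> \<in> (\<Union>j. \<Union>m0. (\<Inter>m\<in>{m0..}. W m -` B j \<inter> space M))"
      unfolding UN_iff INT_iff Int_iff vimage_eq Ball_def atLeast_iff by blast
    finally show "\<omega> \<in> V -` U \<inter> space M \<longleftrightarrow> \<omega> \<in> (\<Union>j. \<Union>m0. (\<Inter>m\<in>{m0..}. W m -` B j \<inter> space M))" .
  qed
  also have "\<dots> \<in> sets M"
    using WB by (intro sets.countable_UN sets.countable_INT' image_subsetI countableI_type) auto
  finally show "V -` U \<inter> space M \<in> sets M" .
qed (simp add: Vh)

text \<open>The squared widths have reciprocals with sum \<open>1 / c\<close>, so bounded second
  moments keep the coefficients inside with high probability. Their polynomial growth preserves
  convergence in the whole unit disc, which geometrically growing widths would destroy.\<close>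

definition coefficient_box :: "real \<Rightarrow> nat \<Rightarrow> real" where
  "coefficient_box c k = sqrt (c * (real (Suc k) * real (Suc (Suc k))))"

lemma sums_inverse_pronic: "(\<lambda>k. 1 / (real (Suc k) * real (Suc (Suc k)))) sums 1"
proof -
  have "(\<lambda>k. 1 / real (Suc k)) \<longlonglongrightarrow> 0"
    using LIMSEQ_inverse_real_of_nat by (simp add: inverse_eq_divide)
  from telescope_sums'[OF this] show ?thesis by (simp add: field_simps)
qed

lemma dominating_coefficient_box:
  assumes "c \<ge> 0"
  shows "dominating (coefficient_box c)"
  unfolding dominating_def
proof (intro conjI allI ballI)
  fix r :: real assume r: "r \<in> {0..<1}"
  have geo: "summable (\<lambda>n. 1 * x ^ n)" if "norm x < 1" for x :: real
    using summable_geometric[OF that] by simp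
  have "summable (\<lambda>n. diffs (\<lambda>_. 1) n * x ^ n)" if "norm x < 1" for x :: real
    using termdiff_converges[OF that geo] by simp
  from this[of r] have s1: "summable (\<lambda>n. real (Suc n) * r ^ n)" using r by (simp add: diffs_def)
  have "summable (\<lambda>n. sqrt c * (2 * (real (Suc n) * r ^ n)))" by (intro summable_mult s1)
  then show "summable (\<lambda>k. coefficient_box c k * r ^ k)"
  proof (rule summable_comparison_test')
    fix k
    have "real (Suc k) * real (Suc (Suc k)) \<le> (2 * real (Suc k)) * (2 * real (Suc k))" by (intro mult_mono) auto
    then have "sqrt (real (Suc k) * real (Suc (Suc k))) \<le> sqrt ((2 * real (Suc k))\<^sup>2)"
      by (simp only: power2_eq_square real_sqrt_le_iff)
    then have "sqrt (real (Suc k) * real (Suc (Suc k))) \<le> 2 * real (Suc k)" by simp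
    then have "coefficient_box c k \<le> sqrt c * (2 * real (Suc k))"
      using assms unfolding coefficient_box_def real_sqrt_mult[of c] by (intro mult_left_mono) auto
    then have "coefficient_box c k * r ^ k \<le> sqrt c * (2 * real (Suc k)) * r ^ k" using r by (intro mult_right_mono) auto
    moreover have "0 \<le> coefficient_box c k * r ^ k" using r assms by (simp add: coefficient_box_def)
    ultimately show "norm (coefficient_box c k * r ^ k) \<le> sqrt c * (2 * (real (Suc k) * r ^ k))"
      unfolding real_norm_def by (simp only: abs_of_nonneg mult.assoc)
  qed
qed (use assms in \<open>simp add: coefficient_box_def\<close>)

text \<open>
  On a compact box of coefficient sequences, truncation changes a continuous functional of the
  power series arbitrarily little, uniformly: otherwise a subsequence would violate continuity.
\<close>

lemma truncation_uniform:
  assumes f: "continuous_map (holomorphic_topology disc) euclideanreal f" and c: "c \<ge> 0" and e: "e > 0"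
  shows "\<exists>m. \<forall>m'\<ge>m. \<forall>a. (\<forall>k. \<bar>a k\<bar> \<le> coefficient_box c k) \<longrightarrow> \<bar>f (power_sum a) - f (power_sum (trunc_seq m' a))\<bar> < e"
proof (rule ccontr)
  let ?S = "{a :: nat \<Rightarrow> real. \<forall>k. a k \<in> {- coefficient_box c k..coefficient_box c k}}"
  assume "\<not> ?thesis"
  then have "\<forall>m. \<exists>m' a. m \<le> m' \<and> (\<forall>k. \<bar>a k\<bar> \<le> coefficient_box c k) \<and> e \<le> \<bar>f (power_sum a) - f (power_sum (trunc_seq m' a))\<bar>"
    by (meson not_less)
  then obtain m a where ma: "\<And>i. i \<le> m i" "\<And>i k. \<bar>a i k\<bar> \<le> coefficient_box c k"
    "\<And>i. e \<le> \<bar>f (power_sum (a i)) - f (power_sum (trunc_seq (m i) (a i)))\<bar>" by metis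
  have sc: "seq_compact ?S" by (rule compact_imp_seq_compact[OF compact_box])
  have aS: "\<forall>i. a i \<in> ?S"
  proof (intro allI CollectI)
    fix i k
    show "a i k \<in> {- coefficient_box c k..coefficient_box c k}"
      unfolding atLeastAtMost_iff using ma(2)[of i k] by linarith
  qed
  \<comment> \<open>Along a subsequence the coefficients converge to \<open>l\<close>. So do their
    truncations, because \<open>i \<le> m i\<close> makes the cutoff pass every fixed index.\<close>
  from seq_compactE[OF sc aS] obtain l r where r: "strict_mono r" "(a \<circ> r) \<longlonglongrightarrow> l" .
  have lim: "(\<lambda>i. a (r i) k) \<longlonglongrightarrow> l k" for k
  proof -
    have "continuous_on UNIV (\<lambda>x :: nat \<Rightarrow> real. x k)" by (rule continuous_on_product_coordinates)
    from continuous_on_tendsto_compose[OF this r(2)] show ?thesis by (simp add: comp_def)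
  qed
  have lim': "(\<lambda>i. trunc_seq (m (r i)) (a (r i)) k) \<longlonglongrightarrow> l k" for k
  proof (rule Lim_transform_eventually[OF lim])
    show "\<forall>\<^sub>F i in sequentially. a (r i) k = trunc_seq (m (r i)) (a (r i)) k"
      using eventually_ge_at_top[of k]
    proof eventually_elim
      case (elim i)
      have "k \<le> m (r i)" using elim seq_suble[OF r(1), of i] ma(1)[of "r i"] by linarith
      then show ?case by (simp add: trunc_seq_def)
    qed
  qed
  note dom = dominating_coefficient_box[OF c]
  have tb: "\<bar>trunc_seq (m (r i)) (a (r i)) k\<bar> \<le> coefficient_box c k" for i k
    using ma(2)[of "r i" k] by (auto simp: trunc_seq_def)
  have "(\<lambda>i. f (power_sum (a (r i)))) \<longlonglongrightarrow> f (power_sum l)"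
    using continuous_map_limit[OF f power_sum_limit[OF dom ma(2) lim]] by (simp add: comp_def)
  moreover have "(\<lambda>i. f (power_sum (trunc_seq (m (r i)) (a (r i))))) \<longlonglongrightarrow> f (power_sum l)"
    using continuous_map_limit[OF f power_sum_limit[OF dom tb lim']] by (simp add: comp_def)
  ultimately have "(\<lambda>i. \<bar>f (power_sum (a (r i))) - f (power_sum (trunc_seq (m (r i)) (a (r i))))\<bar>) \<longlonglongrightarrow> \<bar>f (power_sum l) - f (power_sum l)\<bar>"
    by (intro tendsto_intros)
  from LIMSEQ_le_const[OF this, of e] ma(3) e show False by auto
qed

subsection \<open>The Poisson limit\<close>

lemma poisson_pgf_sums:
  fixes x r :: real
  shows "(\<lambda>k. r ^ k / fact k * exp (- r) * x ^ k) sums exp (r * (x - 1))"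
proof -
  have "(\<lambda>k. (r * x) ^ k / fact k) sums exp (r * x)"
    using exp_converges[of "r * x"] by (simp add: divide_inverse mult.commute)
  from sums_mult[OF this, of "exp (- r)"] have a: "(\<lambda>k. exp (- r) * ((r * x) ^ k / fact k)) sums (exp (- r) * exp (r * x))" .
  have b: "exp (- r) * ((r * x) ^ k / fact k) = r ^ k / fact k * exp (- r) * x ^ k" for k
    by (simp add: power_mult_distrib)
  have c: "exp (- r) * exp (r * x) = exp (r * (x - 1))"
    by (simp add: exp_add[symmetric] algebra_simps)
  show ?thesis using a unfolding b c .
qed

lemma (in prob_space) poisson_pgf:
  fixes x r :: real
  assumes Y: "Y \<in> measurable M (count_space UNIV)" "distr M (count_space UNIV) Y = measure_pmf (poisson_pmf r)"
    and r: "r > 0" and x: "x \<ge> 0"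
  shows "integrable M (\<lambda>\<omega>. x ^ Y \<omega>)" and "(\<integral>\<omega>. x ^ Y \<omega> \<partial>M) = exp (r * (x - 1))"
proof -
  have m: "(\<lambda>\<omega>. x ^ Y \<omega>) \<in> borel_measurable M" using Y(1) by measurable
  have "(\<integral>\<^sup>+\<omega>. ennreal (x ^ Y \<omega>) \<partial>M) = (\<integral>\<^sup>+k. ennreal (x ^ k) \<partial>distr M (count_space UNIV) Y)"
    using Y(1) by (subst nn_integral_distr) auto
  also have "\<dots> = (\<integral>\<^sup>+k. ennreal (pmf (poisson_pmf r) k) * ennreal (x ^ k) \<partial>count_space UNIV)"
    unfolding Y(2) by (rule nn_integral_measure_pmf)
  also have "\<dots> = (\<Sum>k. ennreal (r ^ k / fact k * exp (- r) * x ^ k))"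
    unfolding nn_integral_count_space_nat using r x by (intro suminf_cong) (simp add: ennreal_mult[symmetric])
  also have "\<dots> = ennreal (exp (r * (x - 1)))"
    using r x by (intro suminf_ennreal_eq poisson_pgf_sums) auto
  finally have "(\<integral>\<^sup>+\<omega>. ennreal (x ^ Y \<omega>) \<partial>M) = ennreal (exp (r * (x - 1)))" .
  then have "integrable M (\<lambda>\<omega>. x ^ Y \<omega>) \<and> (\<integral>\<omega>. x ^ Y \<omega> \<partial>M) = exp (r * (x - 1))"
    using x by (subst (asm) nn_integral_eq_integrable[OF m]) auto
  then show "integrable M (\<lambda>\<omega>. x ^ Y \<omega>)" "(\<integral>\<omega>. x ^ Y \<omega> \<partial>M) = exp (r * (x - 1))" by auto
qed

text \<open>The index \<open>i\<close> enumerates the cycle types: \<open>2 * (q - 1)\<close> for positive and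
  \<open>2 * (q - 1) + 1\<close> for negative cycles of length \<open>q\<close>.\<close>

definition type_of :: "nat \<Rightarrow> nat \<times> bool" where "type_of i = (Suc (i div 2), even i)"

definition type_index :: "nat \<times> bool \<Rightarrow> nat" where
  "type_index \<tau> = 2 * (fst \<tau> - 1) + (if snd \<tau> then 0 else 1)"

lemma type_index_type_of [simp]: "type_index (type_of i) = i"
  by (auto simp: type_index_def type_of_def elim: evenE oddE)

lemma type_of_type_index: "fst \<tau> > 0 \<Longrightarrow> type_of (type_index \<tau>) = \<tau>"
  by (cases \<tau>) (auto simp: type_index_def type_of_def)

lemma inj_type_of: "inj type_of"
  by (rule inj_on_inverseI[where g = type_index]) simp

text \<open>The trace formula as a function of the enumerated counts, so that the rounded matrix and
  the limit are images of two count sequences under the same continuous map.\<close>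

definition cycle_traces :: "(nat \<Rightarrow> real) \<Rightarrow> nat \<Rightarrow> real" where
  "cycle_traces c k = (\<Sum>q | q dvd k. real q * (c (type_index (q, True)) + (-1) ^ (k div q) * c (type_index (q, False))))"

lemma continuous_on_cycle_traces: "continuous_on UNIV cycle_traces"
proof (rule continuous_on_coordinatewise_then_product)
  show "continuous_on UNIV (\<lambda>c. cycle_traces c k)" for k
    unfolding cycle_traces_def by (intro continuous_intros continuous_on_product_coordinates)
qed

lemma continuous_on_newton_seq: "continuous_on UNIV (newton :: (nat \<Rightarrow> real) \<Rightarrow> nat \<Rightarrow> real)"
  by (rule continuous_on_coordinatewise_then_product) (rule continuous_on_newton)

locale poisson_cycles = M': prob_space M'
  for M' :: "'b measure" and Nm Np :: "nat \<Rightarrow> 'b \<Rightarrow> nat" +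
  assumes indep_Nm: "M'.indep_vars (\<lambda>_. count_space UNIV) Nm {1..}"
    and indep_Np: "M'.indep_vars (\<lambda>_. count_space UNIV) Np {1..}"
    and indep_Nm_Np: "M'.indep_var (\<Pi>\<^sub>M q\<in>{1..}. count_space UNIV) (\<lambda>\<omega>. \<lambda>q\<in>{1..}. Nm q \<omega>)
           (\<Pi>\<^sub>M q\<in>{1..}. count_space UNIV) (\<lambda>\<omega>. \<lambda>q\<in>{1..}. Np q \<omega>)"
    and law_Nm: "q \<ge> 1 \<Longrightarrow> distr M' (count_space UNIV) (Nm q) = measure_pmf (poisson_pmf (1 / (2 * real q)))"
    and law_Np: "q \<ge> 1 \<Longrightarrow> distr M' (count_space UNIV) (Np q) = measure_pmf (poisson_pmf (1 / (2 * real q)))"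
begin

lemma measurable_Nm: "q \<ge> 1 \<Longrightarrow> Nm q \<in> measurable M' (count_space UNIV)"
  and measurable_Np: "q \<ge> 1 \<Longrightarrow> Np q \<in> measurable M' (count_space UNIV)"
  using indep_Nm indep_Np by (auto simp: M'.indep_vars_def)

definition limit_count :: "nat \<Rightarrow> 'b \<Rightarrow> nat" where
  "limit_count i = (if even i then Np else Nm) (Suc (i div 2))"

lemma limit_count_pgf:
  fixes x :: real
  assumes "x \<ge> 0"
  shows "integrable M' (\<lambda>\<omega>. x ^ limit_count i \<omega>)"
    and "(\<integral>\<omega>. x ^ limit_count i \<omega> \<partial>M') = exp ((x - 1) / (2 * real (fst (type_of i))))"
  using M'.poisson_pgf[OF measurable_Np law_Np _ assms, of "Suc (i div 2)"]
    M'.poisson_pgf[OF measurable_Nm law_Nm _ assms, of "Suc (i div 2)"]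
  by (cases "even i"; simp add: limit_count_def type_of_def)+

lemma measurable_limit_count: "(\<lambda>\<omega>. real (limit_count i \<omega>)) \<in> borel_measurable M'"
  using measurable_Nm[of "Suc (i div 2)"] measurable_Np[of "Suc (i div 2)"]
  by (cases "even i") (auto simp: limit_count_def intro: measurable_compose)

text \<open>From \<open>n \<le> 2 ^ n\<close> and the generating function at 2, which is
  \<open>exp (1 / (2 * q)) \<le> exp 1 \<le> 3\<close>. The same 3 bounds the means of the matrix
  counts in \<open>count_convergence\<close>.\<close>

lemma limit_count_mean:
  "integrable M' (\<lambda>\<omega>. real (limit_count i \<omega>)) \<and> (\<integral>\<omega>. real (limit_count i \<omega>) \<partial>M') \<le> 3"
proof -
  have le: "real (limit_count i \<omega>) \<le> 2 ^ limit_count i \<omega>" for \<omega> by (rule less_imp_le[OF of_nat_less_two_power])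
  have i2: "integrable M' (\<lambda>\<omega>. (2::real) ^ limit_count i \<omega>)" by (rule limit_count_pgf) simp
  have int: "integrable M' (\<lambda>\<omega>. real (limit_count i \<omega>))"
    by (rule Bochner_Integration.integrable_bound[OF i2 measurable_limit_count]) (use le in auto)
  have "(\<integral>\<omega>. real (limit_count i \<omega>) \<partial>M') \<le> (\<integral>\<omega>. 2 ^ limit_count i \<omega> \<partial>M')"
    by (rule integral_mono[OF int i2]) (rule le)
  also have "\<dots> = exp ((2 - 1) / (2 * real (fst (type_of i))))" by (rule limit_count_pgf) simp
  also have "\<dots> \<le> exp 1" by (simp add: type_of_def field_simps)
  also have "\<dots> \<le> 3" by (rule exp_le)
  finally show ?thesis using int by simp
qed

lemma prod_pgf:
  fixes x :: "nat \<Rightarrow> real"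
  assumes N: "M'.indep_vars (\<lambda>_. count_space UNIV) N {1..}" and B: "finite B" "B \<subseteq> {1..}"
    and int: "\<And>q. q \<in> B \<Longrightarrow> integrable M' (\<lambda>\<omega>. x q ^ N q \<omega>)"
  shows "integrable M' (\<lambda>\<omega>. \<Prod>q\<in>B. x q ^ N q \<omega>)"
    and "(\<integral>\<omega>. (\<Prod>q\<in>B. x q ^ N q \<omega>) \<partial>M') = (\<Prod>q\<in>B. \<integral>\<omega>. x q ^ N q \<omega> \<partial>M')"
proof -
  have ind: "M'.indep_vars (\<lambda>_. borel) (\<lambda>q \<omega>. x q ^ N q \<omega>) B"
    by (rule M'.indep_vars_compose2[OF M'.indep_vars_subset[OF N B(2)]]) auto
  show "integrable M' (\<lambda>\<omega>. \<Prod>q\<in>B. x q ^ N q \<omega>)"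
    by (rule M'.indep_vars_integrable[OF B(1) ind int])
  show "(\<integral>\<omega>. (\<Prod>q\<in>B. x q ^ N q \<omega>) \<partial>M') = (\<Prod>q\<in>B. \<integral>\<omega>. x q ^ N q \<omega> \<partial>M')"
    by (rule M'.indep_vars_lebesgue_integral[OF B(1) ind int])
qed

text \<open>Independence is used between the two Poisson families and inside each of them; the
  indices below \<open>m\<close> are split by parity accordingly.\<close>

lemma joint_pgf:
  fixes x :: "nat \<Rightarrow> real"
  assumes x: "\<And>i. 0 < x i \<and> x i \<le> 1"
  shows "(\<integral>\<omega>. (\<Prod>i<m. x i ^ limit_count i \<omega>) \<partial>M') = (\<Prod>i<m. exp ((x i - 1) / (2 * real (fst (type_of i)))))"
proof -
  define B where "B = (\<lambda>s. {q. 1 \<le> q \<and> type_index (q, s) < m})"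
  define F where "F = (\<lambda>s (n::nat \<Rightarrow> nat). \<Prod>q\<in>B s. x (type_index (q, s)) ^ n q)"
  have B: "finite (B s)" "B s \<subseteq> {1..}" for s
    by (rule finite_subset[of _ "{..m}"]) (auto simp: B_def type_index_def split: if_splits)
  have split: "(\<Prod>i<m. f i) = (\<Prod>q\<in>B True. f (type_index (q, True))) * (\<Prod>q\<in>B False. f (type_index (q, False)))"
    for f :: "nat \<Rightarrow> real"
  proof -
    have e: "(\<Prod>q\<in>B s. f (type_index (q, s))) = (\<Prod>i\<in>{i. i < m \<and> even i = s}. f i)" for s
      by (rule prod.reindex_bij_witness[of _ "\<lambda>i. Suc (i div 2)" "\<lambda>q. type_index (q, s)"])
        (auto simp: B_def type_index_def split: if_splits elim: evenE oddE)
    have "{..<m} = {i. i < m \<and> even i = True} \<union> {i. i < m \<and> even i = False}" by auto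
    then show ?thesis unfolding e by (simp only:) (intro prod.union_disjoint; auto)
  qed
  have lc: "limit_count (type_index (q, True)) = Np q" "limit_count (type_index (q, False)) = Nm q" if "q \<ge> 1" for q
    using that by (auto simp: limit_count_def type_index_def)
  have eq: "(\<Prod>i<m. x i ^ limit_count i \<omega>) = F False (\<lambda>q. Nm q \<omega>) * F True (\<lambda>q. Np q \<omega>)" for \<omega>
    unfolding split F_def by (subst mult.commute) (intro arg_cong2[where f = "(*)"] prod.cong refl; auto simp: lc B_def)
  \<comment> \<open>Independence of the two families is given for their restrictions to
    \<open>{1..}\<close>, and \<open>F s\<close> reads only such indices.\<close>
  have restrict: "F s (\<lambda>q\<in>{1..}. n q) = F s n" for s n
    unfolding F_def using B(2)[of s] by (intro prod.cong refl) auto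
  have Fm: "F s \<in> borel_measurable (\<Pi>\<^sub>M q\<in>{1..}. count_space UNIV)" for s
  proof -
    have "(\<lambda>n. x (type_index (q, s)) ^ n q) \<in> borel_measurable (\<Pi>\<^sub>M q\<in>{1::nat..}. count_space (UNIV :: nat set))" if "q \<in> B s" for q
    proof -
      have "(\<lambda>n. n q) \<in> measurable (\<Pi>\<^sub>M q\<in>{1::nat..}. count_space (UNIV :: nat set)) (count_space UNIV)"
        by (rule measurable_component_singleton) (use B(2) that in auto)
      then show ?thesis by (rule measurable_compose) simp
    qed
    then show ?thesis unfolding F_def by (intro borel_measurable_prod)
  qed
  have ind: "M'.indep_var borel (\<lambda>\<omega>. F False (\<lambda>q. Nm q \<omega>)) borel (\<lambda>\<omega>. F True (\<lambda>q. Np q \<omega>))"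
    using M'.indep_var_compose[OF indep_Nm_Np Fm Fm, of False True] by (simp only: comp_def restrict)
  have x0: "0 \<le> x i" for i using x[of i] by simp
  have im: "integrable M' (\<lambda>\<omega>. x (type_index (q, False)) ^ Nm q \<omega>)" if "q \<in> B False" for q
  proof -
    have q: "q \<ge> 1" using that by (simp add: B_def)
    show ?thesis unfolding lc(2)[OF q, symmetric] by (rule limit_count_pgf(1)[OF x0])
  qed
  have ip: "integrable M' (\<lambda>\<omega>. x (type_index (q, True)) ^ Np q \<omega>)" if "q \<in> B True" for q
  proof -
    have q: "q \<ge> 1" using that by (simp add: B_def)
    show ?thesis unfolding lc(1)[OF q, symmetric] by (rule limit_count_pgf(1)[OF x0])
  qed
  note pm = prod_pgf[OF indep_Nm B, of False "\<lambda>q. x (type_index (q, False))", OF im]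
  note pp = prod_pgf[OF indep_Np B, of True "\<lambda>q. x (type_index (q, True))", OF ip]
  have "(\<integral>\<omega>. (\<Prod>i<m. x i ^ limit_count i \<omega>) \<partial>M') = (\<integral>\<omega>. F False (\<lambda>q. Nm q \<omega>) \<partial>M') * (\<integral>\<omega>. F True (\<lambda>q. Np q \<omega>) \<partial>M')"
    unfolding eq by (rule M'.indep_var_lebesgue_integral[OF ind]) (use pm(1) pp(1) in \<open>simp_all add: F_def\<close>)
  also have "(\<integral>\<omega>. F False (\<lambda>q. Nm q \<omega>) \<partial>M') = (\<Prod>q\<in>B False. \<integral>\<omega>. x (type_index (q, False)) ^ limit_count (type_index (q, False)) \<omega> \<partial>M')"
    unfolding F_def using pm(2) by (simp add: lc B_def)
  also have "(\<integral>\<omega>. F True (\<lambda>q. Np q \<omega>) \<partial>M') = (\<Prod>q\<in>B True. \<integral>\<omega>. x (type_index (q, True)) ^ limit_count (type_index (q, True)) \<omega> \<partial>M')"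
    unfolding F_def using pp(2) by (simp add: lc B_def)
  also have "(\<Prod>q\<in>B False. \<integral>\<omega>. x (type_index (q, False)) ^ limit_count (type_index (q, False)) \<omega> \<partial>M') *
      (\<Prod>q\<in>B True. \<integral>\<omega>. x (type_index (q, True)) ^ limit_count (type_index (q, True)) \<omega> \<partial>M') =
    (\<Prod>i<m. \<integral>\<omega>. x i ^ limit_count i \<omega> \<partial>M')"
    by (subst split) (simp only: mult.commute)
  finally show ?thesis by (simp add: limit_count_pgf(2)[OF x0])
qed

lemma limit_trace_eq: "k \<ge> 1 \<Longrightarrow> limit_trace Nm Np k \<omega> = cycle_traces (\<lambda>i. real (limit_count i \<omega>)) k"
  unfolding limit_trace_def cycle_traces_def
proof (rule sum.cong[OF refl])
  fix q assume "k \<ge> 1" "q \<in> {q. q dvd k}"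
  then have "q \<ge> 1" by (auto intro: Suc_leI dvd_pos_nat)
  then show "real q * (real (Np q \<omega>) + (-1) ^ (k div q) * real (Nm q \<omega>)) =
     real q * (real (limit_count (type_index (q, True)) \<omega>) + (-1) ^ (k div q) * real (limit_count (type_index (q, False)) \<omega>))"
    by (auto simp: limit_count_def type_index_def)
qed

lemma measurable_limit_trace: "k \<ge> 1 \<Longrightarrow> limit_trace Nm Np k \<in> borel_measurable M'"
proof -
  assume k: "k \<ge> 1"
  have "(\<lambda>\<omega>. cycle_traces (\<lambda>i. real (limit_count i \<omega>)) k) \<in> borel_measurable M'"
    unfolding cycle_traces_def by (intro borel_measurable_sum borel_measurable_times borel_measurable_add borel_measurable_const measurable_limit_count)
  then show ?thesis using limit_trace_eq[OF k] by (simp add: measurable_cong[of M' "limit_trace Nm Np k"])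
qed

text \<open>There are at most \<open>k\<close> divisors, each at most \<open>k\<close>, with two
  counts of mean at most 3 per divisor.\<close>

lemma limit_trace_mean:
  assumes k: "k \<ge> 1"
  shows "integrable M' (\<lambda>\<omega>. \<bar>limit_trace Nm Np k \<omega>\<bar>)" and "(\<integral>\<omega>. \<bar>limit_trace Nm Np k \<omega>\<bar> \<partial>M') \<le> 6 * (real k)\<^sup>2"
proof -
  let ?c = "\<lambda>i \<omega>. real (limit_count i \<omega>)"
  define D where "D = {q. q dvd k}"
  have D: "finite D" "card D \<le> k" "\<And>q. q \<in> D \<Longrightarrow> q \<le> k"
  proof -
    have "D \<subseteq> {1..k}" using k by (auto simp: D_def dest: dvd_imp_le intro: Suc_leI dvd_pos_nat)
    then show "finite D" "card D \<le> k" "\<And>q. q \<in> D \<Longrightarrow> q \<le> k"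
      using card_mono[of "{1..k}" D] by (auto dest: finite_subset)
  qed
  define U where "U = (\<lambda>\<omega>. \<Sum>q\<in>D. real k * (?c (type_index (q, True)) \<omega> + ?c (type_index (q, False)) \<omega>))"
  have le: "\<bar>limit_trace Nm Np k \<omega>\<bar> \<le> U \<omega>" for \<omega>
  proof -
    have "\<bar>limit_trace Nm Np k \<omega>\<bar> \<le> (\<Sum>q\<in>D. \<bar>real q * (?c (type_index (q, True)) \<omega> + (-1) ^ (k div q) * ?c (type_index (q, False)) \<omega>)\<bar>)"
      unfolding limit_trace_eq[OF k] cycle_traces_def D_def by (rule sum_abs)
    also have "\<dots> \<le> U \<omega>" unfolding U_def
    proof (rule sum_mono)
      fix q assume q: "q \<in> D"
      have "\<bar>?c (type_index (q, True)) \<omega> + (-1) ^ (k div q) * ?c (type_index (q, False)) \<omega>\<bar> \<le>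
        \<bar>?c (type_index (q, True)) \<omega>\<bar> + \<bar>(-1) ^ (k div q) * ?c (type_index (q, False)) \<omega>\<bar>" by (rule abs_triangle_ineq)
      also have "\<dots> = ?c (type_index (q, True)) \<omega> + ?c (type_index (q, False)) \<omega>" by (simp add: abs_mult power_abs)
      finally show "\<bar>real q * (?c (type_index (q, True)) \<omega> + (-1) ^ (k div q) * ?c (type_index (q, False)) \<omega>)\<bar> \<le>
        real k * (?c (type_index (q, True)) \<omega> + ?c (type_index (q, False)) \<omega>)"
        unfolding abs_mult using D(3)[OF q] by (intro mult_mono) auto
    qed
    finally show ?thesis .
  qed
  have iU: "integrable M' U"
    unfolding U_def using limit_count_mean
    by (intro Bochner_Integration.integrable_sum integrable_mult_right Bochner_Integration.integrable_add) auto
  show int: "integrable M' (\<lambda>\<omega>. \<bar>limit_trace Nm Np k \<omega>\<bar>)"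
    by (rule Bochner_Integration.integrable_bound[OF iU]) (use measurable_limit_trace[OF k] le order_trans[OF le abs_ge_self] in auto)
  have "(\<integral>\<omega>. \<bar>limit_trace Nm Np k \<omega>\<bar> \<partial>M') \<le> (\<integral>\<omega>. U \<omega> \<partial>M')"
    by (rule integral_mono[OF int iU]) (rule le)
  also have "\<dots> = (\<Sum>q\<in>D. real k * ((\<integral>\<omega>. ?c (type_index (q, True)) \<omega> \<partial>M') + (\<integral>\<omega>. ?c (type_index (q, False)) \<omega> \<partial>M')))"
    unfolding U_def using limit_count_mean
    by (subst Bochner_Integration.integral_sum) auto
  also have "\<dots> \<le> (\<Sum>q\<in>D. real k * (3 + 3))"
    using limit_count_mean by (intro sum_mono mult_left_mono add_mono) auto
  also have "\<dots> = real (card D) * (real k * 6)" by simp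
  also have "\<dots> \<le> real k * (real k * 6)" using D(2) by (intro mult_right_mono) auto
  finally show "(\<integral>\<omega>. \<bar>limit_trace Nm Np k \<omega>\<bar> \<partial>M') \<le> 6 * (real k)\<^sup>2" by (simp add: power2_eq_square mult_ac)
qed

end

section \<open>The limit function and its power series\<close>

lemma summable_linear_powser:
  fixes r :: real
  assumes "0 \<le> r" "r < 1"
  shows "summable (\<lambda>k. real (Suc k) * r ^ Suc k)"
proof -
  have "summable (\<lambda>k. coefficient_box 1 k * r ^ k)"
    using dominating_coefficient_box[of 1] assms by (simp add: dominating_def)
  then have "summable (\<lambda>k. real (Suc k) * r ^ k)"
  proof (rule summable_comparison_test')
    fix k
    have "real (Suc k) * real (Suc k) \<le> real (Suc k) * real (Suc (Suc k))" by (intro mult_left_mono) auto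
    then have "sqrt (real (Suc k) * real (Suc k)) \<le> sqrt (real (Suc k) * real (Suc (Suc k)))"
      by (simp only: real_sqrt_le_iff)
    then have "real (Suc k) \<le> coefficient_box 1 k" unfolding coefficient_box_def real_sqrt_mult_self by (simp del: of_nat_Suc)
    then show "norm (real (Suc k) * r ^ k) \<le> coefficient_box 1 k * r ^ k"
      using assms by (simp add: mult_right_mono del: of_nat_Suc)
  qed
  from summable_mult[OF this, of r] show ?thesis by (simp add: mult_ac)
qed

text \<open>Countably many radii increasing to 1, through which convergence on the disc becomes a
  countable condition.\<close>

definition radius_seq :: "nat \<Rightarrow> real" where "radius_seq j = 1 - 1 / real (j + 2)"

lemma radius_seq_bounds: "0 < radius_seq j" "radius_seq j < 1"
  by (auto simp: radius_seq_def field_simps)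

lemma less_radius_seq:
  assumes "r < 1"
  obtains j where "r < radius_seq j"
proof -
  obtain j where "inverse (real (Suc j)) < 1 - r" using reals_Archimedean[of "1 - r"] assms by auto
  moreover have "1 / real (j + 2) \<le> inverse (real (Suc j))" by (simp add: field_simps)
  ultimately show ?thesis using that[of j] by (simp add: radius_seq_def)
qed

text \<open>A power series that converges at a point converges at every point of smaller modulus, so
  the test radii suffice. In this form the condition is accessible to measurability and almost sure
  statements.\<close>

lemma limit_series_converges_iff:
  "limit_series_converges Nm Np \<omega> \<longleftrightarrow>
    (\<forall>j. summable (\<lambda>k. radius_seq j ^ Suc k / real (Suc k) * limit_trace Nm Np (Suc k) \<omega>))"
  (is "_ \<longleftrightarrow> (\<forall>j. ?S j)")
proof -
  let ?c = "\<lambda>k. complex_of_real (limit_trace Nm Np (Suc k) \<omega>) / of_nat (Suc k)"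
  let ?t = "\<lambda>z k. z ^ Suc k / of_nat (Suc k) * complex_of_real (limit_trace Nm Np (Suc k) \<omega>)"
  have real: "?S j \<longleftrightarrow> summable (?t (of_real (radius_seq j)))" for j
  proof -
    have "?t (of_real (radius_seq j)) k = complex_of_real (radius_seq j ^ Suc k / real (Suc k) * limit_trace Nm Np (Suc k) \<omega>)" for k
      by simp
    then show ?thesis by (simp only: summable_complex_of_real)
  qed
  have pw: "summable (?t z) \<longleftrightarrow> summable (\<lambda>k. ?c k * z ^ k)" if "z \<noteq> 0" for z
  proof -
    have "?t z = (\<lambda>k. z * (?c k * z ^ k))" by (simp add: fun_eq_iff)
    then show ?thesis using summable_cmult_iff[of z "\<lambda>k. ?c k * z ^ k"] that by simp
  qed
  show ?thesis
  proof
    assume "limit_series_converges Nm Np \<omega>"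
    then have "summable (?t (of_real (radius_seq j)))" for j
      unfolding limit_series_converges_def using radius_seq_bounds[of j] by (simp del: of_nat_Suc power_Suc)
    then show "\<forall>j. ?S j" unfolding real by blast
  next
    assume S: "\<forall>j. ?S j"
    show "limit_series_converges Nm Np \<omega>"
      unfolding limit_series_converges_def
    proof
      fix z :: complex assume "z \<in> ball 0 1"
      then obtain j where j: "norm z < radius_seq j" using less_radius_seq[of "norm z"] by auto
      show "summable (?t z)"
      proof (cases "z = 0")
        case False
        have "complex_of_real (radius_seq j) \<noteq> 0" using radius_seq_bounds[of j] by simp
        then have "summable (\<lambda>k. ?c k * of_real (radius_seq j) ^ k)" using S real[of j] pw by blast
        then have "summable (\<lambda>k. ?c k * z ^ k)" by (rule powser_inside) (use j radius_seq_bounds[of j] in simp)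
        then show ?thesis using pw[OF False] by blast
      qed simp
    qed
  qed
qed

text \<open>\<open>F = exp (- G)\<close> satisfies \<open>F' = - F * G'\<close>, and the Taylor
  coefficients of \<open>G'\<close> are the limit traces, so \<open>fps_nth_newton\<close>
  identifies the coefficients of \<open>F\<close>.\<close>

lemma limit_function_power_series:
  assumes conv: "limit_series_converges Nm Np \<omega>" and w: "w \<in> disc"
  shows "(\<lambda>k. complex_of_real (newton (\<lambda>k. limit_trace Nm Np k \<omega>) k) * w ^ k) sums limit_function Nm Np \<omega> w"
proof -
  define Z where "Z = (\<lambda>k. complex_of_real (limit_trace Nm Np k \<omega>))"
  define G where "G = (\<lambda>z. \<Sum>k. z ^ Suc k / of_nat (Suc k) * Z (Suc k))"
  define c where "c = (\<lambda>k. case k of 0 \<Rightarrow> 0 | Suc k \<Rightarrow> Z (Suc k) / of_nat (Suc k))"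
  define F where "F = (\<lambda>z. exp (- G z))"
  have G: "(\<lambda>k. c k * z ^ k) sums G z" if "z \<in> disc" for z
  proof -
    have "(\<lambda>k. z ^ Suc k / of_nat (Suc k) * Z (Suc k)) sums G z"
      using conv that unfolding limit_series_converges_def G_def Z_def by (intro summable_sums) auto
    then have "(\<lambda>k. c (Suc k) * z ^ Suc k) sums G z" by (simp add: c_def mult.commute del: of_nat_Suc power_Suc)
    then show ?thesis by (subst (asm) sums_Suc_iff) (simp add: c_def)
  qed
  have Gh: "G holomorphic_on disc" by (rule power_series_holomorphic[of 0 1 c]) (use G in simp)
  have Fh: "F holomorphic_on disc" unfolding F_def by (intro holomorphic_intros Gh)
  define B where "B = (\<lambda>n. (deriv ^^ n) F 0 / fact n)"
  have F: "(\<lambda>k. B k * z ^ k) sums F z" if "z \<in> disc" for z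
    using holomorphic_power_series[OF Fh that] by (simp add: B_def)
  have ev: "\<forall>\<^sub>F z in nhds 0. z \<in> disc" by (intro eventually_nhds_in_open) auto
  have Ge: "G has_fps_expansion Abs_fps c" by (rule has_fps_expansionI) (use ev in eventually_elim, use G in simp)
  have Fe: "F has_fps_expansion Abs_fps B" by (rule has_fps_expansionI) (use ev in eventually_elim, use F in simp)
  have d: "\<forall>\<^sub>F z in nhds 0. deriv F z = - (F z * deriv G z)"
    using ev
  proof eventually_elim
    case (elim z)
    have "(G has_field_derivative deriv G z) (at z)"
      by (rule holomorphic_derivI[OF Gh]) (use elim in auto)
    then have "(F has_field_derivative exp (- G z) * (- deriv G z)) (at z)"
      unfolding F_def by (auto intro!: derivative_eq_intros)
    then show ?case using DERIV_imp_deriv by (fastforce simp: F_def)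
  qed
  have "deriv F has_fps_expansion fps_deriv (Abs_fps B)" by (rule has_fps_expansion_deriv[OF Fe])
  moreover have "deriv F has_fps_expansion - (Abs_fps B * fps_deriv (Abs_fps c))"
    by (subst has_fps_expansion_cong[OF d refl]) (intro fps_expansion_intros Fe Ge)
  ultimately have "fps_deriv (Abs_fps B) = - (Abs_fps B * fps_deriv (Abs_fps c))"
    by (rule fps_expansion_unique_complex)
  moreover have "fps_deriv (Abs_fps c) = Abs_fps (\<lambda>k. Z (Suc k))"
    by (rule fps_ext) (simp add: c_def del: of_nat_Suc)
  ultimately have deq: "fps_deriv (Abs_fps B) = - Abs_fps B * Abs_fps (\<lambda>k. Z (Suc k))" by simp
  have "G 0 = 0" by (simp add: G_def)
  then have "fps_nth (Abs_fps B) 0 = 1" by (simp add: B_def F_def)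
  from fps_nth_newton[OF this deq] have "B k = newton Z k" for k by simp
  then have "B k = complex_of_real (newton (\<lambda>k. limit_trace Nm Np k \<omega>) k)" for k
    unfolding Z_def newton_of_real by simp
  then show ?thesis using F[OF w] w conv by (simp add: F_def G_def Z_def limit_function_def)
qed

text \<open>On the exceptional set these are the coefficients of the constant 1, the default of
  \<open>limit_function\<close>.\<close>

definition limit_coeff :: "(nat \<Rightarrow> 'b \<Rightarrow> nat) \<Rightarrow> (nat \<Rightarrow> 'b \<Rightarrow> nat) \<Rightarrow> 'b \<Rightarrow> nat \<Rightarrow> real" where
  "limit_coeff Nm Np \<omega> k = (if limit_series_converges Nm Np \<omega>
     then newton (\<lambda>k. limit_trace Nm Np k \<omega>) k else if k = 0 then 1 else 0)"

lemma limit_coeff_sums: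
  assumes "w \<in> disc"
  shows "(\<lambda>k. complex_of_real (limit_coeff Nm Np \<omega> k) * w ^ k) sums limit_function Nm Np \<omega> w"
proof (cases "limit_series_converges Nm Np \<omega>")
  case True
  then show ?thesis using limit_function_power_series[OF True assms] by (simp add: limit_coeff_def)
next
  case False
  have "(\<lambda>k. complex_of_real (limit_coeff Nm Np \<omega> k) * w ^ k) = (\<lambda>k. if k = 0 then 1 else 0)"
    using False by (auto simp: limit_coeff_def fun_eq_iff)
  moreover have "limit_function Nm Np \<omega> w = 1" using False assms by (simp add: limit_function_def)
  ultimately show ?thesis using sums_single[of 0 "\<lambda>_. 1 :: complex"] by simp
qed

lemma limit_function_eq: "limit_function Nm Np \<omega> = power_sum (limit_coeff Nm Np \<omega>)"
proof
  fix z show "limit_function Nm Np \<omega> z = power_sum (limit_coeff Nm Np \<omega>) z"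
    using sums_unique[OF limit_coeff_sums, of z Nm Np \<omega>]
    by (cases "z \<in> disc") (auto simp: power_sum_def limit_function_def)
qed

lemma dominating_limit_coeff: "dominating (\<lambda>k. \<bar>limit_coeff Nm Np \<omega> k\<bar>)"
  unfolding dominating_def
proof (intro conjI allI ballI)
  fix r :: real assume r: "r \<in> {0..<1}"
  \<comment> \<open>Convergence at a radius \<open>s\<close> between \<open>r\<close> and 1 gives
    absolute convergence at \<open>r\<close>.\<close>
  define s where "s = (1 + r) / 2"
  have s: "r < s" "s < 1" "0 \<le> s" using r by (auto simp: s_def)
  have "summable (\<lambda>k. complex_of_real (limit_coeff Nm Np \<omega> k) * of_real s ^ k)"
    by (rule sums_summable[OF limit_coeff_sums]) (use s in auto)
  from powser_insidea[OF this, of "of_real r"] r s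
  show "summable (\<lambda>k. \<bar>limit_coeff Nm Np \<omega> k\<bar> * r ^ k)" by (simp add: norm_mult norm_power)
qed simp

lemma limit_function_holomorphic: "limit_function Nm Np \<omega> \<in> holomorphic_space disc"
  unfolding limit_function_eq by (rule power_sum_holomorphic[OF dominating_limit_coeff[where Nm = Nm and Np = Np and \<omega> = \<omega>]]) simp

lemma limitin_limit_function:
  "limitin (holomorphic_topology disc) (\<lambda>m. power_sum (trunc_seq m (limit_coeff Nm Np \<omega>))) (limit_function Nm Np \<omega>) sequentially"
  unfolding limit_function_eq
proof (rule power_sum_limit[OF dominating_limit_coeff])
  show "\<bar>trunc_seq m (limit_coeff Nm Np \<omega>) k\<bar> \<le> \<bar>limit_coeff Nm Np \<omega> k\<bar>" for m k
    by (simp add: trunc_seq_def)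
  show "(\<lambda>m. trunc_seq m (limit_coeff Nm Np \<omega>) k) \<longlonglongrightarrow> limit_coeff Nm Np \<omega> k" for k
    by (rule Lim_transform_eventually[OF tendsto_const], use eventually_ge_at_top[of k] in eventually_elim)
      (simp add: trunc_seq_def)
qed

context poisson_cycles
begin

text \<open>For each test radius \<open>r\<close> the expected sum of absolute values is finite: the
  quadratic bound on the mean traces, divided by \<open>k\<close>, leaves terms of order
  \<open>k * r ^ k\<close>.\<close>

lemma AE_limit_series_converges: "AE \<omega> in M'. limit_series_converges Nm Np \<omega>"
proof -
  have "AE \<omega> in M'. summable (\<lambda>k. radius_seq j ^ Suc k / real (Suc k) * limit_trace Nm Np (Suc k) \<omega>)" for j
  proof -
    define r where "r = radius_seq j"
    have r: "0 \<le> r" "r < 1" using radius_seq_bounds[of j] by (auto simp: r_def)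
    define u where "u = (\<lambda>k \<omega>. r ^ Suc k / real (Suc k) * \<bar>limit_trace Nm Np (Suc k) \<omega>\<bar>)"
    have u0: "0 \<le> u k \<omega>" for k \<omega> using r by (simp add: u_def)
    have um [measurable]: "u k \<in> borel_measurable M'" for k
      unfolding u_def using measurable_limit_trace[of "Suc k"] by measurable
    have iu: "integrable M' (u k)" for k unfolding u_def by (intro integrable_mult_right limit_trace_mean) simp
    have "(\<integral>\<omega>. u k \<omega> \<partial>M') \<le> 6 * (real (Suc k) * r ^ Suc k)" for k
    proof -
      have "(\<integral>\<omega>. u k \<omega> \<partial>M') = r ^ Suc k / real (Suc k) * (\<integral>\<omega>. \<bar>limit_trace Nm Np (Suc k) \<omega>\<bar> \<partial>M')"
        by (simp add: u_def)
      also have "\<dots> \<le> r ^ Suc k / real (Suc k) * (6 * (real (Suc k))\<^sup>2)"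
        using r by (intro mult_left_mono limit_trace_mean) auto
      also have "\<dots> = 6 * (real (Suc k) * r ^ Suc k)" by (simp add: power2_eq_square del: of_nat_Suc)
      finally show ?thesis .
    qed
    then have le: "(\<integral>\<^sup>+\<omega>. ennreal (u k \<omega>) \<partial>M') \<le> ennreal (6 * (real (Suc k) * r ^ Suc k))" for k
      using nn_integral_eq_integral[OF iu] u0 by (simp add: ennreal_leI del: of_nat_Suc power_Suc)
    have "(\<integral>\<^sup>+\<omega>. (\<Sum>k. ennreal (u k \<omega>)) \<partial>M') = (\<Sum>k. \<integral>\<^sup>+\<omega>. ennreal (u k \<omega>) \<partial>M')"
      by (rule nn_integral_suminf) simp
    also have "\<dots> \<le> (\<Sum>k. ennreal (6 * (real (Suc k) * r ^ Suc k)))"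
      by (intro suminf_le le) auto
    also have "\<dots> = ennreal (\<Sum>k. 6 * (real (Suc k) * r ^ Suc k))"
      using r by (intro suminf_ennreal_eq summable_sums summable_mult summable_linear_powser) auto
    also have "\<dots> < \<infinity>" by simp
    finally have "(\<integral>\<^sup>+\<omega>. (\<Sum>k. ennreal (u k \<omega>)) \<partial>M') \<noteq> \<infinity>" by simp
    then have "AE \<omega> in M'. (\<Sum>k. ennreal (u k \<omega>)) \<noteq> \<infinity>" by (intro nn_integral_PInf_AE) measurable
    then show ?thesis
    proof eventually_elim
      case (elim \<omega>)
      then have "summable (\<lambda>k. u k \<omega>)" using u0 by (intro summable_suminf_not_top) auto
      then have "summable (\<lambda>k. norm (radius_seq j ^ Suc k / real (Suc k) * limit_trace Nm Np (Suc k) \<omega>))"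
        using r by (simp add: u_def r_def abs_mult power_abs del: of_nat_Suc power_Suc)
      then show ?case by (rule summable_norm_cancel)
    qed
  qed
  then show ?thesis unfolding limit_series_converges_iff by (simp add: AE_all_countable)
qed

lemma limit_series_converges_sets: "{\<omega> \<in> space M'. limit_series_converges Nm Np \<omega>} \<in> sets M'"
proof -
  have "{\<omega> \<in> space M'. summable (\<lambda>k. radius_seq j ^ Suc k / real (Suc k) * limit_trace Nm Np (Suc k) \<omega>)} \<in> sets M'" for j
    unfolding summable_iff_convergent Cauchy_convergent_iff[symmetric]
  proof (rule sets_Collect_Cauchy)
    show "(\<lambda>\<omega>. \<Sum>k<n. radius_seq j ^ Suc k / real (Suc k) * limit_trace Nm Np (Suc k) \<omega>) \<in> borel_measurable M'" for n
      using measurable_limit_trace[of "Suc _"] by (intro borel_measurable_sum borel_measurable_times borel_measurable_const) auto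
  qed
  then have "(\<Inter>j. {\<omega> \<in> space M'. summable (\<lambda>k. radius_seq j ^ Suc k / real (Suc k) * limit_trace Nm Np (Suc k) \<omega>)}) \<in> sets M'"
    by (intro sets.countable_INT') auto
  moreover have "(\<Inter>j. {\<omega> \<in> space M'. summable (\<lambda>k. radius_seq j ^ Suc k / real (Suc k) * limit_trace Nm Np (Suc k) \<omega>)}) =
    {\<omega> \<in> space M'. limit_series_converges Nm Np \<omega>}" unfolding limit_series_converges_iff by auto
  ultimately show ?thesis by simp
qed

lemma measurable_newton_limit_trace: "(\<lambda>\<omega>. newton (\<lambda>k. limit_trace Nm Np k \<omega>) k) \<in> borel_measurable M'"
proof -
  \<comment> \<open>Index 0 is replaced by 0, since \<open>measurable_limit_trace\<close> covers
    \<open>k \<ge> 1\<close>; by \<open>newton_cong\<close> the value is unchanged.\<close>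
  have "(\<lambda>\<omega>. newton (\<lambda>k. if k \<ge> 1 then limit_trace Nm Np k \<omega> else 0) k) \<in> borel_measurable M'"
  proof (rule borel_measurable_continuous_seq[OF continuous_on_newton])
    show "(\<lambda>\<omega>. if k \<ge> 1 then limit_trace Nm Np k \<omega> else 0) \<in> borel_measurable M'" for k
      using measurable_limit_trace[of k] by (cases "k \<ge> 1") (simp_all only: if_True if_False borel_measurable_const)
  qed
  moreover have "newton (\<lambda>k. if k \<ge> 1 then limit_trace Nm Np k \<omega> else 0) k = newton (\<lambda>k. limit_trace Nm Np k \<omega>) k" for \<omega>
    by (rule newton_cong) simp
  ultimately show ?thesis by simp
qed

lemma measurable_limit_coeff: "(\<lambda>\<omega>. limit_coeff Nm Np \<omega> k) \<in> borel_measurable M'"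
  unfolding limit_coeff_def
  by (intro measurable_If measurable_newton_limit_trace measurable_const limit_series_converges_sets) auto

lemma measurable_limit_function:
  "limit_function Nm Np \<in> measurable M' (borel_measure_of (holomorphic_topology disc))"
  by (rule measurable_limit_disc[OF measurable_truncated[OF measurable_limit_coeff] limitin_limit_function
        truncate_holomorphic limit_function_holomorphic])

end

subsection \<open>Convergence of traces and polynomials\<close>

lemma self_normalized_matrix_eq:
  "self_normalized_matrix X n \<omega> = Matrix.mat n n (\<lambda>(i, j). norm_entry n j (row_vec X n i \<omega>))"
  unfolding self_normalized_matrix_def
proof (rule cong_mat[OF refl refl])
  fix i j assume ij: "i < n" "j < n"
  have "(\<Sum>l=1..n. (X (Suc i) l \<omega>)\<^sup>2) = (\<Sum>l<n. (X (Suc i) (Suc l) \<omega>)\<^sup>2)"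
    by (simp add: sum.atLeast1_atMost_eq)
  then show "(case (i, j) of (i, j) \<Rightarrow> X (Suc i) (Suc j) \<omega> / sqrt (\<Sum>l=1..n. (X (Suc i) l \<omega>)\<^sup>2)) =
    (case (i, j) of (i, j) \<Rightarrow> norm_entry n j (row_vec X n i \<omega>))"
    using ij by (simp add: norm_entry_def row_vec_def)
qed

lemma measurable_functional:
  assumes W: "W \<in> measurable M (borel_measure_of T)" and f: "continuous_map T euclideanreal f"
  shows "(\<lambda>\<omega>. f (W \<omega>)) \<in> borel_measurable M"
proof (rule borel_measurableI)
  fix S :: "real set" assume S: "open S"
  have "{U. openin T U} \<subseteq> Pow (topspace T)" by (auto dest: openin_subset)
  then have sp: "W \<omega> \<in> topspace T" if "\<omega> \<in> space M" for \<omega>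
    using measurable_space[OF W that] by (simp add: borel_measure_of_def space_measure_of_conv)
  have "openin T {x \<in> topspace T. f x \<in> S}" using f S by (simp add: continuous_map_def)
  from measurable_borel_measure_ofD[OF W this] have "W -` {x \<in> topspace T. f x \<in> S} \<inter> space M \<in> sets M" .
  moreover have "W -` {x \<in> topspace T. f x \<in> S} \<inter> space M = (\<lambda>\<omega>. f (W \<omega>)) -` S \<inter> space M"
    using sp by auto
  ultimately show "(\<lambda>\<omega>. f (W \<omega>)) -` S \<inter> space M \<in> sets M" by simp
qed

locale spectral_convergence = row_array M \<mu> X + poisson_cycles M' Nm Np
  for M :: "'a measure" and \<mu> X and M' :: "'b measure" and Nm Np
begin

lemma count_convergence: "count_convergence M M' (\<lambda>n i. cycle_count n (type_of i)) limit_count 3"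
proof
  fix n i :: nat assume n: "n > 0"
  have q: "fst (type_of i) > 0" by (simp add: type_of_def)
  show "(\<lambda>\<omega>. real (cycle_count n (type_of i) \<omega>)) \<in> borel_measurable M"
    by (rule borel_measurable_integrable[OF expectation_cycle_count(1)[OF n q]])
  have "1 / (2 * real (fst (type_of i))) \<le> 3" by (simp add: type_of_def field_simps)
  then show "integrable M (\<lambda>\<omega>. real (cycle_count n (type_of i) \<omega>)) \<and>
      (\<integral>\<omega>. real (cycle_count n (type_of i) \<omega>) \<partial>M) \<le> 3"
    using expectation_cycle_count[OF n q] by linarith
next
  fix x :: "nat \<Rightarrow> real" and m :: nat assume x: "\<And>i. 0 < x i \<and> x i \<le> 1"
  \<comment> \<open>\<open>pgf_tendsto\<close> is stated for powers of \<open>1 + t\<close>, so it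
    is applied with \<open>t = x - 1\<close>.\<close>
  have "(\<lambda>n. \<integral>\<omega>. (\<Prod>\<tau>\<in>type_of ` {..<m}. (1 + (x (type_index \<tau>) - 1)) ^ cycle_count n \<tau> \<omega>) \<partial>M) \<longlonglongrightarrow>
      (\<Prod>\<tau>\<in>type_of ` {..<m}. exp ((x (type_index \<tau>) - 1) / (2 * real (fst \<tau>))))"
    by (rule pgf_tendsto) (auto simp: type_of_def)
  moreover have "(\<Prod>\<tau>\<in>type_of ` {..<m}. F \<tau>) = (\<Prod>i<m. F (type_of i))" for F :: "nat \<times> bool \<Rightarrow> real"
    by (rule prod.reindex[OF inj_on_subset[OF inj_type_of subset_UNIV], unfolded comp_def])
  moreover have "1 + (x i - 1) = x i" for i by simp
  ultimately show "(\<lambda>n. \<integral>\<omega>. (\<Prod>i<m. x i ^ cycle_count n (type_of i) \<omega>) \<partial>M) \<longlonglongrightarrow>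
      (\<integral>\<omega>. (\<Prod>i<m. x i ^ limit_count i \<omega>) \<partial>M')"
    by (simp only: joint_pgf[OF x] type_index_type_of)
qed (use measurable_limit_count limit_count_mean in blast)+

lemma row_minor_peak:
  "row_minor n (peak_entry n) k \<omega> = newton (cycle_traces (\<lambda>i. real (cycle_count n (type_of i) \<omega>))) k"
proof -
  have "row_minor n (peak_entry n) k \<omega> =
      newton (\<lambda>k. mat_trace (Matrix.mat n n (\<lambda>(i, j). peak_matrix n \<omega> i j) ^\<^sub>m k)) k"
    unfolding row_minor_def minor_coeff_eq_newton peak_matrix_def ..
  also have "\<dots> = newton (cycle_traces (\<lambda>i. real (cycle_count n (type_of i) \<omega>))) k"
  proof (rule newton_cong)
    fix j :: nat assume j: "1 \<le> j"
    show "mat_trace (Matrix.mat n n (\<lambda>(i, j). peak_matrix n \<omega> i j) ^\<^sub>m j) =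
        cycle_traces (\<lambda>i. real (cycle_count n (type_of i) \<omega>)) j"
      unfolding signed_partial_map.trace_power_eq[OF signed_partial_map_peak j] cycle_traces_def
    proof (rule sum.cong[OF refl])
      fix q assume "q \<in> {q. q dvd j}"
      then have "q > 0" using j by (auto intro: dvd_pos_nat)
      then show "real q * (real (card (signed_partial_map.cycles n (peak_matrix n \<omega>) (q, True))) +
            (- 1) ^ (j div q) * real (card (signed_partial_map.cycles n (peak_matrix n \<omega>) (q, False)))) =
          real q * (real (cycle_count n (type_of (type_index (q, True))) \<omega>) +
            (- 1) ^ (j div q) * real (cycle_count n (type_of (type_index (q, False))) \<omega>))"
        by (simp add: type_of_type_index cycle_count_def)
    qed
  qed
  finally show ?thesis .
qed

text \<open>Joint convergence of the whole coefficient sequence, from which traces and polynomials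
  are both read off. For the rounded matrix it is a continuous image of the cycle counts; the
  normalized matrix differs from it by an \<open>L\<^sup>2\<close> perturbation.\<close>

theorem minors_tendsto:
  fixes g :: "(nat \<Rightarrow> real) \<Rightarrow> real"
  assumes g: "continuous_on UNIV g" and G: "\<And>x. \<bar>g x\<bar> \<le> G"
  shows "(\<lambda>n. \<integral>\<omega>. g (\<lambda>k. row_minor n (norm_entry n) k \<omega>) \<partial>M) \<longlonglongrightarrow>
    (\<integral>\<omega>. g (newton (\<lambda>k. limit_trace Nm Np k \<omega>)) \<partial>M')"
proof -
  have h: "continuous_on UNIV (\<lambda>c. g (newton (cycle_traces c)))"
    by (rule continuous_on_compose2[OF g continuous_on_compose2[OF continuous_on_newton_seq continuous_on_cycle_traces]]) auto
  have peak: "newton (cycle_traces (\<lambda>i. real (cycle_count n (type_of i) \<omega>))) = (\<lambda>k. row_minor n (peak_entry n) k \<omega>)" for n \<omega>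
    by (rule ext) (simp only: row_minor_peak)
  have lim: "newton (cycle_traces (\<lambda>i. real (limit_count i \<omega>))) = newton (\<lambda>k. limit_trace Nm Np k \<omega>)" for \<omega>
    by (rule ext, rule newton_cong) (simp add: limit_trace_eq)
  have 1: "(\<lambda>n. \<integral>\<omega>. g (\<lambda>k. row_minor n (peak_entry n) k \<omega>) \<partial>M) \<longlonglongrightarrow>
      (\<integral>\<omega>. g (newton (\<lambda>k. limit_trace Nm Np k \<omega>)) \<partial>M')"
    using count_convergence.counts_tendsto[OF count_convergence h G] unfolding peak lim .
  have 2: "(\<lambda>n. (\<integral>\<omega>. g (\<lambda>k. row_minor n (norm_entry n) k \<omega>) \<partial>M) -
      (\<integral>\<omega>. g (\<lambda>k. row_minor n (peak_entry n) k \<omega>) \<partial>M)) \<longlonglongrightarrow> 0"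
  proof (rule M.integral_perturbation[OF g G])
    fix k
    have le: "\<forall>\<^sub>F n in sequentially. (\<integral>\<omega>. (row_minor n (norm_entry n) k \<omega> - row_minor n (peak_entry n) k \<omega>)\<^sup>2 \<partial>M) \<le>
        2 * (1 - peak_corr n ^ k)"
      using eventually_gt_at_top[of 0] by eventually_elim (rule row_minor_second_moment(5))
    have "(\<lambda>n. 2 * (1 - peak_corr n ^ k)) \<longlonglongrightarrow> 2 * (1 - 1 ^ k)"
      by (intro tendsto_intros peak_corr_tendsto)
    then have z: "(\<lambda>n. 2 * (1 - peak_corr n ^ k)) \<longlonglongrightarrow> 0" by simp
    show "(\<lambda>n. \<integral>\<omega>. (row_minor n (norm_entry n) k \<omega> - row_minor n (peak_entry n) k \<omega>)\<^sup>2 \<partial>M) \<longlonglongrightarrow> 0"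
      by (rule tendsto_sandwich[OF _ le tendsto_const z]) simp
  next
    fix n k :: nat
    show "row_minor n (norm_entry n) k \<in> borel_measurable M" by (rule measurable_row_minor[OF odd_entry_norm])
    show "row_minor n (peak_entry n) k \<in> borel_measurable M" by (rule measurable_row_minor[OF odd_entry_peak])
    assume n: "n > 0"
    show "integrable M (\<lambda>\<omega>. (row_minor n (norm_entry n) k \<omega>)\<^sup>2) \<and> (\<integral>\<omega>. (row_minor n (norm_entry n) k \<omega>)\<^sup>2 \<partial>M) \<le> 1"
      by (rule conjI[OF row_minor_second_moment(2,1)[OF n]])
    show "integrable M (\<lambda>\<omega>. (row_minor n (peak_entry n) k \<omega>)\<^sup>2) \<and> (\<integral>\<omega>. (row_minor n (peak_entry n) k \<omega>)\<^sup>2 \<partial>M) \<le> 1"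
      by (rule conjI[OF row_minor_second_moment(4,3)[OF n]])
    show "integrable M (\<lambda>\<omega>. (row_minor n (norm_entry n) k \<omega> - row_minor n (peak_entry n) k \<omega>)\<^sup>2)"
      by (rule row_minor_second_moment(6)[OF n])
  qed
  from tendsto_add[OF 2 1] show ?thesis by simp
qed

lemma trace_power_eq_newton_inv:
  assumes "k \<ge> 1"
  shows "mat_trace (self_normalized_matrix X n \<omega> ^\<^sub>m k) = newton_inv (\<lambda>k. row_minor n (norm_entry n) k \<omega>) k"
proof -
  have "(\<lambda>k. row_minor n (norm_entry n) k \<omega>) = newton (\<lambda>k. mat_trace (self_normalized_matrix X n \<omega> ^\<^sub>m k))"
    unfolding row_minor_def self_normalized_matrix_eq by (rule ext, rule minor_coeff_eq_newton)
  then show ?thesis using newton_inv_newton[OF assms, of "\<lambda>k. mat_trace (self_normalized_matrix X n \<omega> ^\<^sub>m k)"] by simp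
qed

text \<open>Through \<open>newton_inv\<close> each trace is a continuous function of the
  coefficients, so a continuous test function of the traces is one of the coefficient
  sequence.\<close>

theorem traces_converge:
  fixes k :: "'l::finite \<Rightarrow> nat"
  assumes k: "\<And>i. k i \<ge> 1"
  shows "converges_in_distribution (euclidean :: (real ^ 'l) topology)
     M (\<lambda>n \<omega>. \<chi> i. mat_trace (self_normalized_matrix X n \<omega> ^\<^sub>m k i)) M' (\<lambda>\<omega>. \<chi> i. limit_trace Nm Np (k i) \<omega>)"
proof -
  define V :: "(nat \<Rightarrow> real) \<Rightarrow> real ^ 'l" where "V = (\<lambda>a. \<chi> i. newton_inv a (k i))"
  have V: "continuous_on UNIV V" unfolding V_def by (intro continuous_on_vec_lambda continuous_on_newton_inv)
  have e1: "(\<chi> i. mat_trace (self_normalized_matrix X n \<omega> ^\<^sub>m k i)) = V (\<lambda>k. row_minor n (norm_entry n) k \<omega>)" for n \<omega>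
    unfolding V_def by (simp only: trace_power_eq_newton_inv[OF k])
  have e2: "(\<chi> i. limit_trace Nm Np (k i) \<omega>) = V (newton (\<lambda>k. limit_trace Nm Np k \<omega>))" for \<omega>
    unfolding V_def by (simp only: newton_inv_newton[OF k])
  have ms: "measurable N (borel_measure_of (euclidean :: (real ^ 'l) topology)) = borel_measurable N" for N :: "'c measure"
    by (rule measurable_cong_sets[OF refl sets_borel_measure_of_euclidean])
  have mV: "(\<lambda>\<omega>. V (\<lambda>k. a k \<omega>)) \<in> borel_measurable N" if "\<And>k. a k \<in> borel_measurable N" for a and N :: "'c measure"
    by (rule measurable_compose[OF measurable_coordinatewise_then_product borel_measurable_continuous_onI[OF V]]) (rule that)
  show ?thesis
    unfolding converges_in_distribution_def e1 e2 ms
  proof (intro conjI allI impI)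
    show "(\<lambda>\<omega>. V (\<lambda>k. row_minor n (norm_entry n) k \<omega>)) \<in> borel_measurable M" for n
      by (rule measurable_compose[OF measurable_coordinatewise_then_product borel_measurable_continuous_onI[OF V]])
        (rule measurable_row_minor[OF odd_entry_norm])
    show "(\<lambda>\<omega>. V (newton (\<lambda>k. limit_trace Nm Np k \<omega>))) \<in> borel_measurable M'"
      by (rule measurable_compose[OF measurable_coordinatewise_then_product borel_measurable_continuous_onI[OF V]])
        (rule measurable_newton_limit_trace)
  next
    fix f :: "real ^ 'l \<Rightarrow> real"
    assume f: "continuous_map euclidean euclideanreal f \<and> bounded (f ` topspace euclidean)"
    then obtain B where B: "\<And>x. \<bar>f x\<bar> \<le> B" unfolding bounded_iff by auto
    have "continuous_on UNIV (\<lambda>a. f (V a))"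
      by (rule continuous_on_compose2[OF _ V, of UNIV]) (use f in auto)
    then show "(\<lambda>n. \<integral>\<omega>. f (V (\<lambda>k. row_minor n (norm_entry n) k \<omega>)) \<partial>M) \<longlonglongrightarrow>
        (\<integral>\<omega>. f (V (newton (\<lambda>k. limit_trace Nm Np k \<omega>))) \<partial>M')"
      by (rule minors_tendsto) (rule B)
  qed
qed

lemma reciprocal_char_poly_eq:
  "reciprocal_char_poly X n \<omega> = power_sum (trunc_seq n (\<lambda>k. row_minor n (norm_entry n) k \<omega>))"
proof -
  have "map_mat complex_of_real (self_normalized_matrix X n \<omega>) =
      Matrix.mat n n (\<lambda>(i, j). complex_of_real (norm_entry n j (row_vec X n i \<omega>)))"
    unfolding self_normalized_matrix_eq by (rule eq_matI) auto
  then show ?thesis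
    unfolding reciprocal_char_poly_def power_sum_truncate
    by (simp only: det_one_minus_smult minor_coeff_of_real row_minor_def)
qed

text \<open>Minors of order above \<open>n\<close> vanish, so the polynomial is the power series of
  the full coefficient sequence, to which \<open>truncation_uniform\<close> applies.\<close>

lemma trunc_row_minor: "trunc_seq n (\<lambda>k. row_minor n U k \<omega>) = (\<lambda>k. row_minor n U k \<omega>)"
  by (rule ext) (simp add: trunc_seq_def row_minor_def minor_coeff_eq_0)

text \<open>Almost surely the truncations converge to \<open>limit_function\<close> in the
  holomorphic topology, and boundedness of \<open>f\<close> permits dominated convergence.\<close>

lemma truncated_functional_limit:
  assumes f: "continuous_map (holomorphic_topology disc) euclideanreal f"
    and B: "\<And>h. h \<in> holomorphic_space disc \<Longrightarrow> \<bar>f h\<bar> \<le> B"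
  shows "(\<lambda>m. \<integral>\<omega>. f (power_sum (trunc_seq m (newton (\<lambda>k. limit_trace Nm Np k \<omega>)))) \<partial>M') \<longlonglongrightarrow>
    (\<integral>\<omega>. f (limit_function Nm Np \<omega>) \<partial>M')"
proof (rule integral_dominated_convergence[where w = "\<lambda>_. B"])
  show "(\<lambda>\<omega>. f (limit_function Nm Np \<omega>)) \<in> borel_measurable M'"
    by (rule measurable_functional[OF measurable_limit_function f])
  show "(\<lambda>\<omega>. f (power_sum (trunc_seq m (newton (\<lambda>k. limit_trace Nm Np k \<omega>))))) \<in> borel_measurable M'" for m
    by (rule borel_measurable_continuous_seq[OF continuous_truncated_functional[OF f]]) (rule measurable_newton_limit_trace)
  show "AE \<omega> in M'. (\<lambda>m. f (power_sum (trunc_seq m (newton (\<lambda>k. limit_trace Nm Np k \<omega>))))) \<longlonglongrightarrow> f (limit_function Nm Np \<omega>)"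
    using AE_limit_series_converges
  proof eventually_elim
    case (elim \<omega>)
    then have "limit_coeff Nm Np \<omega> = newton (\<lambda>k. limit_trace Nm Np k \<omega>)"
      by (simp add: limit_coeff_def fun_eq_iff)
    then show ?case using continuous_map_limit[OF f limitin_limit_function[of Nm Np \<omega>]] by (simp add: comp_def)
  qed
qed (use B truncate_holomorphic in auto)

text \<open>A fixed truncation \<open>m\<close> stands between the polynomials and the limit:
  \<open>minors_tendsto\<close> handles the truncated functional, and both truncation errors are
  small. On the matrix side the error is uniform in \<open>n\<close> because the coefficient box is,
  so \<open>m\<close> can be chosen before \<open>n\<close>.\<close>

theorem polynomials_converge:
  "converges_in_distribution (holomorphic_topology disc) M (reciprocal_char_poly X) M' (limit_function Nm Np)"
  unfolding converges_in_distribution_def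
proof (intro conjI allI impI)
  show "reciprocal_char_poly X n \<in> measurable M (borel_measure_of (holomorphic_topology disc))" for n
    unfolding reciprocal_char_poly_eq[abs_def]
    by (rule measurable_truncated) (rule measurable_row_minor[OF odd_entry_norm])
  show "limit_function Nm Np \<in> measurable M' (borel_measure_of (holomorphic_topology disc))"
    by (rule measurable_limit_function)
next
  fix f :: "(complex \<Rightarrow> complex) \<Rightarrow> real"
  assume "continuous_map (holomorphic_topology disc) euclideanreal f \<and> bounded (f ` topspace (holomorphic_topology disc))"
  then obtain B where f: "continuous_map (holomorphic_topology disc) euclideanreal f"
    and B: "\<And>h. h \<in> holomorphic_space disc \<Longrightarrow> \<bar>f h\<bar> \<le> B"
    unfolding bounded_iff by auto
  have B0: "0 \<le> B" using B[OF truncate_holomorphic[of 0 "\<lambda>_. 0"]] by linarith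
  have fm: "continuous_on UNIV (\<lambda>a. f (power_sum (trunc_seq m a)))" "\<bar>f (power_sum (trunc_seq m a))\<bar> \<le> B" for m a
    using continuous_truncated_functional[OF f] B[OF truncate_holomorphic] by auto
  define I where "I = (\<lambda>m n. \<integral>\<omega>. f (power_sum (trunc_seq m (\<lambda>k. row_minor n (norm_entry n) k \<omega>))) \<partial>M)"
  define J where "J = (\<lambda>m. \<integral>\<omega>. f (power_sum (trunc_seq m (newton (\<lambda>k. limit_trace Nm Np k \<omega>)))) \<partial>M')"
  show "(\<lambda>n. \<integral>\<omega>. f (reciprocal_char_poly X n \<omega>) \<partial>M) \<longlonglongrightarrow> (\<integral>\<omega>. f (limit_function Nm Np \<omega>) \<partial>M')"
  proof (rule LIMSEQ_I)
    fix e :: real assume e: "e > 0"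
    \<comment> \<open>Makes \<open>2 * B / c\<close>, the cost of leaving the coefficient box, at
      most \<open>e / 4\<close>; the added 1 covers \<open>B = 0\<close>.\<close>
    define c where "c = (8 * B + 1) / e"
    have c: "c > 0" "2 * B * (1 / c) \<le> e / 4" using e B0 by (auto simp: c_def field_simps)
    obtain m0 where m0: "\<And>m a. m \<ge> m0 \<Longrightarrow> (\<And>k. \<bar>a k\<bar> \<le> coefficient_box c k) \<Longrightarrow>
        \<bar>f (power_sum a) - f (power_sum (trunc_seq m a))\<bar> < e / 4"
      using truncation_uniform[OF f, of c "e / 4"] c e by (meson less_imp_le divide_pos_pos zero_less_numeral)
    have "J \<longlonglongrightarrow> (\<integral>\<omega>. f (limit_function Nm Np \<omega>) \<partial>M')"
      unfolding J_def by (rule truncated_functional_limit[OF f B])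
    from LIMSEQ_D[OF this, of "e / 4"] e obtain m1 where
      m1: "\<And>m. m \<ge> m1 \<Longrightarrow> \<bar>J m - (\<integral>\<omega>. f (limit_function Nm Np \<omega>) \<partial>M')\<bar> < e / 4" by auto
    define m where "m = max m0 m1"
    have "I m \<longlonglongrightarrow> J m" unfolding I_def J_def by (rule minors_tendsto[OF fm(1), where G = B]) (rule fm(2))
    from LIMSEQ_D[OF this, of "e / 4"] e obtain n1 where n1: "\<And>n. n \<ge> n1 \<Longrightarrow> \<bar>I m n - J m\<bar> < e / 4" by auto
    have near: "\<bar>(\<integral>\<omega>. f (reciprocal_char_poly X n \<omega>) \<partial>M) - I m n\<bar> \<le> e / 2" if n: "n > 0" for n
    proof -
      let ?a = "\<lambda>k \<omega>. row_minor n (norm_entry n) k \<omega>"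
      define A where "A = {\<omega> \<in> space M. \<exists>k. c * (real (Suc k) * real (Suc (Suc k))) \<le> (?a k \<omega>)\<^sup>2}"
      have A: "A \<in> sets M" "M.prob A \<le> 1 / c"
        unfolding A_def
        by (rule M.prob_outside_box[where K = 1];
          use row_minor_second_moment(1,2)[OF n] c(1) sums_inverse_pronic in simp)+
      have ma: "(\<lambda>\<omega>. f (power_sum (trunc_seq m (\<lambda>k. ?a k \<omega>)))) \<in> borel_measurable M" for m
        by (rule borel_measurable_continuous_seq[OF fm(1)]) (rule measurable_row_minor[OF odd_entry_norm])
      have "\<bar>f (reciprocal_char_poly X n \<omega>) - f (power_sum (trunc_seq m (\<lambda>k. ?a k \<omega>)))\<bar> \<le> e / 4"
        if \<omega>: "\<omega> \<in> space M - A" for \<omega>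
      proof -
        have "\<bar>?a k \<omega>\<bar> \<le> coefficient_box c k" for k
          unfolding coefficient_box_def
          by (rule real_le_rsqrt) (use \<omega> in \<open>force simp: A_def not_le simp del: of_nat_Suc intro: less_imp_le\<close>)
        from m0[of m, OF _ this] show ?thesis
          by (simp add: m_def reciprocal_char_poly_eq trunc_row_minor)
      qed
      then have "\<bar>(\<integral>\<omega>. f (reciprocal_char_poly X n \<omega>) \<partial>M) - I m n\<bar> \<le> e / 4 + 2 * B * M.prob A"
        unfolding I_def reciprocal_char_poly_eq
        by (intro M.integral_diff_bound ma fm(2) A(1)) (use e in auto)
      also have "2 * B * M.prob A \<le> 2 * B * (1 / c)" using A(2) B0 by (intro mult_left_mono) auto
      finally show ?thesis using c(2) by linarith
    qed
    show "\<exists>n0. \<forall>n\<ge>n0. norm ((\<integral>\<omega>. f (reciprocal_char_poly X n \<omega>) \<partial>M) - (\<integral>\<omega>. f (limit_function Nm Np \<omega>) \<partial>M')) < e"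
    proof (intro exI allI impI)
      fix n assume n: "n \<ge> max n1 1"
      have "\<bar>(\<integral>\<omega>. f (reciprocal_char_poly X n \<omega>) \<partial>M) - I m n\<bar> \<le> e / 2" by (rule near) (use n in simp)
      moreover have "\<bar>I m n - J m\<bar> < e / 4" using n1 n by simp
      moreover have "\<bar>J m - (\<integral>\<omega>. f (limit_function Nm Np \<omega>) \<partial>M')\<bar> < e / 4" using m1 by (simp add: m_def)
      ultimately show "norm ((\<integral>\<omega>. f (reciprocal_char_poly X n \<omega>) \<partial>M) - (\<integral>\<omega>. f (limit_function Nm Np \<omega>) \<partial>M')) < e"
        unfolding real_norm_def by linarith
    qed
  qed
qed

end

section \<open>From independent entries to independent rows\<close>

lemma (in prob_space) row_array_iid:
  fixes X :: "nat \<Rightarrow> nat \<Rightarrow> 'a \<Rightarrow> real"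
  assumes ind: "indep_vars (\<lambda>_. borel) (\<lambda>(i, j). X i j) ({1..} \<times> {1..})"
    and id: "\<And>i j. i \<ge> 1 \<Longrightarrow> j \<ge> 1 \<Longrightarrow> distr M borel (X i j) = distr M borel (X 1 1)"
    and sym: "distr M borel (X 1 1) = distr M borel (\<lambda>\<omega>. - X 1 1 \<omega>)"
    and tail: "\<And>x. x > 0 \<Longrightarrow> measure M {\<omega> \<in> space M. \<bar>X 1 1 \<omega>\<bar> > x} = L x"
    and slow: "slowly_varying L"
  shows "row_array M (distr M borel (X 1 1)) X"
proof -
  let ?\<mu> = "distr M borel (X 1 1)"
  have mX: "X i j \<in> borel_measurable M" if "1 \<le> i" "1 \<le> j" for i j
    using ind that by (force simp: indep_vars_def)
  have m1: "X 1 1 \<in> borel_measurable M" by (rule mX) simp_all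
  have meas: "measure ?\<mu> {y. x < \<bar>y\<bar>} = L x" if "x > 0" for x
  proof -
    have "{y :: real. x < \<bar>y\<bar>} \<in> sets borel" by measurable
    then have "measure ?\<mu> {y. x < \<bar>y\<bar>} = measure M (X 1 1 -` {y. x < \<bar>y\<bar>} \<inter> space M)" by (rule measure_distr[OF m1])
    also have "X 1 1 -` {y. x < \<bar>y\<bar>} \<inter> space M = {\<omega> \<in> space M. \<bar>X 1 1 \<omega>\<bar> > x}" by auto
    finally show ?thesis using tail[OF that] by simp
  qed
  have slow\<mu>: "slowly_varying (\<lambda>x. measure ?\<mu> {y. x < \<bar>y\<bar>})"
    unfolding slowly_varying_def
  proof (intro allI impI)
    fix t :: real assume t: "t > 0"
    \<comment> \<open>The tail is prescribed for \<open>x > 0\<close>, which determines the limit at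
      infinity.\<close>
    have ev: "\<forall>\<^sub>F x in at_top. L (t * x) / L x = measure ?\<mu> {y. t * x < \<bar>y\<bar>} / measure ?\<mu> {y. x < \<bar>y\<bar>}"
      using eventually_gt_at_top[of 0] by eventually_elim (simp only: meas mult_pos_pos[OF t])
    have "((\<lambda>x. L (t * x) / L x) \<longlongrightarrow> 1) at_top" using slow t unfolding slowly_varying_def by blast
    then show "((\<lambda>x. measure ?\<mu> {y. t * x < \<bar>y\<bar>} / measure ?\<mu> {y. x < \<bar>y\<bar>}) \<longlongrightarrow> 1) at_top"
      by (rule Lim_transform_eventually[OF _ ev])
  qed
  have law\<mu>: "slowly_varying_law ?\<mu>"
    by (intro slowly_varying_law.intro slowly_varying_law_axioms.intro prob_space_distr m1 slow\<mu>) simp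
  have "distr ?\<mu> borel uminus = distr M borel (uminus \<circ> X 1 1)" by (rule distr_distr) (use m1 in auto)
  also have "\<dots> = ?\<mu>" using sym by (simp add: comp_def)
  finally have sym\<mu>: "distr ?\<mu> borel uminus = ?\<mu>" .
  \<comment> \<open>The rows occupy disjoint sets \<open>K n i\<close> of index pairs, so
    independence of the entries groups into independence of the rows; \<open>Y n i\<close> relabels
    the pairs by their columns.\<close>
  define K where "K = (\<lambda>n i. (\<lambda>j. (Suc i, Suc j)) ` {..<n::nat})"
  define Y where "Y = (\<lambda>n (i::nat) (f :: nat \<times> nat \<Rightarrow> real). \<lambda>j\<in>{..<n::nat}. f (Suc i, Suc j))"
  have K: "K n i \<subseteq> {1..} \<times> {1..}" for n i by (auto simp: K_def)
  have Ym: "Y n i \<in> measurable (Pi\<^sub>M (K n i) (\<lambda>_. borel)) (Pi\<^sub>M {..<n} (\<lambda>_. borel))" for n i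
    unfolding Y_def by (intro measurable_restrict measurable_component_singleton) (auto simp: K_def)
  have YX: "Y n i (\<lambda>p\<in>K n i. (case p of (i, j) \<Rightarrow> X i j) \<omega>) = row_vec X n i \<omega>" for n i \<omega>
    by (rule ext) (auto simp: Y_def K_def row_vec_def restrict_def)
  show ?thesis
  proof (intro row_array.intro symmetric_slowly_varying_law.intro symmetric_slowly_varying_law_axioms.intro
      row_array_axioms.intro prob_space_axioms law\<mu> sym\<mu>)
    show "X i j \<in> borel_measurable M" if "1 \<le> i" "1 \<le> j" for i j by (rule mX[OF that])
  next
    fix n :: nat assume "n > 0"
    have "indep_vars (\<lambda>i. Pi\<^sub>M (K n i) (\<lambda>_. borel)) (\<lambda>i \<omega>. \<lambda>p\<in>K n i. (case p of (i, j) \<Rightarrow> X i j) \<omega>) UNIV"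
      by (rule indep_vars_restrict[OF ind K]) (auto simp: disjoint_family_on_def K_def)
    from indep_vars_compose2[OF this Ym]
    show "indep_vars (\<lambda>_. Pi\<^sub>M {..<n} (\<lambda>_. borel)) (row_vec X n) UNIV" by (simp only: YX)
  next
    fix n i :: nat assume n: "n > 0"
    \<comment> \<open>The description of independence by the product law asks for a nonempty index
      set; this is where \<open>n > 0\<close> enters.\<close>
    have ne: "K n i \<noteq> {}" using n by (auto simp: K_def)
    have rv: "(case p of (i, j) \<Rightarrow> X i j) \<in> borel_measurable M" if "p \<in> K n i" for p
      using that by (auto simp: K_def intro: mX)
    have law: "distr M borel (case p of (i, j) \<Rightarrow> X i j) = ?\<mu>" if "p \<in> K n i" for p
    proof -
      from that obtain j where p: "p = (Suc i, Suc j)" by (auto simp: K_def)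
      show ?thesis unfolding p prod.case by (rule id) simp_all
    qed
    have "distr M (Pi\<^sub>M (K n i) (\<lambda>_. borel)) (\<lambda>\<omega>. \<lambda>p\<in>K n i. (case p of (i, j) \<Rightarrow> X i j) \<omega>) =
        (\<Pi>\<^sub>M p\<in>K n i. distr M borel (case p of (i, j) \<Rightarrow> X i j))"
    proof (rule iffD1)
      show "indep_vars (\<lambda>_. borel) (\<lambda>p. case p of (i, j) \<Rightarrow> X i j) (K n i)"
        using indep_vars_subset[OF ind K] by (simp only: split_def)
      show "indep_vars (\<lambda>_. borel) (\<lambda>p. case p of (i, j) \<Rightarrow> X i j) (K n i) \<longleftrightarrow>
          distr M (Pi\<^sub>M (K n i) (\<lambda>_. borel)) (\<lambda>\<omega>. \<lambda>p\<in>K n i. (case p of (i, j) \<Rightarrow> X i j) \<omega>) =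
          (\<Pi>\<^sub>M p\<in>K n i. distr M borel (case p of (i, j) \<Rightarrow> X i j))"
        by (rule indep_vars_iff_distr_eq_PiM'[OF ne]) (rule rv)
    qed
    also have "\<dots> = (\<Pi>\<^sub>M p\<in>K n i. ?\<mu>)" by (intro PiM_cong refl law)
    finally have d: "distr M (Pi\<^sub>M (K n i) (\<lambda>_. borel)) (\<lambda>\<omega>. \<lambda>p\<in>K n i. (case p of (i, j) \<Rightarrow> X i j) \<omega>) = (\<Pi>\<^sub>M p\<in>K n i. ?\<mu>)" .
    have rm: "(\<lambda>\<omega>. \<lambda>p\<in>K n i. (case p of (i, j) \<Rightarrow> X i j) \<omega>) \<in> measurable M (Pi\<^sub>M (K n i) (\<lambda>_. borel))"
      by (intro measurable_restrict rv)
    have "distr M (Pi\<^sub>M {..<n} (\<lambda>_. borel)) (row_vec X n i) =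
        distr (\<Pi>\<^sub>M p\<in>K n i. ?\<mu>) (Pi\<^sub>M {..<n} (\<lambda>_. borel)) (Y n i)"
      unfolding d[symmetric] distr_distr[OF Ym rm] comp_def YX ..
    also have "\<dots> = distr (\<Pi>\<^sub>M p\<in>K n i. ?\<mu>) (\<Pi>\<^sub>M j\<in>{..<n}. ?\<mu>) (Y n i)"
      by (intro distr_cong refl sets_PiM_cong) simp_all
    also have "\<dots> = (\<Pi>\<^sub>M j\<in>{..<n}. ?\<mu>)"
      unfolding Y_def
      by (rule distr_PiM_reindex[where M = "\<lambda>_. ?\<mu>" and f = "\<lambda>j. (Suc i, Suc j)"])
        (use prob_space_distr[OF m1] in \<open>auto simp: K_def inj_on_def\<close>)
    finally show "distr M (Pi\<^sub>M {..<n} (\<lambda>_. borel)) (row_vec X n i) = slowly_varying_law.row_law ?\<mu> n"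
      unfolding slowly_varying_law.row_law_def[OF law\<mu>] .
  qed
qed

theorem theorem2p8:
  fixes M :: "'a measure" and X :: "nat \<Rightarrow> nat \<Rightarrow> 'a \<Rightarrow> real" and L :: "real \<Rightarrow> real"
    and M' :: "'b measure" and Nm Np :: "nat \<Rightarrow> 'b \<Rightarrow> nat"
  assumes "prob_space M"
    and "prob_space.indep_vars M (\<lambda>_. borel) (\<lambda>(i, j). X i j) ({1..} \<times> {1..})"
    and "\<And>i j. i \<ge> 1 \<Longrightarrow> j \<ge> 1 \<Longrightarrow> distr M borel (X i j) = distr M borel (X 1 1)"
    and "\<not> (\<exists>c. AE \<omega> in M. X 1 1 \<omega> = c)"
    and "distr M borel (X 1 1) = distr M borel (\<lambda>\<omega>. - X 1 1 \<omega>)"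
    and "\<And>x. x > 0 \<Longrightarrow> measure M {\<omega> \<in> space M. \<bar>X 1 1 \<omega>\<bar> > x} = L x"
    and "slowly_varying L"
    and "prob_space M'"
    and "prob_space.indep_vars M' (\<lambda>_. count_space UNIV) Nm {1..}"
    and "prob_space.indep_vars M' (\<lambda>_. count_space UNIV) Np {1..}"
    and "prob_space.indep_var M'
           (\<Pi>\<^sub>M q\<in>{1..}. count_space UNIV) (\<lambda>\<omega>. \<lambda>q\<in>{1..}. Nm q \<omega>)
           (\<Pi>\<^sub>M q\<in>{1..}. count_space UNIV) (\<lambda>\<omega>. \<lambda>q\<in>{1..}. Np q \<omega>)"
    and "\<And>q. q \<ge> 1 \<Longrightarrow>
           distr M' (count_space UNIV) (Nm q) = measure_pmf (poisson_pmf (1 / (2 * real q)))"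
    and "\<And>q. q \<ge> 1 \<Longrightarrow>
           distr M' (count_space UNIV) (Np q) = measure_pmf (poisson_pmf (1 / (2 * real q)))"
  shows "(\<forall>k :: 'l::finite \<Rightarrow> nat. (\<forall>i. k i \<ge> 1) \<longrightarrow>
           converges_in_distribution (euclidean :: (real ^ 'l) topology)
             M (\<lambda>n \<omega>. \<chi> i. mat_trace (self_normalized_matrix X n \<omega> ^\<^sub>m k i))
             M' (\<lambda>\<omega>. \<chi> i. limit_trace Nm Np (k i) \<omega>)) \<and>
         (AE \<omega> in M'. limit_series_converges Nm Np \<omega>) \<and>
         converges_in_distribution (holomorphic_topology (ball 0 1))
           M (reciprocal_char_poly X)
           M' (limit_function Nm Np)"
proof -
  have "row_array M (distr M borel (X 1 1)) X"
    by (rule prob_space.row_array_iid[OF assms(1-3,5-7)])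
  moreover have "poisson_cycles M' Nm Np"
    unfolding poisson_cycles_def poisson_cycles_axioms_def using assms(8-13) by blast
  ultimately interpret spectral_convergence M "distr M borel (X 1 1)" X M' Nm Np
    by (rule spectral_convergence.intro)
  show ?thesis using traces_converge AE_limit_series_converges polynomials_converge by blast
qed

end
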